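(* Let $N\ge1$ be an integer, let $v,w$ be submultiplicative weights on $\mathbb{R}^{2d}$, let $m\in\mathcal{M}_v$, $\mu\in\mathcal{M}_w$, $1\le p,q\le\infty$, and assume that $\varphi_1,\varphi_4\in M^1_{wv\langle\cdot\rangle^N}(\mathbb{R}^d)$ and $\varphi_2,\varphi_3\in M^1_w(\mathbb{R}^d)$. For symbols $a,b$ on $\mathbb{R}^{2d}$ let $$E_Nf=\int_{\mathbb{R}^{2d}}\int_{\mathbb{R}^{2d}}a(y)\,b_N(y,z)\,V_{\varphi_3}f(z)\,\langle\pi(z)\varphi_4,\pi(y)\varphi_1\rangle\,\pi(y)\varphi_2\,dz\,dy,$$ $$b_N(y,z)=N\sum_{|\alpha|=N}\int_0^1(1-t)^{N-1}\,\partial^\alpha b(y+t(z-y))\,dt\;\frac{(z-y)^\alpha}{\alpha!}.$$ (i) If $a\in L^\infty_{1/m}(\mathbb{R}^{2d})$ and $\partial^\alpha b\in L^\infty_m(\mathbb{R}^{2d})$ for all $\alpha\in\mathbb{Z}_{\ge0}^{2d}$ with $|\alpha|=N$, then $E_N$ is bounded on $M^{p,q}_\mu(\mathbb{R}^d)$ with $$\|E_Nf\|_{M^{p,q}_\mu}\lesssim\|a\|_{L^\infty_{1/m}}\Big(\sum_{|\alpha|=N}\frac1{\alpha!}\|\partial^\alpha b\|_{L^\infty_m}\Big)\|\varphi_1\|_{M^1_{vw\langle\cdot\rangle^N}}\|\varphi_2\|_{M^1_w}\|\varphi_3\|_{M^1_w}\|\varphi_4\|_{M^1_{vw\langle\cdot\rangle^N}}\|f\|_{M^{p,q}_\mu}.$$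 (ii) If $a\in L^\infty_{1/m}(\mathbb{R}^{2d})$ and $(\partial^\alpha b)\,m\in L^0(\mathbb{R}^{2d})$ for all $\alpha$ with $|\alpha|=N$, then $E_N$ is compact on $M^{p,q}_\mu(\mathbb{R}^d)$.
   Context: $A\lesssim B$ means $A\le cB$ with a constant $c>0$ independent of $f$, the symbols and the windows. Weights. A submultiplicative weight is a continuous, positive, even function $v$ on $\mathbb{R}^{2d}$ with $v(0)=1$, $v(z_1+z_2)\le v(z_1)v(z_2)$, which moreover satisfies the GRS-condition $\lim_{n\to\infty}v(nz)^{1/n}=1$ for all $z$, and $\int_0^1v(tz)\,dt\le C\,v(z)$ for a constant $C$. For such $v$, $\mathcal{M}_v$ is the set of positive even weight functions $m$ on $\mathbb{R}^{2d}$ such that $m(z_1+z_2)\le C\,v(z_1)m(z_2)$ for all $z_1,z_2$ and some constant $C$. $\langle z\rangle=(1+|z|^2)^{1/2}$ for $z\in\mathbb{R}^{2d}$. Time-frequency notation. For $z=(x,\omega)\in\mathbb{R}^{2d}$, $\pi(z)f(t)=M_\omega T_xf(t)=e^{2\pi i\omega t}f(t-x)$. The short-time Fourier transform is $V_gf(z)=\langle f,\pi(z)g\rangle$, where $\langle\cdot,\cdot\rangle$ is the bracket extending the inner product $\int f\bar g$ (linear in the first argument) by duality. The vector-valued integral defining $E_N$ is understood weakly (pair with a test function $g$, replacing $\pi(y)\varphi_2$ by $\langle\pi(y)\varphi_2,g\rangle=\overline{V_{\varphi_2}g(y)}$). Function spaces. $\|F\|_{L^{p,q}_m}=\big(\int_{\mathbb{R}^d}(\int_{\mathbb{R}^d}|F(x,\omega)|^pm(x,\omega)^p\,dx)^{q/p}d\omega\big)^{1/q}$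 (usual modification if $p$ or $q$ is $\infty$); $L^\infty_m=\{F: Fm\in L^\infty(\mathbb{R}^{2d})\}$, $\|F\|_{L^\infty_m}=\|Fm\|_\infty$. $L^0(\mathbb{R}^{2d})$ is the space of $F\in L^\infty(\mathbb{R}^{2d})$ vanishing at infinity: for every $\varepsilon>0$ there is $R>0$ with $|F(z)|<\varepsilon$ for a.a. $|z|>R$. Partial derivatives of symbols are in the sense of distributions and required to be functions as stated. Modulation spaces: let $\varphi_0(t)=e^{-\pi t^2}$ and $\mathcal{S}_{\mathcal{C}}=\mathrm{span}\{\pi(z)\varphi_0:z\in\mathbb{R}^{2d}\}$. For $m\in\mathcal{M}_v$ and $1\le p,q\le\infty$ put $\|f\|_{M^{p,q}_m}=\|V_{\varphi_0}f\|_{L^{p,q}_m}$; $M^{p,q}_m(\mathbb{R}^d)$ is the completion of $\mathcal{S}_{\mathcal{C}}$ in this norm if $p,q<\infty$, and the completion of $\mathcal{S}_{\mathcal{C}}$ in the $\sigma(\mathcal{S}_{\mathcal{C}},\mathcal{S}_{\mathcal{C}})$-topology if $p=\infty$ or $q=\infty$. (Equivalently, $M^\infty_{1/v}$ is the antidual of $M^1_v$, and $M^{p,q}_m$ consists of the $f\in M^\infty_{1/v}$ with $V_{\varphi_0}f\in L^{p,q}_m$.) $M^p_m=M^{p,p}_m$. *)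

theory Defs
  imports "HOL-Analysis.Analysis" "HOL-Probability.Essential_Supremum"
begin

section \<open>Weights\<close>

type_synonym 'd phase = "(real^'d) \<times> (real^'d)"

definition submult_weight :: "('d::finite phase \<Rightarrow> real) \<Rightarrow> bool" where
  "submult_weight v \<longleftrightarrow>
     continuous_on UNIV v \<and> (\<forall>z. 0 < v z) \<and> (\<forall>z. v (- z) = v z) \<and> v 0 = 1 \<and>
     (\<forall>z1 z2. v (z1 + z2) \<le> v z1 * v z2) \<and>
     (\<forall>z. (\<lambda>n. root n (v (real n *\<^sub>R z))) \<longlonglongrightarrow> 1) \<and>
     (\<exists>C. \<forall>z. (LINT t:{0..1}|lborel. v (t *\<^sub>R z)) \<le> C * v z)"

definition moderate_weights :: "('d::finite phase \<Rightarrow> real) \<Rightarrow> ('d phase \<Rightarrow> real) set" where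
  "moderate_weights v =
     {m. m \<in> borel_measurable borel \<and> (\<forall>z. 0 < m z) \<and> (\<forall>z. m (- z) = m z) \<and>
         (\<exists>C. \<forall>z1 z2. m (z1 + z2) \<le> C * v z1 * m z2)}"

definition japanese_bracket :: "'a::euclidean_space \<Rightarrow> real" where
  "japanese_bracket z = sqrt (1 + (norm z)\<^sup>2)"


section \<open>Weighted Lebesgue norms\<close>

text \<open>Norms take values in the extended nonnegative reals, so that finiteness of a norm is
  always an explicit statement.  Exponents lie in \<open>[1, \<infinity>]\<close>.
  Elements of Lebesgue spaces are given by Borel representatives.\<close>

definition epow :: "ennreal \<Rightarrow> real \<Rightarrow> ennreal" where
  "epow x s = (if x = top then top else ennreal (enn2real x powr s))"

definition Lp_enorm :: "ennreal \<Rightarrow> 'a measure \<Rightarrow> ('a \<Rightarrow> ennreal) \<Rightarrow> ennreal" where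
  "Lp_enorm p M F =
     (if p = top then esssup M F
      else epow (\<integral>\<^sup>+ x. epow (F x) (enn2real p) \<partial>M) (1 / enn2real p))"

text \<open>The inner norm is taken in the position variable, the outer one in the frequency
  variable.\<close>

definition Lpq_norm ::
  "ennreal \<Rightarrow> ennreal \<Rightarrow> ('d::finite phase \<Rightarrow> real) \<Rightarrow> ('d phase \<Rightarrow> complex) \<Rightarrow> ennreal" where
  "Lpq_norm p q m F =
     Lp_enorm q lborel (\<lambda>\<omega>. Lp_enorm p lborel (\<lambda>x. ennreal (cmod (F (x, \<omega>)) * m (x, \<omega>))))"

definition Lpq_space ::
  "ennreal \<Rightarrow> ennreal \<Rightarrow> ('d::finite phase \<Rightarrow> real) \<Rightarrow> ('d phase \<Rightarrow> complex) set" where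
  "Lpq_space p q m = {F \<in> borel_measurable borel. Lpq_norm p q m F < top}"

definition Linf_norm :: "('a::euclidean_space \<Rightarrow> real) \<Rightarrow> ('a \<Rightarrow> complex) \<Rightarrow> ennreal" where
  "Linf_norm m F = esssup lborel (\<lambda>z. ennreal (cmod (F z) * m z))"

definition Linf_space :: "('a::euclidean_space \<Rightarrow> real) \<Rightarrow> ('a \<Rightarrow> complex) set" where
  "Linf_space m = {F \<in> borel_measurable borel. Linf_norm m F < top}"

definition L0_space :: "('a::euclidean_space \<Rightarrow> complex) set" where
  "L0_space = {F \<in> Linf_space (\<lambda>_. 1).
     \<forall>\<epsilon>>0. \<exists>R>0. AE z in lborel. norm z > R \<longrightarrow> cmod (F z) < \<epsilon>}"


section \<open>Multi-indices and distributional derivatives\<close>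

text \<open>A multi-index is a function on the standard basis, extended by zero.\<close>

definition multi_indices :: "nat \<Rightarrow> ('a::euclidean_space \<Rightarrow> nat) set" where
  "multi_indices N = {\<alpha>. (\<forall>i. i \<notin> Basis \<longrightarrow> \<alpha> i = 0) \<and> sum \<alpha> Basis = N}"

definition multi_fact :: "('a::euclidean_space \<Rightarrow> nat) \<Rightarrow> real" where
  "multi_fact \<alpha> = (\<Prod>i\<in>Basis. fact (\<alpha> i))"

definition multi_power :: "'a::euclidean_space \<Rightarrow> ('a \<Rightarrow> nat) \<Rightarrow> real" where
  "multi_power z \<alpha> = (\<Prod>i\<in>Basis. (z \<bullet> i) ^ \<alpha> i)"

lemma finite_multi_indices: "finite (multi_indices N :: ('a::euclidean_space \<Rightarrow> nat) set)"
proof (rule finite_subset)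
  show "finite {\<alpha>::'a \<Rightarrow> nat. \<forall>i. (i \<in> Basis \<longrightarrow> \<alpha> i \<in> {..N}) \<and> (i \<notin> Basis \<longrightarrow> \<alpha> i = 0)}"
    by (rule finite_set_of_finite_funs) auto
  show "multi_indices N \<subseteq>
      {\<alpha>::'a \<Rightarrow> nat. \<forall>i. (i \<in> Basis \<longrightarrow> \<alpha> i \<in> {..N}) \<and> (i \<notin> Basis \<longrightarrow> \<alpha> i = 0)}"
    by (auto simp: multi_indices_def intro: member_le_sum)
qed

fun iter_partial ::
  "'a::euclidean_space list \<Rightarrow> ('a \<Rightarrow> complex) \<Rightarrow> 'a \<Rightarrow> complex" where
  "iter_partial [] \<psi> = \<psi>"
| "iter_partial (i # is) \<psi> = (\<lambda>x. frechet_derivative (iter_partial is \<psi>) (at x) i)"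

text \<open>Compactly supported functions all of whose iterated partial derivatives exist and are
  differentiable, that is, the space \<open>C\<^sub>c\<^sup>\<infinity>\<close>.\<close>

definition test_functions :: "('a::euclidean_space \<Rightarrow> complex) set" where
  "test_functions = {\<psi>. compact (closure {x. \<psi> x \<noteq> 0}) \<and>
     (\<forall>is x. set is \<subseteq> Basis \<longrightarrow> iter_partial is \<psi> differentiable (at x))}"

text \<open>Distributions as continuous linear functionals on test functions.  A locally integrable
  function \<open>b\<close> acts by \<open>\<psi> \<mapsto> \<integral> b \<psi>\<close>.\<close>

definition distribution :: "(('a::euclidean_space \<Rightarrow> complex) \<Rightarrow> complex) \<Rightarrow> bool" where
  "distribution T \<longleftrightarrow>
     (\<forall>\<psi>\<in>test_functions. \<forall>\<eta>\<in>test_functions. T (\<lambda>x. \<psi> x + \<eta> x) = T \<psi> + T \<eta>) \<and>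
     (\<forall>c. \<forall>\<psi>\<in>test_functions. T (\<lambda>x. c * \<psi> x) = c * T \<psi>) \<and>
     (\<forall>K. compact K \<longrightarrow> (\<exists>C k. \<forall>\<psi>\<in>test_functions. \<forall>s.
        (\<forall>x. x \<notin> K \<longrightarrow> \<psi> x = 0) \<longrightarrow>
        (\<forall>is x. set is \<subseteq> Basis \<and> length is \<le> k \<longrightarrow> cmod (iter_partial is \<psi> x) \<le> s) \<longrightarrow>
        cmod (T \<psi>) \<le> C * s))"

text \<open>The distributional derivative \<open>\<partial>\<^sup>\<alpha> T\<close> is the locally integrable function \<open>F\<close>.
  The lists \<open>is\<close> are the possible orders in which the derivatives indicated by \<open>\<alpha>\<close> can be
  taken; on test functions the order does not matter.\<close>

definition has_distr_partial ::
  "(('a::euclidean_space \<Rightarrow> complex) \<Rightarrow> complex) \<Rightarrow> ('a \<Rightarrow> nat) \<Rightarrow> ('a \<Rightarrow> complex) \<Rightarrow> bool" where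
  "has_distr_partial T \<alpha> F \<longleftrightarrow>
     F \<in> borel_measurable borel \<and>
     (\<forall>K. compact K \<longrightarrow> set_integrable lborel K F) \<and>
     (\<forall>\<psi>\<in>test_functions. \<forall>is. (\<forall>i. count_list is i = \<alpha> i) \<longrightarrow>
        (- 1) ^ length is * T (iter_partial is \<psi>) = (LINT x|lborel. F x * \<psi> x))"


section \<open>Time-frequency analysis\<close>

definition tf_shift :: "'d::finite phase \<Rightarrow> (real^'d \<Rightarrow> complex) \<Rightarrow> real^'d \<Rightarrow> complex" where
  "tf_shift z f = (\<lambda>t. cis (2 * pi * (snd z \<bullet> t)) * f (t - fst z))"

definition L2_bracket :: "(real^'d::finite \<Rightarrow> complex) \<Rightarrow> (real^'d \<Rightarrow> complex) \<Rightarrow> complex" where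
  "L2_bracket f g = (LINT t|lborel. f t * cnj (g t))"

text \<open>The first argument is an antilinear functional \<open>g \<mapsto> \<langle>f, g\<rangle>\<close>; a function \<open>f\<close> is
  identified with the functional \<open>L2_bracket f\<close>.\<close>

definition STFT ::
  "(real^'d::finite \<Rightarrow> complex) \<Rightarrow> ((real^'d \<Rightarrow> complex) \<Rightarrow> complex) \<Rightarrow> 'd phase \<Rightarrow> complex" where
  "STFT g f z = f (tf_shift z g)"

definition gaussian :: "real^'d::finite \<Rightarrow> complex" where
  "gaussian t = of_real (exp (- pi * (norm t)\<^sup>2))"

definition gaussian_span :: "(real^'d::finite \<Rightarrow> complex) set" where
  "gaussian_span =
     {\<lambda>t. \<Sum>z\<in>Z. c z * tf_shift z gaussian t | (Z :: 'd phase set) c. finite Z}"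

definition M1_norm :: "('d::finite phase \<Rightarrow> real) \<Rightarrow> (real^'d \<Rightarrow> complex) \<Rightarrow> ennreal" where
  "M1_norm v f = Lpq_norm 1 1 v (STFT gaussian (L2_bracket f))"

text \<open>For \<open>v \<ge> 1\<close> (which holds for every submultiplicative weight) the \<open>M\<^sup>1\<^sub>v\<close>-norm
  dominates the \<open>L\<^sup>2\<close>-norm, and the completion of the span of the time-frequency shifts of the
  Gaussian is realised as a space of square integrable functions.\<close>

definition M1_space :: "('d::finite phase \<Rightarrow> real) \<Rightarrow> (real^'d \<Rightarrow> complex) set" where
  "M1_space v =
     {f \<in> borel_measurable borel. integrable lborel (\<lambda>t. (cmod (f t))\<^sup>2) \<and>
        (\<exists>s. (\<forall>n::nat. s n \<in> gaussian_span) \<and>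
             (\<lambda>n. M1_norm v (\<lambda>t. f t - s n t)) \<longlonglongrightarrow> 0)}"

text \<open>\<open>M\<^sup>\<infinity>\<close> with weight \<open>1/v\<close> is the antidual of \<open>M\<^sup>1\<^sub>v\<close>.  Functionals are extended by zero
  outside \<open>M\<^sup>1\<^sub>v\<close>, so that equal elements are equal as functions.\<close>

definition M1_antidual ::
  "('d::finite phase \<Rightarrow> real) \<Rightarrow> ((real^'d \<Rightarrow> complex) \<Rightarrow> complex) set" where
  "M1_antidual v =
     {f. (\<forall>g\<in>M1_space v. \<forall>h\<in>M1_space v. f (\<lambda>t. g t + h t) = f g + f h) \<and>
         (\<forall>c. \<forall>g\<in>M1_space v. f (\<lambda>t. c * g t) = cnj c * f g) \<and>
         (\<exists>C. \<forall>g\<in>M1_space v. ennreal (cmod (f g)) \<le> ennreal C * M1_norm v g) \<and>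
         (\<forall>g. g \<notin> M1_space v \<longrightarrow> f g = 0)}"

definition modulation_norm ::
  "ennreal \<Rightarrow> ennreal \<Rightarrow> ('d::finite phase \<Rightarrow> real) \<Rightarrow>
   ((real^'d \<Rightarrow> complex) \<Rightarrow> complex) \<Rightarrow> ennreal" where
  "modulation_norm p q m f = Lpq_norm p q m (STFT gaussian f)"

text \<open>The space \<open>M\<^sup>p\<^sup>,\<^sup>q\<^sub>m\<close> for \<open>m \<in> moderate_weights v\<close>.\<close>

definition modulation_space ::
  "('d::finite phase \<Rightarrow> real) \<Rightarrow> ennreal \<Rightarrow> ennreal \<Rightarrow> ('d phase \<Rightarrow> real) \<Rightarrow>
   ((real^'d \<Rightarrow> complex) \<Rightarrow> complex) set" where
  "modulation_space v p q m = {f \<in> M1_antidual v. STFT gaussian f \<in> Lpq_space p q m}"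


section \<open>Operators on spaces of functionals\<close>

definition linear_operator_on ::
  "('a \<Rightarrow> complex) set \<Rightarrow> (('a \<Rightarrow> complex) \<Rightarrow> ('a \<Rightarrow> complex)) \<Rightarrow> bool" where
  "linear_operator_on X T \<longleftrightarrow>
     (\<forall>f\<in>X. T f \<in> X) \<and>
     (\<forall>f\<in>X. \<forall>h\<in>X. T (\<lambda>g. f g + h g) = (\<lambda>g. T f g + T h g)) \<and>
     (\<forall>c. \<forall>f\<in>X. T (\<lambda>g. c * f g) = (\<lambda>g. c * T f g))"

definition compact_operator_on ::
  "('a \<Rightarrow> complex) set \<Rightarrow> (('a \<Rightarrow> complex) \<Rightarrow> ennreal) \<Rightarrow>
   (('a \<Rightarrow> complex) \<Rightarrow> ('a \<Rightarrow> complex)) \<Rightarrow> bool" where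
  "compact_operator_on X nrm T \<longleftrightarrow>
     linear_operator_on X T \<and>
     (\<forall>f. (\<forall>n::nat. f n \<in> X) \<and> (\<exists>R<top. \<forall>n. nrm (f n) \<le> R) \<longrightarrow>
        (\<exists>h\<in>X. \<exists>r. strict_mono r \<and>
           (\<lambda>k. nrm (\<lambda>g. T (f (r k)) g - h g)) \<longlonglongrightarrow> 0))"


section \<open>The remainder operator\<close>

text \<open>In the following, \<open>B \<alpha>\<close> stands for the function \<open>\<partial>\<^sup>\<alpha> b\<close>.\<close>

definition taylor_integrand ::
  "nat \<Rightarrow> ('a::euclidean_space \<Rightarrow> complex) \<Rightarrow> 'a \<Rightarrow> 'a \<Rightarrow> real \<Rightarrow> complex" where
  "taylor_integrand N F y z t = of_real ((1 - t) ^ (N - 1)) * F (y + t *\<^sub>R (z - y))"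

definition taylor_remainder ::
  "nat \<Rightarrow> (('a::euclidean_space \<Rightarrow> nat) \<Rightarrow> 'a \<Rightarrow> complex) \<Rightarrow> 'a \<Rightarrow> 'a \<Rightarrow> complex" where
  "taylor_remainder N B y z =
     of_nat N * (\<Sum>\<alpha>\<in>multi_indices N.
       (LINT t:{0..1}|lborel. taylor_integrand N (B \<alpha>) y z t) *
       of_real (multi_power (z - y) \<alpha> / multi_fact \<alpha>))"

text \<open>The integrand of \<open>E\<^sub>N f\<close> paired with a test function \<open>g\<close>.\<close>

definition E_integrand ::
  "nat \<Rightarrow> ('d::finite phase \<Rightarrow> complex) \<Rightarrow> (('d phase \<Rightarrow> nat) \<Rightarrow> 'd phase \<Rightarrow> complex) \<Rightarrow>
   (real^'d \<Rightarrow> complex) \<Rightarrow> (real^'d \<Rightarrow> complex) \<Rightarrow> (real^'d \<Rightarrow> complex) \<Rightarrow> (real^'d \<Rightarrow> complex) \<Rightarrow>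
   ((real^'d \<Rightarrow> complex) \<Rightarrow> complex) \<Rightarrow> (real^'d \<Rightarrow> complex) \<Rightarrow> 'd phase \<Rightarrow> 'd phase \<Rightarrow> complex" where
  "E_integrand N a B \<phi>1 \<phi>2 \<phi>3 \<phi>4 f g y z =
     a y * taylor_remainder N B y z * STFT \<phi>3 f z *
     L2_bracket (tf_shift z \<phi>4) (tf_shift y \<phi>1) * L2_bracket (tf_shift y \<phi>2) g"

text \<open>\<open>E\<^sub>N f\<close> as an antilinear functional on \<open>M\<^sup>1\<^sub>w\<close>.\<close>

definition E_op ::
  "('d::finite phase \<Rightarrow> real) \<Rightarrow>
   nat \<Rightarrow> ('d phase \<Rightarrow> complex) \<Rightarrow> (('d phase \<Rightarrow> nat) \<Rightarrow> 'd phase \<Rightarrow> complex) \<Rightarrow>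
   (real^'d \<Rightarrow> complex) \<Rightarrow> (real^'d \<Rightarrow> complex) \<Rightarrow> (real^'d \<Rightarrow> complex) \<Rightarrow> (real^'d \<Rightarrow> complex) \<Rightarrow>
   ((real^'d \<Rightarrow> complex) \<Rightarrow> complex) \<Rightarrow> (real^'d \<Rightarrow> complex) \<Rightarrow> complex" where
  "E_op w N a B \<phi>1 \<phi>2 \<phi>3 \<phi>4 f =
     (\<lambda>g. if g \<in> M1_space w
          then LINT y|lborel. (LINT z|lborel. E_integrand N a B \<phi>1 \<phi>2 \<phi>3 \<phi>4 f g y z)
          else 0)"

text \<open>All integrals entering \<open>E_op\<close> converge absolutely; since the Bochner integral of a
  non-integrable function is zero by convention, this has to be said separately.\<close>

definition E_converges ::
  "('d::finite phase \<Rightarrow> real) \<Rightarrow>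
   nat \<Rightarrow> ('d phase \<Rightarrow> complex) \<Rightarrow> (('d phase \<Rightarrow> nat) \<Rightarrow> 'd phase \<Rightarrow> complex) \<Rightarrow>
   (real^'d \<Rightarrow> complex) \<Rightarrow> (real^'d \<Rightarrow> complex) \<Rightarrow> (real^'d \<Rightarrow> complex) \<Rightarrow> (real^'d \<Rightarrow> complex) \<Rightarrow>
   ((real^'d \<Rightarrow> complex) \<Rightarrow> complex) \<Rightarrow> bool" where
  "E_converges w N a B \<phi>1 \<phi>2 \<phi>3 \<phi>4 f \<longleftrightarrow>
     (AE (y, z) in lborel. \<forall>\<alpha>\<in>multi_indices N.
        set_integrable lborel {0..1} (taylor_integrand N (B \<alpha>) y z)) \<and>
     (\<forall>g\<in>M1_space w. integrable lborel (\<lambda>(y, z). E_integrand N a B \<phi>1 \<phi>2 \<phi>3 \<phi>4 f g y z))"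

end

theory Submission
  imports Defs "HOL-Probability.Characteristic_Functions" "HOL-Complex_Analysis.Great_Picard"
begin

text \<open>
  Write \<open>V f\<close> for the short-time Fourier transform with Gaussian window.  An explicit Gaussian
  integral gives the reproducing formula \<open>\<kappa> V f(\<zeta>) = \<integral> V f(z) \<langle>\<pi>(z)\<phi>\<^sub>0, \<pi>(\<zeta>)\<phi>\<^sub>0\<rangle> dz\<close> on \<open>L\<^sup>2\<close>; together with
  uniqueness of the Fourier transform on \<open>L\<^sup>1\<close> it yields \<open>\<kappa> f = \<integral> V f(z) \<pi>(z)\<phi>\<^sub>0 dz\<close> whenever \<open>V f\<close> is
  integrable, and by approximation with simple functions the analogous formula for functionals
  in the antidual of \<open>M\<^sup>1\<close>.  All brackets are thereby dominated by convolutions of the functions \<open>|V f|\<close>.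
  Moderateness of \<open>m\<close> bounds \<open>|a(y) b\<^sub>N(y,z) \<langle>\<pi>(z)\<phi>\<^sub>4, \<pi>(y)\<phi>\<^sub>1\<rangle>|\<close> by \<open>H(z - y)\<close> with
  \<open>H(x) = C v(x) |x|\<^sup>N (|V \<phi>\<^sub>1| * |V \<phi>\<^sub>4(- \<sqdot>)|)(x)\<close>, a function in \<open>L\<^sup>1\<^sub>w\<close>, and Young's inequality
  in weighted mixed-norm spaces gives boundedness.

  For compactness let \<open>f\<^sub>k\<close> be bounded.  Since \<open>M\<^sup>p\<^sup>,\<^sup>q\<^sub>\<mu>\<close> embeds into \<open>M\<^sup>\<infinity>\<close> with weight \<open>1/w\<close>, the
  functions \<open>V f\<^sub>k\<close> are bounded by a multiple of \<open>w\<close> and equicontinuous, so a subsequence converges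
  pointwise.  If \<open>|y|\<close> or \<open>|z|\<close> exceeds \<open>R\<close>, then either \<open>|z - y| > R/2\<close>, where \<open>H\<close> has small
  integral, or the whole segment from \<open>y\<close> to \<open>z\<close> avoids the ball of radius \<open>R/2\<close>, where
  \<open>(\<partial>\<^sup>\<alpha> b) m\<close> is small; on the remaining bounded set dominated convergence applies.
\<close>

section \<open>Lebesgue norms of nonnegative functions\<close>

text \<open>Two obstacles shape the proof. The derivatives of b are known only almost everywhere,
  while b_N integrates them over segments, which are null sets; so null sets must be transported to
  null sets of pairs (y,z). And p or q may be infinite, where density and duality arguments fail:
  Minkowski, Young and Fatou are proved directly for extended nonnegative functions, and in the
  compactness proof \<open>\<phi>2\<close> rather than \<open>f\<close> carries the mixed norm of
  the part near the origin. The factor m(y) coming from a is moved to the point y + t(z-y) at the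
  price of v(t(z-y)). The condition on the integral of v(tx) over [0,1] turns this into v(z-y), and
  the Taylor monomials contribute |z-y|^N; hence the weight on \<open>\<phi>1\<close> and
  \<open>\<phi>4\<close>. The Gaussian is the reference window because its transform is explicit and
  beats every submultiplicative weight. Each passage from a bracket to Gaussian transforms costs the
  constant kappa, the squared norm of the Gaussian. Three brackets occur, so kappa^3 appears; it
  mostly stays on the left of the estimates until the end.\<close>

lemma epow_ennreal: "0 \<le> r \<Longrightarrow> epow (ennreal r) s = ennreal (r powr s)"
  by (simp add: epow_def)

lemma epow_top [simp]: "epow top s = top"
  by (simp add: epow_def)

lemma epow_0 [simp]: "epow 0 s = 0"
  by (simp add: epow_def)

lemma epow_1 [simp]: "epow x 1 = x"
  by (cases x) (auto simp: epow_ennreal)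

lemma epow_one [simp]: "epow 1 s = 1"
  using epow_ennreal[of 1 s] by simp

lemma epow_mono: "x \<le> y \<Longrightarrow> 0 \<le> s \<Longrightarrow> epow x s \<le> epow y s"
proof (cases y)
  case (real r)
  assume "x \<le> y" "0 \<le> s"
  with real obtain t where "x = ennreal t" "0 \<le> t" "t \<le> r"
    by (metis ennreal_cases ennreal_le_iff neq_top_trans ennreal_neq_top)
  then show ?thesis using real \<open>0 \<le> s\<close> by (auto simp: epow_ennreal intro!: ennreal_leI powr_mono2)
qed auto

lemma epow_epow: "epow (epow x s) t = epow x (s * t)"
  by (cases x) (auto simp: epow_ennreal powr_powr)

lemma epow_mult:
  assumes "0 < s" shows "epow (x * y) s = epow x s * epow y s"
proof -
  have *: "epow (top * y) s = top * epow y s" for y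
  proof (cases "y = 0")
    case False
    then have "epow y s \<noteq> 0" by (cases y) (auto simp: epow_ennreal)
    with False show ?thesis by (simp add: ennreal_top_mult)
  qed simp
  consider "x = top" | "y = top" | a b where "x = ennreal a" "0 \<le> a" "y = ennreal b" "0 \<le> b"
    by (metis ennreal_cases)
  then show ?thesis
  proof cases
    case 2
    then show ?thesis using *[of x] by (simp add: mult.commute)
  next
    case 3
    then show ?thesis by (simp add: epow_ennreal powr_mult flip: ennreal_mult)
  qed (simp add: *)
qed

text \<open>True for every real exponent because \<open>0 powr s\<close> is 0, and infinity likewise
  stays infinity. Negative powers are therefore meaningful only for positive finite arguments, which
  explains a side condition of \<open>Jensen_weighted\<close>.\<close>

lemma epow_eq_0_iff [simp]: "epow x s = 0 \<longleftrightarrow> x = 0"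
  by (cases x) (auto simp: epow_ennreal)

lemma epow_eq_top_iff [simp]: "epow x s = top \<longleftrightarrow> x = top"
  by (cases x) (auto simp: epow_ennreal)

text \<open>The order adjunction between a power and its root, which converts bounds on norms into
  bounds on integrals.\<close>

lemma epow_inverse_le_iff:
  assumes "0 < s" shows "epow x (1 / s) \<le> c \<longleftrightarrow> x \<le> epow c s"
proof
  assume "epow x (1 / s) \<le> c"
  then have "epow (epow x (1/s)) s \<le> epow c s" using assms by (intro epow_mono) auto
  then show "x \<le> epow c s" using assms by (simp add: epow_epow)
next
  assume "x \<le> epow c s"
  then have "epow x (1/s) \<le> epow (epow c s) (1/s)" using assms by (intro epow_mono) auto
  then show "epow x (1 / s) \<le> c" using assms by (simp add: epow_epow)
qed

text \<open>A monotone map with a monotone inverse, here the root \<open>epow _ (1 / s)\<close>,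
  preserves arbitrary suprema.\<close>

lemma epow_SUP:
  assumes "0 < s" shows "epow (SUP i\<in>I. f i) s = (SUP i\<in>I. epow (f i) s)"
proof (rule antisym)
  have "(SUP i\<in>I. f i) \<le> epow (SUP i\<in>I. epow (f i) s) (1 / s)"
  proof (rule SUP_least)
    fix i assume "i \<in> I"
    then have "epow (f i) s \<le> (SUP i\<in>I. epow (f i) s)" by (rule SUP_upper)
    then have "epow (epow (f i) s) (1 / s) \<le> epow (SUP i\<in>I. epow (f i) s) (1 / s)"
      using assms by (intro epow_mono) auto
    then show "f i \<le> epow (SUP i\<in>I. epow (f i) s) (1 / s)"
      using assms by (simp add: epow_epow)
  qed
  then show "epow (SUP i\<in>I. f i) s \<le> (SUP i\<in>I. epow (f i) s)"
    using epow_mono[of "SUP i\<in>I. f i" _ s] assms by (fastforce simp: epow_epow)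
  show "(SUP i\<in>I. epow (f i) s) \<le> epow (SUP i\<in>I. f i) s"
    using assms by (intro SUP_least epow_mono SUP_upper) auto
qed

lemma measurable_epow [measurable]:
  assumes [measurable]: "f \<in> borel_measurable M"
  shows "(\<lambda>x. epow (f x) s) \<in> borel_measurable M"
proof -
  have "{x \<in> space M. f x = top} = f -` {top} \<inter> space M" by auto
  also have "\<dots> \<in> sets M" by (rule measurable_sets[OF assms]) auto
  finally show ?thesis unfolding epow_def by (intro measurable_If) simp_all
qed

lemma enn2real_exponent:
  assumes "1 \<le> p" "p \<noteq> top" shows "1 \<le> enn2real p"
  using assms by (cases p) auto

lemma Lp_enorm_top: "Lp_enorm top M F = esssup M F"
  by (simp add: Lp_enorm_def)

lemma Lp_enorm_le_iff:
  assumes "1 \<le> p" "p \<noteq> top"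
  shows "Lp_enorm p M F \<le> c \<longleftrightarrow> (\<integral>\<^sup>+ x. epow (F x) (enn2real p) \<partial>M) \<le> epow c (enn2real p)"
  using enn2real_exponent[OF assms] assms by (simp add: Lp_enorm_def epow_inverse_le_iff)

lemma Lp_enorm_mono_AE:
  assumes "1 \<le> p" "AE x in M. F x \<le> G x" and [measurable]: "F \<in> borel_measurable M"
  shows "Lp_enorm p M F \<le> Lp_enorm p M G"
proof (cases "p = top")
  case True then show ?thesis using assms by (simp add: Lp_enorm_top esssup_AE_mono)
next
  case False
  have "1 \<le> enn2real p" using enn2real_exponent assms False by blast
  have "AE x in M. epow (F x) (enn2real p) \<le> epow (G x) (enn2real p)"
    using assms(2) by eventually_elim (simp add: epow_mono)
  then show ?thesis using False \<open>1 \<le> enn2real p\<close>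
    by (auto simp: Lp_enorm_def intro!: epow_mono nn_integral_mono_AE)
qed

lemma Lp_enorm_mono:
  assumes "1 \<le> p" "\<And>x. F x \<le> G x" "F \<in> borel_measurable M"
  shows "Lp_enorm p M F \<le> Lp_enorm p M G"
  using assms by (intro Lp_enorm_mono_AE) auto

text \<open>The inequality covers all \<open>c\<close>, including 0 and infinity. For positive
  finite factors equality is recovered later by applying it to the inverse factor.\<close>

lemma Lp_enorm_cmult_le:
  assumes "1 \<le> p" and [measurable]: "F \<in> borel_measurable M"
  shows "Lp_enorm p M (\<lambda>x. c * F x) \<le> c * Lp_enorm p M F"
proof (cases "p = top")
  case True
  show ?thesis unfolding True Lp_enorm_top
  proof (rule esssup_I)
    show "AE x in M. c * F x \<le> c * esssup M F"
      using esssup_AE[of F M] by eventually_elim (simp add: mult_left_mono)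
  qed simp
next
  case False
  have 1: "1 \<le> enn2real p" using enn2real_exponent assms False by blast
  then show ?thesis using False
    by (simp add: Lp_enorm_def epow_mult nn_integral_cmult epow_epow)
qed

lemma Lp_enorm_1: "Lp_enorm 1 M F = (\<integral>\<^sup>+ x. F x \<partial>M)"
  by (simp add: Lp_enorm_def)

text \<open>The infinite exponent is the delicate case: the essential supremum of a section is at
  most c exactly when the section of {h > c} is a null set, and by sigma-finiteness the measure of a
  section depends measurably on the base point.\<close>

lemma Lp_enorm_measurable [measurable (raw)]:
  assumes "sigma_finite_measure M"
    and h[measurable]: "(\<lambda>(x, y). h x y) \<in> borel_measurable (N \<Otimes>\<^sub>M M)"
  shows "(\<lambda>x. Lp_enorm p M (h x)) \<in> borel_measurable N"
proof -
  interpret sigma_finite_measure M by fact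
  show ?thesis
  proof (cases "p = top")
    case False
    then show ?thesis by (simp add: Lp_enorm_def)
  next
    case True
    show ?thesis unfolding True Lp_enorm_top
    proof (rule borel_measurableI_le)
      fix c :: ennreal
      have "{x \<in> space N. esssup M (h x) \<le> c}
        = {x \<in> space N. (\<integral>\<^sup>+ y. indicator {z \<in> space (N \<Otimes>\<^sub>M M). c < h (fst z) (snd z)} (x, y) \<partial>M) = 0}"
      proof (intro Collect_cong conj_cong refl)
        fix x assume x: "x \<in> space N"
        have [measurable]: "h x \<in> borel_measurable M" using x by measurable
        have "(\<integral>\<^sup>+ y. indicator {z \<in> space (N \<Otimes>\<^sub>M M). c < h (fst z) (snd z)} (x, y) \<partial>M) = 0
          \<longleftrightarrow> (AE y in M. indicator {z \<in> space (N \<Otimes>\<^sub>M M). c < h (fst z) (snd z)} (x, y) = (0::ennreal))"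
          using x by (intro nn_integral_0_iff_AE) measurable
        also have "\<dots> \<longleftrightarrow> (AE y in M. h x y \<le> c)"
          using x by (intro AE_cong) (auto simp: indicator_def space_pair_measure)
        also have "\<dots> \<longleftrightarrow> esssup M (h x) \<le> c"
        proof
          assume "esssup M (h x) \<le> c"
          then show "AE y in M. h x y \<le> c"
            using esssup_AE[of "h x" M] by (auto intro: order_trans)
        qed (auto intro: esssup_I)
        finally show "(esssup M (h x) \<le> c) = ((\<integral>\<^sup>+ y. indicator {z \<in> space (N \<Otimes>\<^sub>M M). c < h (fst z) (snd z)} (x, y) \<partial>M) = 0)"
          by simp
      qed
      also have "\<dots> \<in> sets N" by measurable
      finally show "{x \<in> space N. esssup M (h x) \<le> c} \<in> sets N" .
    qed
  qed
qed

section \<open>Weighted Jensen inequality and Minkowski's integral inequality\<close>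

lemma young_weighted:
  fixes a n l p :: real
  assumes "1 \<le> p" "0 \<le> a" "0 < n" "0 < l"
  shows "a \<le> 1 / p * l powr (1 - p) * (a powr p * n powr (1 - p)) + (1 - 1 / p) * l * n"
proof (cases "a = 0 \<or> p = 1")
  case True
  then show ?thesis using assms by auto
next
  case False
  \<comment> \<open>Weighted arithmetic-geometric mean for \<open>a powr p\<close> and
    \<open>(l * n) powr p\<close>; multiplying by \<open>(l * n) powr (1 - p)\<close> afterwards
    leaves a left side linear in \<open>a\<close>. The parameter \<open>l\<close> is free and is
    optimised in \<open>Jensen_weighted\<close>.\<close>
  have "(a powr p) powr (1 / p) * ((l * n) powr p) powr (1 - 1 / p) \<le> 1 / p * a powr p + (1 - 1 / p) * (l * n) powr p"
    using assms False by (intro Youngs_inequality_0) auto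
  then have "a * (l * n) powr (p - 1) \<le> 1 / p * a powr p + (1 - 1 / p) * (l * n) powr p"
    using assms False by (simp add: powr_powr right_diff_distrib)
  then have "a * (l * n) powr (p - 1) * (l * n) powr (1 - p)
      \<le> (1 / p * a powr p + (1 - 1 / p) * (l * n) powr p) * (l * n) powr (1 - p)"
    by (rule mult_right_mono) simp
  then have "a \<le> 1 / p * a powr p * (l * n) powr (1 - p) + (1 - 1 / p) * (l * n)"
    using assms by (simp add: mult.assoc powr_add[symmetric] distrib_right)
  then show ?thesis using assms by (simp add: powr_mult mult_ac)
qed

lemma ennreal_lincomb:
  "0 \<le> a \<Longrightarrow> 0 \<le> b \<Longrightarrow> 0 \<le> x \<Longrightarrow> 0 \<le> y \<Longrightarrow>
    ennreal (a * x + b * y) = ennreal a * ennreal x + ennreal b * ennreal y"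
  by (simp add: ennreal_plus ennreal_mult)

text \<open>Jensen's inequality for the power p, the probability measure n dN / (int n) and the
  function h/n, obtained by integrating \<open>young_weighted\<close> with the best
  \<open>l\<close>.\<close>

lemma Jensen_weighted:
  fixes h n :: "'a \<Rightarrow> ennreal" and p :: real
  assumes [measurable]: "h \<in> borel_measurable N" "n \<in> borel_measurable N"
    and n: "\<And>y. y \<in> space N \<Longrightarrow> 0 < n y \<and> n y < top" and p: "1 \<le> p" and I: "(\<integral>\<^sup>+ y. n y \<partial>N) \<noteq> top"
  shows "epow (\<integral>\<^sup>+ y. h y \<partial>N) p
      \<le> (\<integral>\<^sup>+ y. epow (h y) p * epow (n y) (1 - p) \<partial>N) * epow (\<integral>\<^sup>+ y. n y \<partial>N) (p - 1)"
proof -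
  define I where "I = (\<integral>\<^sup>+ y. n y \<partial>N)"
  define T where "T = (\<integral>\<^sup>+ y. epow (h y) p * epow (n y) (1 - p) \<partial>N)"
  define S where "S = (\<integral>\<^sup>+ y. h y \<partial>N)"
  have "S = 0" if "I = 0 \<or> T = 0"
  proof -
    have "AE y in N. h y = 0"
      using that
    proof
      assume "I = 0"
      then have "AE y in N. n y = 0" by (simp add: I_def nn_integral_0_iff_AE)
      moreover have "AE y in N. n y > 0" using n by (intro AE_I2) auto
      ultimately show ?thesis by eventually_elim auto
    next
      assume "T = 0"
      then have "AE y in N. epow (h y) p * epow (n y) (1 - p) = 0" by (simp add: T_def nn_integral_0_iff_AE)
      moreover have "AE y in N. n y > 0" using n by (intro AE_I2) auto
      ultimately show ?thesis by eventually_elim auto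
    qed
    then show ?thesis by (simp add: S_def nn_integral_0_iff_AE)
  qed
  moreover have "epow S p \<le> T * epow I (p - 1)" if nz: "I \<noteq> 0" "T \<noteq> 0"
  proof (cases "T = top")
    case True
    then show ?thesis using that by (simp add: ennreal_top_mult)
  next
    case False
    then obtain t i where t: "T = ennreal t" "0 < t" and i: "I = ennreal i" "0 < i"
      using nz I by (metis I_def ennreal_0 ennreal_cases less_eq_real_def)
    \<comment> \<open>This \<open>l\<close> balances the two integrated terms: t = l^p i makes their
      sum l i, and (l i)^p = t i^(p-1) is the claimed bound.\<close>
    define l where "l = (t / i) powr (1 / p)"
    have l: "0 < l" "l powr p = t / i" using t i p by (auto simp: l_def powr_powr)
    have "h y \<le> ennreal (1 / p * l powr (1 - p)) * (epow (h y) p * epow (n y) (1 - p)) + ennreal ((1 - 1 / p) * l) * n y"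
      if y: "y \<in> space N" for y
    proof (cases "h y")
      case top
      then show ?thesis using l p n[OF y] by (auto simp: ennreal_mult_top ennreal_top_mult)
    next
      case (real a)
      obtain b where b: "n y = ennreal b" "0 < b" using n[OF y]
        by (metis ennreal_cases ennreal_less_zero_iff less_irrefl)
      have "ennreal a \<le> ennreal (1 / p * l powr (1 - p) * (a powr p * b powr (1 - p)) + (1 - 1 / p) * l * b)"
        using p real(1) b(2) l(1) by (intro ennreal_leI young_weighted) auto
      also have "\<dots> = ennreal (1 / p * l powr (1 - p)) * (epow (h y) p * epow (n y) (1 - p)) + ennreal ((1 - 1 / p) * l) * n y"
      proof -
        have "ennreal (c1 * (x1 * x2) + c2 * x3) = ennreal c1 * (ennreal x1 * ennreal x2) + ennreal c2 * ennreal x3"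
          if "0 \<le> c1" "0 \<le> c2" "0 \<le> x1" "0 \<le> x2" "0 \<le> x3" for c1 c2 x1 x2 x3
          using that by (simp add: ennreal_plus ennreal_mult)
        from this[of "1 / p * l powr (1 - p)" "(1 - 1 / p) * l" "a powr p" "b powr (1 - p)" b]
        show ?thesis using p b l(1) unfolding real(2) b(1) epow_ennreal[OF real(1)] epow_ennreal[OF less_imp_le[OF b(2)]]
          by simp
      qed
      finally show ?thesis using real by simp
    qed
    then have "S \<le> (\<integral>\<^sup>+ y. ennreal (1 / p * l powr (1 - p)) * (epow (h y) p * epow (n y) (1 - p)) + ennreal ((1 - 1 / p) * l) * n y \<partial>N)"
      unfolding S_def by (rule nn_integral_mono)
    also have "\<dots> = ennreal (1 / p * l powr (1 - p)) * T + ennreal ((1 - 1 / p) * l) * I"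
      unfolding T_def I_def by (simp add: nn_integral_add nn_integral_cmult)
    also have "\<dots> = ennreal (1 / p * l powr (1 - p) * t + (1 - 1 / p) * l * i)"
      unfolding t(1) i(1) by (rule ennreal_lincomb[symmetric]) (use p l t i in auto)
    also have "1 / p * l powr (1 - p) * t + (1 - 1 / p) * l * i = l * i"
    proof -
      have "t = l powr p * i" using l i by simp
      then have "l powr (1 - p) * t = l * i"
        using l(1) by (simp add: powr_add[symmetric])
      then have "1 / p * l powr (1 - p) * t = 1 / p * (l * i)"
        by (simp add: mult.assoc)
      then show ?thesis by (simp add: algebra_simps)
    qed
    finally have "epow S p \<le> epow (ennreal (l * i)) p" using p by (intro epow_mono) auto
    also have "\<dots> = ennreal (t * i powr (p - 1))"
      using l i by (simp add: epow_ennreal powr_mult powr_diff)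
    also have "\<dots> = T * epow I (p - 1)"
      using t i by (simp add: epow_ennreal ennreal_mult)
    finally show ?thesis .
  qed
  ultimately show ?thesis using p unfolding S_def[symmetric] I_def[symmetric] T_def[symmetric] by fastforce
qed

text \<open>Jensen with the majorant \<open>n\<close> itself as weight: after exchanging the
  integrals, a section of norm at most n(y) contributes at most n(y)^p n(y)^(1-p) = n(y). This takes
  the place of the usual duality argument. A majorant is used because the norms themselves may
  vanish or be infinite.\<close>

lemma Minkowski_aux:
  fixes h :: "'a \<Rightarrow> 'b \<Rightarrow> ennreal"
  assumes "1 \<le> p" "sigma_finite_measure M" "sigma_finite_measure N"
    and h[measurable]: "(\<lambda>(x, y). h x y) \<in> borel_measurable (M \<Otimes>\<^sub>M N)"
    and n[measurable]: "n \<in> borel_measurable N"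
    and n: "\<And>y. y \<in> space N \<Longrightarrow> 0 < n y \<and> n y < top"
    and le: "AE y in N. Lp_enorm p M (\<lambda>x. h x y) \<le> n y"
  shows "Lp_enorm p M (\<lambda>x. \<integral>\<^sup>+ y. h x y \<partial>N) \<le> (\<integral>\<^sup>+ y. n y \<partial>N)"
proof (cases "(\<integral>\<^sup>+ y. n y \<partial>N) = top")
  case False
  interpret M: sigma_finite_measure M by fact
  interpret N: sigma_finite_measure N by fact
  interpret MN: pair_sigma_finite M N by standard
  have hy[measurable]: "(\<lambda>x. h x y) \<in> borel_measurable M" if "y \<in> space N" for y
    using that by measurable
  show ?thesis
  proof (cases "p = top")
    case True
    show ?thesis unfolding True Lp_enorm_top
    proof (rule esssup_I)
      have "AE y in N. AE x in M. h x y \<le> n y"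
        using le AE_space
      proof eventually_elim
        case (elim y)
        show ?case using esssup_AE[of "\<lambda>x. h x y" M] elim(1) unfolding True Lp_enorm_top
          by (auto elim: eventually_mono intro: order_trans)
      qed
      then have "AE x in M. AE y in N. h x y \<le> n y"
        by (subst MN.AE_commute) auto
      then show "AE x in M. (\<integral>\<^sup>+ y. h x y \<partial>N) \<le> (\<integral>\<^sup>+ y. n y \<partial>N)"
        by eventually_elim (rule nn_integral_mono_AE)
    qed simp
  next
    case p: False
    define s where "s = enn2real p"
    have s: "1 \<le> s" using enn2real_exponent[OF assms(1) p] by (simp add: s_def)
    define I where "I = (\<integral>\<^sup>+ y. n y \<partial>N)"
    have "(\<integral>\<^sup>+ x. epow (\<integral>\<^sup>+ y. h x y \<partial>N) s \<partial>M)
      \<le> (\<integral>\<^sup>+ x. (\<integral>\<^sup>+ y. epow (h x y) s * epow (n y) (1 - s) \<partial>N) * epow I (s - 1) \<partial>M)"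
      unfolding I_def using n s False by (intro nn_integral_mono Jensen_weighted) auto
    also have "\<dots> = (\<integral>\<^sup>+ x. (\<integral>\<^sup>+ y. epow (h x y) s * epow (n y) (1 - s) \<partial>N) \<partial>M) * epow I (s - 1)"
      by (simp add: nn_integral_multc)
    also have "(\<integral>\<^sup>+ x. (\<integral>\<^sup>+ y. epow (h x y) s * epow (n y) (1 - s) \<partial>N) \<partial>M) =
      (\<integral>\<^sup>+ y. (\<integral>\<^sup>+ x. epow (h x y) s * epow (n y) (1 - s) \<partial>M) \<partial>N)"
      by (rule MN.Fubini'[symmetric]) simp
    also have "\<dots> = (\<integral>\<^sup>+ y. (\<integral>\<^sup>+ x. epow (h x y) s \<partial>M) * epow (n y) (1 - s) \<partial>N)"
      by (intro nn_integral_cong nn_integral_multc) simp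
    also have "\<dots> \<le> (\<integral>\<^sup>+ y. n y \<partial>N)"
    proof (rule nn_integral_mono_AE)
      show "AE y in N. (\<integral>\<^sup>+ x. epow (h x y) s \<partial>M) * epow (n y) (1 - s) \<le> n y"
        using le AE_space
      proof eventually_elim
        case (elim y)
        obtain b where b: "n y = ennreal b" "0 < b" using n[OF elim(2)]
          by (metis ennreal_cases ennreal_less_zero_iff less_irrefl)
        have "(\<integral>\<^sup>+ x. epow (h x y) s \<partial>M) \<le> epow (n y) s"
          using elim Lp_enorm_le_iff[OF assms(1) p, of M "\<lambda>x. h x y" "n y"] by (simp add: s_def)
        then have "(\<integral>\<^sup>+ x. epow (h x y) s \<partial>M) * epow (n y) (1 - s) \<le> epow (n y) s * epow (n y) (1 - s)"
          by (rule mult_right_mono) simp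
        also have "\<dots> = n y" using b by (simp add: epow_ennreal ennreal_mult'[symmetric] powr_add[symmetric])
        finally show ?case .
      qed
    qed
    finally have "(\<integral>\<^sup>+ x. epow (\<integral>\<^sup>+ y. h x y \<partial>N) s \<partial>M) \<le> I * epow I (s - 1)"
      unfolding I_def by (simp add: mult_right_mono)
    also have "\<dots> = epow I s"
      using False unfolding I_def[symmetric]
    proof (cases I)
      case (real r)
      have "r * r powr (s - 1) = r powr s" using real by (cases "r = 0") (auto simp: powr_diff)
      then show ?thesis using real by (simp add: epow_ennreal ennreal_mult'[symmetric])
    qed simp
    finally show ?thesis
      using Lp_enorm_le_iff[OF assms(1) p] unfolding s_def I_def by blast
  qed
qed simp

lemma Minkowski:
  fixes h :: "'a \<Rightarrow> 'b \<Rightarrow> ennreal"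
  assumes "1 \<le> p" "sigma_finite_measure M" "sigma_finite_measure N"
    and h[measurable]: "(\<lambda>(x, y). h x y) \<in> borel_measurable (M \<Otimes>\<^sub>M N)"
  shows "Lp_enorm p M (\<lambda>x. \<integral>\<^sup>+ y. h x y \<partial>N) \<le> (\<integral>\<^sup>+ y. Lp_enorm p M (\<lambda>x. h x y) \<partial>N)"
proof (cases "(\<integral>\<^sup>+ y. Lp_enorm p M (\<lambda>x. h x y) \<partial>N) = top")
  case False
  interpret M: sigma_finite_measure M by fact
  interpret N: sigma_finite_measure N by fact
  define k where "k = (\<lambda>y. Lp_enorm p M (\<lambda>x. h x y))"
  have k[measurable]: "k \<in> borel_measurable N"
    unfolding k_def by (rule Lp_enorm_measurable) (use assms in measurable)
  have kf: "AE y in N. k y \<noteq> top"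
    using False unfolding k_def[symmetric] by (rule nn_integral_PInf_AE[OF k, simplified])
  \<comment> \<open>Sigma-finiteness provides a strictly positive integrable function. With k set to
    0 on the null set where it is infinite, k + e g is an admissible majorant in
    \<open>Minkowski_aux\<close>; finally e tends to 0.\<close>
  obtain g where g[measurable]: "g \<in> borel_measurable N" and gi: "(\<integral>\<^sup>+ y. g y \<partial>N) \<noteq> top"
    and gp: "\<And>y. y \<in> space N \<Longrightarrow> 0 < g y \<and> g y < top"
    using N.Ex_finite_integrable_function by auto
  have "Lp_enorm p M (\<lambda>x. \<integral>\<^sup>+ y. h x y \<partial>N) \<le> (\<integral>\<^sup>+ y. k y \<partial>N) + ennreal e * (\<integral>\<^sup>+ y. g y \<partial>N)"
    if e: "0 < e" for e
  proof -
    have "Lp_enorm p M (\<lambda>x. \<integral>\<^sup>+ y. h x y \<partial>N)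
        \<le> (\<integral>\<^sup>+ y. (if k y = top then 0 else k y) + ennreal e * g y \<partial>N)"
    proof (rule Minkowski_aux[OF assms])
      show "0 < (if k y = top then 0 else k y) + ennreal e * g y \<and> (if k y = top then 0 else k y) + ennreal e * g y < top" if "y \<in> space N" for y
        using gp[OF that] e by (auto simp: zero_less_iff_neq_zero less_top[symmetric] ennreal_mult_eq_top_iff)
      show "AE y in N. Lp_enorm p M (\<lambda>x. h x y) \<le> (if k y = top then 0 else k y) + ennreal e * g y"
        using kf by eventually_elim (auto simp: k_def add_increasing2)
    qed measurable
    also have "\<dots> = (\<integral>\<^sup>+ y. (if k y = top then 0 else k y) \<partial>N) + ennreal e * (\<integral>\<^sup>+ y. g y \<partial>N)"
      by (simp add: nn_integral_add nn_integral_cmult)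
    also have "(\<integral>\<^sup>+ y. (if k y = top then 0 else k y) \<partial>N) \<le> (\<integral>\<^sup>+ y. k y \<partial>N)"
      by (intro nn_integral_mono) auto
    finally show ?thesis by (simp add: add_mono)
  qed
  note * = this
  obtain J where J: "(\<integral>\<^sup>+ y. g y \<partial>N) = ennreal J" "0 \<le> J" using gi by (cases "\<integral>\<^sup>+ y. g y \<partial>N") auto
  show ?thesis unfolding k_def[symmetric]
  proof (rule ennreal_le_epsilon)
    fix e :: real assume e: "0 < e"
    have "Lp_enorm p M (\<lambda>x. \<integral>\<^sup>+ y. h x y \<partial>N) \<le> (\<integral>\<^sup>+ y. k y \<partial>N) + ennreal (e / (J + 1)) * ennreal J"
      using *[of "e / (J + 1)"] e J by simp
    also have "ennreal (e / (J + 1)) * ennreal J \<le> ennreal e"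
      using e J by (simp add: ennreal_mult'[symmetric] ennreal_leI field_simps)
    finally show "Lp_enorm p M (\<lambda>x. \<integral>\<^sup>+ y. h x y \<partial>N) \<le> (\<integral>\<^sup>+ y. k y \<partial>N) + ennreal e"
      by (simp add: add_mono)
  qed
qed simp

section \<open>Monotone limits, Fatou's lemma and a crude Hoelder inequality\<close>

lemma Lp_enorm_SUP_le:
  assumes p: "1 \<le> p" and "incseq J" and [measurable]: "\<And>n. J n \<in> borel_measurable M"
  shows "Lp_enorm p M (\<lambda>x. SUP n. J n x) \<le> (SUP n::nat. Lp_enorm p M (J n))"
proof (cases "p = top")
  case True
  show ?thesis unfolding True Lp_enorm_top
  proof (rule esssup_I)
    have "AE x in M. \<forall>n. J n x \<le> esssup M (J n)"
      by (subst AE_all_countable) (auto intro: esssup_AE)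
    then show "AE x in M. (SUP n. J n x) \<le> (SUP n. esssup M (J n))"
      by eventually_elim (auto intro!: SUP_mono)
  qed measurable
next
  case False
  have s: "1 \<le> enn2real p" using enn2real_exponent[OF p False] .
  have inc: "incseq (\<lambda>n x. epow (J n x) (enn2real p))"
    using assms(2) s by (auto simp: incseq_def le_fun_def intro: epow_mono)
  show ?thesis using s False
    by (simp add: Lp_enorm_def epow_SUP nn_integral_monotone_convergence_SUP[OF inc])
qed

lemma Lp_enorm_liminf_le:
  assumes p: "1 \<le> p" and [measurable]: "\<And>n. F n \<in> borel_measurable M"
  shows "Lp_enorm p M (\<lambda>x. liminf (\<lambda>n. F n x)) \<le> liminf (\<lambda>n. Lp_enorm p M (F n))"
proof -
  have "Lp_enorm p M (\<lambda>x. liminf (\<lambda>n. F n x)) = Lp_enorm p M (\<lambda>x. SUP n. INF k\<in>{n..}. F k x)"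
    by (simp add: liminf_SUP_INF)
  also have "\<dots> \<le> (SUP n. Lp_enorm p M (\<lambda>x. INF k\<in>{n..}. F k x))"
    using p by (intro Lp_enorm_SUP_le) (auto simp: incseq_def le_fun_def intro!: INF_superset_mono)
  also have "\<dots> \<le> (SUP n. INF k\<in>{n..}. Lp_enorm p M (F k))"
    using p by (intro SUP_mono') (auto intro!: INF_greatest Lp_enorm_mono INF_lower)
  finally show ?thesis by (simp add: liminf_SUP_INF)
qed

text \<open>A Hoelder inequality whose constant does not depend on p. With L the norm of h, the
  integrand is at most L psi where h <= L; elsewhere h <= L^(1-p) h^p, and the integral of the
  latter is at most L.\<close>

lemma nn_integral_mult_le_Lp_enorm:
  assumes p: "1 \<le> p" and [measurable]: "h \<in> borel_measurable M" "\<psi> \<in> borel_measurable M"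
    and \<psi>: "\<And>x. \<psi> x \<le> 1"
  shows "(\<integral>\<^sup>+ x. h x * \<psi> x \<partial>M) \<le> (1 + (\<integral>\<^sup>+ x. \<psi> x \<partial>M)) * Lp_enorm p M h"
proof (cases "p = top")
  case True
  have "(\<integral>\<^sup>+ x. h x * \<psi> x \<partial>M) \<le> (\<integral>\<^sup>+ x. esssup M h * \<psi> x \<partial>M)"
    using esssup_AE[of h M] by (intro nn_integral_mono_AE) (auto elim!: eventually_mono intro: mult_right_mono)
  also have "\<dots> = (\<integral>\<^sup>+ x. \<psi> x \<partial>M) * Lp_enorm p M h"
    by (simp add: nn_integral_multc True Lp_enorm_top mult.commute)
  also have "\<dots> \<le> (1 + (\<integral>\<^sup>+ x. \<psi> x \<partial>M)) * Lp_enorm p M h"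
    by (intro mult_right_mono) auto
  finally show ?thesis .
next
  case False
  define s where "s = enn2real p"
  have s: "1 \<le> s" using enn2real_exponent[OF p False] by (simp add: s_def)
  define L where "L = Lp_enorm p M h"
  have L: "(\<integral>\<^sup>+ x. epow (h x) s \<partial>M) \<le> epow L s"
    using Lp_enorm_le_iff[OF p False, of M h L] by (simp add: L_def s_def)
  consider "L = 0" | "L = top" | l where "L = ennreal l" "0 < l"
    by (metis ennreal_0 ennreal_cases less_eq_real_def)
  then show ?thesis unfolding L_def[symmetric]
  proof cases
    case 1
    then have "AE x in M. h x = 0" using L by (simp add: nn_integral_0_iff_AE)
    then have "AE x in M. h x * \<psi> x = 0" by eventually_elim auto
    then have "(\<integral>\<^sup>+ x. h x * \<psi> x \<partial>M) = 0" by (simp add: nn_integral_0_iff_AE)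
    then show "(\<integral>\<^sup>+ x. h x * \<psi> x \<partial>M) \<le> (1 + (\<integral>\<^sup>+ x. \<psi> x \<partial>M)) * L" by simp
  next
    case 2
    then show "(\<integral>\<^sup>+ x. h x * \<psi> x \<partial>M) \<le> (1 + (\<integral>\<^sup>+ x. \<psi> x \<partial>M)) * L" by (simp add: ennreal_mult_top)
  next
    case 3
    have pw: "h x * \<psi> x \<le> L * \<psi> x + ennreal (l powr (1 - s)) * epow (h x) s" for x
    proof (cases "h x")
      case top
      then show ?thesis using 3 by (simp add: ennreal_mult_top)
    next
      case (real a)
      show ?thesis
      proof (cases "a \<le> l")
        case True
        then have "h x * \<psi> x \<le> L * \<psi> x" using real 3 by (intro mult_right_mono) (auto intro: ennreal_leI)
        then show ?thesis by (rule add_increasing2[rotated]) simp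
      next
        case False
        have "l powr (s - 1) \<le> a powr (s - 1)" using False 3 s by (intro powr_mono2) auto
        then have "(l powr (1 - s) * a) * l powr (s - 1) \<le> (l powr (1 - s) * a) * a powr (s - 1)"
          using real by (intro mult_left_mono) auto
        moreover have "(l powr (1 - s) * a) * l powr (s - 1) = a"
          using 3 by (simp add: powr_diff)
        moreover have "a * a powr (s - 1) = a powr s" using 3 False by (simp add: powr_diff)
        ultimately have "a \<le> l powr (1 - s) * a powr s" by (metis mult.assoc)
        then have "h x \<le> ennreal (l powr (1 - s)) * epow (h x) s"
          using real by (simp add: epow_ennreal ennreal_mult'[symmetric] ennreal_leI)
        moreover have "h x * \<psi> x \<le> h x" using mult_left_mono[OF \<psi>, of "h x" x] by simp
        ultimately have "h x * \<psi> x \<le> ennreal (l powr (1 - s)) * epow (h x) s" by (rule order_trans[rotated])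
        then show ?thesis by (rule add_increasing[rotated]) simp
      qed
    qed
    have "(\<integral>\<^sup>+ x. h x * \<psi> x \<partial>M) \<le> (\<integral>\<^sup>+ x. L * \<psi> x + ennreal (l powr (1 - s)) * epow (h x) s \<partial>M)"
      by (intro nn_integral_mono pw)
    also have "\<dots> = L * (\<integral>\<^sup>+ x. \<psi> x \<partial>M) + ennreal (l powr (1 - s)) * (\<integral>\<^sup>+ x. epow (h x) s \<partial>M)"
      by (simp add: nn_integral_add nn_integral_cmult)
    also have "\<dots> \<le> L * (\<integral>\<^sup>+ x. \<psi> x \<partial>M) + ennreal (l powr (1 - s)) * epow L s"
      using L by (intro add_left_mono mult_left_mono) auto
    also have "ennreal (l powr (1 - s)) * epow L s = L"
      using 3 by (simp add: epow_ennreal ennreal_mult'[symmetric] powr_add[symmetric])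
    finally show "(\<integral>\<^sup>+ x. h x * \<psi> x \<partial>M) \<le> (1 + (\<integral>\<^sup>+ x. \<psi> x \<partial>M)) * L"
      by (simp add: algebra_simps)
  qed
qed

text \<open>For 0 <= h <= 1 one has h^p <= h, so the integral controls all finite exponents at
  once.\<close>

lemma Lp_enorm_finite:
  assumes p: "1 \<le> p" and [measurable]: "h \<in> borel_measurable M"
    and h: "\<And>x. h x \<le> 1" "(\<integral>\<^sup>+ x. h x \<partial>M) < top"
  shows "Lp_enorm p M h < top"
proof (cases "p = top")
  case True
  have "esssup M h \<le> 1" using h by (intro esssup_I) auto
  then show ?thesis unfolding True Lp_enorm_top by (simp add: order_le_less_trans)
next
  case False
  have s: "1 \<le> enn2real p" using enn2real_exponent[OF p False] .
  have "epow (h x) (enn2real p) \<le> h x" for x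
  proof -
    obtain a where a: "h x = ennreal a" "0 \<le> a" "a \<le> 1"
      using h(1)[of x] by (metis ennreal_cases ennreal_le_1 top.extremum_uniqueI ennreal_one_neq_top)
    then have "a powr enn2real p \<le> a" using s powr_mono'[of 1 "enn2real p" a] by (cases "a = 0") auto
    then show ?thesis using a by (simp add: epow_ennreal ennreal_leI)
  qed
  then have "(\<integral>\<^sup>+ x. epow (h x) (enn2real p) \<partial>M) \<le> (\<integral>\<^sup>+ x. h x \<partial>M)" by (rule nn_integral_mono)
  then have "(\<integral>\<^sup>+ x. epow (h x) (enn2real p) \<partial>M) \<noteq> top" using h(2) by (auto simp: top_unique)
  then show ?thesis using False by (simp add: Lp_enorm_def less_top[symmetric])
qed

section \<open>Mixed norms and convolutions\<close>

lemma borel_measurable_fst' [measurable (raw)]: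
  fixes f :: "'c \<Rightarrow> 'a::second_countable_topology \<times> 'b::second_countable_topology"
  assumes "f \<in> borel_measurable M" shows "(\<lambda>x. fst (f x)) \<in> borel_measurable M"
  using assms by (rule measurable_compose) (simp add: borel_measurable_continuous_onI continuous_on_fst)

lemma borel_measurable_snd' [measurable (raw)]:
  fixes f :: "'c \<Rightarrow> 'a::second_countable_topology \<times> 'b::second_countable_topology"
  assumes "f \<in> borel_measurable M" shows "(\<lambda>x. snd (f x)) \<in> borel_measurable M"
  using assms by (rule measurable_compose) (simp add: borel_measurable_continuous_onI continuous_on_snd)

lemma nn_integral_lborel_reflect:
  fixes a :: "'a::euclidean_space"
  assumes [measurable]: "f \<in> borel_measurable borel"
  shows "(\<integral>\<^sup>+ x. f (a - x) \<partial>lborel) = (\<integral>\<^sup>+ x. f x \<partial>lborel)"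
  by (subst (2) lborel_affine[of "-1" a]) (simp_all add: nn_integral_density nn_integral_distr)

lemma nn_integral_lborel_shift:
  fixes a :: "'a::euclidean_space"
  assumes [measurable]: "f \<in> borel_measurable borel"
  shows "(\<integral>\<^sup>+ x. f (x - a) \<partial>lborel) = (\<integral>\<^sup>+ x. f x \<partial>lborel)"
  by (subst (2) lborel_affine[of 1 "- a"]) (simp_all add: nn_integral_density nn_integral_distr)

lemma AE_lborel_shift:
  fixes a :: "'a::euclidean_space"
  assumes [measurable]: "Measurable.pred borel P" and "AE x in lborel. P x"
  shows "AE x in lborel. P (x - a)"
proof -
  have eq: "distr lborel borel (\<lambda>x. x - a) = lborel"
    using lborel_affine[of 1 "- a"] by (simp add: density_1)
  have "AE x in distr lborel borel (\<lambda>x. x - a). P x"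
    unfolding eq by (rule assms(2))
  then show ?thesis by (subst (asm) AE_distr_iff) auto
qed

lemma Lp_enorm_shift_le:
  fixes a :: "'a::euclidean_space"
  assumes [measurable]: "h \<in> borel_measurable borel"
  shows "Lp_enorm p lborel (\<lambda>x. h (x - a)) \<le> Lp_enorm p lborel h"
proof (cases "p = top")
  case True
  show ?thesis unfolding True Lp_enorm_top
  proof (rule esssup_I)
    show "AE x in lborel. h (x - a) \<le> esssup lborel h"
      by (rule AE_lborel_shift[OF _ esssup_AE[of h lborel]]) simp
  qed simp
next
  case False
  have "(\<integral>\<^sup>+ x. epow (h (x - a)) (enn2real p) \<partial>lborel) = (\<integral>\<^sup>+ x. epow (h x) (enn2real p) \<partial>lborel)"
    by (rule nn_integral_lborel_shift[of "\<lambda>x. epow (h x) (enn2real p)"]) simp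
  then show ?thesis using False by (simp add: Lp_enorm_def)
qed

text \<open>The mixed norm of an extended nonnegative function into which the weight is already
  multiplied. In this form Minkowski, Fatou and Young apply without any integrability
  question.\<close>

definition Lpq_enorm ::
  "ennreal \<Rightarrow> ennreal \<Rightarrow> ('a::euclidean_space \<times> 'b::euclidean_space \<Rightarrow> ennreal) \<Rightarrow> ennreal" where
  "Lpq_enorm p q h = Lp_enorm q lborel (\<lambda>\<omega>. Lp_enorm p lborel (\<lambda>x. h (x, \<omega>)))"

lemma Lpq_norm_eq: "Lpq_norm p q m F = Lpq_enorm p q (\<lambda>z. ennreal (cmod (F z)) * ennreal (m z))"
  by (simp add: Lpq_norm_def Lpq_enorm_def ennreal_mult')

lemma Lp_enorm_section_measurable [measurable]:
  fixes h :: "'a::euclidean_space \<times> 'b::euclidean_space \<Rightarrow> ennreal"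
  assumes [measurable]: "h \<in> borel_measurable borel"
  shows "(\<lambda>\<omega>. Lp_enorm p lborel (\<lambda>x. h (x, \<omega>))) \<in> borel_measurable borel"
proof -
  have [measurable]: "h \<in> borel_measurable (borel \<Otimes>\<^sub>M borel)" by (simp add: borel_prod)
  show ?thesis by (rule Lp_enorm_measurable) (auto intro: sigma_finite_lborel)
qed

lemma section_measurable [measurable (raw)]:
  fixes h :: "'a::euclidean_space \<times> 'b::euclidean_space \<Rightarrow> ennreal"
  assumes "h \<in> borel_measurable borel"
  shows "(\<lambda>x. h (x, \<omega>)) \<in> borel_measurable borel"
proof -
  have [measurable]: "h \<in> borel_measurable (borel \<Otimes>\<^sub>M borel)" using assms by (simp add: borel_prod)
  show ?thesis by measurable
qed

lemma Lpq_enorm_mono: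
  assumes "1 \<le> p" "1 \<le> q" "\<And>z. h z \<le> k z" and [measurable]: "h \<in> borel_measurable borel"
  shows "Lpq_enorm p q h \<le> Lpq_enorm p q k"
  unfolding Lpq_enorm_def using assms by (intro Lp_enorm_mono) simp_all

lemma Lpq_enorm_cmult_le:
  assumes "1 \<le> p" "1 \<le> q" and [measurable]: "h \<in> borel_measurable borel"
  shows "Lpq_enorm p q (\<lambda>z. c * h z) \<le> c * Lpq_enorm p q h"
proof -
  have "Lpq_enorm p q (\<lambda>z. c * h z) \<le> Lp_enorm q lborel (\<lambda>\<omega>. c * Lp_enorm p lborel (\<lambda>x. h (x, \<omega>)))"
    unfolding Lpq_enorm_def using assms by (intro Lp_enorm_mono Lp_enorm_cmult_le) simp_all
  also have "\<dots> \<le> c * Lpq_enorm p q h"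
    unfolding Lpq_enorm_def using assms by (intro Lp_enorm_cmult_le) simp_all
  finally show ?thesis .
qed

lemma Lpq_enorm_Minkowski:
  fixes h :: "'a::euclidean_space \<times> 'b::euclidean_space \<Rightarrow> 'c \<Rightarrow> ennreal"
  assumes p: "1 \<le> p" "1 \<le> q" and N: "sigma_finite_measure N"
    and h: "(\<lambda>(z, y). h z y) \<in> borel_measurable (borel \<Otimes>\<^sub>M N)"
  shows "Lpq_enorm p q (\<lambda>z. \<integral>\<^sup>+ y. h z y \<partial>N) \<le> (\<integral>\<^sup>+ y. Lpq_enorm p q (\<lambda>z. h z y) \<partial>N)"
proof -
  interpret N: sigma_finite_measure N by fact
  have h'[measurable]: "(\<lambda>(z, y). h z y) \<in> borel_measurable ((borel \<Otimes>\<^sub>M borel) \<Otimes>\<^sub>M N)"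
    using h by (simp add: borel_prod)
  have m1: "(\<lambda>(x, y). h (x, \<omega>) y) \<in> borel_measurable (lborel \<Otimes>\<^sub>M N)" for \<omega>
    by measurable
  have "(\<lambda>z. \<integral>\<^sup>+ y. h z y \<partial>N) \<in> borel_measurable borel"
    using h by (intro N.borel_measurable_nn_integral)
  note [measurable] = this
  have m2: "(\<lambda>(\<omega>, y). Lp_enorm p lborel (\<lambda>x. h (x, \<omega>) y)) \<in> borel_measurable (lborel \<Otimes>\<^sub>M N)"
    unfolding case_prod_beta'
    by (rule Lp_enorm_measurable[OF sigma_finite_lborel]) measurable
  have "Lpq_enorm p q (\<lambda>z. \<integral>\<^sup>+ y. h z y \<partial>N) \<le>
      Lp_enorm q lborel (\<lambda>\<omega>. \<integral>\<^sup>+ y. Lp_enorm p lborel (\<lambda>x. h (x, \<omega>) y) \<partial>N)"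
    unfolding Lpq_enorm_def
    by (intro Lp_enorm_mono Minkowski p N sigma_finite_lborel m1) simp
  also have "\<dots> \<le> (\<integral>\<^sup>+ y. Lp_enorm q lborel (\<lambda>\<omega>. Lp_enorm p lborel (\<lambda>x. h (x, \<omega>) y)) \<partial>N)"
    by (intro Minkowski p N sigma_finite_lborel m2)
  finally show ?thesis unfolding Lpq_enorm_def .
qed

lemma Lpq_enorm_add_le:
  assumes p: "1 \<le> p" "1 \<le> q" and [measurable]: "h \<in> borel_measurable borel" "k \<in> borel_measurable borel"
  shows "Lpq_enorm p q (\<lambda>z. h z + k z) \<le> Lpq_enorm p q h + Lpq_enorm p q k"
proof -
  \<comment> \<open>The triangle inequality is Minkowski's inequality for counting measure on two
    points.\<close>
  have "Lpq_enorm p q (\<lambda>z. \<integral>\<^sup>+ b. (if b then h z else k z) \<partial>count_space (UNIV :: bool set))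
    \<le> (\<integral>\<^sup>+ b. Lpq_enorm p q (\<lambda>z. if b then h z else k z) \<partial>count_space (UNIV :: bool set))"
    by (intro Lpq_enorm_Minkowski p sigma_finite_measure_count_space_finite) measurable
  then show ?thesis by (simp add: nn_integral_count_space_finite UNIV_bool add.commute)
qed

lemma Lpq_enorm_shift_le:
  fixes a :: "'a::euclidean_space \<times> 'b::euclidean_space"
  assumes p: "1 \<le> p" "1 \<le> q" and [measurable]: "h \<in> borel_measurable borel"
  shows "Lpq_enorm p q (\<lambda>z. h (z - a)) \<le> Lpq_enorm p q h"
proof -
  have "Lpq_enorm p q (\<lambda>z. h (z - a)) \<le> Lp_enorm q lborel (\<lambda>\<omega>. Lp_enorm p lborel (\<lambda>x. h (x, \<omega> - snd a)))"
    unfolding Lpq_enorm_def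
  proof (rule Lp_enorm_mono[OF p(2)])
    show "Lp_enorm p lborel (\<lambda>x. h ((x, \<omega>) - a)) \<le> Lp_enorm p lborel (\<lambda>x. h (x, \<omega> - snd a))" for \<omega>
      using Lp_enorm_shift_le[of "\<lambda>x. h (x, \<omega> - snd a)" p "fst a"] by (simp add: minus_prod_def)
    have "(\<lambda>z. h (z - a)) \<in> borel_measurable borel" by simp
    then show "(\<lambda>\<omega>. Lp_enorm p lborel (\<lambda>x. h ((x, \<omega>) - a))) \<in> borel_measurable lborel" by simp
  qed
  also have "\<dots> \<le> Lpq_enorm p q h"
    unfolding Lpq_enorm_def by (rule Lp_enorm_shift_le[of "\<lambda>\<omega>. Lp_enorm p lborel (\<lambda>x. h (x, \<omega>))"]) simp
  finally show ?thesis .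
qed

lemma Lpq_enorm_liminf_le:
  assumes p: "1 \<le> p" "1 \<le> q" and [measurable]: "\<And>n. F n \<in> borel_measurable borel"
  shows "Lpq_enorm p q (\<lambda>z. liminf (\<lambda>n. F n z)) \<le> liminf (\<lambda>n. Lpq_enorm p q (F n))"
proof -
  have "Lpq_enorm p q (\<lambda>z. liminf (\<lambda>n. F n z)) \<le> Lp_enorm q lborel (\<lambda>\<omega>. liminf (\<lambda>n. Lp_enorm p lborel (\<lambda>x. F n (x, \<omega>))))"
    unfolding Lpq_enorm_def using p by (intro Lp_enorm_mono Lp_enorm_liminf_le) simp_all
  also have "\<dots> \<le> liminf (\<lambda>n. Lpq_enorm p q (F n))"
    unfolding Lpq_enorm_def using p by (intro Lp_enorm_liminf_le) simp_all
  finally show ?thesis .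
qed

lemma nn_integral_lborel_iterated:
  fixes h :: "'a::euclidean_space \<times> 'b::euclidean_space \<Rightarrow> ennreal"
  assumes "h \<in> borel_measurable borel"
  shows "(\<integral>\<^sup>+ \<omega>. \<integral>\<^sup>+ x. h (x, \<omega>) \<partial>lborel \<partial>lborel) = (\<integral>\<^sup>+ z. h z \<partial>lborel)"
proof -
  have "h \<in> borel_measurable (lborel \<Otimes>\<^sub>M lborel)" using assms by (simp add: lborel_prod)
  from lborel_pair.nn_integral_snd[OF this] show ?thesis by (simp add: lborel_prod)
qed

lemma Lpq_enorm_1: "h \<in> borel_measurable borel \<Longrightarrow> Lpq_enorm 1 1 h = (\<integral>\<^sup>+ z. h z \<partial>lborel)"
  by (simp add: Lpq_enorm_def Lp_enorm_1 nn_integral_lborel_iterated)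

text \<open>The crude Hoelder inequality is applied first in position and then in frequency;
  therefore the cut-off is a product of functions of one variable each.\<close>

lemma nn_integral_mult_le_Lpq_enorm:
  assumes p: "1 \<le> p" "1 \<le> q" and [measurable]: "h \<in> borel_measurable borel"
    "\<psi>1 \<in> borel_measurable borel" "\<psi>2 \<in> borel_measurable borel"
    and \<psi>: "\<And>x. \<psi>1 x \<le> 1" "\<And>x. \<psi>2 x \<le> 1"
  shows "(\<integral>\<^sup>+ z. h z * (\<psi>1 (fst z) * \<psi>2 (snd z)) \<partial>lborel)
    \<le> (1 + (\<integral>\<^sup>+ x. \<psi>1 x \<partial>lborel)) * (1 + (\<integral>\<^sup>+ x. \<psi>2 x \<partial>lborel)) * Lpq_enorm p q h"
proof -
  have "(\<integral>\<^sup>+ z. h z * (\<psi>1 (fst z) * \<psi>2 (snd z)) \<partial>lborel)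
    = (\<integral>\<^sup>+ \<omega>. \<integral>\<^sup>+ x. h (x, \<omega>) * \<psi>1 x * \<psi>2 \<omega> \<partial>lborel \<partial>lborel)"
    by (subst nn_integral_lborel_iterated[symmetric]) (simp_all add: mult.assoc)
  also have "\<dots> = (\<integral>\<^sup>+ \<omega>. (\<integral>\<^sup>+ x. h (x, \<omega>) * \<psi>1 x \<partial>lborel) * \<psi>2 \<omega> \<partial>lborel)"
    by (intro nn_integral_cong nn_integral_multc) simp
  also have "\<dots> \<le> (\<integral>\<^sup>+ \<omega>. ((1 + (\<integral>\<^sup>+ x. \<psi>1 x \<partial>lborel)) * Lp_enorm p lborel (\<lambda>x. h (x, \<omega>))) * \<psi>2 \<omega> \<partial>lborel)"
    using p \<psi> by (intro nn_integral_mono mult_right_mono nn_integral_mult_le_Lp_enorm) simp_all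
  also have "\<dots> = (1 + (\<integral>\<^sup>+ x. \<psi>1 x \<partial>lborel)) * (\<integral>\<^sup>+ \<omega>. Lp_enorm p lborel (\<lambda>x. h (x, \<omega>)) * \<psi>2 \<omega> \<partial>lborel)"
    by (simp add: mult.assoc nn_integral_cmult)
  also have "\<dots> \<le> (1 + (\<integral>\<^sup>+ x. \<psi>1 x \<partial>lborel)) * ((1 + (\<integral>\<^sup>+ x. \<psi>2 x \<partial>lborel)) * Lpq_enorm p q h)"
    unfolding Lpq_enorm_def using p \<psi> by (intro mult_left_mono nn_integral_mult_le_Lp_enorm) simp_all
  finally show ?thesis by (simp add: mult.assoc)
qed

lemma Lpq_enorm_finite:
  assumes p: "1 \<le> p" "1 \<le> q" and [measurable]: "\<psi>1 \<in> borel_measurable borel" "\<psi>2 \<in> borel_measurable borel"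
    and \<psi>: "\<And>x. \<psi>1 x \<le> 1" "\<And>x. \<psi>2 x \<le> 1"
    and fin: "(\<integral>\<^sup>+ x. \<psi>1 x \<partial>lborel) < top" "(\<integral>\<^sup>+ x. \<psi>2 x \<partial>lborel) < top"
  shows "Lpq_enorm p q (\<lambda>z. \<psi>1 (fst z) * \<psi>2 (snd z)) < top"
proof -
  have "Lpq_enorm p q (\<lambda>z. \<psi>1 (fst z) * \<psi>2 (snd z)) = Lp_enorm q lborel (\<lambda>\<omega>. Lp_enorm p lborel (\<lambda>x. \<psi>2 \<omega> * \<psi>1 x))"
    by (simp add: Lpq_enorm_def mult.commute)
  also have "\<dots> \<le> Lp_enorm q lborel (\<lambda>\<omega>. Lp_enorm p lborel \<psi>1 * \<psi>2 \<omega>)"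
  proof (rule Lp_enorm_mono[OF p(2)])
    show "Lp_enorm p lborel (\<lambda>x. \<psi>2 \<omega> * \<psi>1 x) \<le> Lp_enorm p lborel \<psi>1 * \<psi>2 \<omega>" for \<omega>
      using Lp_enorm_cmult_le[OF p(1), of \<psi>1 lborel "\<psi>2 \<omega>"] by (simp add: mult.commute)
    show "(\<lambda>\<omega>. Lp_enorm p lborel (\<lambda>x. \<psi>2 \<omega> * \<psi>1 x)) \<in> borel_measurable lborel"
      by (rule Lp_enorm_measurable[OF sigma_finite_lborel]) measurable
  qed
  also have "\<dots> \<le> Lp_enorm p lborel \<psi>1 * Lp_enorm q lborel \<psi>2"
    using p by (intro Lp_enorm_cmult_le) auto
  also have "\<dots> < top"
    using Lp_enorm_finite[OF p(1) _ \<psi>(1) fin(1)] Lp_enorm_finite[OF p(2) _ \<psi>(2) fin(2)]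
    by (simp add: ennreal_mult_less_top)
  finally show ?thesis .
qed

section \<open>Convolution and weighted Young inequalities\<close>

definition cnv :: "('a::euclidean_space \<Rightarrow> ennreal) \<Rightarrow> ('a \<Rightarrow> ennreal) \<Rightarrow> 'a \<Rightarrow> ennreal" where
  "cnv F G z = (\<integral>\<^sup>+ y. F y * G (z - y) \<partial>lborel)"

lemma cnv_measurable [measurable]:
  assumes [measurable]: "F \<in> borel_measurable borel" "G \<in> borel_measurable borel"
  shows "cnv F G \<in> borel_measurable borel"
  unfolding cnv_def[abs_def] by measurable

lemma cnv_commute:
  assumes [measurable]: "F \<in> borel_measurable borel" "G \<in> borel_measurable borel"
  shows "cnv F G z = cnv G F z"
  unfolding cnv_def
  by (subst nn_integral_lborel_reflect[symmetric, where a=z]) (simp_all add: mult.commute)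

text \<open>Young's inequality for L^1_w * L^{p,q}_mu. A convolution is a superposition of
  translates, to which Minkowski applies, and mu(z) <= C w(y) mu(z-y) distributes the weight over
  the two factors.\<close>

lemma cnv_Lpq_enorm:
  fixes F G :: "'a::euclidean_space \<times> 'b::euclidean_space \<Rightarrow> ennreal" and \<mu> w :: "'a \<times> 'b \<Rightarrow> real"
  assumes p: "1 \<le> p" "1 \<le> q" and [measurable]: "F \<in> borel_measurable borel" "G \<in> borel_measurable borel"
    "\<mu> \<in> borel_measurable borel" "w \<in> borel_measurable borel"
    and C: "0 \<le> C" "\<And>z. 0 \<le> w z" "\<And>z. 0 \<le> \<mu> z" "\<And>x y. \<mu> (x + y) \<le> C * w x * \<mu> y"
  shows "Lpq_enorm p q (\<lambda>z. cnv F G z * ennreal (\<mu> z))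
    \<le> ennreal C * (\<integral>\<^sup>+ z. F z * ennreal (w z) \<partial>lborel) * Lpq_enorm p q (\<lambda>z. G z * ennreal (\<mu> z))"
proof -
  have "Lpq_enorm p q (\<lambda>z. cnv F G z * ennreal (\<mu> z))
    \<le> Lpq_enorm p q (\<lambda>z. \<integral>\<^sup>+ y. ennreal C * (F y * ennreal (w y)) * (G (z - y) * ennreal (\<mu> (z - y))) \<partial>lborel)"
  proof (rule Lpq_enorm_mono[OF p])
    fix z
    have "cnv F G z * ennreal (\<mu> z) = (\<integral>\<^sup>+ y. F y * G (z - y) * ennreal (\<mu> z) \<partial>lborel)"
      unfolding cnv_def by (rule nn_integral_multc[symmetric]) measurable
    also have "\<dots> \<le> (\<integral>\<^sup>+ y. ennreal C * (F y * ennreal (w y)) * (G (z - y) * ennreal (\<mu> (z - y))) \<partial>lborel)"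
    proof (rule nn_integral_mono)
      fix y
      have "ennreal (\<mu> z) \<le> ennreal (C * w y * \<mu> (z - y))" using C(4)[of y "z - y"] by (intro ennreal_leI) simp
      also have "\<dots> = ennreal C * ennreal (w y) * ennreal (\<mu> (z - y))" using C by (simp add: ennreal_mult)
      finally have "F y * G (z - y) * ennreal (\<mu> z) \<le> F y * G (z - y) * (ennreal C * ennreal (w y) * ennreal (\<mu> (z - y)))"
        by (rule mult_left_mono) simp
      then show "F y * G (z - y) * ennreal (\<mu> z) \<le> ennreal C * (F y * ennreal (w y)) * (G (z - y) * ennreal (\<mu> (z - y)))"
        by (simp add: mult_ac)
    qed
    finally show "cnv F G z * ennreal (\<mu> z) \<le> (\<integral>\<^sup>+ y. ennreal C * (F y * ennreal (w y)) * (G (z - y) * ennreal (\<mu> (z - y))) \<partial>lborel)" .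
  qed measurable
  also have "\<dots> \<le> (\<integral>\<^sup>+ y. Lpq_enorm p q (\<lambda>z. ennreal C * (F y * ennreal (w y)) * (G (z - y) * ennreal (\<mu> (z - y)))) \<partial>lborel)"
    by (rule Lpq_enorm_Minkowski[OF p sigma_finite_lborel]) measurable
  also have "\<dots> \<le> (\<integral>\<^sup>+ y. ennreal C * (F y * ennreal (w y)) * Lpq_enorm p q (\<lambda>z. G z * ennreal (\<mu> z)) \<partial>lborel)"
  proof (rule nn_integral_mono)
    fix y
    have "Lpq_enorm p q (\<lambda>z. ennreal C * (F y * ennreal (w y)) * (G (z - y) * ennreal (\<mu> (z - y))))
      \<le> ennreal C * (F y * ennreal (w y)) * Lpq_enorm p q (\<lambda>z. G (z - y) * ennreal (\<mu> (z - y)))"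
      by (rule Lpq_enorm_cmult_le[OF p]) measurable
    also have "\<dots> \<le> ennreal C * (F y * ennreal (w y)) * Lpq_enorm p q (\<lambda>z. G z * ennreal (\<mu> z))"
      by (intro mult_left_mono Lpq_enorm_shift_le[OF p, of "\<lambda>z. G z * ennreal (\<mu> z)"]) simp_all
    finally show "Lpq_enorm p q (\<lambda>z. ennreal C * (F y * ennreal (w y)) * (G (z - y) * ennreal (\<mu> (z - y))))
      \<le> ennreal C * (F y * ennreal (w y)) * Lpq_enorm p q (\<lambda>z. G z * ennreal (\<mu> z))" .
  qed
  also have "\<dots> = ennreal C * (\<integral>\<^sup>+ z. F z * ennreal (w z) \<partial>lborel) * Lpq_enorm p q (\<lambda>z. G z * ennreal (\<mu> z))"
    by (simp add: nn_integral_cmult nn_integral_multc)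
  finally show ?thesis .
qed

lemma cnv_L1:
  fixes F G :: "'a::euclidean_space \<times> 'b::euclidean_space \<Rightarrow> ennreal"
  assumes [measurable]: "F \<in> borel_measurable borel" "G \<in> borel_measurable borel" "w \<in> borel_measurable borel"
    and C: "0 \<le> C" "\<And>z. 0 \<le> w z" "\<And>x y. w (x + y) \<le> C * w x * w y"
  shows "(\<integral>\<^sup>+ z. cnv F G z * ennreal (w z) \<partial>lborel)
    \<le> ennreal C * (\<integral>\<^sup>+ z. F z * ennreal (w z) \<partial>lborel) * (\<integral>\<^sup>+ z. G z * ennreal (w z) \<partial>lborel)"
  using cnv_Lpq_enorm[of 1 1 F G w w C] C by (simp add: Lpq_enorm_1)

text \<open>The endpoint version for functions growing at most like w: by evenness w(y) <= w(z)
  w(z-y), so the growth rate is preserved and the second factor of w goes to the integrable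
  function.\<close>

lemma cnv_le_weight:
  fixes F G :: "'a::euclidean_space \<Rightarrow> ennreal"
  assumes [measurable]: "F \<in> borel_measurable borel" "G \<in> borel_measurable borel" "w \<in> borel_measurable borel"
    and w: "\<And>z. 0 \<le> w z" "\<And>x y. w (x + y) \<le> w x * w y" "\<And>z. w (- z) = w z"
    and F: "\<And>z. F z \<le> K * ennreal (w z)"
  shows "cnv F G z \<le> K * (\<integral>\<^sup>+ y. G y * ennreal (w y) \<partial>lborel) * ennreal (w z)"
proof -
  have "cnv F G z \<le> (\<integral>\<^sup>+ y. K * ennreal (w z) * (G (z - y) * ennreal (w (z - y))) \<partial>lborel)"
    unfolding cnv_def
  proof (rule nn_integral_mono)
    fix y
    have "ennreal (w y) \<le> ennreal (w z * w (z - y))"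
      using w(2)[of z "y - z"] w(3)[of "z - y"] by (intro ennreal_leI) simp
    then have "K * ennreal (w y) \<le> K * (ennreal (w z) * ennreal (w (z - y)))"
      using w(1) by (intro mult_left_mono) (auto simp: ennreal_mult)
    with F[of y] have "F y \<le> K * (ennreal (w z) * ennreal (w (z - y)))" by (rule order_trans)
    then have "F y * G (z - y) \<le> K * (ennreal (w z) * ennreal (w (z - y))) * G (z - y)"
      by (rule mult_right_mono) simp
    then show "F y * G (z - y) \<le> K * ennreal (w z) * (G (z - y) * ennreal (w (z - y)))"
      by (simp add: mult_ac)
  qed
  also have "\<dots> = K * ennreal (w z) * (\<integral>\<^sup>+ y. G (z - y) * ennreal (w (z - y)) \<partial>lborel)"
    by (rule nn_integral_cmult) measurable
  also have "(\<integral>\<^sup>+ y. G (z - y) * ennreal (w (z - y)) \<partial>lborel) = (\<integral>\<^sup>+ y. G y * ennreal (w y) \<partial>lborel)"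
    by (rule nn_integral_lborel_reflect[of "\<lambda>y. G y * ennreal (w y)"]) measurable
  finally show ?thesis by (simp add: mult_ac)
qed

section \<open>Gaussian integrals and uniqueness of the Fourier transform\<close>

lemma borel_measurable_pairI:
  fixes f :: "'a::second_countable_topology \<Rightarrow> 'b::second_countable_topology \<Rightarrow> 'c::topological_space"
  shows "(\<lambda>(x, y). f x y) \<in> borel_measurable (borel \<Otimes>\<^sub>M borel) \<longleftrightarrow> (\<lambda>z. f (fst z) (snd z)) \<in> borel_measurable borel"
  by (simp add: borel_prod case_prod_beta')

lemma borel_measurable_cis [measurable (raw)]:
  "f \<in> borel_measurable M \<Longrightarrow> (\<lambda>x. cis (f x)) \<in> borel_measurable M"
  unfolding cis_conv_exp by measurable

text \<open>Fubini's theorem with its hypothesis as an iterated nonnegative integral, the form in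
  which the estimates below arise.\<close>

lemma Fubini_lborel:
  fixes f :: "'a::euclidean_space \<Rightarrow> 'b::euclidean_space \<Rightarrow> complex"
  assumes [measurable]: "(\<lambda>(x, y). f x y) \<in> borel_measurable (borel \<Otimes>\<^sub>M borel)"
    and fin: "(\<integral>\<^sup>+ x. \<integral>\<^sup>+ y. ennreal (cmod (f x y)) \<partial>lborel \<partial>lborel) < top"
  shows "integrable lborel (\<lambda>(x, y). f x y)"
    and "(LINT x|lborel. LINT y|lborel. f x y) = (LINT z|lborel. f (fst z) (snd z))"
    and "(LINT x|lborel. LINT y|lborel. f x y) = (LINT y|lborel. LINT x|lborel. f x y)"
    and "integrable lborel (\<lambda>x. LINT y|lborel. f x y)"
    and "integrable lborel (\<lambda>y. LINT x|lborel. f x y)"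
    and "AE x in lborel. integrable lborel (f x)"
proof -
  have m: "(\<lambda>(x, y). f x y) \<in> borel_measurable (lborel \<Otimes>\<^sub>M lborel)" by measurable
  have i: "integrable (lborel \<Otimes>\<^sub>M lborel) (\<lambda>(x, y). f x y)"
  proof (rule integrableI_bounded[OF m])
    have "(\<integral>\<^sup>+ z. ennreal (norm (case z of (x, y) \<Rightarrow> f x y)) \<partial>(lborel \<Otimes>\<^sub>M lborel)) =
       (\<integral>\<^sup>+ x. \<integral>\<^sup>+ y. ennreal (cmod (f x y)) \<partial>lborel \<partial>lborel)"
      by (subst lborel.nn_integral_fst[symmetric]) (use m in simp_all)
    then show "(\<integral>\<^sup>+ z. ennreal (norm (case z of (x, y) \<Rightarrow> f x y)) \<partial>(lborel \<Otimes>\<^sub>M lborel)) < \<infinity>" using fin by simp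
  qed
  then show "integrable lborel (\<lambda>(x, y). f x y)" by (simp add: lborel_prod)
  show "(LINT x|lborel. LINT y|lborel. f x y) = (LINT z|lborel. f (fst z) (snd z))"
    using lborel_pair.integral_fst'[OF i] by (simp add: lborel_prod case_prod_beta')
  show "(LINT x|lborel. LINT y|lborel. f x y) = (LINT y|lborel. LINT x|lborel. f x y)"
    using lborel_pair.Fubini_integral[OF i] by simp
  show "integrable lborel (\<lambda>x. LINT y|lborel. f x y)"
    using lborel_pair.integrable_fst'[OF i] by simp
  show "integrable lborel (\<lambda>y. LINT x|lborel. f x y)"
    using lborel_pair.integrable_snd[OF i] by simp
  show "AE x in lborel. integrable lborel (f x)"
    using lborel_pair.AE_integrable_fst'[OF i] by simp
qed

lemma integrable_cmult_iff:
  fixes f :: "'a \<Rightarrow> complex"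
  assumes "c \<noteq> 0" shows "integrable M (\<lambda>x. c * f x) \<longleftrightarrow> integrable M f"
proof
  assume "integrable M (\<lambda>x. c * f x)"
  then have "integrable M (\<lambda>x. inverse c * (c * f x))" by (rule integrable_mult_right)
  then show "integrable M f" using assms by (simp add: mult.assoc[symmetric])
qed simp

lemma integral_lborel_affine:
  fixes f :: "'a::euclidean_space \<Rightarrow> complex"
  assumes [measurable]: "f \<in> borel_measurable borel" and c: "c \<noteq> 0"
  shows "(LINT x|lborel. f x) = \<bar>c\<bar> ^ DIM('a) *\<^sub>R (LINT x|lborel. f (t + c *\<^sub>R x))"
    and "integrable lborel f \<longleftrightarrow> integrable lborel (\<lambda>x. f (t + c *\<^sub>R x))"
proof -
  show "(LINT x|lborel. f x) = \<bar>c\<bar> ^ DIM('a) *\<^sub>R (LINT x|lborel. f (t + c *\<^sub>R x))"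
    by (subst lborel_affine[OF c, of t]) (simp add: integral_density integral_distr)
  have "integrable lborel f \<longleftrightarrow> integrable lborel (\<lambda>x. \<bar>c\<bar> ^ DIM('a) *\<^sub>R f (t + c *\<^sub>R x))"
    by (subst lborel_affine[OF c, of t]) (simp add: integrable_density integrable_distr_eq)
  then show "integrable lborel f \<longleftrightarrow> integrable lborel (\<lambda>x. f (t + c *\<^sub>R x))"
    using c by (simp add: scaleR_conv_of_real integrable_cmult_iff del: of_real_power)
qed

lemma integral_lborel_shift:
  fixes f :: "'a::euclidean_space \<Rightarrow> complex"
  assumes [measurable]: "f \<in> borel_measurable borel"
  shows "(LINT x|lborel. f (x + a)) = (LINT x|lborel. f x)"
    and "integrable lborel (\<lambda>x. f (x + a)) \<longleftrightarrow> integrable lborel f"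
  using integral_lborel_affine[OF assms, of 1 a] by (simp_all add: add.commute)

section \<open>Fourier transforms of Gaussians\<close>

lemma gauss_fourier_real:
  fixes a x :: real
  assumes a: "0 < a"
  shows "integrable lborel (\<lambda>t. complex_of_real (exp (- pi * a * t\<^sup>2)) * cis (2 * pi * (x * t)))" (is ?I)
    and "(LINT t|lborel. complex_of_real (exp (- pi * a * t\<^sup>2)) * cis (2 * pi * (x * t)))
      = complex_of_real (1 / sqrt a * exp (- pi * x\<^sup>2 / a))" (is ?E)
proof -
  \<comment> \<open>The substitution y = c t turns exp(-pi a t^2) into exp(-y^2/2), so the integral
    becomes the characteristic function of the standard normal law at s = 2 pi x / c.\<close>
  define c where "c = sqrt (2 * pi * a)"
  have c: "0 < c" "c\<^sup>2 = 2 * pi * a" using a by (auto simp: c_def)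
  define s where "s = 2 * pi * x / c"
  have sc: "s * c = 2 * pi * x" using c by (simp add: s_def)
  interpret prob_space std_normal_distribution by (rule prob_space_normal_density) simp
  have int: "integrable lborel (\<lambda>y. std_normal_density y *\<^sub>R iexp (s * y))"
    using integrable_iexp[of "\<lambda>y. s * y"] by (simp add: integrable_density)
  have E: "(LINT y|lborel. std_normal_density y *\<^sub>R iexp (s * y)) = complex_of_real (exp (- (s\<^sup>2) / 2))"
    using fun_cong[OF char_std_normal_distribution, of s] by (simp add: char_def integral_density)
  have eq: "std_normal_density (c * t) *\<^sub>R iexp (s * (c * t))
      = complex_of_real (1 / sqrt (2 * pi)) * (complex_of_real (exp (- pi * a * t\<^sup>2)) * cis (2 * pi * (x * t)))" for t
  proof -
    have "exp (- (c * t)\<^sup>2 / 2) = exp (- pi * a * t\<^sup>2)" using c by (simp add: power_mult_distrib)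
    moreover have "iexp (s * (c * t)) = cis (2 * pi * (x * t))"
      using sc by (simp add: cis_conv_exp mult.assoc[symmetric])
    ultimately show ?thesis by (simp add: std_normal_density_def scaleR_conv_of_real)
  qed
  have "integrable lborel (\<lambda>t. std_normal_density (0 + c * t) *\<^sub>R iexp (s * (0 + c * t)))"
    using int c by (intro lborel_integrable_real_affine) auto
  then show ?I unfolding add_0 eq by (subst (asm) integrable_cmult_iff) simp_all
  have "(LINT y|lborel. std_normal_density y *\<^sub>R iexp (s * y))
      = \<bar>c\<bar> *\<^sub>R (LINT t|lborel. std_normal_density (0 + c * t) *\<^sub>R iexp (s * (0 + c * t)))"
    using c by (intro lborel_integral_real_affine) auto
  also have "\<dots> = complex_of_real (c / sqrt (2 * pi)) * (LINT t|lborel. complex_of_real (exp (- pi * a * t\<^sup>2)) * cis (2 * pi * (x * t)))"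
    unfolding add_0 eq using c by (simp add: scaleR_conv_of_real)
  also have "c / sqrt (2 * pi) = sqrt a" by (simp add: c_def real_sqrt_mult)
  finally have "complex_of_real (sqrt a) * (LINT t|lborel. complex_of_real (exp (- pi * a * t\<^sup>2)) * cis (2 * pi * (x * t)))
      = complex_of_real (exp (- (s\<^sup>2) / 2))" using E by simp
  moreover have "s\<^sup>2 / 2 = pi * x\<^sup>2 / a"
    using a c by (simp add: s_def power_divide field_simps power2_eq_square)
  ultimately show ?E using a by (simp add: field_simps)
qed

lemma gauss_fourier:
  fixes \<omega> :: "'a::euclidean_space"
  assumes a: "0 < a"
  shows "integrable lborel (\<lambda>t::'a. complex_of_real (exp (- pi * a * (norm t)\<^sup>2)) * cis (2 * pi * (\<omega> \<bullet> t)))" (is ?I)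
    and "(LINT t|lborel. complex_of_real (exp (- pi * a * (norm t)\<^sup>2)) * cis (2 * pi * (\<omega> \<bullet> t)))
      = complex_of_real ((1 / sqrt a) ^ DIM('a) * exp (- pi * (norm \<omega>)\<^sup>2 / a))" (is ?E)
proof -
  interpret product_sigma_finite "\<lambda>b::'a. lborel :: real measure" by standard
  let ?f = "\<lambda>b t. complex_of_real (exp (- pi * a * t\<^sup>2)) * cis (2 * pi * ((\<omega> \<bullet> b) * t))"
  let ?g = "\<lambda>t::'a. complex_of_real (exp (- pi * a * (norm t)\<^sup>2)) * cis (2 * pi * (\<omega> \<bullet> t))"
  let ?s = "\<lambda>y. \<Sum>b\<in>Basis. y b *\<^sub>R (b :: 'a)"
  have nrm: "(norm t)\<^sup>2 = (\<Sum>b\<in>Basis. (t \<bullet> b)\<^sup>2)" for t :: 'a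
    unfolding power2_norm_eq_inner by (subst euclidean_inner) (simp add: power2_eq_square)
  have cissum: "cis (sum h A) = (\<Prod>i\<in>A. cis (h i))" if "finite A" for h and A :: "'a set"
    using that by (induction A) (auto simp: cis_mult[symmetric])
  have g: "?g (?s y) = (\<Prod>b\<in>Basis. ?f b (y b))" for y
    by (simp add: nrm prod.distrib inner_sum_right mult.commute sum_distrib_left
        flip: exp_sum of_real_prod cissum)
  have int: "integrable (Pi\<^sub>M Basis (\<lambda>b::'a. lborel)) (\<lambda>y. \<Prod>b\<in>Basis. ?f b (y b))"
    by (intro product_integrable_prod gauss_fourier_real(1)[OF a]) simp_all
  have [measurable]: "?s \<in> measurable (Pi\<^sub>M Basis (\<lambda>b::'a. lborel)) borel" by measurable
  have [measurable]: "?g \<in> borel_measurable borel" by measurable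
  show ?I
    by (subst lborel_eq, subst integrable_distr_eq) (use int g in simp_all)
  have "(LINT t|lborel. ?g t) = (LINT y|Pi\<^sub>M Basis (\<lambda>b::'a. lborel). ?g (?s y))"
    by (subst lborel_eq, subst integral_distr) simp_all
  also have "\<dots> = (\<Prod>b\<in>Basis. LINT t|lborel. ?f b t)"
    unfolding g by (intro product_integral_prod gauss_fourier_real(1)[OF a]) simp_all
  also have "\<dots> = (\<Prod>b\<in>Basis. complex_of_real (1 / sqrt a * exp (- pi * (\<omega> \<bullet> b)\<^sup>2 / a)))"
    by (intro prod.cong refl gauss_fourier_real a)
  also have "\<dots> = complex_of_real ((1 / sqrt a) ^ DIM('a) * (\<Prod>b\<in>Basis. exp (- pi * (\<omega> \<bullet> b)\<^sup>2 / a)))"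
    by (simp only: prod.distrib prod_constant flip: of_real_prod)
  also have "(\<Prod>b\<in>Basis. exp (- pi * (\<omega> \<bullet> b)\<^sup>2 / a)) = exp (- pi * (norm \<omega>)\<^sup>2 / a)"
    by (simp add: nrm sum_distrib_left sum_divide_distrib sum_negf flip: exp_sum)
  finally show ?E .
qed

lemma gauss_integrable:
  assumes a: "0 < a"
  shows "integrable lborel (\<lambda>t::'a::euclidean_space. exp (- a * (norm t)\<^sup>2))"
proof -
  have "integrable lborel (\<lambda>t::'a. complex_of_real (exp (- pi * (a / pi) * (norm t)\<^sup>2)) * cis (2 * pi * (0 \<bullet> t)))"
    using a by (intro gauss_fourier) simp
  from integrable_norm[OF this] show ?thesis by simp
qed

text \<open>Expanding (c - a r)^2 >= 0 shows that half of a Gaussian exponent absorbs any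
  exponential. All exponentially bounded weights are controlled in this way.\<close>

lemma exp_mult_gauss_le:
  fixes a c r :: real
  assumes "0 < a" shows "exp (c * r) * exp (- a * r\<^sup>2) \<le> exp (c\<^sup>2 / (2 * a)) * exp (- (a / 2) * r\<^sup>2)"
proof -
  have "0 \<le> (c - a * r)\<^sup>2 / (2 * a)" using assms by simp
  also have "\<dots> = c\<^sup>2 / (2 * a) + a / 2 * r\<^sup>2 - c * r"
    using assms by (simp add: power2_diff power_mult_distrib field_simps power2_eq_square)
  finally show ?thesis by (simp add: exp_add[symmetric] algebra_simps)
qed

text \<open>A Gaussian is a superposition of characters, so its pairing with k is a superposition of
  values of the Fourier transform of k.\<close>

lemma gauss_convolution_zero:
  fixes k :: "'a::euclidean_space \<Rightarrow> complex"
  assumes k: "integrable lborel k" and hat: "\<And>\<omega>. (LINT t|lborel. k t * cis (2 * pi * (\<omega> \<bullet> t))) = 0" and a: "0 < a"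
  shows "(LINT t|lborel. k t * of_real (exp (- pi * a * (norm (t - s))\<^sup>2))) = 0"
proof -
  have [measurable]: "k \<in> borel_measurable borel" using k by simp
  let ?G = "\<lambda>\<omega>. complex_of_real (exp (- pi * (1 / a) * (norm (\<omega>::'a))\<^sup>2))"
  have G: "integrable lborel ?G" using gauss_fourier(1)[of "1 / a" 0] a by simp
  have "complex_of_real ((1 / sqrt (1 / a)) ^ DIM('a)) * (LINT t|lborel. k t * of_real (exp (- pi * a * (norm (t - s))\<^sup>2)))
    = (LINT t|lborel. k t * of_real ((1 / sqrt (1 / a)) ^ DIM('a) * exp (- pi * (norm (t - s))\<^sup>2 / (1 / a))))"
    by (subst integral_mult_right_zero[symmetric]) (simp add: mult_ac)
  also have "\<dots> = (LINT t|lborel. LINT \<omega>|lborel. k t * (?G \<omega> * cis (2 * pi * ((t - s) \<bullet> \<omega>))))"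
    using a by (subst gauss_fourier(2)[symmetric]) auto
  also have "\<dots> = (LINT \<omega>|lborel. LINT t|lborel. k t * (?G \<omega> * cis (2 * pi * ((t - s) \<bullet> \<omega>))))"
  proof (rule Fubini_lborel(3))
    have "(\<integral>\<^sup>+ t. \<integral>\<^sup>+ \<omega>. ennreal (cmod (k t * (?G \<omega> * cis (2 * pi * ((t - s) \<bullet> \<omega>))))) \<partial>lborel \<partial>lborel)
      = (\<integral>\<^sup>+ t. ennreal (cmod (k t)) \<partial>lborel) * (\<integral>\<^sup>+ \<omega>. ennreal (cmod (?G \<omega>)) \<partial>lborel)"
      by (simp add: norm_mult ennreal_mult nn_integral_cmult nn_integral_multc)
    also have "\<dots> < top" using k G by (simp add: integrable_iff_bounded ennreal_mult_less_top)
    finally show "(\<integral>\<^sup>+ t. \<integral>\<^sup>+ \<omega>. ennreal (cmod (k t * (?G \<omega> * cis (2 * pi * ((t - s) \<bullet> \<omega>))))) \<partial>lborel \<partial>lborel) < top" .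
  qed measurable
  also have "\<dots> = (LINT \<omega>|lborel. ?G \<omega> * cis (- 2 * pi * (s \<bullet> \<omega>)) * (LINT t|lborel. k t * cis (2 * pi * (\<omega> \<bullet> t))))"
  proof (intro Bochner_Integration.integral_cong refl)
    fix \<omega>
    have "k t * (?G \<omega> * cis (2 * pi * ((t - s) \<bullet> \<omega>))) = ?G \<omega> * cis (- 2 * pi * (s \<bullet> \<omega>)) * (k t * cis (2 * pi * (\<omega> \<bullet> t)))" for t
    proof -
      have "cis (2 * pi * ((t - s) \<bullet> \<omega>)) = cis (- 2 * pi * (s \<bullet> \<omega>)) * cis (2 * pi * (\<omega> \<bullet> t))"
        by (simp add: cis_mult inner_diff_left inner_commute algebra_simps)
      then show ?thesis by (simp add: mult_ac)
    qed
    then show "(LINT t|lborel. k t * (?G \<omega> * cis (2 * pi * ((t - s) \<bullet> \<omega>))))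
      = ?G \<omega> * cis (- 2 * pi * (s \<bullet> \<omega>)) * (LINT t|lborel. k t * cis (2 * pi * (\<omega> \<bullet> t)))"
      by (simp only: integral_mult_right_zero)
  qed
  also have "\<dots> = 0" unfolding hat by simp
  finally show ?thesis using a by simp
qed

text \<open>Normalised narrow Gaussians, integrated over their centres in the box, converge
  boundedly to the indicator of the box off its boundary, and the boundary is a null set.\<close>

lemma fourier_box_zero:
  fixes k :: "'a::euclidean_space \<Rightarrow> complex"
  assumes k: "integrable lborel k" and hat: "\<And>\<omega>. (LINT t|lborel. k t * cis (2 * pi * (\<omega> \<bullet> t))) = 0"
  shows "(LINT t|lborel. indicator (box l u) t *\<^sub>R k t) = 0"
proof -
  have [measurable]: "k \<in> borel_measurable borel" using k by simp
  let ?B = "box l u"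
  let ?G = "\<lambda>r::'a. exp (- pi * (norm r)\<^sup>2)"
  have G: "integrable lborel ?G" using gauss_integrable[of pi, where 'a='a] by simp
  define I where "I = (LINT r|lborel. ?G r)"
  have I: "0 < I"
  proof -
    have "complex_of_real I = (LINT r|lborel. complex_of_real (?G r))" unfolding I_def by simp
    also have "\<dots> = 1" using gauss_fourier(2)[of 1 "0::'a"] by simp
    finally show ?thesis by simp
  qed
  \<comment> \<open>\<open>?J n\<close> is the indicator of the box smoothed at scale 1/(n+1). In
    this form, as an average over \<open>r\<close>, it converges by dominated convergence; rewritten
    as an integral over \<open>s\<close> below, it is a superposition of Gaussians.\<close>
  let ?J = "\<lambda>n t. (LINT r|lborel. indicator ?B (t + (1 / real (Suc n)) *\<^sub>R r) * ?G r)"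
  have Jm[measurable]: "?J n \<in> borel_measurable borel" for n by measurable
  have zero: "(LINT t|lborel. k t * of_real (?J n t)) = 0" for n
  proof -
    define c where "c = 1 / real (Suc n)"
    have c: "0 < c" by (simp add: c_def)
    have J: "complex_of_real (?J n t) = (LINT s|lborel. of_real ((1 / c) ^ DIM('a)) * (indicator ?B s * of_real (exp (- pi * (1 / c\<^sup>2) * (norm (t - s))\<^sup>2))))" for t
    proof -
      have "(LINT s|lborel. indicator ?B s * complex_of_real (exp (- pi * (1 / c\<^sup>2) * (norm (t - s))\<^sup>2)))
        = \<bar>c\<bar> ^ DIM('a) *\<^sub>R (LINT r|lborel. indicator ?B (t + c *\<^sub>R r) * complex_of_real (exp (- pi * (1 / c\<^sup>2) * (norm (t - (t + c *\<^sub>R r)))\<^sup>2)))"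
        using c by (intro integral_lborel_affine) (auto intro!: borel_measurable_times)
      also have "\<dots> = of_real (c ^ DIM('a)) * (LINT r|lborel. of_real (indicator ?B (t + c *\<^sub>R r) * ?G r))"
        using c by (simp add: scaleR_conv_of_real power_mult_distrib of_real_indicator)
      also have "(LINT r|lborel. complex_of_real (indicator ?B (t + c *\<^sub>R r) * ?G r)) = of_real (?J n t)"
        unfolding c_def by (rule integral_complex_of_real)
      finally have E: "(LINT s|lborel. indicator ?B s * complex_of_real (exp (- pi * (1 / c\<^sup>2) * (norm (t - s))\<^sup>2)))
        = of_real (c ^ DIM('a)) * of_real (?J n t)" .
      have "(1 / c) ^ DIM('a) * c ^ DIM('a) = 1" using c by (simp add: power_divide)
      then have "of_real ((1 / c) ^ DIM('a)) * (of_real (c ^ DIM('a)) * complex_of_real (?J n t)) = of_real (?J n t)"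
        by (simp only: mult.assoc[symmetric] of_real_mult[symmetric]) simp
      then show ?thesis by (simp only: integral_mult_right_zero E)
    qed
    have "(LINT t|lborel. k t * of_real (?J n t))
      = (LINT t|lborel. LINT s|lborel. k t * (of_real ((1 / c) ^ DIM('a)) * (indicator ?B s * of_real (exp (- pi * (1 / c\<^sup>2) * (norm (t - s))\<^sup>2)))))"
      unfolding J by simp
    also have "\<dots> = (LINT s|lborel. LINT t|lborel. k t * (of_real ((1 / c) ^ DIM('a)) * (indicator ?B s * of_real (exp (- pi * (1 / c\<^sup>2) * (norm (t - s))\<^sup>2)))))"
    proof (rule Fubini_lborel(3))
      have "(\<integral>\<^sup>+ t. \<integral>\<^sup>+ s. ennreal (cmod (k t * (of_real ((1 / c) ^ DIM('a)) * (indicator ?B s * of_real (exp (- pi * (1 / c\<^sup>2) * (norm (t - s))\<^sup>2)))))) \<partial>lborel \<partial>lborel)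
        \<le> (\<integral>\<^sup>+ t. \<integral>\<^sup>+ s. ennreal (cmod (k t)) * (ennreal ((1 / c) ^ DIM('a)) * indicator ?B s) \<partial>lborel \<partial>lborel)"
        using c by (intro nn_integral_mono)
          (auto simp: norm_mult norm_power norm_divide ennreal_mult[symmetric] indicator_def intro!: ennreal_leI mult_left_mono mult_left_le)
      also have "\<dots> = (\<integral>\<^sup>+ t. ennreal (cmod (k t)) \<partial>lborel) * (ennreal ((1 / c) ^ DIM('a)) * emeasure lborel ?B)"
        by (simp add: nn_integral_cmult nn_integral_multc)
      also have "\<dots> < top" using k emeasure_bounded_finite[OF bounded_box, of l u] by (simp add: integrable_iff_bounded ennreal_mult_less_top)
      finally show "(\<integral>\<^sup>+ t. \<integral>\<^sup>+ s. ennreal (cmod (k t * (of_real ((1 / c) ^ DIM('a)) * (indicator ?B s * of_real (exp (- pi * (1 / c\<^sup>2) * (norm (t - s))\<^sup>2)))))) \<partial>lborel \<partial>lborel) < top" .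
    qed measurable
    also have "\<dots> = (LINT s|lborel. of_real ((1 / c) ^ DIM('a)) * indicator ?B s * (LINT t|lborel. k t * of_real (exp (- pi * (1 / c\<^sup>2) * (norm (t - s))\<^sup>2))))"
      by (intro Bochner_Integration.integral_cong refl, subst integral_mult_right_zero[symmetric]) (simp add: mult_ac)
    also have "\<dots> = 0" using gauss_convolution_zero[OF k hat, of "1 / c\<^sup>2"] c by simp
    finally show ?thesis .
  qed
  have "(\<lambda>n. LINT t|lborel. k t * of_real (?J n t)) \<longlonglongrightarrow> (LINT t|lborel. k t * of_real (indicator ?B t * I))"
  proof (rule integral_dominated_convergence[where w="\<lambda>t. cmod (k t) * I"])
    have "negligible (cbox l u - box l u)" by (rule negligible_frontier_interval)
    then have "cbox l u - box l u \<in> null_sets lborel"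
      by (simp add: negligible_iff_null_sets null_sets_completion_iff)
    then have "AE t in lborel. t \<notin> cbox l u - box l u" by (rule AE_not_in)
    then show "AE t in lborel. (\<lambda>n. k t * of_real (?J n t)) \<longlonglongrightarrow> k t * of_real (indicator ?B t * I)"
    proof eventually_elim
      case (elim t)
      have "(\<lambda>n. ?J n t) \<longlonglongrightarrow> (LINT r|lborel. indicator ?B t * ?G r)"
      proof (rule integral_dominated_convergence[where w="?G"])
        show "AE r in lborel. (\<lambda>n. indicator ?B (t + (1 / real (Suc n)) *\<^sub>R r) * ?G r) \<longlonglongrightarrow> indicator ?B t * ?G r"
        proof (rule AE_I2)
          fix r :: 'a
          have lim: "(\<lambda>n. t + (1 / real (Suc n)) *\<^sub>R r) \<longlonglongrightarrow> t + 0 *\<^sub>R r"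
            by (intro tendsto_intros LIMSEQ_Suc[OF lim_1_over_n])
          have "\<forall>\<^sub>F n in sequentially. indicator ?B (t + (1 / real (Suc n)) *\<^sub>R r) = (indicator ?B t :: real)"
          proof (cases "t \<in> ?B")
            case True
            then have "\<forall>\<^sub>F n in sequentially. t + (1 / real (Suc n)) *\<^sub>R r \<in> ?B"
              using lim open_box by (intro topological_tendstoD) auto
            then show ?thesis by (rule eventually_mono) (use True in auto)
          next
            case False
            then have "t \<in> - cbox l u" using elim by auto
            then have "\<forall>\<^sub>F n in sequentially. t + (1 / real (Suc n)) *\<^sub>R r \<in> - cbox l u"
              using lim closed_cbox by (intro topological_tendstoD) auto
            then show ?thesis by (rule eventually_mono) (use False box_subset_cbox[of l u] in \<open>auto simp: indicator_def\<close>)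
          qed
          then show "(\<lambda>n. indicator ?B (t + (1 / real (Suc n)) *\<^sub>R r) * ?G r) \<longlonglongrightarrow> indicator ?B t * ?G r"
            by (intro tendsto_mult tendsto_const tendsto_eventually)
        qed
        show "\<And>n. AE r in lborel. norm (indicator ?B (t + (1 / real (Suc n)) *\<^sub>R r) * ?G r) \<le> ?G r"
          by (auto simp: indicator_def)
      qed (use G in measurable)
      then show ?case unfolding I_def by (intro tendsto_intros) simp
    qed
    show "\<And>n. AE t in lborel. norm (k t * of_real (?J n t)) \<le> cmod (k t) * I"
    proof (intro AE_I2)
      fix n t
      have "\<bar>?J n t\<bar> \<le> I"
      proof -
        have "\<bar>?J n t\<bar> = ?J n t" by (intro abs_of_nonneg integral_nonneg) auto
        also have "\<dots> \<le> I" unfolding I_def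
          by (rule integral_mono') (use G in \<open>auto simp: indicator_def\<close>)
        finally show ?thesis .
      qed
      then show "norm (k t * of_real (?J n t)) \<le> cmod (k t) * I" by (simp add: norm_mult mult_left_mono)
    qed
    show "integrable lborel (\<lambda>t. cmod (k t) * I)" using k by auto
  qed measurable
  then have "(LINT t|lborel. k t * of_real (indicator ?B t * I)) = 0"
    unfolding zero by (simp add: LIMSEQ_const_iff)
  also have "(LINT t|lborel. k t * of_real (indicator ?B t * I)) = of_real I * (LINT t|lborel. indicator ?B t *\<^sub>R k t)"
    by (subst integral_mult_right_zero[symmetric]) (simp add: scaleR_conv_of_real mult_ac)
  finally show ?thesis using I by simp
qed

text \<open>Boxes form an intersection-stable generator of the Borel sets. Complements require the
  total integral, which is the Fourier transform at 0.\<close>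

lemma fourier_unique:
  fixes k :: "'a::euclidean_space \<Rightarrow> complex"
  assumes k: "integrable lborel k" and hat: "\<And>\<omega>. (LINT t|lborel. k t * cis (2 * pi * (\<omega> \<bullet> t))) = 0"
  shows "AE t in lborel. k t = 0"
proof -
  have tot: "(LINT t|lborel. k t) = 0" using hat[of 0] by simp
  have int: "integrable lborel (\<lambda>t. indicator A t *\<^sub>R k t)" if "A \<in> sets borel" for A
    using k that by (intro integrable_mult_indicator) auto
  have stable: "Int_stable (range (\<lambda>(a, b). box a b :: 'a set))"
    and closed: "range (\<lambda>(a, b). box a b :: 'a set) \<subseteq> Pow UNIV"
    by (auto simp: Int_stable_def box_Int_box)
  have *: "(LINT t|lborel. indicator A t *\<^sub>R k t) = 0" if "A \<in> sigma_sets UNIV (range (\<lambda>(a, b). box a b :: 'a set))" for A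
    using stable closed that
  proof (induction rule: sigma_sets_induct_disjoint)
    case (basic A)
    then show ?case using fourier_box_zero[OF k hat] by auto
  next
    case (compl A)
    then have A: "A \<in> sets borel" by (simp add: borel_eq_box)
    have "(LINT t|lborel. indicator (UNIV - A) t *\<^sub>R k t) = (LINT t|lborel. k t - indicator A t *\<^sub>R k t)"
      by (intro Bochner_Integration.integral_cong) (auto simp: indicator_def)
    also have "\<dots> = 0" using k int[OF A] tot compl by simp
    finally show ?case .
  next
    case (union A)
    then have A: "A i \<in> sets borel" for i by (auto simp: borel_eq_box)
    have "(LINT t:(\<Union>i. A i)|lborel. k t) = (\<Sum>i. LINT t:A i|lborel. k t)"
    proof (rule lebesgue_integral_countable_add)
      show "set_integrable lborel (\<Union>i. A i) k"
        unfolding set_integrable_def using A by (intro int) auto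
      show "A i \<inter> A j = {}" if "i \<noteq> j" for i j using union(1) that by (auto simp: disjoint_family_on_def)
    qed (use A in auto)
    then show ?case using union(3) by (simp add: set_lebesgue_integral_def)
  qed simp
  have **: "(LINT t|lborel. indicator A t *\<^sub>R k t) = 0" if "A \<in> sets borel" for A
    using * that by (simp add: borel_eq_box)
  have Re0: "(LINT t|lborel. indicator A t * Re (k t)) = 0" if "A \<in> sets borel" for A
    using integral_Re[OF int[OF that]] **[OF that] by simp
  have Im0: "(LINT t|lborel. indicator A t * Im (k t)) = 0" if "A \<in> sets borel" for A
    using integral_Im[OF int[OF that]] **[OF that] by simp
  have "AE t in lborel. Re (k t) = 0"
    by (rule density_unique_real) (use k Re0 in \<open>auto simp: set_lebesgue_integral_def\<close>)
  moreover have "AE t in lborel. Im (k t) = 0"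
    by (rule density_unique_real) (use k Im0 in \<open>auto simp: set_lebesgue_integral_def\<close>)
  ultimately show ?thesis by eventually_elim (simp add: complex_eq_iff)
qed

section \<open>The Gabor transform of square integrable functions\<close>

lemma borel_measurable_cnj [measurable (raw)]:
  "f \<in> borel_measurable M \<Longrightarrow> (\<lambda>x. cnj (f x)) \<in> borel_measurable M"
  by (rule measurable_compose[where N=borel]) (auto intro!: borel_measurable_continuous_onI continuous_intros)

lemma tf_shift_measurable [measurable (raw)]:
  assumes "f \<in> borel_measurable borel" and [measurable]: "a \<in> borel_measurable M" "t \<in> borel_measurable M"
  shows "(\<lambda>x. tf_shift (a x) f (t x)) \<in> borel_measurable M"
proof -
  have [measurable]: "(\<lambda>x. f (t x - fst (a x))) \<in> borel_measurable M"
    by (rule measurable_compose[OF _ assms(1)]) measurable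
  show ?thesis unfolding tf_shift_def by measurable
qed

lemma gaussian_measurable [measurable]: "gaussian \<in> borel_measurable borel"
  unfolding gaussian_def[abs_def] by measurable

lemma L2_bracket_measurable [measurable (raw)]:
  assumes "(\<lambda>(x, t). f x t) \<in> borel_measurable (M \<Otimes>\<^sub>M borel)" "(\<lambda>(x, t). g x t) \<in> borel_measurable (M \<Otimes>\<^sub>M borel)"
  shows "(\<lambda>x. L2_bracket (f x) (g x)) \<in> borel_measurable M"
proof -
  have [measurable]: "(\<lambda>(x, t). f x t) \<in> borel_measurable (M \<Otimes>\<^sub>M lborel)" "(\<lambda>(x, t). g x t) \<in> borel_measurable (M \<Otimes>\<^sub>M lborel)"
    using assms by (simp_all cong: measurable_cong_sets)
  have "(\<lambda>z. f (fst z) (snd z) * cnj (g (fst z) (snd z))) \<in> borel_measurable (M \<Otimes>\<^sub>M lborel)"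
    using assms by measurable
  then have "(\<lambda>(x, t). f x t * cnj (g x t)) \<in> borel_measurable (M \<Otimes>\<^sub>M lborel)" by (simp add: case_prod_beta')
  then show ?thesis unfolding L2_bracket_def by (rule lborel.borel_measurable_lebesgue_integral)
qed

lemma cmod_tf_shift: "cmod (tf_shift z f t) = cmod (f (t - fst z))"
  by (simp add: tf_shift_def norm_mult)

section \<open>Square integrable functions and time-frequency shifts\<close>

definition square_integrable :: "(real^'d::finite \<Rightarrow> complex) set" where
  "square_integrable = {f \<in> borel_measurable borel. integrable lborel (\<lambda>t. (cmod (f t))\<^sup>2)}"

lemma square_integrableD [measurable_dest]: "f \<in> square_integrable \<Longrightarrow> f \<in> borel_measurable borel"
  by (simp add: square_integrable_def)

lemma square_integrableD2: "f \<in> square_integrable \<Longrightarrow> integrable lborel (\<lambda>t. (cmod (f t))\<^sup>2)"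
  by (simp add: square_integrable_def)

lemma square_integrable_cmult: "f \<in> square_integrable \<Longrightarrow> (\<lambda>t. c * f t) \<in> square_integrable"
  by (auto simp: square_integrable_def norm_mult power_mult_distrib)

lemma square_integrable_add:
  assumes "f \<in> square_integrable" "g \<in> square_integrable"
  shows "(\<lambda>t. f t + g t) \<in> square_integrable"
proof -
  note [measurable] = assms[THEN square_integrableD]
  have "integrable lborel (\<lambda>t. (cmod (f t + g t))\<^sup>2)"
  proof (rule Bochner_Integration.integrable_bound)
    show "integrable lborel (\<lambda>t. 2 * (cmod (f t))\<^sup>2 + 2 * (cmod (g t))\<^sup>2)"
      using assms by (intro Bochner_Integration.integrable_add integrable_mult_right square_integrableD2)
    show "AE t in lborel. norm ((cmod (f t + g t))\<^sup>2) \<le> norm (2 * (cmod (f t))\<^sup>2 + 2 * (cmod (g t))\<^sup>2)"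
    proof (rule AE_I2)
      fix t
      have "(cmod (f t + g t))\<^sup>2 \<le> (cmod (f t) + cmod (g t))\<^sup>2" by (intro power_mono norm_triangle_ineq) auto
      also have "\<dots> \<le> 2 * (cmod (f t))\<^sup>2 + 2 * (cmod (g t))\<^sup>2"
        using sum_squares_bound[of "cmod (f t)" "cmod (g t)"] by (simp add: power2_sum)
      finally show "norm ((cmod (f t + g t))\<^sup>2) \<le> norm (2 * (cmod (f t))\<^sup>2 + 2 * (cmod (g t))\<^sup>2)" by simp
    qed
  qed measurable
  then show ?thesis unfolding square_integrable_def by simp
qed

lemma square_integrable_diff:
  assumes "f \<in> square_integrable" "g \<in> square_integrable"
  shows "(\<lambda>t. f t - g t) \<in> square_integrable"
  using square_integrable_add[OF assms(1) square_integrable_cmult[OF assms(2), of "- 1"]] by simp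

lemma square_integrable_tf_shift:
  assumes "f \<in> square_integrable" shows "tf_shift z f \<in> square_integrable"
proof -
  note [measurable] = assms[THEN square_integrableD]
  have "integrable lborel (\<lambda>t. complex_of_real ((cmod (f (t + (- fst z))))\<^sup>2))"
    using integral_lborel_shift(2)[of "\<lambda>t. complex_of_real ((cmod (f t))\<^sup>2)" "- fst z"] square_integrableD2[OF assms]
    by (simp only: integrable_of_real) simp
  then have "integrable lborel (\<lambda>t. (cmod (f (t - fst z)))\<^sup>2)"
    using integrable_Re by fastforce
  then show ?thesis by (simp add: square_integrable_def cmod_tf_shift)
qed

lemma cmod_gaussian: "cmod (gaussian t) = exp (- pi * (norm t)\<^sup>2)"
  by (simp add: gaussian_def)

lemma cnj_gaussian [simp]: "cnj (gaussian t) = gaussian t"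
  by (simp add: gaussian_def)

lemma gaussian_square_integrable: "(gaussian :: real^'d::finite \<Rightarrow> complex) \<in> square_integrable"
proof -
  have "(cmod (gaussian t))\<^sup>2 = exp (- (2 * pi) * (norm (t::real^'d))\<^sup>2)" for t
    by (simp add: cmod_gaussian power2_eq_square flip: exp_add)
  then show ?thesis
    using gauss_integrable[of "2 * pi", where 'a="real^'d"] by (simp add: square_integrable_def)
qed

lemma nn_integral_square_bound:
  assumes "f \<in> square_integrable" "g \<in> square_integrable"
  shows "(\<integral>\<^sup>+ t. ennreal (cmod (f t)) * ennreal (cmod (g t)) \<partial>lborel)
    \<le> (\<integral>\<^sup>+ t. ennreal ((cmod (f t))\<^sup>2) \<partial>lborel) + (\<integral>\<^sup>+ t. ennreal ((cmod (g t))\<^sup>2) \<partial>lborel)"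
proof -
  note [measurable] = assms[THEN square_integrableD]
  have "(\<integral>\<^sup>+ t. ennreal (cmod (f t)) * ennreal (cmod (g t)) \<partial>lborel)
    \<le> (\<integral>\<^sup>+ t. ennreal ((cmod (f t))\<^sup>2) + ennreal ((cmod (g t))\<^sup>2) \<partial>lborel)"
  proof (rule nn_integral_mono)
    fix t
    have "cmod (f t) * cmod (g t) \<le> (cmod (f t))\<^sup>2 + (cmod (g t))\<^sup>2"
    proof -
      have "2 * (cmod (f t) * cmod (g t)) \<le> (cmod (f t))\<^sup>2 + (cmod (g t))\<^sup>2"
        using sum_squares_bound[of "cmod (f t)" "cmod (g t)"] by (simp add: mult.assoc)
      moreover have "0 \<le> cmod (f t) * cmod (g t)" by simp
      ultimately show ?thesis by linarith
    qed
    then show "ennreal (cmod (f t)) * ennreal (cmod (g t)) \<le> ennreal ((cmod (f t))\<^sup>2) + ennreal ((cmod (g t))\<^sup>2)"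
      by (simp add: ennreal_mult[symmetric] ennreal_plus[symmetric] ennreal_leI del: ennreal_plus)
  qed
  then show ?thesis by (simp add: nn_integral_add)
qed

lemma nn_integral_square_finite:
  "f \<in> square_integrable \<Longrightarrow> (\<integral>\<^sup>+ t. ennreal ((cmod (f t))\<^sup>2) \<partial>lborel) < top"
  using square_integrableD2[of f] by (simp add: integrable_iff_bounded)

lemma integrable_bracket:
  assumes "f \<in> square_integrable" "g \<in> square_integrable"
  shows "integrable lborel (\<lambda>t. f t * cnj (g t))"
proof (rule integrableI_bounded)
  note [measurable] = assms[THEN square_integrableD]
  show "(\<lambda>t. f t * cnj (g t)) \<in> borel_measurable lborel" by measurable
  have "(\<integral>\<^sup>+ t. ennreal (cmod (f t * cnj (g t))) \<partial>lborel)
    \<le> (\<integral>\<^sup>+ t. ennreal ((cmod (f t))\<^sup>2) \<partial>lborel) + (\<integral>\<^sup>+ t. ennreal ((cmod (g t))\<^sup>2) \<partial>lborel)"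
    using nn_integral_square_bound[OF assms] by (simp add: norm_mult ennreal_mult)
  also have "\<dots> < top" using assms by (simp add: nn_integral_square_finite)
  finally show "(\<integral>\<^sup>+ t. ennreal (cmod (f t * cnj (g t))) \<partial>lborel) < \<infinity>" by simp
qed

lemma L2_bracket_add_left:
  assumes "f \<in> square_integrable" "g \<in> square_integrable" "h \<in> square_integrable"
  shows "L2_bracket (\<lambda>t. f t + g t) h = L2_bracket f h + L2_bracket g h"
  using assms by (simp add: L2_bracket_def distrib_right integrable_bracket)

lemma L2_bracket_add_right:
  assumes "f \<in> square_integrable" "g \<in> square_integrable" "h \<in> square_integrable"
  shows "L2_bracket h (\<lambda>t. f t + g t) = L2_bracket h f + L2_bracket h g"
  using assms by (simp add: L2_bracket_def distrib_left integrable_bracket)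

lemma L2_bracket_cmult_left: "L2_bracket (\<lambda>t. c * f t) g = c * L2_bracket f g"
  by (simp add: L2_bracket_def mult.assoc)

lemma L2_bracket_cmult_right: "L2_bracket f (\<lambda>t. c * g t) = cnj c * L2_bracket f g"
  unfolding L2_bracket_def by (subst integral_mult_right_zero[symmetric]) (simp add: mult_ac)

lemma L2_bracket_cnj: "cnj (L2_bracket f g) = L2_bracket g f"
  unfolding L2_bracket_def by (simp add: mult.commute flip: Bochner_Integration.integral_cnj)

text \<open>The shifts form a projective representation. Its phase disappears in absolute values, so
  moduli of transforms are simply translated; every later bound by a convolution rests on
  this.\<close>

lemma tf_shift_tf_shift:
  "tf_shift a (tf_shift b f) t = cis (- 2 * pi * (snd b \<bullet> fst a)) * tf_shift (a + b) f t"
proof -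
  have "2 * pi * (snd a \<bullet> t) + 2 * pi * (snd b \<bullet> (t - fst a)) = - 2 * pi * (snd b \<bullet> fst a) + 2 * pi * (snd (a + b) \<bullet> t)"
    by (simp add: inner_diff_right inner_add_left algebra_simps)
  then have "cis (2 * pi * (snd a \<bullet> t)) * cis (2 * pi * (snd b \<bullet> (t - fst a)))
      = cis (- 2 * pi * (snd b \<bullet> fst a)) * cis (2 * pi * (snd (a + b) \<bullet> t))"
    by (simp only: cis_mult)
  moreover have "t - fst a - fst b = t - fst (a + b)" by simp
  ultimately show ?thesis unfolding tf_shift_def by (simp only: mult.assoc[symmetric])
qed

lemma cis_mult_cnj_cancel: "(cis \<theta> * a) * cnj (cis \<theta> * b) = a * cnj b"
proof -
  have "(cis \<theta> * a) * cnj (cis \<theta> * b) = (cis \<theta> * cis (- \<theta>)) * (a * cnj b)"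
    by (simp add: cis_cnj mult_ac)
  then show ?thesis by (simp add: cis_mult)
qed

lemma tf_shift_add:
  "tf_shift (a + b) f t = cis (2 * pi * (snd b \<bullet> fst a)) * tf_shift a (tf_shift b f) t"
  by (simp add: tf_shift_tf_shift mult.assoc[symmetric] cis_mult)

lemma L2_bracket_tf_shift_same:
  assumes [measurable]: "f \<in> borel_measurable borel" "g \<in> borel_measurable borel"
  shows "L2_bracket (tf_shift a f) (tf_shift a g) = L2_bracket f g"
proof -
  have "tf_shift a f t * cnj (tf_shift a g t) = f (t + (- fst a)) * cnj (g (t + (- fst a)))" for t
    by (simp only: tf_shift_def cis_mult_cnj_cancel) simp
  then show ?thesis
    unfolding L2_bracket_def using integral_lborel_shift(1)[of "\<lambda>t. f t * cnj (g t)" "- fst a"] by simp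
qed

lemma L2_bracket_tf_shift:
  assumes [measurable]: "f \<in> borel_measurable borel" "g \<in> borel_measurable borel"
  shows "L2_bracket (tf_shift a f) (tf_shift b g)
    = cis (- 2 * pi * (snd (b - a) \<bullet> fst a)) * L2_bracket f (tf_shift (b - a) g)"
proof -
  have "tf_shift b g = (\<lambda>t. cis (2 * pi * (snd (b - a) \<bullet> fst a)) * tf_shift a (tf_shift (b - a) g) t)"
    using tf_shift_add[of a "b - a" g] by auto
  then have "L2_bracket (tf_shift a f) (tf_shift b g)
     = cis (- 2 * pi * (snd (b - a) \<bullet> fst a)) * L2_bracket (tf_shift a f) (tf_shift a (tf_shift (b - a) g))"
    by (simp add: L2_bracket_cmult_right cis_cnj)
  also have "L2_bracket (tf_shift a f) (tf_shift a (tf_shift (b - a) g)) = L2_bracket f (tf_shift (b - a) g)"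
    by (rule L2_bracket_tf_shift_same) measurable
  finally show ?thesis .
qed

section \<open>The transform with Gaussian window and its reproducing formula\<close>

definition gabor :: "(real^'d::finite \<Rightarrow> complex) \<Rightarrow> 'd phase \<Rightarrow> complex" where
  "gabor f z = L2_bracket f (tf_shift z gaussian)"

lemma STFT_L2_bracket: "STFT gaussian (L2_bracket f) = gabor f"
  by (simp add: fun_eq_iff STFT_def gabor_def)

lemma gabor_measurable' [measurable (raw)]:
  assumes "(\<lambda>(x, t). f x t) \<in> borel_measurable (M \<Otimes>\<^sub>M borel)" and [measurable]: "z \<in> borel_measurable M"
  shows "(\<lambda>x. gabor (f x) (z x)) \<in> borel_measurable M"
  unfolding gabor_def by (rule L2_bracket_measurable[OF assms(1)]) measurable

lemma gabor_measurable [measurable]: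
  assumes [measurable]: "f \<in> borel_measurable borel"
  shows "gabor f \<in> borel_measurable borel"
  unfolding gabor_def[abs_def] by measurable

lemma gabor_add:
  "f \<in> square_integrable \<Longrightarrow> g \<in> square_integrable \<Longrightarrow> gabor (\<lambda>t. f t + g t) z = gabor f z + gabor g z"
  by (simp add: gabor_def L2_bracket_add_left square_integrable_tf_shift gaussian_square_integrable)

lemma gabor_cmult: "gabor (\<lambda>t. c * f t) z = c * gabor f z"
  by (simp add: gabor_def L2_bracket_cmult_left)

lemma gabor_diff:
  "f \<in> square_integrable \<Longrightarrow> g \<in> square_integrable \<Longrightarrow> gabor (\<lambda>t. f t - g t) z = gabor f z - gabor g z"
  using gabor_add[of f "\<lambda>t. (- 1) * g t" z] square_integrable_cmult[of g "- 1"] gabor_cmult[of "- 1" g z] by simp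

lemma gabor_tf_shift:
  "f \<in> borel_measurable borel \<Longrightarrow>
    gabor (tf_shift a f) z = cis (- 2 * pi * (snd (z - a) \<bullet> fst a)) * gabor f (z - a)"
  unfolding gabor_def by (intro L2_bracket_tf_shift gaussian_measurable)

lemma cmod_gabor_tf_shift:
  "f \<in> borel_measurable borel \<Longrightarrow> cmod (gabor (tf_shift a f) z) = cmod (gabor f (z - a))"
  by (simp add: gabor_tf_shift norm_mult)

text \<open>The squared L^2-norm of the Gaussian, equal to \<open>gabor gaussian 0\<close>; it is
  the constant kappa of all reproducing formulas.\<close>

definition gconst :: "'d::finite itself \<Rightarrow> real" where
  "gconst _ = (1 / sqrt 2) ^ CARD('d)"

lemma gconst_pos: "0 < gconst TYPE('d::finite)"
  by (simp add: gconst_def)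

lemma norm_pair_squared: "(norm z)\<^sup>2 = (norm (fst z))\<^sup>2 + (norm (snd z))\<^sup>2"
  by (cases z) (simp add: norm_Pair)

lemma gabor_gaussian:
  "gabor gaussian (z :: 'd::finite phase)
    = of_real (gconst TYPE('d) * exp (- (pi / 2) * (norm z)\<^sup>2)) * cis (- pi * (snd z \<bullet> fst z))"
proof -
  obtain x \<omega> where z: "z = (x, \<omega>)" by (cases z)
  let ?g = "\<lambda>t. gaussian t * cnj (tf_shift z gaussian t)"
  \<comment> \<open>Recentring at x/2 makes the product of the two Gaussians even in t: the
    parallelogram identity leaves exp(-2 pi |t|^2) times a constant.\<close>
  have sq: "(norm (t + (1 / 2) *\<^sub>R x))\<^sup>2 + (norm (t + (1 / 2) *\<^sub>R x - x))\<^sup>2 = 2 * (norm t)\<^sup>2 + (norm x)\<^sup>2 / 2" for t :: "real^'d"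
  proof -
    have "t + (1 / 2) *\<^sub>R x - x = t - (1 / 2) *\<^sub>R x"
      by (simp add: algebra_simps flip: scaleR_add_left)
    then show ?thesis
      by (simp add: power2_norm_eq_inner inner_add_left inner_add_right inner_diff_left inner_diff_right inner_commute field_simps)
  qed
  have eq: "?g (t + (1 / 2) *\<^sub>R x) = of_real (exp (- (pi / 2) * (norm x)\<^sup>2)) * cis (- pi * (\<omega> \<bullet> x)) *
     (of_real (exp (- pi * 2 * (norm t)\<^sup>2)) * cis (2 * pi * (- \<omega> \<bullet> t)))" for t
  proof -
    have "?g (t + (1 / 2) *\<^sub>R x) = of_real (exp (- pi * (norm (t + (1 / 2) *\<^sub>R x))\<^sup>2) * exp (- pi * (norm (t + (1 / 2) *\<^sub>R x - x))\<^sup>2))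
       * cis (- (2 * pi * (\<omega> \<bullet> (t + (1 / 2) *\<^sub>R x))))"
      by (simp add: z tf_shift_def gaussian_def cis_cnj)
    also have "exp (- pi * (norm (t + (1 / 2) *\<^sub>R x))\<^sup>2) * exp (- pi * (norm (t + (1 / 2) *\<^sub>R x - x))\<^sup>2)
       = exp (- pi * ((norm (t + (1 / 2) *\<^sub>R x))\<^sup>2 + (norm (t + (1 / 2) *\<^sub>R x - x))\<^sup>2))"
      by (simp add: exp_add[symmetric] algebra_simps)
    also have "\<dots> = exp (- (pi / 2) * (norm x)\<^sup>2) * exp (- pi * 2 * (norm t)\<^sup>2)"
      unfolding sq by (simp add: exp_add[symmetric] algebra_simps)
    also have "cis (- (2 * pi * (\<omega> \<bullet> (t + (1 / 2) *\<^sub>R x)))) = cis (- pi * (\<omega> \<bullet> x)) * cis (2 * pi * (- \<omega> \<bullet> t))"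
      by (simp add: cis_mult inner_add_right algebra_simps)
    finally show ?thesis by (simp add: mult_ac)
  qed
  have "gabor gaussian z = (LINT t|lborel. ?g t)" by (simp add: gabor_def L2_bracket_def)
  also have "\<dots> = (LINT t|lborel. ?g (t + (1 / 2) *\<^sub>R x))" by (rule integral_lborel_shift(1)[symmetric]) measurable
  also have "\<dots> = of_real (exp (- (pi / 2) * (norm x)\<^sup>2)) * cis (- pi * (\<omega> \<bullet> x)) *
     of_real ((1 / sqrt 2) ^ DIM(real^'d) * exp (- pi * (norm (- \<omega>))\<^sup>2 / 2))"
    unfolding eq by (subst integral_mult_right_zero, subst gauss_fourier(2)) simp_all
  also have "\<dots> = of_real (gconst TYPE('d) * (exp (- (pi / 2) * (norm x)\<^sup>2) * exp (- (pi / 2) * (norm \<omega>)\<^sup>2))) * cis (- pi * (\<omega> \<bullet> x))"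
    by (simp add: gconst_def mult_ac)
  also have "exp (- (pi / 2) * (norm x)\<^sup>2) * exp (- (pi / 2) * (norm \<omega>)\<^sup>2) = exp (- (pi / 2) * (norm z)\<^sup>2)"
    by (simp add: z norm_pair_squared exp_add[symmetric] algebra_simps)
  finally show ?thesis by (simp add: z)
qed

lemma cmod_gabor_gaussian:
  "cmod (gabor gaussian (z :: 'd::finite phase)) = gconst TYPE('d) * exp (- (pi / 2) * (norm z)\<^sup>2)"
  using gconst_pos[where 'd='d] by (simp add: gabor_gaussian norm_mult)

lemma cmod_gabor_gaussian_integrable: "integrable lborel (\<lambda>z :: 'd::finite phase. cmod (gabor gaussian z))"
  unfolding cmod_gabor_gaussian using gauss_integrable[of "pi / 2", where 'a="'d phase"] by simp

text \<open>At the unshifted Gaussian everything is explicit: a Gaussian integral over frequency,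
  then, after completing the square, one over position. Covariance carries the identity to all
  shifts in \<open>reproducing_pointwise\<close>.\<close>

lemma reproducing_0:
  "(LINT z|lborel. gabor gaussian (z :: 'd::finite phase) * tf_shift z gaussian t) = of_real (gconst TYPE('d)) * gaussian t"
proof -
  let ?k = "gconst TYPE('d)"
  let ?F = "\<lambda>x \<omega>. gabor gaussian (x, \<omega>) * tf_shift (x, \<omega>) gaussian t"
  have F: "?F x \<omega> = of_real (?k * (exp (- (pi / 2) * (norm x)\<^sup>2) * exp (- pi * (norm (t - x))\<^sup>2))) *
      (of_real (exp (- pi * (1 / 2) * (norm \<omega>)\<^sup>2)) * cis (2 * pi * ((t - (1 / 2) *\<^sub>R x) \<bullet> \<omega>)))" for x \<omega>
  proof -
    have "exp (- (pi / 2) * (norm (x, \<omega>))\<^sup>2) = exp (- (pi / 2) * (norm x)\<^sup>2) * exp (- pi * (1 / 2) * (norm \<omega>)\<^sup>2)"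
      by (simp add: norm_pair_squared exp_add[symmetric] algebra_simps)
    moreover have "cis (- pi * (\<omega> \<bullet> x)) * cis (2 * pi * (\<omega> \<bullet> t)) = cis (2 * pi * ((t - (1 / 2) *\<^sub>R x) \<bullet> \<omega>))"
      by (simp add: cis_mult inner_diff_left inner_commute algebra_simps)
    ultimately show ?thesis
      by (simp add: gabor_gaussian tf_shift_def gaussian_def mult_ac)
  qed
  have fin: "(\<integral>\<^sup>+ x. \<integral>\<^sup>+ \<omega>. ennreal (cmod (?F x \<omega>)) \<partial>lborel \<partial>lborel) < top"
  proof -
    have G1: "(\<integral>\<^sup>+ \<omega>. ennreal (exp (- pi * (1 / 2) * (norm (\<omega>::real^'d))\<^sup>2)) \<partial>lborel) < top"
      using gauss_integrable[of "pi / 2", where 'a="real^'d"] by (simp add: integrable_iff_bounded)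
    have "(\<integral>\<^sup>+ x. \<integral>\<^sup>+ \<omega>. ennreal (cmod (?F x \<omega>)) \<partial>lborel \<partial>lborel)
      \<le> (\<integral>\<^sup>+ x. \<integral>\<^sup>+ \<omega>. ennreal ?k * (ennreal (exp (- pi * (1 / 2) * (norm (x::real^'d))\<^sup>2)) * ennreal (exp (- pi * (1 / 2) * (norm (\<omega>::real^'d))\<^sup>2))) \<partial>lborel \<partial>lborel)"
    proof (intro nn_integral_mono)
      fix x \<omega> :: "real^'d"
      have "cmod (?F x \<omega>) = ?k * (exp (- (pi / 2) * (norm x)\<^sup>2) * exp (- pi * (norm (t - x))\<^sup>2)) * exp (- pi * (1 / 2) * (norm \<omega>)\<^sup>2)"
        unfolding F norm_mult norm_cis norm_of_real using gconst_pos[where 'd='d] by simp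
      also have "\<dots> \<le> ?k * (exp (- (pi / 2) * (norm x)\<^sup>2) * 1) * exp (- pi * (1 / 2) * (norm \<omega>)\<^sup>2)"
        using gconst_pos[where 'd='d] by (intro mult_right_mono mult_left_mono) auto
      finally have "ennreal (cmod (?F x \<omega>)) \<le> ennreal (?k * (exp (- pi * (1 / 2) * (norm x)\<^sup>2) * exp (- pi * (1 / 2) * (norm \<omega>)\<^sup>2)))"
        by (intro ennreal_leI) (simp add: mult_ac)
      then show "ennreal (cmod (?F x \<omega>)) \<le> ennreal ?k * (ennreal (exp (- pi * (1 / 2) * (norm x)\<^sup>2)) * ennreal (exp (- pi * (1 / 2) * (norm \<omega>)\<^sup>2)))"
        using gconst_pos[where 'd='d] by (simp add: ennreal_mult)
    qed
    also have "\<dots> < top" using G1 by (simp add: nn_integral_cmult nn_integral_multc ennreal_mult_less_top)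
    finally show ?thesis .
  qed
  have "(LINT z|lborel. gabor gaussian (z :: 'd::finite phase) * tf_shift z gaussian t) = (LINT x|lborel. LINT \<omega>|lborel. ?F x \<omega>)"
    by (subst Fubini_lborel(2)[OF _ fin]) simp_all
  also have "\<dots> = (LINT x|lborel. of_real (?k * (exp (- (pi / 2) * (norm x)\<^sup>2) * exp (- pi * (norm (t - x))\<^sup>2))) *
      of_real ((1 / sqrt (1 / 2)) ^ DIM(real^'d) * exp (- pi * (norm (t - (1 / 2) *\<^sub>R x))\<^sup>2 / (1 / 2))))"
    unfolding F by (subst integral_mult_right_zero, subst gauss_fourier(2)) simp_all
  also have "\<dots> = (LINT x|lborel. of_real (?k * (1 / sqrt (1 / 2)) ^ DIM(real^'d) * exp (- pi * (norm t)\<^sup>2)) * complex_of_real (exp (- pi * 2 * (norm (x + (- t)))\<^sup>2)))"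
  proof (intro Bochner_Integration.integral_cong refl)
    fix x :: "real^'d"
    have "exp (- (pi / 2) * (norm x)\<^sup>2) * exp (- pi * (norm (t - x))\<^sup>2) * exp (- pi * (norm (t - (1 / 2) *\<^sub>R x))\<^sup>2 / (1 / 2))
       = exp (- pi * ((norm x)\<^sup>2 / 2 + (norm (t - x))\<^sup>2 + 2 * (norm (t - (1 / 2) *\<^sub>R x))\<^sup>2))"
      by (simp add: exp_add[symmetric] algebra_simps)
    also have "(norm x)\<^sup>2 / 2 + (norm (t - x))\<^sup>2 + 2 * (norm (t - (1 / 2) *\<^sub>R x))\<^sup>2 = (norm t)\<^sup>2 + 2 * (norm (x + (- t)))\<^sup>2"
      by (simp add: power2_norm_eq_inner inner_add_left inner_add_right inner_diff_left inner_diff_right inner_commute field_simps)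
    also have "exp (- pi * ((norm t)\<^sup>2 + 2 * (norm (x + (- t)))\<^sup>2)) = exp (- pi * (norm t)\<^sup>2) * exp (- pi * 2 * (norm (x + (- t)))\<^sup>2)"
      by (simp add: exp_add[symmetric] algebra_simps)
    finally have *: "exp (- (pi / 2) * (norm x)\<^sup>2) * exp (- pi * (norm (t - x))\<^sup>2) * exp (- pi * (norm (t - (1 / 2) *\<^sub>R x))\<^sup>2 / (1 / 2))
      = exp (- pi * (norm t)\<^sup>2) * exp (- pi * 2 * (norm (x + (- t)))\<^sup>2)" .
    show "of_real (?k * (exp (- (pi / 2) * (norm x)\<^sup>2) * exp (- pi * (norm (t - x))\<^sup>2))) *
      of_real ((1 / sqrt (1 / 2)) ^ DIM(real^'d) * exp (- pi * (norm (t - (1 / 2) *\<^sub>R x))\<^sup>2 / (1 / 2)))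
      = of_real (?k * (1 / sqrt (1 / 2)) ^ DIM(real^'d) * exp (- pi * (norm t)\<^sup>2)) * complex_of_real (exp (- pi * 2 * (norm (x + (- t)))\<^sup>2))"
      using arg_cong[OF *, of "\<lambda>r. complex_of_real (?k * (1 / sqrt (1 / 2)) ^ DIM(real^'d) * r)"]
      unfolding of_real_mult[symmetric] by (simp only: mult_ac)
  qed
  also have "\<dots> = of_real (?k * (1 / sqrt (1 / 2)) ^ DIM(real^'d) * exp (- pi * (norm t)\<^sup>2)) * (LINT x|lborel. complex_of_real (exp (- pi * 2 * (norm (x::real^'d))\<^sup>2)))"
    by (subst integral_mult_right_zero, subst integral_lborel_shift(1)) simp_all
  also have "(LINT x|lborel. complex_of_real (exp (- pi * 2 * (norm (x::real^'d))\<^sup>2))) = of_real ((1 / sqrt 2) ^ DIM(real^'d))"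
    using gauss_fourier(2)[of 2 "0 :: real^'d"] by simp
  also have "of_real (?k * (1 / sqrt (1 / 2)) ^ DIM(real^'d) * exp (- pi * (norm t)\<^sup>2)) * complex_of_real ((1 / sqrt 2) ^ DIM(real^'d)) = of_real ?k * gaussian t"
  proof -
    have "(1 / sqrt (1 / 2)) ^ n * (1 / sqrt 2) ^ n = (1::real)" for n
      by (simp add: real_sqrt_divide flip: power_mult_distrib)
    moreover have "k * a * e * b = (a * b) * (k * e)" for k a e b :: real by (simp only: mult_ac)
    ultimately have "?k * (1 / sqrt (1 / 2)) ^ DIM(real^'d) * exp (- pi * (norm t)\<^sup>2) * (1 / sqrt 2) ^ DIM(real^'d) = ?k * exp (- pi * (norm t)\<^sup>2)"
      by (simp only: mult_1)
    then show ?thesis unfolding gaussian_def of_real_mult[symmetric] by (rule arg_cong)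
  qed
  finally show ?thesis .
qed

lemma reproducing_pointwise:
  fixes \<zeta> :: "'d::finite phase"
  shows "(LINT z|lborel. gabor (tf_shift \<zeta> gaussian) z * tf_shift z gaussian t)
    = of_real (gconst TYPE('d)) * tf_shift \<zeta> gaussian t"
proof -
  have "(LINT z|lborel. gabor (tf_shift \<zeta> gaussian) z * tf_shift z gaussian t)
    = (LINT z|lborel. gabor (tf_shift \<zeta> gaussian) (z + \<zeta>) * tf_shift (z + \<zeta>) gaussian t)"
    by (rule integral_lborel_shift(1)[symmetric]) measurable
  also have "\<dots> = (LINT z|lborel. cis (2 * pi * (snd \<zeta> \<bullet> t)) * (gabor gaussian z * tf_shift z gaussian (t - fst \<zeta>)))"
  proof (intro Bochner_Integration.integral_cong refl)
    fix z
    have "gabor (tf_shift \<zeta> gaussian) (z + \<zeta>) * tf_shift (z + \<zeta>) gaussian t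
      = cis (- 2 * pi * (snd z \<bullet> fst \<zeta>)) * gabor gaussian z * (cis (2 * pi * (snd z \<bullet> fst \<zeta>)) * tf_shift \<zeta> (tf_shift z gaussian) t)"
    proof -
      have "gabor (tf_shift \<zeta> gaussian) (z + \<zeta>) = cis (- 2 * pi * (snd z \<bullet> fst \<zeta>)) * gabor gaussian z"
        by (simp add: gabor_tf_shift)
      moreover have "tf_shift (z + \<zeta>) gaussian t = cis (2 * pi * (snd z \<bullet> fst \<zeta>)) * tf_shift \<zeta> (tf_shift z gaussian) t"
        using tf_shift_add[of \<zeta> z gaussian t] by (simp only: add.commute)
      ultimately show ?thesis by (simp only:)
    qed
    also have "\<dots> = gabor gaussian z * tf_shift \<zeta> (tf_shift z gaussian) t"
    proof -
      have "cis (- 2 * pi * (snd z \<bullet> fst \<zeta>)) * cis (2 * pi * (snd z \<bullet> fst \<zeta>)) = 1" by (simp add: cis_mult)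
      moreover have "c * g * (d * h) = (c * d) * (g * h)" for c d g h :: complex by (simp only: mult_ac)
      ultimately show ?thesis by simp
    qed
    finally show "gabor (tf_shift \<zeta> gaussian) (z + \<zeta>) * tf_shift (z + \<zeta>) gaussian t
      = cis (2 * pi * (snd \<zeta> \<bullet> t)) * (gabor gaussian z * tf_shift z gaussian (t - fst \<zeta>))"
      by (simp add: tf_shift_def mult_ac)
  qed
  also have "\<dots> = cis (2 * pi * (snd \<zeta> \<bullet> t)) * (of_real (gconst TYPE('d)) * gaussian (t - fst \<zeta>))"
    by (simp only: integral_mult_right_zero reproducing_0)
  also have "\<dots> = of_real (gconst TYPE('d)) * tf_shift \<zeta> gaussian t"
    by (simp add: tf_shift_def mult_ac)
  finally show ?thesis .
qed

text \<open>A product is at most the sum of the squares, and the second square is translation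
  invariant, so the bound is uniform in \<open>x\<close>. It supplies the absolute convergence for
  Fubini in the next three formulas.\<close>

lemma nn_integral_gabor_bound:
  assumes f: "f \<in> square_integrable"
  shows "\<exists>M<top. \<forall>x::real^'d::finite. (\<integral>\<^sup>+ t. ennreal (cmod (f t)) * ennreal (cmod (gaussian (t - x))) \<partial>lborel) \<le> M"
proof (intro exI conjI allI)
  note [measurable] = f[THEN square_integrableD]
  let ?M = "(\<integral>\<^sup>+ t. ennreal ((cmod (f t))\<^sup>2) \<partial>lborel) + (\<integral>\<^sup>+ t. ennreal ((cmod (gaussian (t::real^'d)))\<^sup>2) \<partial>lborel)"
  show "?M < top" using f by (simp add: nn_integral_square_finite gaussian_square_integrable)
  fix x :: "real^'d"
  have "(\<integral>\<^sup>+ t. ennreal (cmod (f t)) * ennreal (cmod (gaussian (t - x))) \<partial>lborel)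
    = (\<integral>\<^sup>+ t. ennreal (cmod (f t)) * ennreal (cmod (tf_shift (x, 0) gaussian t)) \<partial>lborel)"
    by (simp add: cmod_tf_shift)
  also have "\<dots> \<le> (\<integral>\<^sup>+ t. ennreal ((cmod (f t))\<^sup>2) \<partial>lborel) + (\<integral>\<^sup>+ t. ennreal ((cmod (tf_shift (x, 0) gaussian t))\<^sup>2) \<partial>lborel)"
    by (intro nn_integral_square_bound f square_integrable_tf_shift gaussian_square_integrable)
  also have "(\<integral>\<^sup>+ t. ennreal ((cmod (tf_shift (x, 0) gaussian t))\<^sup>2) \<partial>lborel) = (\<integral>\<^sup>+ t. ennreal ((cmod (gaussian (t::real^'d)))\<^sup>2) \<partial>lborel)"
    unfolding cmod_tf_shift fst_conv by (rule nn_integral_lborel_shift[of "\<lambda>t. ennreal ((cmod (gaussian t))\<^sup>2)"]) measurable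
  finally show "(\<integral>\<^sup>+ t. ennreal (cmod (f t)) * ennreal (cmod (gaussian (t - x))) \<partial>lborel) \<le> ?M" .
qed

text \<open>The conjugate of \<open>reproducing_pointwise\<close>, integrated against
  \<open>f\<close>. Here \<open>gabor f\<close> is merely bounded; absolute convergence comes from
  the integrable transform of the Gaussian.\<close>

lemma gabor_reproducing:
  fixes \<zeta> :: "'d::finite phase"
  assumes f: "f \<in> square_integrable"
  shows "(LINT z|lborel. gabor f z * gabor (tf_shift z gaussian) \<zeta>) = of_real (gconst TYPE('d)) * gabor f \<zeta>"
proof -
  note [measurable] = f[THEN square_integrableD]
  obtain M where M: "M < top" "\<And>x. (\<integral>\<^sup>+ t. ennreal (cmod (f t)) * ennreal (cmod (gaussian (t - x))) \<partial>lborel) \<le> M"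
    using nn_integral_gabor_bound[OF f] by blast
  let ?h = "\<lambda>z. gabor (tf_shift z gaussian) \<zeta>"
  have "(LINT z|lborel. gabor f z * ?h z) = (LINT z|lborel. LINT t|lborel. f t * cnj (tf_shift z gaussian t) * ?h z)"
    by (simp add: gabor_def[of f] L2_bracket_def)
  also have "\<dots> = (LINT t|lborel. LINT z|lborel. f t * cnj (tf_shift z gaussian t) * ?h z)"
  proof (rule Fubini_lborel(3))
    have "(\<integral>\<^sup>+ z. \<integral>\<^sup>+ t. ennreal (cmod (f t * cnj (tf_shift z gaussian t) * ?h z)) \<partial>lborel \<partial>lborel)
      = (\<integral>\<^sup>+ z. (\<integral>\<^sup>+ t. ennreal (cmod (f t)) * ennreal (cmod (gaussian (t - fst z))) \<partial>lborel) * ennreal (cmod (gabor gaussian (\<zeta> - z))) \<partial>lborel)"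
      by (simp add: norm_mult cmod_tf_shift ennreal_mult nn_integral_multc cmod_gabor_tf_shift)
    also have "\<dots> \<le> (\<integral>\<^sup>+ z. M * ennreal (cmod (gabor gaussian (\<zeta> - z))) \<partial>lborel)"
      by (intro nn_integral_mono mult_right_mono M) auto
    also have "\<dots> = M * (\<integral>\<^sup>+ z. ennreal (cmod (gabor gaussian (z :: 'd phase))) \<partial>lborel)"
      by (subst nn_integral_cmult, simp, subst nn_integral_lborel_reflect[of "\<lambda>z. ennreal (cmod (gabor gaussian z))"]) simp_all
    also have "\<dots> < top"
      using M(1) cmod_gabor_gaussian_integrable[where 'd='d] by (simp add: integrable_iff_bounded ennreal_mult_less_top)
    finally show "(\<integral>\<^sup>+ z. \<integral>\<^sup>+ t. ennreal (cmod (f t * cnj (tf_shift z gaussian t) * ?h z)) \<partial>lborel \<partial>lborel) < top" .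
  qed measurable
  also have "\<dots> = (LINT t|lborel. f t * cnj (LINT z|lborel. gabor (tf_shift \<zeta> gaussian) z * tf_shift z gaussian t))"
  proof (intro Bochner_Integration.integral_cong refl)
    fix t
    have "?h z = cnj (gabor (tf_shift \<zeta> gaussian) z)" for z
      by (simp add: gabor_def L2_bracket_cnj)
    then have "(LINT z|lborel. f t * cnj (tf_shift z gaussian t) * ?h z) = f t * (LINT z|lborel. cnj (gabor (tf_shift \<zeta> gaussian) z * tf_shift z gaussian t))"
      by (subst integral_mult_right_zero[symmetric]) (simp add: mult_ac)
    then show "(LINT z|lborel. f t * cnj (tf_shift z gaussian t) * ?h z)
      = f t * cnj (LINT z|lborel. gabor (tf_shift \<zeta> gaussian) z * tf_shift z gaussian t)"
      by (simp only: Bochner_Integration.integral_cnj)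
  qed
  also have "\<dots> = of_real (gconst TYPE('d)) * gabor f \<zeta>"
    unfolding reproducing_pointwise unfolding gabor_def L2_bracket_def
    by (subst integral_mult_right_zero[symmetric]) (simp add: mult_ac)
  finally show ?thesis .
qed

text \<open>The synthesised function \<open>h\<close> is not known to be square integrable, so it
  cannot be compared with \<open>f\<close> inside L^2. Both sides have the same brackets with all
  shifted Gaussians, and the brackets with the pure modulations (0, -omega) are the Fourier
  transform of the difference times the Gaussian. That product is integrable, hence vanishes, and
  the Gaussian has no zeros.\<close>

lemma gabor_inversion:
  fixes f :: "real^'d::finite \<Rightarrow> complex"
  assumes f: "f \<in> square_integrable" and i: "integrable lborel (gabor f)"
  shows "AE t in lborel. of_real (gconst TYPE('d)) * f t = (LINT z|lborel. gabor f z * tf_shift z gaussian t)"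
proof -
  note [measurable] = f[THEN square_integrableD]
  define h where "h t = (LINT z|lborel. gabor f z * tf_shift z gaussian t)" for t
  have [measurable]: "h \<in> borel_measurable borel" unfolding h_def by measurable
  let ?F = "\<lambda>\<zeta> z t. gabor f z * tf_shift z gaussian t * cnj (tf_shift \<zeta> gaussian t)"
  have fin: "(\<integral>\<^sup>+ z. \<integral>\<^sup>+ t. ennreal (cmod (?F \<zeta> z t)) \<partial>lborel \<partial>lborel) < top" for \<zeta>
  proof -
    obtain M where M: "M < top" "\<And>x. (\<integral>\<^sup>+ t. ennreal (cmod (tf_shift \<zeta> gaussian t)) * ennreal (cmod (gaussian (t - x))) \<partial>lborel) \<le> M"
      using nn_integral_gabor_bound[OF square_integrable_tf_shift[OF gaussian_square_integrable]] by blast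
    have "(\<integral>\<^sup>+ z. \<integral>\<^sup>+ t. ennreal (cmod (?F \<zeta> z t)) \<partial>lborel \<partial>lborel)
      = (\<integral>\<^sup>+ z. ennreal (cmod (gabor f z)) * (\<integral>\<^sup>+ t. ennreal (cmod (tf_shift \<zeta> gaussian t)) * ennreal (cmod (gaussian (t - fst z))) \<partial>lborel) \<partial>lborel)"
      by (subst nn_integral_cmult[symmetric]) (simp_all add: norm_mult cmod_tf_shift[of _ gaussian] ennreal_mult mult_ac)
    also have "\<dots> \<le> (\<integral>\<^sup>+ z. ennreal (cmod (gabor f z)) * M \<partial>lborel)"
      by (intro nn_integral_mono mult_left_mono M) auto
    also have "\<dots> < top" using i M(1) by (simp add: nn_integral_multc integrable_iff_bounded ennreal_mult_less_top)
    finally show ?thesis .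
  qed
  have hF: "(\<lambda>t. h t * cnj (tf_shift \<zeta> gaussian t)) = (\<lambda>t. LINT z|lborel. ?F \<zeta> z t)" for \<zeta>
    by (simp add: h_def)
  have hint: "integrable lborel (\<lambda>t. h t * cnj (tf_shift \<zeta> gaussian t))" for \<zeta>
    unfolding hF by (rule Fubini_lborel(5)[OF _ fin]) measurable
  have hbr: "L2_bracket h (tf_shift \<zeta> gaussian) = of_real (gconst TYPE('d)) * gabor f \<zeta>" for \<zeta>
  proof -
    have "L2_bracket h (tf_shift \<zeta> gaussian) = (LINT z|lborel. LINT t|lborel. ?F \<zeta> z t)"
      unfolding L2_bracket_def hF by (rule Fubini_lborel(3)[OF _ fin, symmetric]) measurable
    also have "\<dots> = (LINT z|lborel. gabor f z * gabor (tf_shift z gaussian) \<zeta>)"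
      by (simp add: gabor_def[of "tf_shift _ _"] L2_bracket_def mult.assoc)
    finally show ?thesis by (simp add: gabor_reproducing[OF f])
  qed
  let ?k = "\<lambda>t. of_real (gconst TYPE('d)) * f t - h t"
  have cnjs: "cnj (tf_shift (0, - \<omega>) gaussian t) = gaussian t * cis (2 * pi * (\<omega> \<bullet> t))" for \<omega> t :: "real^'d"
    by (simp add: tf_shift_def cis_cnj)
  have "AE t in lborel. ?k t * gaussian t = 0"
  proof (rule fourier_unique)
    have fi: "integrable lborel (\<lambda>t. f t * cnj (tf_shift \<zeta> gaussian t))" for \<zeta>
      by (intro integrable_bracket f square_integrable_tf_shift gaussian_square_integrable)
    show "integrable lborel (\<lambda>t. ?k t * gaussian t)"
      using fi[of "(0, 0)"] hint[of "(0, 0)"] by (simp add: tf_shift_def left_diff_distrib mult.assoc)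
    fix \<omega> :: "real^'d"
    have "(LINT t|lborel. ?k t * gaussian t * cis (2 * pi * (\<omega> \<bullet> t)))
      = (LINT t|lborel. of_real (gconst TYPE('d)) * (f t * cnj (tf_shift (0, - \<omega>) gaussian t)) - h t * cnj (tf_shift (0, - \<omega>) gaussian t))"
      unfolding cnjs by (simp add: left_diff_distrib mult.assoc)
    also have "\<dots> = of_real (gconst TYPE('d)) * gabor f (0, - \<omega>) - L2_bracket h (tf_shift (0, - \<omega>) gaussian)"
      using fi hint by (simp add: gabor_def L2_bracket_def)
    finally show "(LINT t|lborel. ?k t * gaussian t * cis (2 * pi * (\<omega> \<bullet> t))) = 0"
      by (simp add: hbr)
  qed
  then show ?thesis
    by eventually_elim (auto simp: gaussian_def h_def)
qed

text \<open>Parseval's identity with integrability asked of one transform only: the synthesis of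
  \<open>f\<close> is inserted and the integrals are exchanged.\<close>

lemma L2_bracket_gabor:
  fixes f g :: "real^'d::finite \<Rightarrow> complex"
  assumes f: "f \<in> square_integrable" and i: "integrable lborel (gabor f)" and g: "g \<in> square_integrable"
  shows "of_real (gconst TYPE('d)) * L2_bracket f g = (LINT z|lborel. gabor f z * cnj (gabor g z))"
proof -
  note [measurable] = f[THEN square_integrableD] g[THEN square_integrableD]
  obtain M where M: "M < top" "\<And>x. (\<integral>\<^sup>+ t. ennreal (cmod (g t)) * ennreal (cmod (gaussian (t - x))) \<partial>lborel) \<le> M"
    using nn_integral_gabor_bound[OF g] by blast
  have "of_real (gconst TYPE('d)) * L2_bracket f g = (LINT t|lborel. of_real (gconst TYPE('d)) * f t * cnj (g t))"
    by (simp add: L2_bracket_def mult.assoc)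
  also have "\<dots> = (LINT t|lborel. (LINT z|lborel. gabor f z * tf_shift z gaussian t) * cnj (g t))"
    using gabor_inversion[OF f i] by (intro integral_cong_AE) (auto elim!: eventually_mono)
  also have "\<dots> = (LINT t|lborel. LINT z|lborel. gabor f z * tf_shift z gaussian t * cnj (g t))"
    by simp
  also have "\<dots> = (LINT z|lborel. LINT t|lborel. gabor f z * tf_shift z gaussian t * cnj (g t))"
  proof (rule Fubini_lborel(3)[symmetric])
    have "(\<integral>\<^sup>+ z. \<integral>\<^sup>+ t. ennreal (cmod (gabor f z * tf_shift z gaussian t * cnj (g t))) \<partial>lborel \<partial>lborel)
      = (\<integral>\<^sup>+ z. ennreal (cmod (gabor f z)) * (\<integral>\<^sup>+ t. ennreal (cmod (g t)) * ennreal (cmod (gaussian (t - fst z))) \<partial>lborel) \<partial>lborel)"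
      by (subst nn_integral_cmult[symmetric]) (simp_all add: norm_mult cmod_tf_shift[of _ gaussian] ennreal_mult mult_ac)
    also have "\<dots> \<le> (\<integral>\<^sup>+ z. ennreal (cmod (gabor f z)) * M \<partial>lborel)"
      by (intro nn_integral_mono mult_left_mono M) auto
    also have "\<dots> < top" using i M(1) by (simp add: nn_integral_multc integrable_iff_bounded ennreal_mult_less_top)
    finally show "(\<integral>\<^sup>+ z. \<integral>\<^sup>+ t. ennreal (cmod (gabor f z * tf_shift z gaussian t * cnj (g t))) \<partial>lborel \<partial>lborel) < top" .
  qed measurable
  also have "\<dots> = (LINT z|lborel. gabor f z * L2_bracket (tf_shift z gaussian) g)"
    by (simp add: L2_bracket_def mult.assoc)
  also have "\<dots> = (LINT z|lborel. gabor f z * cnj (gabor g z))"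
    by (simp add: gabor_def L2_bracket_cnj)
  finally show ?thesis .
qed

text \<open>Valid for every function, because a Bochner integral that does not exist has the value
  0.\<close>

lemma cmod_integral_le_nn_integral: "ennreal (cmod (LINT z|M. h z)) \<le> (\<integral>\<^sup>+ z. ennreal (cmod (h z)) \<partial>M)"
  by (cases "integrable M h") (auto simp: integral_norm_bound_ennreal not_integrable_integral_eq)

lemma cmod_L2_bracket_le:
  fixes f g :: "real^'d::finite \<Rightarrow> complex"
  assumes f: "f \<in> square_integrable" and i: "integrable lborel (gabor f)" and g: "g \<in> square_integrable"
  shows "ennreal (gconst TYPE('d)) * ennreal (cmod (L2_bracket (tf_shift a f) (tf_shift b g)))
    \<le> (\<integral>\<^sup>+ z. ennreal (cmod (gabor f (z - a))) * ennreal (cmod (gabor g (z - b))) \<partial>lborel)"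
proof -
  note [measurable] = f[THEN square_integrableD] g[THEN square_integrableD]
  have "integrable lborel (\<lambda>z. complex_of_real (cmod (gabor f z)))" using i by simp
  then have "integrable lborel (\<lambda>z. complex_of_real (cmod (gabor f (z + (- a)))))"
    by (subst integral_lborel_shift(2)) simp_all
  then have "integrable lborel (\<lambda>z. cmod (gabor f (z - a)))"
    using integrable_Re by fastforce
  then have i': "integrable lborel (gabor (tf_shift a f))"
    by (subst integrable_norm_iff[symmetric]) (simp_all add: cmod_gabor_tf_shift)
  have "ennreal (gconst TYPE('d)) * ennreal (cmod (L2_bracket (tf_shift a f) (tf_shift b g)))
    = ennreal (cmod (of_real (gconst TYPE('d)) * L2_bracket (tf_shift a f) (tf_shift b g)))"
    using gconst_pos[where 'd='d] by (simp add: norm_mult ennreal_mult)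
  also have "\<dots> \<le> (\<integral>\<^sup>+ z. ennreal (cmod (gabor (tf_shift a f) z * cnj (gabor (tf_shift b g) z))) \<partial>lborel)"
    by (subst L2_bracket_gabor[OF square_integrable_tf_shift[OF f] i' square_integrable_tf_shift[OF g]])
       (rule cmod_integral_le_nn_integral)
  also have "\<dots> = (\<integral>\<^sup>+ z. ennreal (cmod (gabor f (z - a))) * ennreal (cmod (gabor g (z - b))) \<partial>lborel)"
    by (simp add: norm_mult ennreal_mult cmod_gabor_tf_shift)
  finally show ?thesis .
qed

section \<open>Weights\<close>

text \<open>A class closed under products that contains the submultiplicative weights and the
  Japanese bracket. The weight wv<.>^N is submultiplicative only up to a constant, so finiteness of
  M^1-norms is proved for this larger class.\<close>

definition exp_bounded :: "('a::euclidean_space \<Rightarrow> real) \<Rightarrow> bool" where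
  "exp_bounded w \<longleftrightarrow> w \<in> borel_measurable borel \<and> (\<forall>z. 0 \<le> w z) \<and> (\<exists>C\<ge>0. \<exists>c\<ge>0. \<forall>z. w z \<le> C * exp (c * norm z))"

lemma exp_boundedD: "exp_bounded w \<Longrightarrow> w \<in> borel_measurable borel" "exp_bounded w \<Longrightarrow> 0 \<le> w z"
  by (auto simp: exp_bounded_def)

lemma exp_boundedI:
  "w \<in> borel_measurable borel \<Longrightarrow> (\<And>z. 0 \<le> w z) \<Longrightarrow> 0 \<le> C \<Longrightarrow> 0 \<le> c \<Longrightarrow> (\<And>z. w z \<le> C * exp (c * norm z)) \<Longrightarrow> exp_bounded w"
  unfolding exp_bounded_def by blast

lemma exp_bounded_mult:
  assumes "exp_bounded v" "exp_bounded w" shows "exp_bounded (\<lambda>z. v z * w z)"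
proof -
  obtain C c D d where "0 \<le> C" "0 \<le> c" "0 \<le> D" "0 \<le> d"
    and *: "\<And>z. v z \<le> C * exp (c * norm z)" "\<And>z. w z \<le> D * exp (d * norm z)"
    using assms unfolding exp_bounded_def by blast
  have "v z * w z \<le> (C * D) * exp ((c + d) * norm z)" for z
  proof -
    have "v z * w z \<le> (C * exp (c * norm z)) * (D * exp (d * norm z))"
      using assms \<open>0 \<le> C\<close> by (intro mult_mono *) (auto simp: exp_bounded_def)
    then show ?thesis by (simp add: ring_distribs exp_add mult_ac)
  qed
  then have "\<exists>C\<ge>0. \<exists>c\<ge>0. \<forall>z. v z * w z \<le> C * exp (c * norm z)"
    using \<open>0 \<le> C\<close> \<open>0 \<le> c\<close> \<open>0 \<le> D\<close> \<open>0 \<le> d\<close> by (intro exI[of _ "C * D"] conjI exI[of _ "c + d"]) auto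
  then show ?thesis using assms by (auto simp: exp_bounded_def)
qed

lemma exp_bounded_power: "exp_bounded v \<Longrightarrow> exp_bounded (\<lambda>z. v z ^ n)"
proof (induction n)
  case 0
  show ?case unfolding exp_bounded_def by (auto intro!: exI[of _ 1])
next
  case (Suc n)
  then show ?case by (auto intro: exp_bounded_mult)
qed

lemma japanese_bracket_measurable [measurable]: "japanese_bracket \<in> borel_measurable borel"
  unfolding japanese_bracket_def[abs_def] by measurable

lemma exp_bounded_japanese_bracket: "exp_bounded (japanese_bracket :: 'a::euclidean_space \<Rightarrow> real)"
proof -
  have "japanese_bracket z \<le> 1 * exp (1 * norm z)" for z :: 'a
  proof -
    have "japanese_bracket z \<le> sqrt ((1 + norm z)\<^sup>2)"
      unfolding japanese_bracket_def by (intro real_sqrt_le_mono) (simp add: power2_eq_square algebra_simps)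
    also have "\<dots> = 1 + norm z" by simp
    also have "\<dots> \<le> exp (norm z)" by (rule exp_ge_add_one_self)
    finally show ?thesis by simp
  qed
  then show ?thesis unfolding exp_bounded_def
    by (auto simp: japanese_bracket_def intro!: exI[of _ 1])
qed

lemma submult_weightD:
  fixes w :: "'d::finite phase \<Rightarrow> real"
  assumes "submult_weight w"
  shows "w \<in> borel_measurable borel" and "0 < w z" and "w (- z) = w z" and "w (y + z) \<le> w y * w z" and "1 \<le> w z" and "w 0 = 1"
proof -
  show "w \<in> borel_measurable borel" using assms by (auto simp: submult_weight_def intro: borel_measurable_continuous_onI)
  have A: "\<And>z. 0 < w z" "\<And>z. w (- z) = w z" "\<And>y z. w (y + z) \<le> w y * w z" "w 0 = 1"
    using assms unfolding submult_weight_def by blast+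
  then show "0 < w z" "w (- z) = w z" "w (y + z) \<le> w y * w z" "w 0 = 1" by blast+
  have "1\<^sup>2 \<le> (w z)\<^sup>2" using A(3)[of z "- z"] A(2,4) by (simp add: power2_eq_square)
  then show "1 \<le> w z" using A(1)[of z] by (intro power2_le_imp_le[of 1]) (simp_all add: less_imp_le)
qed

text \<open>Cut z into n <= |z| + 1 equal pieces lying in the unit ball, where w is bounded by some
  M >= 1; submultiplicativity then gives w(z) <= M^n.\<close>

lemma submult_weight_exp_bounded:
  fixes w :: "'d::finite phase \<Rightarrow> real"
  assumes "submult_weight w"
  shows "exp_bounded w"
proof -
  note w = submult_weightD[OF assms]
  have "compact (w ` cball 0 1)"
    using assms by (intro compact_continuous_image) (auto simp: submult_weight_def intro: continuous_on_subset)
  then obtain M where M: "\<And>z. norm z \<le> 1 \<Longrightarrow> w z \<le> M"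
    using compact_imp_bounded bounded_imp_bdd_above unfolding bdd_above_def by (metis imageI mem_cball_0)
  have M1: "1 \<le> M" using M[of 0] w(6) by simp
  have pow: "w (real n *\<^sub>R z) \<le> w z ^ n" for n z
  proof (induction n)
    case (Suc n)
    have "w (real (Suc n) *\<^sub>R z) \<le> w z * w (real n *\<^sub>R z)"
      using w(4)[of z "real n *\<^sub>R z"] by (simp add: scaleR_add_left algebra_simps)
    also have "\<dots> \<le> w z * w z ^ n" using Suc w(2)[of z] by (intro mult_left_mono) auto
    finally show ?case by simp
  qed (simp add: w)
  have "w z \<le> M * exp (ln M * norm z)" for z
  proof -
    define n where "n = Suc (nat \<lfloor>norm z\<rfloor>)"
    have n: "norm z \<le> real n" "real n \<le> norm z + 1" "n > 0"
      using of_nat_floor[of "norm z"] unfolding n_def by (linarith, simp_all)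
    have "w z = w (real n *\<^sub>R (z /\<^sub>R real n))" using n by simp
    also have "\<dots> \<le> w (z /\<^sub>R real n) ^ n" by (rule pow)
    also have "\<dots> \<le> M ^ n" using n w(2)[of "z /\<^sub>R real n"] by (intro power_mono M) (auto simp: divide_simps)
    also have "M ^ n = exp (ln M * real n)" using M1 by (simp add: mult.commute[of "ln M"] exp_of_nat_mult)
    also have "\<dots> \<le> exp (ln M * (norm z + 1))" using n M1 by (simp add: mult_left_mono)
    also have "\<dots> = M * exp (ln M * norm z)" using M1 by (simp add: algebra_simps exp_add)
    finally show ?thesis .
  qed
  then show ?thesis
    using M1 w(1) less_imp_le[OF w(2)] by (intro exp_boundedI[of w M "ln M"]) simp_all
qed

lemma exp_bounded_gauss:
  fixes w :: "'a::euclidean_space \<Rightarrow> real"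
  assumes "exp_bounded w" "0 < a"
  shows "\<exists>K\<ge>0. \<forall>z. w z * exp (- a * (norm z)\<^sup>2) \<le> K * exp (- (a / 2) * (norm z)\<^sup>2)"
proof -
  obtain C c where C: "0 \<le> C" "\<And>z. w z \<le> C * exp (c * norm z)" using assms unfolding exp_bounded_def by blast
  show ?thesis
  proof (intro exI[of _ "C * exp (c\<^sup>2 / (2 * a))"] conjI allI)
    fix z
    have "w z * exp (- a * (norm z)\<^sup>2) \<le> C * exp (c * norm z) * exp (- a * (norm z)\<^sup>2)"
      by (intro mult_right_mono C) auto
    also have "\<dots> = C * (exp (c * norm z) * exp (- a * (norm z)\<^sup>2))" by (simp only: mult.assoc)
    also have "\<dots> \<le> C * (exp (c\<^sup>2 / (2 * a)) * exp (- (a / 2) * (norm z)\<^sup>2))"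
      by (intro mult_left_mono exp_mult_gauss_le assms C)
    finally show "w z * exp (- a * (norm z)\<^sup>2) \<le> C * exp (c\<^sup>2 / (2 * a)) * exp (- (a / 2) * (norm z)\<^sup>2)"
      by (simp only: mult.assoc)
  qed (use C in simp)
qed

lemma exp_bounded_gauss_integral:
  fixes w :: "'a::euclidean_space \<Rightarrow> real"
  assumes "exp_bounded w" "0 < a"
  shows "(\<integral>\<^sup>+ z. ennreal (w z * exp (- a * (norm z)\<^sup>2)) \<partial>lborel) < top"
proof -
  obtain K where K: "0 \<le> K" "\<And>z. w z * exp (- a * (norm z)\<^sup>2) \<le> K * exp (- (a / 2) * (norm z)\<^sup>2)"
    using exp_bounded_gauss[OF assms] by blast
  have "(\<integral>\<^sup>+ z. ennreal (w z * exp (- a * (norm z)\<^sup>2)) \<partial>lborel)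
      \<le> (\<integral>\<^sup>+ z. ennreal K * ennreal (exp (- (a / 2) * (norm (z::'a))\<^sup>2)) \<partial>lborel)"
    using K by (intro nn_integral_mono) (simp add: ennreal_mult[symmetric] ennreal_leI)
  also have "\<dots> < top"
    using gauss_integrable[of "a / 2", where 'a='a] assms(2)
    by (simp add: nn_integral_cmult integrable_iff_bounded ennreal_mult_less_top)
  finally show ?thesis .
qed

section \<open>The space of test functions and its antidual\<close>

lemma gaussian_spanE:
  assumes "f \<in> gaussian_span"
  obtains Z c where "finite Z" "f = (\<lambda>t. \<Sum>z\<in>Z. c z * tf_shift z gaussian t)"
  using assms unfolding gaussian_span_def by blast

lemma gaussian_spanI: "finite Z \<Longrightarrow> (\<lambda>t. \<Sum>z\<in>Z. c z * tf_shift z gaussian t) \<in> gaussian_span"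
  unfolding gaussian_span_def by blast

lemma gaussian_span_cmult:
  assumes "f \<in> gaussian_span" shows "(\<lambda>t. k * f t) \<in> gaussian_span"
proof -
  obtain Z c where Z: "finite Z" "f = (\<lambda>t. \<Sum>z\<in>Z. c z * tf_shift z gaussian t)" using assms by (rule gaussian_spanE)
  have "(\<lambda>t. k * f t) = (\<lambda>t. \<Sum>z\<in>Z. (k * c z) * tf_shift z gaussian t)"
    by (simp add: Z sum_distrib_left mult.assoc)
  then show ?thesis using gaussian_spanI[OF Z(1), of "\<lambda>z. k * c z"] by simp
qed

lemma gaussian_span_add:
  assumes "f \<in> gaussian_span" "g \<in> gaussian_span" shows "(\<lambda>t. f t + g t) \<in> gaussian_span"
proof -
  obtain Z c where Z: "finite Z" "f = (\<lambda>t. \<Sum>z\<in>Z. c z * tf_shift z gaussian t)" using assms(1) by (rule gaussian_spanE)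
  obtain Y d where Y: "finite Y" "g = (\<lambda>t. \<Sum>z\<in>Y. d z * tf_shift z gaussian t)" using assms(2) by (rule gaussian_spanE)
  have "(\<Sum>z\<in>Z. c z * tf_shift z gaussian t) = (\<Sum>z\<in>Z \<union> Y. (if z \<in> Z then c z else 0) * tf_shift z gaussian t)" for t
    using Z Y by (intro sum.mono_neutral_cong_left) auto
  moreover have "(\<Sum>z\<in>Y. d z * tf_shift z gaussian t) = (\<Sum>z\<in>Z \<union> Y. (if z \<in> Y then d z else 0) * tf_shift z gaussian t)" for t
    using Z Y by (intro sum.mono_neutral_cong_left) auto
  ultimately have "(\<lambda>t. f t + g t) = (\<lambda>t. \<Sum>z\<in>Z \<union> Y. ((if z \<in> Z then c z else 0) + (if z \<in> Y then d z else 0)) * tf_shift z gaussian t)"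
    unfolding Z Y by (simp only: sum.distrib distrib_right)
  then show ?thesis using gaussian_spanI[of "Z \<union> Y"] Z Y by simp
qed

lemma gaussian_span_tf_shift:
  assumes "f \<in> gaussian_span" shows "tf_shift a f \<in> gaussian_span"
proof -
  obtain Z c where Z: "finite Z" "f = (\<lambda>t. \<Sum>z\<in>Z. c z * tf_shift z gaussian t)" using assms by (rule gaussian_spanE)
  have "tf_shift a f t = (\<Sum>y\<in>(+) a ` Z. (c (y - a) * cis (- 2 * pi * (snd (y - a) \<bullet> fst a))) * tf_shift y gaussian t)" for t
  proof -
    have "tf_shift a f t = (\<Sum>z\<in>Z. c z * tf_shift a (tf_shift z gaussian) t)"
      unfolding Z(2) by (subst (1 2) tf_shift_def) (simp add: sum_distrib_left mult_ac)
    also have "\<dots> = (\<Sum>y\<in>(+) a ` Z. c (y - a) * tf_shift a (tf_shift (y - a) gaussian) t)"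
      by (subst sum.reindex) auto
    finally show ?thesis by (simp add: tf_shift_tf_shift mult.assoc)
  qed
  then have "tf_shift a f = (\<lambda>t. \<Sum>y\<in>(+) a ` Z. (c (y - a) * cis (- 2 * pi * (snd (y - a) \<bullet> fst a))) * tf_shift y gaussian t)"
    by (rule ext)
  then show ?thesis using gaussian_spanI[of "(+) a ` Z"] Z by simp
qed

lemma tf_shift_gaussian_span: "tf_shift z gaussian \<in> gaussian_span"
  using gaussian_spanI[of "{z}" "\<lambda>_. 1"] by simp

lemma gaussian_span_induct [consumes 1, case_names zero add]:
  assumes "f \<in> gaussian_span" and "P (\<lambda>_. 0)"
    and "\<And>c z f. f \<in> gaussian_span \<Longrightarrow> P f \<Longrightarrow> P (\<lambda>t. c * tf_shift z gaussian t + f t)"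
  shows "P f"
proof -
  obtain Z c where Z: "finite Z" "f = (\<lambda>t. \<Sum>z\<in>Z. c z * tf_shift z gaussian t)" using assms(1) by (rule gaussian_spanE)
  have "P (\<lambda>t. \<Sum>z\<in>Z. c z * tf_shift z gaussian t)"
    using Z(1)
  proof (induction Z)
    case empty
    then show ?case using assms(2) by simp
  next
    case (insert z Z)
    then show ?case using assms(3)[OF gaussian_spanI[OF insert(1), of c] insert(3), of "c z" z] by simp
  qed
  then show ?thesis using Z by simp
qed

lemma zero_square_integrable: "(\<lambda>_. 0) \<in> square_integrable"
  by (simp add: square_integrable_def)

lemma gaussian_span_square_integrable: "f \<in> gaussian_span \<Longrightarrow> f \<in> square_integrable"
  by (induction rule: gaussian_span_induct)
    (intro zero_square_integrable square_integrable_add square_integrable_cmult square_integrable_tf_shift gaussian_square_integrable)+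

section \<open>The norm and the space M^1 with weight\<close>

lemma M1_norm_eq:
  fixes f :: "real^'d::finite \<Rightarrow> complex"
  assumes [measurable]: "f \<in> borel_measurable borel" "w \<in> borel_measurable borel"
  shows "M1_norm w f = (\<integral>\<^sup>+ z. ennreal (cmod (gabor f z)) * ennreal (w z) \<partial>lborel)"
  by (simp add: M1_norm_def STFT_L2_bracket Lpq_norm_eq Lpq_enorm_1)

lemma M1_norm_add_le:
  assumes "f \<in> square_integrable" "g \<in> square_integrable" and [measurable]: "w \<in> borel_measurable borel"
  shows "M1_norm w (\<lambda>t. f t + g t) \<le> M1_norm w f + M1_norm w g"
proof -
  note [measurable] = assms(1,2)[THEN square_integrableD]
  have "M1_norm w (\<lambda>t. f t + g t) = (\<integral>\<^sup>+ z. ennreal (cmod (gabor f z + gabor g z)) * ennreal (w z) \<partial>lborel)"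
    by (subst M1_norm_eq) (simp_all add: gabor_add assms)
  also have "\<dots> \<le> (\<integral>\<^sup>+ z. ennreal (cmod (gabor f z)) * ennreal (w z) + ennreal (cmod (gabor g z)) * ennreal (w z) \<partial>lborel)"
    by (intro nn_integral_mono) (auto simp: distrib_right[symmetric] ennreal_plus[symmetric] simp del: ennreal_plus
        intro!: mult_right_mono ennreal_leI norm_triangle_ineq)
  also have "\<dots> = M1_norm w f + M1_norm w g" by (simp add: nn_integral_add M1_norm_eq)
  finally show ?thesis .
qed

lemma M1_norm_cmult:
  assumes [measurable]: "f \<in> borel_measurable borel" "w \<in> borel_measurable borel"
  shows "M1_norm w (\<lambda>t. c * f t) = ennreal (cmod c) * M1_norm w f"
  by (simp add: M1_norm_eq gabor_cmult norm_mult ennreal_mult mult.assoc nn_integral_cmult)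

lemma M1_norm_tf_shift_le:
  fixes w :: "'d::finite phase \<Rightarrow> real"
  assumes w: "submult_weight w" and [measurable]: "f \<in> borel_measurable borel"
  shows "M1_norm w (tf_shift a f) \<le> ennreal (w a) * M1_norm w f"
proof -
  note [measurable] = submult_weightD(1)[OF w]
  have "M1_norm w (tf_shift a f) = (\<integral>\<^sup>+ z. ennreal (cmod (gabor f (z - a))) * ennreal (w z) \<partial>lborel)"
    by (subst M1_norm_eq) (simp_all add: cmod_gabor_tf_shift)
  also have "\<dots> \<le> (\<integral>\<^sup>+ z. ennreal (w a) * (ennreal (cmod (gabor f (z - a))) * ennreal (w (z - a))) \<partial>lborel)"
  proof (rule nn_integral_mono)
    fix z
    have "ennreal (w z) \<le> ennreal (w a * w (z - a))" using submult_weightD(4)[OF w, of a "z - a"] by (intro ennreal_leI) simp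
    then have "ennreal (cmod (gabor f (z - a))) * ennreal (w z) \<le> ennreal (cmod (gabor f (z - a))) * (ennreal (w a) * ennreal (w (z - a)))"
      using submult_weightD(2)[OF w] by (intro mult_left_mono) (auto simp: ennreal_mult less_imp_le)
    then show "ennreal (cmod (gabor f (z - a))) * ennreal (w z) \<le> ennreal (w a) * (ennreal (cmod (gabor f (z - a))) * ennreal (w (z - a)))"
      by (simp add: mult_ac)
  qed
  also have "\<dots> = ennreal (w a) * M1_norm w f"
    by (subst nn_integral_cmult, simp, subst nn_integral_lborel_shift[of "\<lambda>z. ennreal (cmod (gabor f z)) * ennreal (w z)"])
      (simp_all add: M1_norm_eq)
  finally show ?thesis .
qed

lemma M1_norm_tf_shift_gaussian_finite:
  fixes w :: "'d::finite phase \<Rightarrow> real"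
  assumes w: "exp_bounded w"
  shows "M1_norm w (tf_shift a gaussian) < top"
proof -
  note [measurable] = exp_boundedD(1)[OF w]
  obtain C c where C: "0 \<le> C" "0 \<le> c" "\<And>z. w z \<le> C * exp (c * norm z)" using w unfolding exp_bounded_def by blast
  have "M1_norm w (tf_shift a gaussian) = (\<integral>\<^sup>+ z. ennreal (cmod (gabor gaussian (z - a))) * ennreal (w z) \<partial>lborel)"
    by (subst M1_norm_eq) (simp_all add: cmod_gabor_tf_shift)
  also have "\<dots> = (\<integral>\<^sup>+ z. ennreal (cmod (gabor gaussian z)) * ennreal (w (z - (- a))) \<partial>lborel)"
    by (subst (2) nn_integral_lborel_shift[symmetric, of _ a]) simp_all
  also have "\<dots> \<le> (\<integral>\<^sup>+ z. ennreal (gconst TYPE('d)) * ennreal ((C * exp (c * norm a) * exp (c * norm z)) * exp (- (pi / 2) * (norm (z::'d phase))\<^sup>2)) \<partial>lborel)"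
  proof (rule nn_integral_mono)
    fix z
    have "w (z - (- a)) \<le> C * exp (c * norm (z + a))" using C(3) by simp
    also have "\<dots> \<le> C * exp (c * norm a + c * norm z)"
      using C norm_triangle_ineq[of z a] by (intro mult_left_mono) (auto simp: mult_left_mono distrib_left[symmetric] add.commute)
    finally have "w (z - (- a)) \<le> C * exp (c * norm a) * exp (c * norm z)" by (simp add: exp_add mult.assoc)
    then have "ennreal (w (z - (- a))) \<le> ennreal (C * exp (c * norm a) * exp (c * norm z))" by (rule ennreal_leI)
    then have "ennreal (cmod (gabor gaussian z)) * ennreal (w (z - (- a)))
      \<le> ennreal (gconst TYPE('d) * exp (- (pi / 2) * (norm z)\<^sup>2)) * ennreal (C * exp (c * norm a) * exp (c * norm z))"
      unfolding cmod_gabor_gaussian by (rule mult_left_mono) simp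
    also have "\<dots> = ennreal (gconst TYPE('d)) * ennreal ((C * exp (c * norm a) * exp (c * norm z)) * exp (- (pi / 2) * (norm z)\<^sup>2))"
      using C gconst_pos[where 'd='d] by (simp add: ennreal_mult[symmetric] mult_ac)
    finally show "ennreal (cmod (gabor gaussian z)) * ennreal (w (z - (- a)))
      \<le> ennreal (gconst TYPE('d)) * ennreal ((C * exp (c * norm a) * exp (c * norm z)) * exp (- (pi / 2) * (norm z)\<^sup>2))" .
  qed
  also have "\<dots> < top"
  proof -
    have "exp_bounded (\<lambda>z::'d phase. C * exp (c * norm a) * exp (c * norm z))"
      using C by (intro exp_boundedI[of _ "C * exp (c * norm a)" c]) auto
    from exp_bounded_gauss_integral[OF this, of "pi / 2"] show ?thesis
      by (simp add: nn_integral_cmult ennreal_mult_less_top)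
  qed
  finally show ?thesis .
qed

lemma M1_norm_zero: "w \<in> borel_measurable borel \<Longrightarrow> M1_norm w (\<lambda>_. 0) = 0"
  using M1_norm_cmult[of "\<lambda>_. 0" w 0] by simp

lemma M1_norm_gaussian_span_finite:
  assumes w: "exp_bounded w" and "f \<in> gaussian_span"
  shows "M1_norm w f < top"
  using assms(2)
proof (induction rule: gaussian_span_induct)
  case zero
  then show ?case using w by (simp add: M1_norm_zero exp_boundedD)
next
  case (add c z f)
  have "M1_norm w (\<lambda>t. c * tf_shift z gaussian t + f t) \<le> M1_norm w (\<lambda>t. c * tf_shift z gaussian t) + M1_norm w f"
    by (intro M1_norm_add_le square_integrable_cmult square_integrable_tf_shift gaussian_square_integrable
        gaussian_span_square_integrable add exp_boundedD w)
  also have "M1_norm w (\<lambda>t. c * tf_shift z gaussian t) = ennreal (cmod c) * M1_norm w (tf_shift z gaussian)"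
    by (intro M1_norm_cmult exp_boundedD w) measurable
  also have "ennreal (cmod c) * M1_norm w (tf_shift z gaussian) + M1_norm w f < top"
    using add M1_norm_tf_shift_gaussian_finite[OF w] by (simp add: ennreal_mult_less_top)
  finally show ?case .
qed

lemma M1_spaceD:
  "f \<in> M1_space w \<Longrightarrow> \<exists>s. (\<forall>n. s n \<in> gaussian_span) \<and> (\<lambda>n. M1_norm w (\<lambda>t. f t - s n t)) \<longlonglongrightarrow> 0"
  unfolding M1_space_def by blast

lemma M1_space_square_integrable: "f \<in> M1_space w \<Longrightarrow> f \<in> square_integrable"
  by (simp add: M1_space_def square_integrable_def)

lemma M1_spaceI:
  "f \<in> square_integrable \<Longrightarrow> (\<And>n. s n \<in> gaussian_span) \<Longrightarrow> (\<lambda>n. M1_norm w (\<lambda>t. f t - s n t)) \<longlonglongrightarrow> 0 \<Longrightarrow> f \<in> M1_space w"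
  unfolding M1_space_def square_integrable_def by blast

text \<open>\<open>M1_space\<close> asks only for approximability; finiteness of the norm follows
  from a single approximant at distance less than 1.\<close>

lemma M1_space_finite:
  assumes w: "exp_bounded w" and f: "f \<in> M1_space w"
  shows "M1_norm w f < top"
proof -
  obtain s where "(\<forall>n. s n \<in> gaussian_span) \<and> (\<lambda>n. M1_norm w (\<lambda>t. f t - s n t)) \<longlonglongrightarrow> 0"
    using M1_spaceD[OF f] by blast
  then have s: "\<And>n. s n \<in> gaussian_span" "(\<lambda>n. M1_norm w (\<lambda>t. f t - s n t)) \<longlonglongrightarrow> 0" by auto
  have "\<forall>\<^sub>F n in sequentially. M1_norm w (\<lambda>t. f t - s n t) < 1"
    using s(2) by (rule order_tendstoD) simp
  then obtain n where n: "M1_norm w (\<lambda>t. f t - s n t) < 1"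
    using eventually_happens'[OF sequentially_bot] by blast
  have "M1_norm w f = M1_norm w (\<lambda>t. (f t - s n t) + s n t)" by simp
  also have "\<dots> \<le> M1_norm w (\<lambda>t. f t - s n t) + M1_norm w (s n)"
    by (intro M1_norm_add_le square_integrable_diff M1_space_square_integrable[OF f] gaussian_span_square_integrable s exp_boundedD w)
  also have "\<dots> < top"
    using n M1_norm_gaussian_span_finite[OF w s(1)[of n]] by (auto intro: less_trans)
  finally show ?thesis .
qed

lemma gaussian_span_M1_space:
  assumes "w \<in> borel_measurable borel" "f \<in> gaussian_span" shows "f \<in> M1_space w"
  using assms by (intro M1_spaceI[where s="\<lambda>_. f"] gaussian_span_square_integrable) (simp_all add: M1_norm_zero)

lemma tf_shift_gaussian_M1_space: "w \<in> borel_measurable borel \<Longrightarrow> tf_shift z gaussian \<in> M1_space w"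
  by (intro gaussian_span_M1_space tf_shift_gaussian_span)

lemma M1_space_add:
  assumes [measurable]: "w \<in> borel_measurable borel" and f: "f \<in> M1_space w" and g: "g \<in> M1_space w"
  shows "(\<lambda>t. f t + g t) \<in> M1_space w"
proof -
  obtain s where "(\<forall>n. s n \<in> gaussian_span) \<and> (\<lambda>n. M1_norm w (\<lambda>t. f t - s n t)) \<longlonglongrightarrow> 0"
    using M1_spaceD[OF f] by blast
  then have s: "\<And>n. s n \<in> gaussian_span" "(\<lambda>n. M1_norm w (\<lambda>t. f t - s n t)) \<longlonglongrightarrow> 0" by auto
  obtain r where "(\<forall>n. r n \<in> gaussian_span) \<and> (\<lambda>n. M1_norm w (\<lambda>t. g t - r n t)) \<longlonglongrightarrow> 0"
    using M1_spaceD[OF g] by blast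
  then have r: "\<And>n. r n \<in> gaussian_span" "(\<lambda>n. M1_norm w (\<lambda>t. g t - r n t)) \<longlonglongrightarrow> 0" by auto
  note sq = M1_space_square_integrable[OF f] M1_space_square_integrable[OF g]
    gaussian_span_square_integrable[OF s(1)] gaussian_span_square_integrable[OF r(1)]
  show ?thesis
  proof (rule M1_spaceI)
    show "(\<lambda>t. f t + g t) \<in> square_integrable" by (intro square_integrable_add sq)
    show "(\<lambda>t. s n t + r n t) \<in> gaussian_span" for n by (intro gaussian_span_add s r)
    show "(\<lambda>n. M1_norm w (\<lambda>t. f t + g t - (s n t + r n t))) \<longlonglongrightarrow> 0"
    proof (rule tendsto_sandwich[OF _ _ tendsto_const])
      show "(\<lambda>n. M1_norm w (\<lambda>t. f t - s n t) + M1_norm w (\<lambda>t. g t - r n t)) \<longlonglongrightarrow> 0"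
        using tendsto_add[OF s(2) r(2)] by simp
      have "M1_norm w (\<lambda>t. (f t - s n t) + (g t - r n t)) \<le> M1_norm w (\<lambda>t. f t - s n t) + M1_norm w (\<lambda>t. g t - r n t)" for n
        by (intro M1_norm_add_le square_integrable_diff sq) measurable
      then show "\<forall>\<^sub>F n in sequentially. M1_norm w (\<lambda>t. f t + g t - (s n t + r n t)) \<le> M1_norm w (\<lambda>t. f t - s n t) + M1_norm w (\<lambda>t. g t - r n t)"
        by (simp add: algebra_simps)
    qed simp
  qed
qed

lemma M1_space_cmult:
  assumes [measurable]: "w \<in> borel_measurable borel" and f: "f \<in> M1_space w"
  shows "(\<lambda>t. c * f t) \<in> M1_space w"
proof -
  obtain s where "(\<forall>n. s n \<in> gaussian_span) \<and> (\<lambda>n. M1_norm w (\<lambda>t. f t - s n t)) \<longlonglongrightarrow> 0"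
    using M1_spaceD[OF f] by blast
  then have s: "\<And>n. s n \<in> gaussian_span" "(\<lambda>n. M1_norm w (\<lambda>t. f t - s n t)) \<longlonglongrightarrow> 0" by auto
  note sq = M1_space_square_integrable[OF f] gaussian_span_square_integrable[OF s(1)]
  note [measurable] = sq[THEN square_integrableD]
  show ?thesis
  proof (rule M1_spaceI)
    show "(\<lambda>t. c * f t) \<in> square_integrable" by (intro square_integrable_cmult sq)
    show "(\<lambda>t. c * s n t) \<in> gaussian_span" for n by (intro gaussian_span_cmult s)
    have "M1_norm w (\<lambda>t. c * f t - c * s n t) = ennreal (cmod c) * M1_norm w (\<lambda>t. f t - s n t)" for n
      using M1_norm_cmult[of "\<lambda>t. f t - s n t" w c] by (simp add: right_diff_distrib)
    moreover have "(\<lambda>n. ennreal (cmod c) * M1_norm w (\<lambda>t. f t - s n t)) \<longlonglongrightarrow> ennreal (cmod c) * 0"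
      by (intro ennreal_tendsto_cmult s) simp
    ultimately show "(\<lambda>n. M1_norm w (\<lambda>t. c * f t - c * s n t)) \<longlonglongrightarrow> 0" by simp
  qed
qed

lemma M1_space_diff:
  assumes "w \<in> borel_measurable borel" and f: "f \<in> M1_space w" and g: "g \<in> M1_space w"
  shows "(\<lambda>t. f t - g t) \<in> M1_space w"
  using M1_space_add[OF assms(1) f M1_space_cmult[OF assms(1) g, of "- 1"]] by simp

lemma M1_space_tf_shift:
  assumes w: "submult_weight w" and f: "f \<in> M1_space w"
  shows "tf_shift a f \<in> M1_space w"
proof -
  obtain s where "(\<forall>n. s n \<in> gaussian_span) \<and> (\<lambda>n. M1_norm w (\<lambda>t. f t - s n t)) \<longlonglongrightarrow> 0"
    using M1_spaceD[OF f] by blast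
  then have s: "\<And>n. s n \<in> gaussian_span" "(\<lambda>n. M1_norm w (\<lambda>t. f t - s n t)) \<longlonglongrightarrow> 0" by auto
  note sq = M1_space_square_integrable[OF f] gaussian_span_square_integrable[OF s(1)]
  note [measurable] = sq[THEN square_integrableD]
  show ?thesis
  proof (rule M1_spaceI)
    show "tf_shift a f \<in> square_integrable" by (intro square_integrable_tf_shift sq)
    show "tf_shift a (s n) \<in> gaussian_span" for n by (intro gaussian_span_tf_shift s)
    show "(\<lambda>n. M1_norm w (\<lambda>t. tf_shift a f t - tf_shift a (s n) t)) \<longlonglongrightarrow> 0"
    proof (rule tendsto_sandwich[OF _ _ tendsto_const])
      have "(\<lambda>n. ennreal (w a) * M1_norm w (\<lambda>t. f t - s n t)) \<longlonglongrightarrow> ennreal (w a) * 0"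
        by (intro ennreal_tendsto_cmult s) simp
      then show "(\<lambda>n. ennreal (w a) * M1_norm w (\<lambda>t. f t - s n t)) \<longlonglongrightarrow> 0" by simp
      have "(\<lambda>t. tf_shift a f t - tf_shift a (s n) t) = tf_shift a (\<lambda>t. f t - s n t)" for n
        by (auto simp: tf_shift_def right_diff_distrib)
      then show "\<forall>\<^sub>F n in sequentially. M1_norm w (\<lambda>t. tf_shift a f t - tf_shift a (s n) t) \<le> ennreal (w a) * M1_norm w (\<lambda>t. f t - s n t)"
        using M1_norm_tf_shift_le[OF w, of "\<lambda>t. f t - s _ t" a] by simp
    qed simp
  qed
qed

lemma gabor_gaussian_continuous: "continuous_on UNIV (\<lambda>a. gabor (tf_shift a gaussian) z)"
  unfolding gabor_tf_shift[OF gaussian_measurable] gabor_gaussian cis_conv_exp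
  by (intro continuous_intros)

text \<open>Continuity of the Gaussian orbit in M^1_w. It makes \<open>STFT gaussian f\<close>
  continuous for each functional f, and it is the source of equicontinuity for bounded families of
  functionals.\<close>

lemma tf_shift_gaussian_tendsto:
  fixes w :: "'d::finite phase \<Rightarrow> real"
  assumes w: "exp_bounded w" and lim: "a \<longlonglongrightarrow> a0"
  shows "(\<lambda>n. M1_norm w (\<lambda>t. tf_shift (a n) gaussian t - tf_shift a0 gaussian t)) \<longlonglongrightarrow> 0"
proof -
  note [measurable] = exp_boundedD(1)[OF w]
  let ?k = "gconst TYPE('d)"
  note k = gconst_pos[where 'd='d]
  note sq = square_integrable_tf_shift[OF gaussian_square_integrable]
  obtain R where R: "\<And>n. norm (a n) \<le> R" "norm a0 \<le> R"
  proof -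
    obtain R where "\<And>n. norm (a n) \<le> R" using convergent_imp_Bseq[OF convergentI[OF lim]] BseqE by blast
    then show ?thesis using that[of "max R (norm a0)"] by (meson max.cobounded2 max.coboundedI1)
  qed
  \<comment> \<open>For |b| <= R the Gaussian centred at b is dominated by one centred at 0 with
    half the rate, since |z|^2 <= 2|z-b|^2 + 2R^2. This gives the integrable majorant.\<close>
  have gb: "cmod (gabor (tf_shift b gaussian) z) \<le> ?k * exp (pi / 2 * R\<^sup>2) * exp (- (pi / 4) * (norm z)\<^sup>2)" if "norm b \<le> R" for b z :: "'d phase"
  proof -
    have "norm z \<le> norm (z - b) + norm b" using norm_triangle_ineq[of "z - b" b] by simp
    then have "(norm z)\<^sup>2 \<le> (norm (z - b) + norm b)\<^sup>2" by (intro power_mono) auto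
    also have "\<dots> \<le> 2 * (norm (z - b))\<^sup>2 + 2 * (norm b)\<^sup>2"
      using sum_squares_bound[of "norm (z - b)" "norm b"] by (simp add: power2_sum)
    also have "(norm b)\<^sup>2 \<le> R\<^sup>2" using that by (intro power_mono) auto
    finally have "(norm z)\<^sup>2 / 2 - R\<^sup>2 \<le> (norm (z - b))\<^sup>2" by simp
    then have "- (pi / 2) * (norm (z - b))\<^sup>2 \<le> - (pi / 2) * ((norm z)\<^sup>2 / 2 - R\<^sup>2)" by (intro mult_left_mono_neg) auto
    also have "\<dots> = pi / 2 * R\<^sup>2 + - (pi / 4) * (norm z)\<^sup>2" by (simp add: algebra_simps)
    finally have "exp (- (pi / 2) * (norm (z - b))\<^sup>2) \<le> exp (pi / 2 * R\<^sup>2) * exp (- (pi / 4) * (norm z)\<^sup>2)"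
      by (simp only: exp_add[symmetric] exp_le_cancel_iff)
    then show ?thesis using k by (simp add: cmod_gabor_tf_shift cmod_gabor_gaussian mult.assoc)
  qed
  have eq: "M1_norm w (\<lambda>t. tf_shift (a n) gaussian t - tf_shift a0 gaussian t)
      = (\<integral>\<^sup>+ z. ennreal (cmod (gabor (tf_shift (a n) gaussian) z - gabor (tf_shift a0 gaussian) z)) * ennreal (w z) \<partial>lborel)" for n
    by (subst M1_norm_eq) (simp_all add: gabor_diff[OF sq sq])
  have "(\<lambda>n. \<integral>\<^sup>+ z. ennreal (cmod (gabor (tf_shift (a n) gaussian) z - gabor (tf_shift a0 gaussian) z)) * ennreal (w z) \<partial>lborel)
    \<longlonglongrightarrow> (\<integral>\<^sup>+ z. 0 \<partial>(lborel :: 'd phase measure))"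
  proof (rule nn_integral_dominated_convergence[where w="\<lambda>z. ennreal (2 * (?k * exp (pi / 2 * R\<^sup>2))) * ennreal (w z * exp (- (pi / 4) * (norm z)\<^sup>2))"])
    show "AE z in lborel. ennreal (cmod (gabor (tf_shift (a n) gaussian) z - gabor (tf_shift a0 gaussian) z)) * ennreal (w z)
      \<le> ennreal (2 * (?k * exp (pi / 2 * R\<^sup>2))) * ennreal (w z * exp (- (pi / 4) * (norm z)\<^sup>2))" for n
    proof (rule AE_I2)
      fix z
      have "cmod (gabor (tf_shift (a n) gaussian) z - gabor (tf_shift a0 gaussian) z)
        \<le> cmod (gabor (tf_shift (a n) gaussian) z) + cmod (gabor (tf_shift a0 gaussian) z)" by (rule norm_triangle_ineq4)
      also have "\<dots> \<le> 2 * (?k * exp (pi / 2 * R\<^sup>2)) * exp (- (pi / 4) * (norm z)\<^sup>2)"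
        using gb[OF R(1), of n z] gb[OF R(2), of z] by simp
      finally have "cmod (gabor (tf_shift (a n) gaussian) z - gabor (tf_shift a0 gaussian) z) * w z
        \<le> 2 * (?k * exp (pi / 2 * R\<^sup>2)) * exp (- (pi / 4) * (norm z)\<^sup>2) * w z"
        using exp_boundedD(2)[OF w, of z] by (intro mult_right_mono)
      then show "ennreal (cmod (gabor (tf_shift (a n) gaussian) z - gabor (tf_shift a0 gaussian) z)) * ennreal (w z)
        \<le> ennreal (2 * (?k * exp (pi / 2 * R\<^sup>2))) * ennreal (w z * exp (- (pi / 4) * (norm z)\<^sup>2))"
        using exp_boundedD(2)[OF w, of z] k by (simp add: ennreal_mult[symmetric] mult_ac ennreal_leI)
    qed
    show "(\<integral>\<^sup>+ z. ennreal (2 * (?k * exp (pi / 2 * R\<^sup>2))) * ennreal (w z * exp (- (pi / 4) * (norm z)\<^sup>2)) \<partial>lborel) < \<infinity>"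
      using exp_bounded_gauss_integral[OF w, of "pi / 4"] by (simp add: nn_integral_cmult ennreal_mult_less_top)
    show "AE z in lborel. (\<lambda>n. ennreal (cmod (gabor (tf_shift (a n) gaussian) z - gabor (tf_shift a0 gaussian) z)) * ennreal (w z)) \<longlonglongrightarrow> 0"
    proof (rule AE_I2)
      fix z
      have "(\<lambda>n. gabor (tf_shift (a n) gaussian) z) \<longlonglongrightarrow> gabor (tf_shift a0 gaussian) z"
        using continuous_on_tendsto_compose[OF gabor_gaussian_continuous[of z] lim] by simp
      then have "(\<lambda>n. ennreal (cmod (gabor (tf_shift (a n) gaussian) z - gabor (tf_shift a0 gaussian) z) * w z)) \<longlonglongrightarrow> ennreal (cmod (gabor (tf_shift a0 gaussian) z - gabor (tf_shift a0 gaussian) z) * w z)"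
        by (intro tendsto_intros)
      then show "(\<lambda>n. ennreal (cmod (gabor (tf_shift (a n) gaussian) z - gabor (tf_shift a0 gaussian) z)) * ennreal (w z)) \<longlonglongrightarrow> 0"
        by (simp add: ennreal_mult')
    qed
  qed measurable
  then show ?thesis unfolding eq by simp
qed

section \<open>Antilinear functionals on M^1 and their transforms\<close>

lemma M1_antidualD:
  assumes "f \<in> M1_antidual w"
  shows "g \<in> M1_space w \<Longrightarrow> h \<in> M1_space w \<Longrightarrow> f (\<lambda>t. g t + h t) = f g + f h"
    and "g \<in> M1_space w \<Longrightarrow> f (\<lambda>t. c * g t) = cnj c * f g"
    and "g \<notin> M1_space w \<Longrightarrow> f g = 0"
  using assms unfolding M1_antidual_def by blast+

text \<open>The constant can be made nonnegative because \<open>ennreal\<close> sends negative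
  numbers to 0.\<close>

lemma M1_antidual_bound:
  assumes "f \<in> M1_antidual w"
  obtains C where "0 \<le> C" "\<And>g. g \<in> M1_space w \<Longrightarrow> ennreal (cmod (f g)) \<le> ennreal C * M1_norm w g"
proof -
  obtain C where C: "\<And>g. g \<in> M1_space w \<Longrightarrow> ennreal (cmod (f g)) \<le> ennreal C * M1_norm w g"
    using assms unfolding M1_antidual_def by blast
  show ?thesis
  proof (rule that[of "max 0 C"])
    show "ennreal (cmod (f g)) \<le> ennreal (max 0 C) * M1_norm w g" if "g \<in> M1_space w" for g
      using C[OF that] by (rule order_trans) (intro mult_right_mono ennreal_leI, auto)
  qed simp
qed

lemma M1_antidual_diff:
  assumes "f \<in> M1_antidual w" "w \<in> borel_measurable borel" "g \<in> M1_space w" "h \<in> M1_space w"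
  shows "f (\<lambda>t. g t - h t) = f g - f h"
  using M1_antidualD(1)[OF assms(1,3) M1_space_cmult[OF assms(2,4), of "- 1"]]
    M1_antidualD(2)[OF assms(1,4), of "- 1"] by simp

lemma M1_antidual_sum:
  assumes f: "f \<in> M1_antidual w" and w: "w \<in> borel_measurable borel" and "finite Z"
  shows "f (\<lambda>t. \<Sum>z\<in>Z. c z * tf_shift z gaussian t) = (\<Sum>z\<in>Z. cnj (c z) * STFT gaussian f z)"
  using \<open>finite Z\<close>
proof (induction Z)
  case empty
  show ?case using M1_antidualD(2)[OF f gaussian_span_M1_space[OF w tf_shift_gaussian_span], of 0] by simp
next
  case (insert z Z)
  have "f (\<lambda>t. c z * tf_shift z gaussian t + (\<Sum>z\<in>Z. c z * tf_shift z gaussian t))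
    = f (\<lambda>t. c z * tf_shift z gaussian t) + f (\<lambda>t. \<Sum>z\<in>Z. c z * tf_shift z gaussian t)"
    by (intro M1_antidualD(1)[OF f] gaussian_span_M1_space[OF w] gaussian_spanI insert gaussian_span_cmult tf_shift_gaussian_span)
  also have "f (\<lambda>t. c z * tf_shift z gaussian t) = cnj (c z) * STFT gaussian f z"
    unfolding STFT_def by (intro M1_antidualD(2)[OF f] tf_shift_gaussian_M1_space w)
  finally show ?case using insert by simp
qed

text \<open>The functional enters the bound only through \<open>C\<close>; for sequences sharing a
  constant this is equicontinuity.\<close>

lemma STFT_gaussian_diff_le:
  assumes f: "f \<in> M1_antidual w" and w: "w \<in> borel_measurable borel"
    and C: "\<And>g. g \<in> M1_space w \<Longrightarrow> ennreal (cmod (f g)) \<le> ennreal C * M1_norm w g"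
  shows "ennreal (cmod (STFT gaussian f a - STFT gaussian f b))
    \<le> ennreal C * M1_norm w (\<lambda>t. tf_shift a gaussian t - tf_shift b gaussian t)"
  using C[OF M1_space_diff[OF w tf_shift_gaussian_M1_space[OF w] tf_shift_gaussian_M1_space[OF w]], of a b]
    M1_antidual_diff[OF f w tf_shift_gaussian_M1_space[OF w] tf_shift_gaussian_M1_space[OF w], of a b]
  by (simp add: STFT_def)

lemma STFT_gaussian_tendsto:
  fixes w :: "'d::finite phase \<Rightarrow> real"
  assumes f: "f \<in> M1_antidual w" and w: "exp_bounded w" and lim: "a \<longlonglongrightarrow> a0"
  shows "(\<lambda>n. STFT gaussian f (a n)) \<longlonglongrightarrow> STFT gaussian f a0"
proof -
  obtain C where C: "\<And>g. g \<in> M1_space w \<Longrightarrow> ennreal (cmod (f g)) \<le> ennreal C * M1_norm w g"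
    using M1_antidual_bound[OF f] by blast
  have "(\<lambda>n. ennreal (cmod (STFT gaussian f (a n) - STFT gaussian f a0))) \<longlonglongrightarrow> 0"
  proof (rule tendsto_sandwich[OF _ _ tendsto_const])
    have "(\<lambda>n. ennreal C * M1_norm w (\<lambda>t. tf_shift (a n) gaussian t - tf_shift a0 gaussian t)) \<longlonglongrightarrow> ennreal C * 0"
      by (intro ennreal_tendsto_cmult tf_shift_gaussian_tendsto w lim) simp
    then show "(\<lambda>n. ennreal C * M1_norm w (\<lambda>t. tf_shift (a n) gaussian t - tf_shift a0 gaussian t)) \<longlonglongrightarrow> 0" by simp
  qed (auto intro!: always_eventually STFT_gaussian_diff_le[OF f exp_boundedD(1)[OF w] C])
  then have "(\<lambda>n. cmod (STFT gaussian f (a n) - STFT gaussian f a0)) \<longlonglongrightarrow> 0"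
    using tendsto_ennreal_iff[of "\<lambda>n. cmod (STFT gaussian f (a n) - STFT gaussian f a0)" sequentially 0] by simp
  then show ?thesis by (rule LIM_zero_cancel[OF tendsto_norm_zero_cancel])
qed

lemma STFT_gaussian_measurable:
  fixes w :: "'d::finite phase \<Rightarrow> real"
  assumes f: "f \<in> M1_antidual w" and w: "exp_bounded w"
  shows "STFT gaussian f \<in> borel_measurable borel"
proof (rule borel_measurable_continuous_onI)
  show "continuous_on UNIV (STFT gaussian f)"
    unfolding continuous_on_sequentially using STFT_gaussian_tendsto[OF f w] by (auto simp: comp_def)
qed

lemma STFT_gaussian_bound:
  fixes w :: "'d::finite phase \<Rightarrow> real"
  assumes f: "f \<in> M1_antidual w" and w: "submult_weight w"
  obtains C where "0 \<le> C" "\<And>z. cmod (STFT gaussian f z) \<le> C * w z"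
proof -
  obtain C where C: "0 \<le> C" "\<And>g. g \<in> M1_space w \<Longrightarrow> ennreal (cmod (f g)) \<le> ennreal C * M1_norm w g"
    using M1_antidual_bound[OF f] by blast
  have g0: "tf_shift 0 gaussian = gaussian" by (simp add: tf_shift_def fun_eq_iff)
  have "M1_norm w gaussian < top"
    using M1_norm_tf_shift_gaussian_finite[OF submult_weight_exp_bounded[OF w], of 0] by (simp add: g0)
  then obtain m where m: "M1_norm w gaussian = ennreal m" "0 \<le> m" by (cases "M1_norm w gaussian") auto
  show ?thesis
  proof (rule that[of "C * m"])
    show "0 \<le> C * m" using C m by simp
    fix z
    have "ennreal (cmod (STFT gaussian f z)) \<le> ennreal C * M1_norm w (tf_shift z gaussian)"
      unfolding STFT_def by (intro C tf_shift_gaussian_M1_space submult_weightD(1)[OF w])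
    also have "\<dots> \<le> ennreal C * (ennreal (w z) * M1_norm w gaussian)"
      by (intro mult_left_mono M1_norm_tf_shift_le w) auto
    also have "\<dots> = ennreal (C * m * w z)"
      using C m submult_weightD(2)[OF w, of z] by (simp add: m ennreal_mult[symmetric] mult_ac)
    finally show "cmod (STFT gaussian f z) \<le> C * m * w z"
      using C m submult_weightD(2)[OF w, of z] by (simp add: ennreal_le_iff)
  qed
qed

text \<open>The right-hand side is a finite sum, to which an antilinear functional can be applied
  term by term. \<open>G\<close> may be arbitrary, as only its values on the finite range of
  \<open>s\<close> enter.\<close>

lemma integral_simple_compose:
  fixes K :: "'a \<Rightarrow> complex" and G :: "'b \<Rightarrow> complex"
  assumes K: "integrable M K" and s: "simple_function M s"
  shows "(LINT x|M. K x * G (s x)) = (\<Sum>a\<in>s ` space M. (LINT x|M. K x * indicator {x \<in> space M. s x = a} x) * G a)"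
proof -
  have fin: "finite (s ` space M)" using s by (rule simple_functionD)
  have set: "{x \<in> space M. s x = a} \<in> sets M" for a
  proof -
    have "{x \<in> space M. s x = a} = s -` {a} \<inter> space M" by auto
    then show ?thesis using simple_functionD(2)[OF s] by simp
  qed
  have "(LINT x|M. K x * G (s x)) = (LINT x|M. (\<Sum>a\<in>s ` space M. K x * indicator {x \<in> space M. s x = a} x * G a))"
  proof (rule Bochner_Integration.integral_cong[OF refl])
    fix x assume x: "x \<in> space M"
    have "(\<Sum>a\<in>s ` space M. K x * indicator {x \<in> space M. s x = a} x * G a) = (\<Sum>a\<in>{s x}. K x * indicator {x \<in> space M. s x = a} x * G a)"
      using x fin by (intro sum.mono_neutral_right) (auto simp: indicator_def)
    then show "K x * G (s x) = (\<Sum>a\<in>s ` space M. K x * indicator {x \<in> space M. s x = a} x * G a)"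
      using x by simp
  qed
  also have "\<dots> = (\<Sum>a\<in>s ` space M. LINT x|M. K x * indicator {x \<in> space M. s x = a} x * G a)"
  proof (rule Bochner_Integration.integral_sum)
    fix a
    have "integrable M (\<lambda>x. indicator {x \<in> space M. s x = a} x *\<^sub>R K x)"
      by (intro integrable_mult_indicator set K)
    then show "integrable M (\<lambda>x. K x * indicator {x \<in> space M. s x = a} x * G a)"
      by (intro integrable_mult_left) (simp add: scaleR_conv_of_real of_real_indicator mult.commute)
  qed
  finally show ?thesis by simp
qed

lemma square_integrable_sum:
  assumes "finite Z" shows "(\<lambda>t. \<Sum>z\<in>Z. c z * tf_shift z gaussian t) \<in> square_integrable"
  by (intro gaussian_span_square_integrable gaussian_spanI assms)

lemma gabor_sum:
  assumes "finite Z"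
  shows "gabor (\<lambda>t. \<Sum>y\<in>Z. c y * tf_shift y gaussian t) z = (\<Sum>y\<in>Z. c y * gabor (tf_shift y gaussian) z)"
  using assms
proof (induction Z)
  case empty
  show ?case using gabor_cmult[of 0 "\<lambda>_. 0"] by simp
next
  case (insert y Z)
  have "gabor (\<lambda>t. c y * tf_shift y gaussian t + (\<Sum>y\<in>Z. c y * tf_shift y gaussian t)) z
    = gabor (\<lambda>t. c y * tf_shift y gaussian t) z + gabor (\<lambda>t. \<Sum>y\<in>Z. c y * tf_shift y gaussian t) z"
    by (intro gabor_add square_integrable_sum insert square_integrable_cmult square_integrable_tf_shift gaussian_square_integrable)
  then show ?case using insert by (simp add: gabor_cmult)
qed

text \<open>A functional cannot be moved directly under a vector-valued integral. In pi(zeta)phi_0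
  the variable zeta is therefore replaced by simple functions \<open>\<sigma> i\<close> tending to
  the identity. The resulting finite combinations \<open>s i\<close> converge in M^1_w to kappa
  pi(eta)phi_0 by \<open>gabor_reproducing\<close>, while the numbers \<open>f (s i)\<close>
  converge to the integral by dominated convergence.\<close>

lemma STFT_gaussian_reproducing:
  fixes w :: "'d::finite phase \<Rightarrow> real"
  assumes f: "f \<in> M1_antidual w" and w: "submult_weight w"
  shows "of_real (gconst TYPE('d)) * STFT gaussian f \<eta> = (LINT \<zeta>|lborel. STFT gaussian f \<zeta> * cnj (gabor (tf_shift \<eta> gaussian) \<zeta>))"
proof -
  note wb = submult_weight_exp_bounded[OF w]
  note [measurable] = submult_weightD(1)[OF w] STFT_gaussian_measurable[OF f wb]
  define F where "F = STFT gaussian f"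
  note [measurable] = STFT_gaussian_measurable[OF f wb, folded F_def]
  obtain C where C: "0 \<le> C" "\<And>g. g \<in> M1_space w \<Longrightarrow> ennreal (cmod (f g)) \<le> ennreal C * M1_norm w g"
    using M1_antidual_bound[OF f] by blast
  obtain C' where C': "0 \<le> C'" "\<And>z. cmod (F z) \<le> C' * w z"
    using STFT_gaussian_bound[OF f w] unfolding F_def by blast
  obtain D d where D: "0 \<le> D" "0 \<le> d" "\<And>z. w z \<le> D * exp (d * norm z)" using wb unfolding exp_bounded_def by blast
  define K where "K = gabor (tf_shift \<eta> gaussian)"
  have [measurable]: "K \<in> borel_measurable borel" unfolding K_def by measurable
  \<comment> \<open>Since |sigma_i(zeta)| <= 2|zeta|, the doubled rate 2d makes \<open>E\<close>
    dominate \<open>w\<close> both at zeta and at sigma_i(zeta).\<close>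
  define E where "E z = D * exp (2 * d * norm z)" for z :: "'d phase"
  have E: "exp_bounded E" unfolding E_def using D by (intro exp_boundedI[of _ D "2 * d"]) auto
  note [measurable] = exp_boundedD(1)[OF E]
  have KE: "(\<integral>\<^sup>+ \<zeta>. ennreal (cmod (K \<zeta>)) * ennreal (E \<zeta>) \<partial>lborel) < top"
    using M1_norm_tf_shift_gaussian_finite[OF E, of \<eta>] by (subst (asm) M1_norm_eq) (simp_all add: K_def)
  have K: "integrable lborel K"
    using M1_norm_tf_shift_gaussian_finite[of "\<lambda>_. 1" \<eta>] exp_boundedI[of "\<lambda>_. 1" 1 0]
    by (intro integrableI_bounded) (simp_all add: M1_norm_eq K_def)
  obtain \<sigma> :: "nat \<Rightarrow> 'd phase \<Rightarrow> 'd phase" where \<sigma>: "\<And>i. simple_function lborel (\<sigma> i)"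
      "\<And>\<zeta>. (\<lambda>i. \<sigma> i \<zeta>) \<longlonglongrightarrow> \<zeta>" "\<And>i \<zeta>. norm (\<sigma> i \<zeta>) \<le> 2 * norm \<zeta>"
  proof -
    have "(\<lambda>\<zeta>::'d phase. \<zeta>) \<in> borel_measurable lborel" by simp
    from borel_measurable_implies_sequence_metric[OF this, of 0] show ?thesis using that by auto
  qed
  have [measurable]: "\<sigma> i \<in> borel_measurable borel" for i
    using borel_measurable_simple_function[OF \<sigma>(1)] by simp
  have wE: "w (\<sigma> i \<zeta>) \<le> E \<zeta>" "w \<zeta> \<le> E \<zeta>" for i \<zeta>
  proof -
    have "w (\<sigma> i \<zeta>) \<le> D * exp (d * norm (\<sigma> i \<zeta>))" by (rule D)
    also have "\<dots> \<le> E \<zeta>" unfolding E_def using D \<sigma>(3)[of i \<zeta>] mult_left_mono[OF \<sigma>(3)[of i \<zeta>] D(2)]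
      by (intro mult_left_mono) (auto simp: mult.assoc mult.left_commute)
    finally show "w (\<sigma> i \<zeta>) \<le> E \<zeta>" .
    have "w \<zeta> \<le> D * exp (d * norm \<zeta>)" by (rule D)
    also have "\<dots> \<le> E \<zeta>" unfolding E_def using D mult_nonneg_nonneg[OF D(2) norm_ge_zero[of \<zeta>]]
      by (intro mult_left_mono) auto
    finally show "w \<zeta> \<le> E \<zeta>" .
  qed
  define c where "c i a = (LINT \<zeta>|lborel. K \<zeta> * indicator {\<zeta> \<in> space lborel. \<sigma> i \<zeta> = a} \<zeta>)" for i a
  define s where "s i t = (\<Sum>a\<in>\<sigma> i ` space lborel. c i a * tf_shift a gaussian t)" for i t
  have fin: "finite (\<sigma> i ` space lborel)" for i using \<sigma>(1) by (rule simple_functionD)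
  have sspan: "s i \<in> gaussian_span" for i unfolding s_def by (intro gaussian_spanI fin)
  note ssq = gaussian_span_square_integrable[OF sspan]
  have simp_int: "(LINT \<zeta>|lborel. K \<zeta> * G (\<sigma> i \<zeta>)) = (\<Sum>a\<in>\<sigma> i ` space lborel. c i a * G a)" for G i
    unfolding c_def by (rule integral_simple_compose[OF K \<sigma>(1)])
  have fs: "f (s i) = cnj (LINT \<zeta>|lborel. K \<zeta> * cnj (F (\<sigma> i \<zeta>)))" for i
    using simp_int[where G="\<lambda>a. cnj (F a)" and i=i] M1_antidual_sum[OF f submult_weightD(1)[OF w] fin[of i], where c="c i"]
    by (simp add: s_def[abs_def] F_def)
  have gs: "gabor (s i) z = (LINT \<zeta>|lborel. K \<zeta> * gabor (tf_shift (\<sigma> i \<zeta>) gaussian) z)" for i z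
    using simp_int[where G="\<lambda>a. gabor (tf_shift a gaussian) z" and i=i] gabor_sum[OF fin[of i], where c="c i" and z=z]
    by (simp add: s_def[abs_def])
  have lim1: "(\<lambda>i. LINT \<zeta>|lborel. K \<zeta> * cnj (F (\<sigma> i \<zeta>))) \<longlonglongrightarrow> (LINT \<zeta>|lborel. K \<zeta> * cnj (F \<zeta>))"
  proof (rule integral_dominated_convergence[where w="\<lambda>\<zeta>. C' * (cmod (K \<zeta>) * E \<zeta>)"])
    show "integrable lborel (\<lambda>\<zeta>. C' * (cmod (K \<zeta>) * E \<zeta>))"
    proof (intro integrable_mult_right integrableI_bounded)
      show "(\<integral>\<^sup>+ \<zeta>. ennreal (norm (cmod (K \<zeta>) * E \<zeta>)) \<partial>lborel) < \<infinity>"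
        using KE exp_boundedD(2)[OF E] by (simp add: ennreal_mult abs_mult)
    qed measurable
    show "AE \<zeta> in lborel. (\<lambda>i. K \<zeta> * cnj (F (\<sigma> i \<zeta>))) \<longlonglongrightarrow> K \<zeta> * cnj (F \<zeta>)"
      unfolding F_def by (intro AE_I2 tendsto_intros STFT_gaussian_tendsto[OF f wb] \<sigma>(2))
    show "AE \<zeta> in lborel. norm (K \<zeta> * cnj (F (\<sigma> i \<zeta>))) \<le> C' * (cmod (K \<zeta>) * E \<zeta>)" for i
    proof (rule AE_I2)
      fix \<zeta>
      have "cmod (F (\<sigma> i \<zeta>)) \<le> C' * E \<zeta>"
        using C'(2)[of "\<sigma> i \<zeta>"] mult_left_mono[OF wE(1)[of i \<zeta>] C'(1)] by linarith
      then have "cmod (K \<zeta>) * cmod (F (\<sigma> i \<zeta>)) \<le> cmod (K \<zeta>) * (C' * E \<zeta>)" by (rule mult_left_mono) simp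
      then show "norm (K \<zeta> * cnj (F (\<sigma> i \<zeta>))) \<le> C' * (cmod (K \<zeta>) * E \<zeta>)" by (simp add: norm_mult mult_ac)
    qed
  qed measurable
  let ?\<Delta> = "\<lambda>i \<zeta> z. gabor (tf_shift (\<sigma> i \<zeta>) gaussian) z - gabor (tf_shift \<zeta> gaussian) z"
  define N where "N i \<zeta> = (\<integral>\<^sup>+ z. ennreal (cmod (?\<Delta> i \<zeta> z)) * ennreal (w z) \<partial>lborel)" for i \<zeta>
  have [measurable]: "N i \<in> borel_measurable borel" for i unfolding N_def by measurable
  note tsq = square_integrable_tf_shift[OF gaussian_square_integrable]
  have N: "N i \<zeta> = M1_norm w (\<lambda>t. tf_shift (\<sigma> i \<zeta>) gaussian t - tf_shift \<zeta> gaussian t)" for i \<zeta>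
    unfolding N_def by (subst M1_norm_eq) (simp_all add: gabor_diff[OF tsq tsq])
  define m where "m = M1_norm w gaussian"
  have g0: "tf_shift 0 gaussian = (gaussian :: real^'d \<Rightarrow> complex)" by (simp add: tf_shift_def fun_eq_iff)
  have m: "m < top" using M1_norm_tf_shift_gaussian_finite[OF wb, of 0] by (simp add: m_def g0)
  have lim2: "(\<lambda>i. \<integral>\<^sup>+ \<zeta>. ennreal (cmod (K \<zeta>)) * N i \<zeta> \<partial>lborel) \<longlonglongrightarrow> (\<integral>\<^sup>+ \<zeta>. 0 \<partial>(lborel :: 'd phase measure))"
  proof (rule nn_integral_dominated_convergence[where w="\<lambda>\<zeta>. (2 * m) * (ennreal (cmod (K \<zeta>)) * ennreal (E \<zeta>))"])
    show "(\<integral>\<^sup>+ \<zeta>. (2 * m) * (ennreal (cmod (K \<zeta>)) * ennreal (E \<zeta>)) \<partial>lborel) < \<infinity>"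
      using KE m by (simp add: nn_integral_cmult ennreal_mult_less_top)
    show "AE \<zeta> in lborel. ennreal (cmod (K \<zeta>)) * N i \<zeta> \<le> (2 * m) * (ennreal (cmod (K \<zeta>)) * ennreal (E \<zeta>))" for i
    proof (rule AE_I2)
      fix \<zeta>
      have "N i \<zeta> = (\<integral>\<^sup>+ z. ennreal (cmod (gabor (tf_shift (\<sigma> i \<zeta>) gaussian) z - gabor (tf_shift \<zeta> gaussian) z)) * ennreal (w z) \<partial>lborel)"
        by (simp add: N_def)
      also have "\<dots> \<le> (\<integral>\<^sup>+ z. ennreal (cmod (gabor (tf_shift (\<sigma> i \<zeta>) gaussian) z)) * ennreal (w z) + ennreal (cmod (gabor (tf_shift \<zeta> gaussian) z)) * ennreal (w z) \<partial>lborel)"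
        by (intro nn_integral_mono) (auto simp: distrib_right[symmetric] ennreal_plus[symmetric] simp del: ennreal_plus
          intro!: mult_right_mono ennreal_leI norm_triangle_ineq4)
      also have "\<dots> = M1_norm w (tf_shift (\<sigma> i \<zeta>) gaussian) + M1_norm w (tf_shift \<zeta> gaussian)"
        by (simp add: nn_integral_add M1_norm_eq)
      also have "\<dots> \<le> ennreal (w (\<sigma> i \<zeta>)) * m + ennreal (w \<zeta>) * m"
        unfolding m_def by (intro add_mono M1_norm_tf_shift_le w) measurable
      also have "\<dots> \<le> ennreal (E \<zeta>) * m + ennreal (E \<zeta>) * m"
        by (intro add_mono mult_right_mono ennreal_leI wE) auto
      also have "\<dots> = (2 * m) * ennreal (E \<zeta>)" by (simp only: mult_2 distrib_right mult.commute[of "ennreal (E \<zeta>)" m])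
      finally have "ennreal (cmod (K \<zeta>)) * N i \<zeta> \<le> ennreal (cmod (K \<zeta>)) * ((2 * m) * ennreal (E \<zeta>))"
        by (rule mult_left_mono) simp
      then show "ennreal (cmod (K \<zeta>)) * N i \<zeta> \<le> (2 * m) * (ennreal (cmod (K \<zeta>)) * ennreal (E \<zeta>))"
        by (simp add: mult_ac)
    qed
    show "AE \<zeta> in lborel. (\<lambda>i. ennreal (cmod (K \<zeta>)) * N i \<zeta>) \<longlonglongrightarrow> 0"
    proof (rule AE_I2)
      fix \<zeta>
      have "(\<lambda>i. ennreal (cmod (K \<zeta>)) * N i \<zeta>) \<longlonglongrightarrow> ennreal (cmod (K \<zeta>)) * 0"
        unfolding N by (intro ennreal_tendsto_cmult tf_shift_gaussian_tendsto[OF wb] \<sigma>(2)) simp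
      then show "(\<lambda>i. ennreal (cmod (K \<zeta>)) * N i \<zeta>) \<longlonglongrightarrow> 0" by simp
    qed
  qed measurable
  let ?k = "of_real (gconst TYPE('d)) :: complex"
  \<comment> \<open>Minkowski's inequality in M^1_w: the transform of the difference is the integral
    of K against \<open>?\<Delta>\<close>, so its norm is at most the integral of |K| times the
    norms \<open>N i\<close>.\<close>
  have normle: "M1_norm w (\<lambda>t. s i t - ?k * tf_shift \<eta> gaussian t) \<le> (\<integral>\<^sup>+ \<zeta>. ennreal (cmod (K \<zeta>)) * N i \<zeta> \<partial>lborel)" for i
  proof -
    have bdd: "cmod (gabor (tf_shift a gaussian) z) \<le> gconst TYPE('d)" for a z :: "'d phase"
      using gconst_pos[where 'd='d] by (simp add: cmod_gabor_tf_shift cmod_gabor_gaussian mult_left_le)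
    have iK: "integrable lborel (\<lambda>\<zeta>. K \<zeta> * G \<zeta>)" if [measurable]: "G \<in> borel_measurable borel" and G: "\<And>\<zeta>. cmod (G \<zeta>) \<le> gconst TYPE('d)" for G
    proof (rule Bochner_Integration.integrable_bound)
      show "integrable lborel (\<lambda>\<zeta>. cmod (K \<zeta>) * gconst TYPE('d))" using K by (intro integrable_mult_left) simp
      show "AE \<zeta> in lborel. norm (K \<zeta> * G \<zeta>) \<le> norm (cmod (K \<zeta>) * gconst TYPE('d))"
        using G gconst_pos[where 'd='d] by (intro AE_I2) (simp add: norm_mult abs_mult mult_left_mono)
    qed measurable
    have i1: "integrable lborel (\<lambda>\<zeta>. K \<zeta> * gabor (tf_shift (\<sigma> i \<zeta>) gaussian) z)"
      and i2: "integrable lborel (\<lambda>\<zeta>. K \<zeta> * gabor (tf_shift \<zeta> gaussian) z)" for z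
      by (rule iK; simp add: bdd)+
    have g: "gabor (\<lambda>t. s i t - ?k * tf_shift \<eta> gaussian t) z = (LINT \<zeta>|lborel. K \<zeta> * ?\<Delta> i \<zeta> z)" for z
    proof -
      have "gabor (\<lambda>t. s i t - ?k * tf_shift \<eta> gaussian t) z = gabor (s i) z - ?k * gabor (tf_shift \<eta> gaussian) z"
        by (subst gabor_diff[OF ssq square_integrable_cmult[OF tsq]]) (simp add: gabor_cmult)
      also have "?k * gabor (tf_shift \<eta> gaussian) z = (LINT \<zeta>|lborel. K \<zeta> * gabor (tf_shift \<zeta> gaussian) z)"
        unfolding K_def by (rule gabor_reproducing[OF tsq, symmetric])
      also have "gabor (s i) z - (LINT \<zeta>|lborel. K \<zeta> * gabor (tf_shift \<zeta> gaussian) z)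
        = (LINT \<zeta>|lborel. K \<zeta> * gabor (tf_shift (\<sigma> i \<zeta>) gaussian) z - K \<zeta> * gabor (tf_shift \<zeta> gaussian) z)"
        unfolding gs by (rule Bochner_Integration.integral_diff[OF i1 i2, symmetric])
      finally show ?thesis by (simp add: right_diff_distrib)
    qed
    note [measurable] = ssq[THEN square_integrableD]
    have "M1_norm w (\<lambda>t. s i t - ?k * tf_shift \<eta> gaussian t)
      = (\<integral>\<^sup>+ z. ennreal (cmod (LINT \<zeta>|lborel. K \<zeta> * ?\<Delta> i \<zeta> z)) * ennreal (w z) \<partial>lborel)"
      by (subst M1_norm_eq) (simp_all add: g)
    also have "\<dots> \<le> (\<integral>\<^sup>+ z. (\<integral>\<^sup>+ \<zeta>. ennreal (cmod (K \<zeta> * ?\<Delta> i \<zeta> z)) \<partial>lborel) * ennreal (w z) \<partial>lborel)"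
      by (intro nn_integral_mono mult_right_mono cmod_integral_le_nn_integral) simp
    also have "\<dots> = (\<integral>\<^sup>+ z. \<integral>\<^sup>+ \<zeta>. ennreal (cmod (K \<zeta>)) * (ennreal (cmod (?\<Delta> i \<zeta> z)) * ennreal (w z)) \<partial>lborel \<partial>lborel)"
      by (subst nn_integral_multc[symmetric]) (simp_all add: norm_mult ennreal_mult mult.assoc)
    also have "\<dots> = (\<integral>\<^sup>+ \<zeta>. \<integral>\<^sup>+ z. ennreal (cmod (K \<zeta>)) * (ennreal (cmod (?\<Delta> i \<zeta> z)) * ennreal (w z)) \<partial>lborel \<partial>lborel)"
      by (rule lborel_pair.Fubini') measurable
    also have "\<dots> = (\<integral>\<^sup>+ \<zeta>. ennreal (cmod (K \<zeta>)) * N i \<zeta> \<partial>lborel)"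
      unfolding N_def by (intro nn_integral_cong nn_integral_cmult) measurable
    finally show ?thesis .
  qed
  have "(\<lambda>i. ennreal (cmod (f (s i) - ?k * F \<eta>))) \<longlonglongrightarrow> 0"
  proof (rule tendsto_sandwich[OF _ _ tendsto_const])
    have "(\<lambda>i. ennreal C * (\<integral>\<^sup>+ \<zeta>. ennreal (cmod (K \<zeta>)) * N i \<zeta> \<partial>lborel)) \<longlonglongrightarrow> ennreal C * 0"
      using lim2 by (intro ennreal_tendsto_cmult) simp_all
    then show "(\<lambda>i. ennreal C * (\<integral>\<^sup>+ \<zeta>. ennreal (cmod (K \<zeta>)) * N i \<zeta> \<partial>lborel)) \<longlonglongrightarrow> 0" by simp
    have "ennreal (cmod (f (s i) - ?k * F \<eta>)) \<le> ennreal C * (\<integral>\<^sup>+ \<zeta>. ennreal (cmod (K \<zeta>)) * N i \<zeta> \<partial>lborel)" for i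
    proof -
      have tM: "tf_shift \<eta> gaussian \<in> M1_space w" by (intro tf_shift_gaussian_M1_space) measurable
      have sM: "s i \<in> M1_space w" by (intro gaussian_span_M1_space sspan) measurable
      have kM: "(\<lambda>t. ?k * tf_shift \<eta> gaussian t) \<in> M1_space w" by (intro M1_space_cmult tM) measurable
      have "f (s i) - ?k * F \<eta> = f (\<lambda>t. s i t - ?k * tf_shift \<eta> gaussian t)"
        using M1_antidual_diff[OF f _ sM kM] M1_antidualD(2)[OF f tM, of ?k] by (simp add: F_def STFT_def)
      then have "ennreal (cmod (f (s i) - ?k * F \<eta>)) \<le> ennreal C * M1_norm w (\<lambda>t. s i t - ?k * tf_shift \<eta> gaussian t)"
        using C(2)[OF M1_space_diff[OF _ sM kM]] by simp
      also have "\<dots> \<le> ennreal C * (\<integral>\<^sup>+ \<zeta>. ennreal (cmod (K \<zeta>)) * N i \<zeta> \<partial>lborel)"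
        by (intro mult_left_mono normle) simp
      finally show ?thesis .
    qed
    then show "\<forall>\<^sub>F i in sequentially. ennreal (cmod (f (s i) - ?k * F \<eta>)) \<le> ennreal C * (\<integral>\<^sup>+ \<zeta>. ennreal (cmod (K \<zeta>)) * N i \<zeta> \<partial>lborel)"
      by simp
  qed simp
  then have "(\<lambda>i. cmod (f (s i) - ?k * F \<eta>)) \<longlonglongrightarrow> 0"
    using tendsto_ennreal_iff[of "\<lambda>i. cmod (f (s i) - ?k * F \<eta>)" sequentially 0] by simp
  then have "(\<lambda>i. f (s i)) \<longlonglongrightarrow> ?k * F \<eta>" by (rule LIM_zero_cancel[OF tendsto_norm_zero_cancel])
  moreover have "(\<lambda>i. f (s i)) \<longlonglongrightarrow> cnj (LINT \<zeta>|lborel. K \<zeta> * cnj (F \<zeta>))"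
    unfolding fs by (intro tendsto_cnj lim1)
  ultimately have "?k * F \<eta> = cnj (LINT \<zeta>|lborel. K \<zeta> * cnj (F \<zeta>))" by (rule LIMSEQ_unique)
  also have "\<dots> = (LINT \<zeta>|lborel. F \<zeta> * cnj (K \<zeta>))"
    by (subst Bochner_Integration.integral_cnj[symmetric]) (simp add: mult.commute)
  finally show ?thesis by (simp add: F_def K_def)
qed

lemma weighted_bracket_integrable:
  fixes w :: "'d::finite phase \<Rightarrow> real"
  assumes w: "exp_bounded w" and [measurable]: "F \<in> borel_measurable borel" and F: "\<And>z. cmod (F z) \<le> C * w z"
    and g: "g \<in> borel_measurable borel" "M1_norm w g < top"
  shows "integrable lborel (\<lambda>\<zeta>. F \<zeta> * cnj (gabor g \<zeta>))"
    and "ennreal (cmod (LINT \<zeta>|lborel. F \<zeta> * cnj (gabor g \<zeta>))) \<le> ennreal C * M1_norm w g"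
proof -
  note [measurable] = exp_boundedD(1)[OF w] g(1)
  have le: "(\<integral>\<^sup>+ \<zeta>. ennreal (cmod (F \<zeta> * cnj (gabor g \<zeta>))) \<partial>lborel) \<le> ennreal C * M1_norm w g"
  proof -
    have "(\<integral>\<^sup>+ \<zeta>. ennreal (cmod (F \<zeta> * cnj (gabor g \<zeta>))) \<partial>lborel)
      \<le> (\<integral>\<^sup>+ \<zeta>. ennreal C * (ennreal (cmod (gabor g \<zeta>)) * ennreal (w \<zeta>)) \<partial>lborel)"
    proof (rule nn_integral_mono)
      fix \<zeta>
      have "ennreal (cmod (F \<zeta> * cnj (gabor g \<zeta>))) \<le> ennreal (C * w \<zeta> * cmod (gabor g \<zeta>))"
        using F[of \<zeta>] by (intro ennreal_leI) (auto simp: norm_mult intro: mult_right_mono)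
      also have "\<dots> = ennreal C * (ennreal (cmod (gabor g \<zeta>)) * ennreal (w \<zeta>))"
        using exp_boundedD(2)[OF w, of \<zeta>] by (simp add: ennreal_mult'' mult_ac)
      finally show "ennreal (cmod (F \<zeta> * cnj (gabor g \<zeta>))) \<le> ennreal C * (ennreal (cmod (gabor g \<zeta>)) * ennreal (w \<zeta>))" .
    qed
    then show ?thesis by (simp add: nn_integral_cmult M1_norm_eq)
  qed
  then show "ennreal (cmod (LINT \<zeta>|lborel. F \<zeta> * cnj (gabor g \<zeta>))) \<le> ennreal C * M1_norm w g"
    by (rule order_trans[OF cmod_integral_le_nn_integral])
  have "ennreal C * M1_norm w g < top" using g by (simp add: ennreal_mult_less_top)
  then show "integrable lborel (\<lambda>\<zeta>. F \<zeta> * cnj (gabor g \<zeta>))"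
    using le by (intro integrableI_bounded) (auto intro: le_less_trans)
qed

text \<open>Both sides are antilinear in \<open>g\<close> and bounded by multiples of the
  M^1_w-norm, so the identity extends from shifted Gaussians to their span and then to its
  closure.\<close>

lemma M1_antidual_reproducing:
  fixes w :: "'d::finite phase \<Rightarrow> real"
  assumes f: "f \<in> M1_antidual w" and w: "submult_weight w" and g: "g \<in> M1_space w"
  shows "of_real (gconst TYPE('d)) * f g = (LINT \<zeta>|lborel. STFT gaussian f \<zeta> * cnj (gabor g \<zeta>))"
proof -
  note wb = submult_weight_exp_bounded[OF w]
  note wm = submult_weightD(1)[OF w]
  define F where "F = STFT gaussian f"
  note Fm[measurable] = STFT_gaussian_measurable[OF f wb, folded F_def]
  obtain C where C: "0 \<le> C" "\<And>g. g \<in> M1_space w \<Longrightarrow> ennreal (cmod (f g)) \<le> ennreal C * M1_norm w g"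
    using M1_antidual_bound[OF f] by blast
  obtain C' where C': "0 \<le> C'" "\<And>z. cmod (F z) \<le> C' * w z"
    using STFT_gaussian_bound[OF f w] unfolding F_def by blast
  let ?k = "of_real (gconst TYPE('d)) :: complex"
  let ?I = "\<lambda>g. (LINT \<zeta>|lborel. F \<zeta> * cnj (gabor g \<zeta>))"
  have int: "integrable lborel (\<lambda>\<zeta>. F \<zeta> * cnj (gabor g \<zeta>))"
    and le: "ennreal (cmod (?I g)) \<le> ennreal C' * M1_norm w g" if "g \<in> M1_space w" for g
    using weighted_bracket_integrable[OF wb Fm C'(2) square_integrableD[OF M1_space_square_integrable[OF that]] M1_space_finite[OF wb that]]
    by auto
  have span: "?k * f g = ?I g" if "g \<in> gaussian_span" for g
    using that
  proof (induction rule: gaussian_span_induct)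
    case zero
    have "f (\<lambda>_. 0) = 0" using M1_antidualD(2)[OF f g, of 0] by simp
    moreover have "gabor (\<lambda>_. 0) z = 0" for z :: "'d phase" using gabor_cmult[of 0 "\<lambda>_. 0" z] by simp
    ultimately show ?case by simp
  next
    case (add c z h)
    have t: "tf_shift z gaussian \<in> M1_space w" by (rule tf_shift_gaussian_M1_space[OF wm])
    have h: "h \<in> M1_space w" by (rule gaussian_span_M1_space[OF wm add(1)])
    have "?k * f (\<lambda>t. c * tf_shift z gaussian t + h t) = cnj c * (?k * F z) + ?k * f h"
      using M1_antidualD(1)[OF f M1_space_cmult[OF wm t, of c] h] M1_antidualD(2)[OF f t, of c]
      by (simp add: F_def STFT_def distrib_left mult_ac)
    also have "\<dots> = cnj c * ?I (tf_shift z gaussian) + ?I h"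
      using STFT_gaussian_reproducing[OF f w, of z] add by (simp add: F_def)
    also have "\<dots> = (LINT \<zeta>|lborel. cnj c * (F \<zeta> * cnj (gabor (tf_shift z gaussian) \<zeta>)) + F \<zeta> * cnj (gabor h \<zeta>))"
      using int[OF t] int[OF h] by simp
    also have "\<dots> = ?I (\<lambda>t. c * tf_shift z gaussian t + h t)"
      using M1_space_square_integrable[OF M1_space_cmult[OF wm t, of c]] M1_space_square_integrable[OF h]
      by (simp add: gabor_add gabor_cmult distrib_left mult_ac)
    finally show ?case .
  qed
  obtain s where "(\<forall>n. s n \<in> gaussian_span) \<and> (\<lambda>n. M1_norm w (\<lambda>t. g t - s n t)) \<longlonglongrightarrow> 0"
    using M1_spaceD[OF g] by blast
  then have s: "\<And>n. s n \<in> gaussian_span" "(\<lambda>n. M1_norm w (\<lambda>t. g t - s n t)) \<longlonglongrightarrow> 0" by auto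
  have bound: "ennreal (cmod (?k * f g - ?I g)) \<le> (ennreal (gconst TYPE('d)) * ennreal C + ennreal C') * M1_norm w (\<lambda>t. g t - s n t)" for n
  proof -
    have sM: "s n \<in> M1_space w" by (rule gaussian_span_M1_space[OF wm s(1)])
    have dM: "(\<lambda>t. g t - s n t) \<in> M1_space w" by (rule M1_space_diff[OF wm g sM])
    have "?I (\<lambda>t. g t - s n t) = ?I g - ?I (s n)"
      using int[OF g] int[OF sM] M1_space_square_integrable[OF g] M1_space_square_integrable[OF sM]
      by (simp add: gabor_diff right_diff_distrib)
    then have "?k * f g - ?I g = ?k * f (\<lambda>t. g t - s n t) - ?I (\<lambda>t. g t - s n t)"
      using M1_antidual_diff[OF f wm g sM] span[OF s(1)[of n]] by (simp add: right_diff_distrib)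
    then have "ennreal (cmod (?k * f g - ?I g)) \<le> ennreal (cmod (?k * f (\<lambda>t. g t - s n t)) + cmod (?I (\<lambda>t. g t - s n t)))"
      by (simp only: ennreal_leI[OF norm_triangle_ineq4])
    also have "\<dots> = ennreal (gconst TYPE('d)) * ennreal (cmod (f (\<lambda>t. g t - s n t))) + ennreal (cmod (?I (\<lambda>t. g t - s n t)))"
      using gconst_pos[where 'd='d] by (simp add: norm_mult ennreal_mult)
    also have "\<dots> \<le> ennreal (gconst TYPE('d)) * (ennreal C * M1_norm w (\<lambda>t. g t - s n t)) + ennreal C' * M1_norm w (\<lambda>t. g t - s n t)"
      by (intro add_mono mult_left_mono C(2)[OF dM] le[OF dM]) simp
    finally show ?thesis by (simp add: distrib_right mult.assoc)
  qed
  have "(\<lambda>n. (ennreal (gconst TYPE('d)) * ennreal C + ennreal C') * M1_norm w (\<lambda>t. g t - s n t)) \<longlonglongrightarrow> (ennreal (gconst TYPE('d)) * ennreal C + ennreal C') * 0"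
    by (intro ennreal_tendsto_cmult s) (simp add: ennreal_mult_less_top)
  then have "ennreal (cmod (?k * f g - ?I g)) \<le> 0"
    by (intro LIMSEQ_le_const[where X="\<lambda>n. (ennreal (gconst TYPE('d)) * ennreal C + ennreal C') * M1_norm w (\<lambda>t. g t - s n t)"]) (use bound in auto)
  then show ?thesis by (simp add: F_def)
qed

text \<open>The reproducing formula exhibits the transform with a general window as a parameter
  integral of measurable functions.\<close>

lemma STFT_measurable:
  fixes w :: "'d::finite phase \<Rightarrow> real"
  assumes f: "f \<in> M1_antidual w" and w: "submult_weight w" and \<phi>: "\<phi> \<in> M1_space w"
  shows "STFT \<phi> f \<in> borel_measurable borel"
proof -
  note [measurable] = STFT_gaussian_measurable[OF f submult_weight_exp_bounded[OF w]]
    square_integrableD[OF M1_space_square_integrable[OF \<phi>]]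
  have "STFT \<phi> f = (\<lambda>z. (LINT \<zeta>|lborel. STFT gaussian f \<zeta> * cnj (gabor (tf_shift z \<phi>) \<zeta>)) / of_real (gconst TYPE('d)))"
    using M1_antidual_reproducing[OF f w M1_space_tf_shift[OF w \<phi>]] gconst_pos[where 'd='d]
    by (simp add: STFT_def[of \<phi>] fun_eq_iff field_simps)
  moreover have "\<dots> \<in> borel_measurable borel" by measurable
  ultimately show ?thesis by simp
qed

lemma STFT_le_cnv:
  fixes w :: "'d::finite phase \<Rightarrow> real"
  assumes f: "f \<in> M1_antidual w" and w: "submult_weight w" and \<phi>: "\<phi> \<in> M1_space w"
  shows "ennreal (gconst TYPE('d)) * ennreal (cmod (STFT \<phi> f z))
    \<le> cnv (\<lambda>\<zeta>. ennreal (cmod (STFT gaussian f \<zeta>))) (\<lambda>\<zeta>. ennreal (cmod (gabor \<phi> (- \<zeta>)))) z"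
proof -
  note [measurable] = square_integrableD[OF M1_space_square_integrable[OF \<phi>]]
  have "ennreal (gconst TYPE('d)) * ennreal (cmod (STFT \<phi> f z)) = ennreal (cmod (of_real (gconst TYPE('d)) * f (tf_shift z \<phi>)))"
    using gconst_pos[where 'd='d] by (simp add: norm_mult ennreal_mult STFT_def)
  also have "\<dots> \<le> (\<integral>\<^sup>+ \<zeta>. ennreal (cmod (STFT gaussian f \<zeta> * cnj (gabor (tf_shift z \<phi>) \<zeta>))) \<partial>lborel)"
    unfolding M1_antidual_reproducing[OF f w M1_space_tf_shift[OF w \<phi>]] by (rule cmod_integral_le_nn_integral)
  also have "\<dots> = cnv (\<lambda>\<zeta>. ennreal (cmod (STFT gaussian f \<zeta>))) (\<lambda>\<zeta>. ennreal (cmod (gabor \<phi> (- \<zeta>)))) z"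
    unfolding cnv_def by (simp add: norm_mult ennreal_mult cmod_gabor_tf_shift)
  finally show ?thesis .
qed

section \<open>Integral operators dominated by convolution kernels\<close>

lemma wL1_reflect:
  fixes w :: "'a::euclidean_space \<Rightarrow> real"
  assumes [measurable]: "G \<in> borel_measurable borel" "w \<in> borel_measurable borel" and "\<And>z. w (- z) = w z"
  shows "(\<integral>\<^sup>+ z. G (- z) * ennreal (w z) \<partial>lborel) = (\<integral>\<^sup>+ z. G z * ennreal (w z) \<partial>lborel)"
  using nn_integral_lborel_reflect[of "\<lambda>z. G z * ennreal (w z)" 0] assms(3) by simp

definition gab :: "(real^'d::finite \<Rightarrow> complex) \<Rightarrow> 'd phase \<Rightarrow> ennreal" where
  "gab f z = ennreal (cmod (gabor f z))"

lemma gab_measurable [measurable]: "f \<in> borel_measurable borel \<Longrightarrow> gab f \<in> borel_measurable borel"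
  unfolding gab_def[abs_def] by measurable

text \<open>Majorant for three successive operations on f: analysis with \<open>\<phi>3\<close>,
  integration against a kernel H(z - y), synthesis with \<open>\<phi>2\<close>. The reflections
  bring \<open>gab \<phi>3 (\<zeta> - z)\<close> and \<open>H (z - y)\<close> into convolution
  form.\<close>

definition kernel_cnv :: "('d::finite phase \<Rightarrow> ennreal) \<Rightarrow> ('d phase \<Rightarrow> ennreal) \<Rightarrow> (real^'d \<Rightarrow> complex) \<Rightarrow> (real^'d \<Rightarrow> complex) \<Rightarrow> 'd phase \<Rightarrow> ennreal" where
  "kernel_cnv F H \<phi>2 \<phi>3 = cnv (cnv (cnv F (\<lambda>z. gab \<phi>3 (- z))) (\<lambda>z. H (- z))) (gab \<phi>2)"

lemma tf_shift_0 [simp]: "tf_shift 0 f = f"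
  by (simp add: tf_shift_def fun_eq_iff)

lemma M1_space_gabor_integrable:
  assumes f: "f \<in> square_integrable" and w: "\<And>z. 1 \<le> w z" "w \<in> borel_measurable borel" and fin: "M1_norm w f < top"
  shows "integrable lborel (gabor f)"
proof (rule integrableI_bounded)
  note [measurable] = square_integrableD[OF f] w(2)
  show "gabor f \<in> borel_measurable lborel" by measurable
  have "(\<integral>\<^sup>+ z. ennreal (norm (gabor f z)) \<partial>lborel) \<le> (\<integral>\<^sup>+ z. ennreal (cmod (gabor f z)) * ennreal (w z) \<partial>lborel)"
  proof (rule nn_integral_mono)
    fix z
    have "ennreal (norm (gabor f z)) * ennreal 1 \<le> ennreal (cmod (gabor f z)) * ennreal (w z)"
      by (intro mult_left_mono ennreal_leI w) simp
    then show "ennreal (norm (gabor f z)) \<le> ennreal (cmod (gabor f z)) * ennreal (w z)" by simp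
  qed
  then show "(\<integral>\<^sup>+ z. ennreal (norm (gabor f z)) \<partial>lborel) < \<infinity>"
    using fin by (simp add: M1_norm_eq)
qed

text \<open>The two factors kappa pay for expressing \<open>STFT \<phi>3 f\<close> and the bracket
  with \<open>\<phi>2\<close> by Gaussian transforms; the rest is Tonelli. Keeping them on the left
  avoids division in \<open>ennreal\<close>.\<close>

lemma kernel_pairing_le:
  fixes w :: "'d::finite phase \<Rightarrow> real"
  assumes f: "f \<in> M1_antidual w" and w: "submult_weight w"
    and \<phi>2: "\<phi>2 \<in> square_integrable" "integrable lborel (gabor \<phi>2)" and \<phi>3: "\<phi>3 \<in> M1_space w"
    and g: "g \<in> square_integrable" and [measurable]: "H \<in> borel_measurable borel"
  shows "ennreal (gconst TYPE('d)) * ennreal (gconst TYPE('d)) *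
      (\<integral>\<^sup>+ y. \<integral>\<^sup>+ z. H (z - y) * ennreal (cmod (STFT \<phi>3 f z)) * ennreal (cmod (L2_bracket (tf_shift y \<phi>2) g)) \<partial>lborel \<partial>lborel)
    \<le> (\<integral>\<^sup>+ \<zeta>. gab g \<zeta> * kernel_cnv (\<lambda>z. ennreal (cmod (STFT gaussian f z))) H \<phi>2 \<phi>3 \<zeta> \<partial>lborel)"
proof -
  note sq3 = M1_space_square_integrable[OF \<phi>3]
  note [measurable] = STFT_gaussian_measurable[OF f submult_weight_exp_bounded[OF w]] STFT_measurable[OF f w \<phi>3]
    square_integrableD[OF \<phi>2(1)] square_integrableD[OF sq3] square_integrableD[OF g]
  let ?k = "ennreal (gconst TYPE('d))"
  define T where "T = cnv (\<lambda>z. ennreal (cmod (STFT gaussian f z))) (\<lambda>z. gab \<phi>3 (- z))"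
  have [measurable]: "T \<in> borel_measurable borel" unfolding T_def by measurable
  define U where "U y = (\<integral>\<^sup>+ \<zeta>. gab \<phi>2 (\<zeta> - y) * gab g \<zeta> \<partial>lborel)" for y
  have [measurable]: "U \<in> borel_measurable borel" unfolding U_def by measurable
  have T: "?k * ennreal (cmod (STFT \<phi>3 f z)) \<le> T z" for z
    unfolding T_def gab_def by (rule STFT_le_cnv[OF f w \<phi>3])
  have U: "?k * ennreal (cmod (L2_bracket (tf_shift y \<phi>2) g)) \<le> U y" for y
    using cmod_L2_bracket_le[OF \<phi>2 g, of y 0] by (simp add: U_def gab_def)
  have [measurable]: "(\<lambda>(y, z). H (z - y) * ennreal (cmod (STFT \<phi>3 f z)) * ennreal (cmod (L2_bracket (tf_shift y \<phi>2) g))) \<in> borel_measurable (borel \<Otimes>\<^sub>M borel)"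
    by measurable
  have "?k * ?k * (\<integral>\<^sup>+ y. \<integral>\<^sup>+ z. H (z - y) * ennreal (cmod (STFT \<phi>3 f z)) * ennreal (cmod (L2_bracket (tf_shift y \<phi>2) g)) \<partial>lborel \<partial>lborel)
    = (\<integral>\<^sup>+ y. \<integral>\<^sup>+ z. H (z - y) * (?k * ennreal (cmod (STFT \<phi>3 f z))) * (?k * ennreal (cmod (L2_bracket (tf_shift y \<phi>2) g))) \<partial>lborel \<partial>lborel)"
    by (simp add: nn_integral_cmult[symmetric] mult_ac)
  also have "\<dots> \<le> (\<integral>\<^sup>+ y. \<integral>\<^sup>+ z. H (z - y) * T z * U y \<partial>lborel \<partial>lborel)"
    by (intro nn_integral_mono mult_mono T U) auto
  also have "\<dots> = (\<integral>\<^sup>+ y. cnv T (\<lambda>z. H (- z)) y * U y \<partial>lborel)"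
    unfolding cnv_def by (intro nn_integral_cong, subst nn_integral_multc[symmetric]) (simp_all add: mult_ac)
  also have "\<dots> = (\<integral>\<^sup>+ y. \<integral>\<^sup>+ \<zeta>. cnv T (\<lambda>z. H (- z)) y * (gab \<phi>2 (\<zeta> - y) * gab g \<zeta>) \<partial>lborel \<partial>lborel)"
    unfolding U_def by (intro nn_integral_cong nn_integral_cmult[symmetric]) measurable
  also have "\<dots> = (\<integral>\<^sup>+ \<zeta>. \<integral>\<^sup>+ y. cnv T (\<lambda>z. H (- z)) y * (gab \<phi>2 (\<zeta> - y) * gab g \<zeta>) \<partial>lborel \<partial>lborel)"
    by (rule lborel_pair.Fubini') measurable
  also have "\<dots> = (\<integral>\<^sup>+ \<zeta>. gab g \<zeta> * cnv (cnv T (\<lambda>z. H (- z))) (gab \<phi>2) \<zeta> \<partial>lborel)"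
    unfolding cnv_def[of "cnv T _"] by (intro nn_integral_cong, subst nn_integral_cmult[symmetric]) (simp_all add: mult_ac)
  finally show ?thesis unfolding kernel_cnv_def T_def .
qed

lemma kernel_cnv_measurable [measurable]:
  assumes [measurable]: "F \<in> borel_measurable borel" "H \<in> borel_measurable borel" "\<phi>2 \<in> borel_measurable borel" "\<phi>3 \<in> borel_measurable borel"
  shows "kernel_cnv F H \<phi>2 \<phi>3 \<in> borel_measurable borel"
  unfolding kernel_cnv_def by measurable

text \<open>Young's inequality once for each of the three convolutions, hence C^3. Each convolution
  is first commuted so that the factor in L^1_w comes first.\<close>

lemma kernel_cnv_Lpq:
  fixes \<mu> w :: "'d::finite phase \<Rightarrow> real"
  assumes p: "1 \<le> p" "1 \<le> q" and [measurable]: "F \<in> borel_measurable borel" "H \<in> borel_measurable borel"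
    "\<phi>2 \<in> borel_measurable borel" "\<phi>3 \<in> borel_measurable borel" "\<mu> \<in> borel_measurable borel"
    and w: "submult_weight w"
    and C: "0 \<le> C" "\<And>z. 0 \<le> \<mu> z" "\<And>x y. \<mu> (x + y) \<le> C * w x * \<mu> y"
  shows "Lpq_enorm p q (\<lambda>z. kernel_cnv F H \<phi>2 \<phi>3 z * ennreal (\<mu> z))
    \<le> ennreal (C ^ 3) * M1_norm w \<phi>2 * (\<integral>\<^sup>+ z. H z * ennreal (w z) \<partial>lborel) * M1_norm w \<phi>3 * Lpq_enorm p q (\<lambda>z. F z * ennreal (\<mu> z))"
proof -
  note [measurable] = submult_weightD(1)[OF w]
  have w0: "0 \<le> w z" for z using submult_weightD(2)[OF w, of z] by simp
  note young = cnv_Lpq_enorm[where \<mu>=\<mu> and w=w and C=C, OF p _ _ _ _ C(1) w0 C(2,3)]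
  define T where "T = cnv F (\<lambda>z. gab \<phi>3 (- z))"
  have [measurable]: "T \<in> borel_measurable borel" unfolding T_def by measurable
  define S where "S = cnv T (\<lambda>z. H (- z))"
  have [measurable]: "S \<in> borel_measurable borel" unfolding S_def by measurable
  have [measurable]: "(\<lambda>z. H (- z)) \<in> borel_measurable borel" "(\<lambda>z. gab \<phi>3 (- z)) \<in> borel_measurable borel" by measurable
  have M: "(\<integral>\<^sup>+ z. gab \<phi> z * ennreal (w z) \<partial>lborel) = M1_norm w \<phi>" if "\<phi> \<in> borel_measurable borel" for \<phi>
    using that by (simp add: M1_norm_eq gab_def)
  have 1: "Lpq_enorm p q (\<lambda>z. T z * ennreal (\<mu> z)) \<le> ennreal C * M1_norm w \<phi>3 * Lpq_enorm p q (\<lambda>z. F z * ennreal (\<mu> z))"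
  proof -
    have "T = cnv (\<lambda>z. gab \<phi>3 (- z)) F" unfolding T_def by (intro ext cnv_commute) measurable
    then have "Lpq_enorm p q (\<lambda>z. T z * ennreal (\<mu> z)) \<le> ennreal C * (\<integral>\<^sup>+ z. gab \<phi>3 (- z) * ennreal (w z) \<partial>lborel) * Lpq_enorm p q (\<lambda>z. F z * ennreal (\<mu> z))"
      by (simp only:) (rule young, measurable)
    then show ?thesis by (simp add: wL1_reflect submult_weightD(3)[OF w] M)
  qed
  have 2: "Lpq_enorm p q (\<lambda>z. S z * ennreal (\<mu> z)) \<le> ennreal C * (\<integral>\<^sup>+ z. H z * ennreal (w z) \<partial>lborel) * Lpq_enorm p q (\<lambda>z. T z * ennreal (\<mu> z))"
  proof -
    have "S = cnv (\<lambda>z. H (- z)) T" unfolding S_def by (intro ext cnv_commute) measurable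
    then have "Lpq_enorm p q (\<lambda>z. S z * ennreal (\<mu> z)) \<le> ennreal C * (\<integral>\<^sup>+ z. H (- z) * ennreal (w z) \<partial>lborel) * Lpq_enorm p q (\<lambda>z. T z * ennreal (\<mu> z))"
      by (simp only:) (rule young, measurable)
    then show ?thesis by (simp add: wL1_reflect submult_weightD(3)[OF w])
  qed
  have 3: "Lpq_enorm p q (\<lambda>z. kernel_cnv F H \<phi>2 \<phi>3 z * ennreal (\<mu> z)) \<le> ennreal C * M1_norm w \<phi>2 * Lpq_enorm p q (\<lambda>z. S z * ennreal (\<mu> z))"
  proof -
    have "kernel_cnv F H \<phi>2 \<phi>3 = cnv (gab \<phi>2) S" unfolding kernel_cnv_def S_def T_def by (intro ext cnv_commute) measurable
    then have "Lpq_enorm p q (\<lambda>z. kernel_cnv F H \<phi>2 \<phi>3 z * ennreal (\<mu> z)) \<le> ennreal C * (\<integral>\<^sup>+ z. gab \<phi>2 z * ennreal (w z) \<partial>lborel) * Lpq_enorm p q (\<lambda>z. S z * ennreal (\<mu> z))"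
      by (simp only:) (rule young, measurable)
    then show ?thesis by (simp add: M)
  qed
  have "Lpq_enorm p q (\<lambda>z. kernel_cnv F H \<phi>2 \<phi>3 z * ennreal (\<mu> z)) \<le> ennreal C * M1_norm w \<phi>2 *
      (ennreal C * (\<integral>\<^sup>+ z. H z * ennreal (w z) \<partial>lborel) * (ennreal C * M1_norm w \<phi>3 * Lpq_enorm p q (\<lambda>z. F z * ennreal (\<mu> z))))"
    by (rule order_trans[OF 3 mult_left_mono[OF order_trans[OF 2 mult_left_mono[OF 1]]]]) auto
  also have "\<dots> = ennreal (C ^ 3) * M1_norm w \<phi>2 * (\<integral>\<^sup>+ z. H z * ennreal (w z) \<partial>lborel) * M1_norm w \<phi>3 * Lpq_enorm p q (\<lambda>z. F z * ennreal (\<mu> z))"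
  proof -
    have "ennreal (C ^ 3) = ennreal C * (ennreal C * ennreal C)"
      using C(1) by (simp add: power3_eq_cube ennreal_mult mult.assoc)
    then show ?thesis by (simp only: mult_ac)
  qed
  finally show ?thesis .
qed

text \<open>The companion for arbitrary functionals in the antidual: growth like w survives all
  three convolutions. It gives absolute convergence before any mixed norm is considered.\<close>

lemma kernel_cnv_le_weight:
  fixes w :: "'d::finite phase \<Rightarrow> real"
  assumes [measurable]: "F \<in> borel_measurable borel" "H \<in> borel_measurable borel"
    "\<phi>2 \<in> borel_measurable borel" "\<phi>3 \<in> borel_measurable borel"
    and w: "submult_weight w" and F: "\<And>z. F z \<le> K * ennreal (w z)"
  shows "kernel_cnv F H \<phi>2 \<phi>3 z \<le> K * M1_norm w \<phi>3 * (\<integral>\<^sup>+ z. H z * ennreal (w z) \<partial>lborel) * M1_norm w \<phi>2 * ennreal (w z)"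
proof -
  note [measurable] = submult_weightD(1)[OF w]
  have w0: "0 \<le> w z" for z using submult_weightD(2)[OF w, of z] by simp
  note cw = cnv_le_weight[where w=w, OF _ _ _ w0 submult_weightD(4)[OF w] submult_weightD(3)[OF w]]
  have M: "(\<integral>\<^sup>+ z. gab \<phi> z * ennreal (w z) \<partial>lborel) = M1_norm w \<phi>" if "\<phi> \<in> borel_measurable borel" for \<phi>
    using that by (simp add: M1_norm_eq gab_def)
  have "cnv F (\<lambda>z. gab \<phi>3 (- z)) z \<le> K * (\<integral>\<^sup>+ z. gab \<phi>3 (- z) * ennreal (w z) \<partial>lborel) * ennreal (w z)" for z
    by (rule cw) (use F in measurable)
  then have 1: "cnv F (\<lambda>z. gab \<phi>3 (- z)) z \<le> K * M1_norm w \<phi>3 * ennreal (w z)" for z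
    by (simp add: wL1_reflect submult_weightD(3)[OF w] M)
  have "cnv (cnv F (\<lambda>z. gab \<phi>3 (- z))) (\<lambda>z. H (- z)) z \<le> K * M1_norm w \<phi>3 * (\<integral>\<^sup>+ z. H (- z) * ennreal (w z) \<partial>lborel) * ennreal (w z)" for z
    by (rule cw) (use 1 in measurable)
  then have 2: "cnv (cnv F (\<lambda>z. gab \<phi>3 (- z))) (\<lambda>z. H (- z)) z \<le> K * M1_norm w \<phi>3 * (\<integral>\<^sup>+ z. H z * ennreal (w z) \<partial>lborel) * ennreal (w z)" for z
    by (simp add: wL1_reflect submult_weightD(3)[OF w])
  have "kernel_cnv F H \<phi>2 \<phi>3 z \<le> K * M1_norm w \<phi>3 * (\<integral>\<^sup>+ z. H z * ennreal (w z) \<partial>lborel) * (\<integral>\<^sup>+ z. gab \<phi>2 z * ennreal (w z) \<partial>lborel) * ennreal (w z)"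
    unfolding kernel_cnv_def by (rule cw) (use 2 in measurable)
  then show ?thesis by (simp add: M)
qed

section \<open>Estimates for the Taylor remainder\<close>

lemma AE_lborel_affine:
  fixes b :: "'a::euclidean_space"
  assumes [measurable]: "Measurable.pred borel P" and "AE x in lborel. P x" and c: "c \<noteq> 0"
  shows "AE x in lborel. P (b + c *\<^sub>R x)"
proof -
  have eq: "density (distr lborel borel (\<lambda>x. b + c *\<^sub>R x)) (\<lambda>_. ennreal (\<bar>c\<bar> ^ DIM('a))) = lborel"
    by (rule lborel_affine[OF c, symmetric])
  have "AE x in density (distr lborel borel (\<lambda>x. b + c *\<^sub>R x)) (\<lambda>_. ennreal (\<bar>c\<bar> ^ DIM('a))). P x"
    unfolding eq by (rule assms(2))
  then have "AE x in distr lborel borel (\<lambda>x. b + c *\<^sub>R x). 0 < ennreal (\<bar>c\<bar> ^ DIM('a)) \<longrightarrow> P x"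
    by (subst (asm) AE_density) simp_all
  then show ?thesis using c by (subst (asm) AE_distr_iff) simp_all
qed

text \<open>For fixed z and t other than 1, y -> y + t(z - y) is an invertible affine map, so it
  pulls null sets back to null sets. Exchanging the almost-everywhere quantifiers over t, z and y
  then gives almost every point of almost every segment; the value t = 1 is itself
  negligible.\<close>

lemma AE_segment:
  fixes P :: "'a::euclidean_space \<Rightarrow> bool"
  assumes P[measurable]: "Measurable.pred borel P" and "AE x in lborel. P x"
  shows "AE (y, z) in lborel. AE t in lborel. P (y + t *\<^sub>R (z - y))"
proof -
  have [measurable]: "Measurable.pred ((lborel \<Otimes>\<^sub>M lborel) \<Otimes>\<^sub>M lborel) (\<lambda>((y, z), t::real). P (y + t *\<^sub>R (z - y)))"
    unfolding case_prod_beta' by (rule measurable_compose[OF _ P]) measurable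
  have "AE t::real in lborel. AE z in lborel. AE y in lborel. P (y + t *\<^sub>R (z - y))"
    using AE_lborel_singleton[of "1::real"]
  proof eventually_elim
    case (elim t)
    have "AE y in lborel. P (y + t *\<^sub>R (z - y))" for z
    proof -
      have "AE y in lborel. P (t *\<^sub>R z + (1 - t) *\<^sub>R y)"
        using elim by (intro AE_lborel_affine[OF P assms(2)]) auto
      then show ?thesis by (simp add: algebra_simps)
    qed
    then show ?case by (rule AE_I2)
  qed
  then have "AE t::real in lborel. AE y in lborel. AE z in lborel. P (y + t *\<^sub>R (z - y))"
  proof eventually_elim
    case (elim t)
    then show ?case by (subst lborel_pair.AE_commute) measurable
  qed
  then have "AE t::real in lborel. AE yz in (lborel \<Otimes>\<^sub>M lborel). P (fst yz + t *\<^sub>R (snd yz - fst yz))"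
  proof eventually_elim
    case (elim t)
    have [measurable]: "Measurable.pred (lborel \<Otimes>\<^sub>M lborel) (\<lambda>yz. P (fst yz + t *\<^sub>R (snd yz - fst yz)))"
      by (rule measurable_compose[OF _ P]) measurable
    show ?case
      by (rule lborel_pair.AE_pair_measure) (measurable, use elim in simp)
  qed
  then have "AE t::real in lborel. AE yz in (lborel :: ('a \<times> 'a) measure). P (fst yz + t *\<^sub>R (snd yz - fst yz))"
    unfolding lborel_prod .
  moreover have "{x \<in> space ((lborel :: ('a \<times> 'a) measure) \<Otimes>\<^sub>M (lborel :: real measure)). P (fst (fst x) + snd x *\<^sub>R (snd (fst x) - fst (fst x)))}
      \<in> sets ((lborel :: ('a \<times> 'a) measure) \<Otimes>\<^sub>M (lborel :: real measure))"
  proof -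
    have [measurable]: "Measurable.pred ((lborel :: ('a \<times> 'a) measure) \<Otimes>\<^sub>M (lborel :: real measure)) (\<lambda>x. P (fst (fst x) + snd x *\<^sub>R (snd (fst x) - fst (fst x))))"
      by (rule measurable_compose[OF _ P]) measurable
    show ?thesis by measurable
  qed
  ultimately have "AE yz in (lborel :: ('a \<times> 'a) measure). AE t::real in lborel. P (fst yz + t *\<^sub>R (snd yz - fst yz))"
    using lborel_pair.AE_commute[of "\<lambda>yz (t::real). P (fst yz + t *\<^sub>R (snd yz - fst yz))"] by simp
  then show ?thesis by (simp add: case_prod_beta')
qed

lemma abs_multi_power_le:
  assumes "\<alpha> \<in> multi_indices N" shows "\<bar>multi_power (z :: 'a::euclidean_space) \<alpha>\<bar> \<le> norm z ^ N"
proof -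
  have "\<bar>multi_power z \<alpha>\<bar> = (\<Prod>i\<in>Basis. \<bar>z \<bullet> i\<bar> ^ \<alpha> i)" by (simp add: multi_power_def abs_prod power_abs)
  also have "\<dots> \<le> (\<Prod>i\<in>Basis. norm z ^ \<alpha> i)"
    by (intro prod_mono conjI power_mono Basis_le_norm) auto
  also have "\<dots> = norm z ^ sum \<alpha> Basis" by (rule power_sum[symmetric])
  finally show ?thesis using assms by (simp add: multi_indices_def)
qed

lemma multi_fact_pos: "0 < multi_fact \<alpha>"
  unfolding multi_fact_def by (intro prod_pos) auto

lemma multi_power_measurable [measurable]: "(\<lambda>z. multi_power z \<alpha>) \<in> borel_measurable borel"
  unfolding multi_power_def by measurable

lemma taylor_remainder_measurable:
  fixes B :: "('a::euclidean_space \<Rightarrow> nat) \<Rightarrow> 'a \<Rightarrow> complex"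
  assumes B: "\<And>\<alpha>. \<alpha> \<in> multi_indices N \<Longrightarrow> B \<alpha> \<in> borel_measurable borel"
  shows "(\<lambda>(y, z). taylor_remainder N B y z) \<in> borel_measurable (borel \<Otimes>\<^sub>M borel)"
proof -
  have m: "(\<lambda>x. (LINT t:{0..1}|lborel. taylor_integrand N (B \<alpha>) (fst x) (snd x) t) * complex_of_real (multi_power (snd x - fst x) \<alpha> / multi_fact \<alpha>))
      \<in> borel_measurable (borel \<Otimes>\<^sub>M borel)" if "\<alpha> \<in> multi_indices N" for \<alpha>
  proof -
    note [measurable] = B[OF that]
    have [measurable]: "(\<lambda>x. multi_power (snd x - fst x) \<alpha>) \<in> borel_measurable (borel \<Otimes>\<^sub>M (borel :: 'a measure))"
      by (rule measurable_compose[OF _ multi_power_measurable]) measurable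
    show ?thesis unfolding taylor_integrand_def set_lebesgue_integral_def by measurable
  qed
  show ?thesis unfolding taylor_remainder_def case_prod_beta'
    by (intro borel_measurable_times borel_measurable_const borel_measurable_sum m)
qed

text \<open>Up to constants and |z - y|^N this bounds |b_N(y,z)| m(y). The weight m already stands
  at the point where the derivative is evaluated, so bounds for |B alpha| m along the segment can be
  inserted; the factor v(t(z - y)) is the price of moving it.\<close>

definition taylor_kernel ::
  "nat \<Rightarrow> (('a::euclidean_space \<Rightarrow> nat) \<Rightarrow> 'a \<Rightarrow> complex) \<Rightarrow> ('a \<Rightarrow> real) \<Rightarrow> ('a \<Rightarrow> real) \<Rightarrow> 'a \<Rightarrow> 'a \<Rightarrow> ennreal" where
  "taylor_kernel N B m v y z = (\<Sum>\<alpha>\<in>multi_indices N. ennreal (1 / multi_fact \<alpha>) *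
     (\<integral>\<^sup>+ t. ennreal (cmod (B \<alpha> (y + t *\<^sub>R (z - y))) * m (y + t *\<^sub>R (z - y))) * ennreal (v (t *\<^sub>R (z - y))) * indicator {0..1} t \<partial>lborel))"

text \<open>Moderateness with the increment -t(z - y) and evenness of v move m from y to the
  evaluation point, and (1 - t)^(N-1) <= 1.\<close>

lemma taylor_integrand_bound:
  fixes m v :: "'d::finite phase \<Rightarrow> real"
  assumes v: "submult_weight v" and m: "m \<in> moderate_weights v"
    and C: "0 \<le> C" "\<And>z1 z2. m (z1 + z2) \<le> C * v z1 * m z2"
    and t: "t \<in> {0..1}"
  shows "ennreal (cmod (taylor_integrand N F y z t)) * ennreal (m y)
    \<le> ennreal C * (ennreal (cmod (F (y + t *\<^sub>R (z - y))) * m (y + t *\<^sub>R (z - y))) * ennreal (v (t *\<^sub>R (z - y))))"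
proof -
  let ?x = "y + t *\<^sub>R (z - y)"
  have mpos: "0 < m x" for x using m unfolding moderate_weights_def by blast
  have "m y \<le> C * v (t *\<^sub>R (z - y)) * m ?x"
    using C(2)[of "- (t *\<^sub>R (z - y))" ?x] submult_weightD(3)[OF v, of "t *\<^sub>R (z - y)"] by simp
  moreover have "cmod (taylor_integrand N F y z t) \<le> cmod (F ?x)"
  proof -
    have "(1 - t) ^ (N - 1) \<le> 1" using t by (intro power_le_one) auto
    moreover have "0 \<le> (1 - t) ^ (N - 1)" using t by simp
    ultimately show ?thesis unfolding taylor_integrand_def norm_mult norm_of_real
      by (simp only: abs_of_nonneg mult_left_le_one_le norm_ge_zero)
  qed
  ultimately have "cmod (taylor_integrand N F y z t) * m y \<le> cmod (F ?x) * (C * v (t *\<^sub>R (z - y)) * m ?x)"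
    using mpos[of y] by (intro mult_mono) auto
  then have "ennreal (cmod (taylor_integrand N F y z t) * m y) \<le> ennreal (C * ((cmod (F ?x) * m ?x) * v (t *\<^sub>R (z - y))))"
    by (intro ennreal_leI) (simp add: mult_ac)
  then show ?thesis using C(1) mpos[of y] mpos[of ?x] submult_weightD(2)[OF v, of "t *\<^sub>R (z - y)"]
    by (simp add: ennreal_mult mult_nonneg_nonneg less_imp_le)
qed

lemma taylor_remainder_le:
  fixes m v :: "'d::finite phase \<Rightarrow> real"
  assumes v: "submult_weight v" and m: "m \<in> moderate_weights v"
    and C: "0 \<le> C" "\<And>z1 z2. m (z1 + z2) \<le> C * v z1 * m z2"
    and B: "\<And>\<alpha>. \<alpha> \<in> multi_indices N \<Longrightarrow> B \<alpha> \<in> borel_measurable borel"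
  shows "ennreal (cmod (taylor_remainder N B y z)) * ennreal (m y)
    \<le> ennreal (real N * C) * taylor_kernel N B m v y z * ennreal (norm (z - y) ^ N)"
proof -
  have mpos: "0 < m x" for x using m unfolding moderate_weights_def by blast
  have [measurable]: "m \<in> borel_measurable borel" using m by (auto simp: moderate_weights_def)
  note [measurable] = submult_weightD(1)[OF v]
  define J where "J \<alpha> = (\<integral>\<^sup>+ t. ennreal (cmod (B \<alpha> (y + t *\<^sub>R (z - y))) * m (y + t *\<^sub>R (z - y))) * ennreal (v (t *\<^sub>R (z - y))) * indicator {0..1} t \<partial>lborel)" for \<alpha>
  define I where "I \<alpha> = (LINT t:{0..1}|lborel. taylor_integrand N (B \<alpha>) y z t)" for \<alpha>
  have I: "ennreal (cmod (I \<alpha>)) * ennreal (m y) \<le> ennreal C * J \<alpha>" if "\<alpha> \<in> multi_indices N" for \<alpha>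
  proof -
    note [measurable] = B[OF that]
    have "ennreal (cmod (I \<alpha>)) * ennreal (m y) \<le> (\<integral>\<^sup>+ t. ennreal (cmod (indicator {0..1} t *\<^sub>R taylor_integrand N (B \<alpha>) y z t)) \<partial>lborel) * ennreal (m y)"
      unfolding I_def set_lebesgue_integral_def by (intro mult_right_mono cmod_integral_le_nn_integral) simp
    also have "\<dots> = (\<integral>\<^sup>+ t. ennreal (cmod (indicator {0..1} t *\<^sub>R taylor_integrand N (B \<alpha>) y z t)) * ennreal (m y) \<partial>lborel)"
      unfolding taylor_integrand_def by (rule nn_integral_multc[symmetric]) measurable
    also have "\<dots> \<le> (\<integral>\<^sup>+ t. ennreal C * (ennreal (cmod (B \<alpha> (y + t *\<^sub>R (z - y))) * m (y + t *\<^sub>R (z - y))) * ennreal (v (t *\<^sub>R (z - y))) * indicator {0..1} t) \<partial>lborel)"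
      using taylor_integrand_bound[OF v m C, of _ N "B \<alpha>" y z]
      by (intro nn_integral_mono) (auto simp: indicator_def)
    also have "\<dots> = ennreal C * J \<alpha>" unfolding J_def by (rule nn_integral_cmult) measurable
    finally show ?thesis .
  qed
  have "cmod (taylor_remainder N B y z) \<le> real N * (\<Sum>\<alpha>\<in>multi_indices N. cmod (I \<alpha>) * (norm (z - y) ^ N * (1 / multi_fact \<alpha>)))"
  proof -
    have "cmod (\<Sum>\<alpha>\<in>multi_indices N. I \<alpha> * of_real (multi_power (z - y) \<alpha> / multi_fact \<alpha>))
      \<le> (\<Sum>\<alpha>\<in>multi_indices N. cmod (I \<alpha>) * (norm (z - y) ^ N * (1 / multi_fact \<alpha>)))"
    proof (rule sum_norm_le)
      fix \<alpha> :: "'d phase \<Rightarrow> nat" assume "\<alpha> \<in> multi_indices N"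
      then show "cmod (I \<alpha> * of_real (multi_power (z - y) \<alpha> / multi_fact \<alpha>)) \<le> cmod (I \<alpha>) * (norm (z - y) ^ N * (1 / multi_fact \<alpha>))"
        using abs_multi_power_le[of \<alpha> N "z - y"] multi_fact_pos[of \<alpha>]
        by (simp add: norm_mult norm_divide divide_right_mono mult_left_mono)
    qed
    then show ?thesis unfolding taylor_remainder_def I_def by (simp add: norm_mult mult_left_mono)
  qed
  then have "ennreal (cmod (taylor_remainder N B y z)) * ennreal (m y)
      \<le> ennreal (real N * (\<Sum>\<alpha>\<in>multi_indices N. cmod (I \<alpha>) * (norm (z - y) ^ N * (1 / multi_fact \<alpha>)))) * ennreal (m y)"
    by (intro mult_right_mono ennreal_leI) simp_all
  also have "\<dots> = ennreal (real N) * (\<Sum>\<alpha>\<in>multi_indices N. ennreal (cmod (I \<alpha>)) * (ennreal (norm (z - y) ^ N) * ennreal (1 / multi_fact \<alpha>))) * ennreal (m y)"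
  proof -
    have nn: "0 \<le> cmod (I \<alpha>) * (norm (z - y) ^ N * (1 / multi_fact \<alpha>))" for \<alpha>
      using multi_fact_pos[of \<alpha>] by simp
    have "ennreal (\<Sum>\<alpha>\<in>multi_indices N. cmod (I \<alpha>) * (norm (z - y) ^ N * (1 / multi_fact \<alpha>)))
        = (\<Sum>\<alpha>\<in>multi_indices N. ennreal (cmod (I \<alpha>) * (norm (z - y) ^ N * (1 / multi_fact \<alpha>))))"
      by (rule sum_ennreal[symmetric]) (rule nn)
    also have "\<dots> = (\<Sum>\<alpha>\<in>multi_indices N. ennreal (cmod (I \<alpha>)) * (ennreal (norm (z - y) ^ N) * ennreal (1 / multi_fact \<alpha>)))"
      by (simp only: ennreal_mult' norm_ge_zero zero_le_power)
    finally show ?thesis by (simp only: ennreal_mult' of_nat_0_le_iff)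
  qed
  also have "\<dots> = ennreal (real N) * ennreal (norm (z - y) ^ N) * (\<Sum>\<alpha>\<in>multi_indices N. ennreal (1 / multi_fact \<alpha>) * (ennreal (cmod (I \<alpha>)) * ennreal (m y)))"
    by (simp add: sum_distrib_left sum_distrib_right mult_ac)
  also have "\<dots> \<le> ennreal (real N) * ennreal (norm (z - y) ^ N) * (\<Sum>\<alpha>\<in>multi_indices N. ennreal (1 / multi_fact \<alpha>) * (ennreal C * J \<alpha>))"
    by (intro mult_left_mono sum_mono I) simp_all
  also have "\<dots> = ennreal (real N * C) * taylor_kernel N B m v y z * ennreal (norm (z - y) ^ N)"
  proof -
    have "taylor_kernel N B m v y z = (\<Sum>\<alpha>\<in>multi_indices N. ennreal (1 / multi_fact \<alpha>) * J \<alpha>)"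
      by (simp only: taylor_kernel_def J_def)
    then show ?thesis using C(1) by (simp add: sum_distrib_left sum_distrib_right ennreal_mult mult_ac)
  qed
  finally show ?thesis .
qed

text \<open>Continuity of v makes the Bochner integral in \<open>submult_weight\<close> a genuine
  one, so its bound transfers to the nonnegative integral.\<close>

lemma submult_weight_segment:
  assumes v: "submult_weight v"
  obtains C where "0 \<le> C" "\<And>x. (\<integral>\<^sup>+ t. ennreal (v (t *\<^sub>R x)) * indicator {0..1} t \<partial>lborel) \<le> ennreal (C * v x)"
proof -
  obtain C where C: "\<And>z. (LINT t:{0..1}|lborel. v (t *\<^sub>R z)) \<le> C * v z"
    using v unfolding submult_weight_def by blast
  have v0: "0 \<le> v z" for z using submult_weightD(2)[OF v, of z] by simp
  show ?thesis
  proof (rule that[of "max 0 C"])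
    fix x
    have "continuous_on {0..1} (\<lambda>t::real. v (t *\<^sub>R x))"
      using v unfolding submult_weight_def
      by (auto intro!: continuous_on_compose2[of UNIV v] continuous_intros)
    then have "set_integrable lborel {0..1} (\<lambda>t::real. v (t *\<^sub>R x))" by (rule borel_integrable_atLeastAtMost')
    then have "(\<integral>\<^sup>+ t. ennreal (indicator {0..1} t *\<^sub>R v (t *\<^sub>R x)) \<partial>lborel) = ennreal (LINT t:{0..1}|lborel. v (t *\<^sub>R x))"
      unfolding set_integrable_def set_lebesgue_integral_def using v0 by (intro nn_integral_eq_integral) auto
    also have "\<dots> \<le> ennreal (max 0 C * v x)"
      using C[of x] mult_right_mono[OF _ v0, of C "max 0 C" x] by (intro ennreal_leI) auto
    also have "(\<lambda>t. ennreal (indicator {0..1} t *\<^sub>R v (t *\<^sub>R x))) = (\<lambda>t. ennreal (v (t *\<^sub>R x)) * indicator {0..1} t)"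
      by (auto simp: indicator_def)
    finally show "(\<integral>\<^sup>+ t. ennreal (v (t *\<^sub>R x)) * indicator {0..1} t \<partial>lborel) \<le> ennreal (max 0 C * v x)" .
  qed simp
qed

text \<open>\<open>L\<close> has to bound the derivatives only along this one segment. Hence the
  same lemma serves the uniform bound for boundedness and the refined bound for compactness.\<close>

lemma taylor_kernel_le:
  fixes m v :: "'d::finite phase \<Rightarrow> real"
  assumes v: "submult_weight v" and C: "\<And>x. (\<integral>\<^sup>+ t. ennreal (v (t *\<^sub>R x)) * indicator {0..1} t \<partial>lborel) \<le> ennreal (C * v x)"
    and L: "\<And>\<alpha>. \<alpha> \<in> multi_indices N \<Longrightarrow> AE t in lborel. t \<in> {0..1} \<longrightarrow> ennreal (cmod (B \<alpha> (y + t *\<^sub>R (z - y))) * m (y + t *\<^sub>R (z - y))) \<le> L \<alpha>"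
  shows "taylor_kernel N B m v y z \<le> ennreal (C * v (z - y)) * (\<Sum>\<alpha>\<in>multi_indices N. ennreal (1 / multi_fact \<alpha>) * L \<alpha>)"
proof -
  note [measurable] = submult_weightD(1)[OF v]
  have "taylor_kernel N B m v y z \<le> (\<Sum>\<alpha>\<in>multi_indices N. ennreal (1 / multi_fact \<alpha>) * (L \<alpha> * ennreal (C * v (z - y))))"
    unfolding taylor_kernel_def
  proof (intro sum_mono mult_left_mono)
    fix \<alpha> :: "'d phase \<Rightarrow> nat" assume "\<alpha> \<in> multi_indices N"
    have "(\<integral>\<^sup>+ t. ennreal (cmod (B \<alpha> (y + t *\<^sub>R (z - y))) * m (y + t *\<^sub>R (z - y))) * ennreal (v (t *\<^sub>R (z - y))) * indicator {0..1} t \<partial>lborel)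
      \<le> (\<integral>\<^sup>+ t. L \<alpha> * (ennreal (v (t *\<^sub>R (z - y))) * indicator {0..1} t) \<partial>lborel)"
      using L[OF \<open>\<alpha> \<in> multi_indices N\<close>]
      by (intro nn_integral_mono_AE) (auto elim!: eventually_mono simp: indicator_def intro: mult_right_mono)
    also have "\<dots> = L \<alpha> * (\<integral>\<^sup>+ t. ennreal (v (t *\<^sub>R (z - y))) * indicator {0..1} t \<partial>lborel)"
      by (rule nn_integral_cmult) measurable
    also have "\<dots> \<le> L \<alpha> * ennreal (C * v (z - y))" by (intro mult_left_mono C) simp
    finally show "(\<integral>\<^sup>+ t. ennreal (cmod (B \<alpha> (y + t *\<^sub>R (z - y))) * m (y + t *\<^sub>R (z - y))) * ennreal (v (t *\<^sub>R (z - y))) * indicator {0..1} t \<partial>lborel)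
      \<le> L \<alpha> * ennreal (C * v (z - y))" .
  qed simp
  then show ?thesis by (simp add: sum_distrib_left mult_ac)
qed

section \<open>Boundedness of the remainder operator\<close>

definition FF :: "((real^'d::finite \<Rightarrow> complex) \<Rightarrow> complex) \<Rightarrow> 'd phase \<Rightarrow> ennreal" where
  "FF f z = ennreal (cmod (STFT gaussian f z))"

text \<open>The constants attached to the weights are fixed here, before windows and symbols enter
  in \<open>remainder_op\<close>: the constant of the theorem has to be chosen before the
  latter.\<close>

locale remainder =
  fixes N :: nat and v w m \<mu> :: "'d::finite phase \<Rightarrow> real" and p q :: ennreal and Cm Cv C\<mu> :: real
  assumes v: "submult_weight v" and w: "submult_weight w"
    and m: "m \<in> moderate_weights v" and \<mu>: "\<mu> \<in> moderate_weights w"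
    and p: "1 \<le> p" and q: "1 \<le> q"
    and Cm: "0 \<le> Cm" "\<And>z1 z2. m (z1 + z2) \<le> Cm * v z1 * m z2"
    and Cv: "0 \<le> Cv" "\<And>x. (\<integral>\<^sup>+ t. ennreal (v (t *\<^sub>R x)) * indicator {0..1} t \<partial>lborel) \<le> ennreal (Cv * v x)"
    and C\<mu>: "0 \<le> C\<mu>" "\<And>z1 z2. \<mu> (z1 + z2) \<le> C\<mu> * w z1 * \<mu> z2"
begin

lemma pos [simp]: "0 < v z" "0 < w z" "0 < m z" "0 < \<mu> z" "0 \<le> v z" "0 \<le> w z" "0 \<le> m z" "0 \<le> \<mu> z"
proof -
  show "0 < v z" "0 < w z" using submult_weightD(2)[OF v] submult_weightD(2)[OF w] by simp_all
  show "0 < m z" "0 < \<mu> z" using m \<mu> unfolding moderate_weights_def by blast+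
  then show "0 \<le> v z" "0 \<le> w z" "0 \<le> m z" "0 \<le> \<mu> z"
    using \<open>0 < v z\<close> \<open>0 < w z\<close> by simp_all
qed

lemma weights_measurable [measurable]:
  "v \<in> borel_measurable borel" "w \<in> borel_measurable borel" "m \<in> borel_measurable borel" "\<mu> \<in> borel_measurable borel"
  using submult_weightD(1)[OF v] submult_weightD(1)[OF w] m \<mu> unfolding moderate_weights_def by blast+

lemma w_exp: "exp_bounded w"
  by (rule submult_weight_exp_bounded[OF w])

definition u :: "'d phase \<Rightarrow> real" where
  "u z = w z * v z * japanese_bracket z ^ N"

lemma u_exp: "exp_bounded u"
  unfolding u_def[abs_def]
  by (intro exp_bounded_mult exp_bounded_power exp_bounded_japanese_bracket submult_weight_exp_bounded v w)

lemma japanese_bracket_ge: "1 \<le> japanese_bracket z" "norm z \<le> japanese_bracket z"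
  by (simp_all add: japanese_bracket_def real_le_rsqrt)

lemma u_measurable [measurable]: "u \<in> borel_measurable borel"
  using exp_boundedD(1)[OF u_exp] .

lemma u_ge_1: "1 \<le> u z"
proof -
  have "1 * 1 * 1 \<le> w z * v z * japanese_bracket z ^ N"
    using submult_weightD(5)[OF v] submult_weightD(5)[OF w] japanese_bracket_ge(1)[of z]
    by (intro mult_mono one_le_power) auto
  then show ?thesis by (simp add: u_def)
qed

lemma u_even: "u (- z) = u z"
  by (simp add: u_def submult_weightD(3)[OF v] submult_weightD(3)[OF w] japanese_bracket_def)

lemma japanese_bracket_add: "japanese_bracket (x + y) \<le> 2 * japanese_bracket x * japanese_bracket y"
proof -
  have "1 + (norm (x + y))\<^sup>2 \<le> 1 + (norm x + norm y)\<^sup>2"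
    using norm_triangle_ineq[of x y] by (intro add_left_mono power_mono) auto
  also have "\<dots> \<le> 4 * ((1 + (norm x)\<^sup>2) * (1 + (norm y)\<^sup>2))"
  proof -
    have "(norm x + norm y)\<^sup>2 \<le> 2 * (norm x)\<^sup>2 + 2 * (norm y)\<^sup>2"
      using sum_squares_bound[of "norm x" "norm y"] by (simp add: power2_sum)
    moreover have "0 \<le> (norm x)\<^sup>2 * (norm y)\<^sup>2" "0 \<le> (norm x)\<^sup>2" "0 \<le> (norm y)\<^sup>2" by simp_all
    moreover have "4 * ((1 + (norm x)\<^sup>2) * (1 + (norm y)\<^sup>2)) = 4 + 4 * (norm x)\<^sup>2 + 4 * (norm y)\<^sup>2 + 4 * ((norm x)\<^sup>2 * (norm y)\<^sup>2)"
      by (simp add: algebra_simps)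
    ultimately show ?thesis by linarith
  qed
  finally have "japanese_bracket (x + y) \<le> sqrt (4 * ((1 + (norm x)\<^sup>2) * (1 + (norm y)\<^sup>2)))"
    unfolding japanese_bracket_def by (rule real_sqrt_le_mono)
  also have "\<dots> = 2 * japanese_bracket x * japanese_bracket y"
    by (simp add: japanese_bracket_def real_sqrt_mult)
  finally show ?thesis .
qed

text \<open>The Japanese bracket is submultiplicative up to the factor 2, and it enters with the
  power N.\<close>

lemma u_submult: "u (x + y) \<le> 2 ^ N * u x * u y"
proof -
  have j: "0 \<le> japanese_bracket z" for z :: "'d phase" using japanese_bracket_ge(1)[of z] by linarith
  have "u (x + y) \<le> (w x * w y) * (v x * v y) * (2 * japanese_bracket x * japanese_bracket y) ^ N"
    unfolding u_def using j by (intro mult_mono power_mono japanese_bracket_add submult_weightD(4)[OF v] submult_weightD(4)[OF w]) auto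
  then show ?thesis by (simp add: u_def power_mult_distrib mult_ac)
qed

text \<open>Here the degree N of the Taylor monomials is paid for by the bracket in the weight of
  \<open>\<phi>1\<close> and \<open>\<phi>4\<close>.\<close>

lemma le_u: "w z * (v z * norm z ^ N) \<le> u z"
  unfolding u_def mult.assoc using japanese_bracket_ge(2)[of z]
  by (intro mult_left_mono power_mono) auto

lemma gaussian_M1 [simp]: "gaussian \<in> M1_space w"
  using tf_shift_gaussian_M1_space[of w 0] by simp

lemma gaussian_finite: "M1_norm w gaussian < top"
  by (rule M1_space_finite[OF w_exp gaussian_M1])

lemma gab_tf_shift: "\<phi> \<in> borel_measurable borel \<Longrightarrow> gab (tf_shift a \<phi>) z = gab \<phi> (z - a)"
  by (simp add: gab_def cmod_gabor_tf_shift)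

lemma gab_gaussian_even: "gab gaussian (x - y) = gab gaussian (y - (x :: 'd phase))"
  by (simp add: gab_def cmod_gabor_gaussian norm_minus_commute)

lemma M1_norm_gab: "\<phi> \<in> borel_measurable borel \<Longrightarrow> x \<in> borel_measurable borel \<Longrightarrow> (\<integral>\<^sup>+ z. gab \<phi> z * ennreal (x z) \<partial>lborel) = M1_norm x \<phi>"
  by (simp add: M1_norm_eq gab_def)

lemma FF_measurable: "f \<in> M1_antidual w \<Longrightarrow> FF f \<in> borel_measurable borel"
  unfolding FF_def[abs_def] using STFT_gaussian_measurable[OF _ w_exp] by measurable

lemma modulation_norm_eq: "modulation_norm p q \<mu> f = Lpq_enorm p q (\<lambda>z. FF f z * ennreal (\<mu> z))"
  by (simp add: modulation_norm_def Lpq_norm_eq FF_def)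

abbreviation X where "X \<equiv> modulation_space w p q \<mu>"

lemma X_iff: "f \<in> X \<longleftrightarrow> f \<in> M1_antidual w \<and> modulation_norm p q \<mu> f < top"
  using STFT_gaussian_measurable[OF _ w_exp] by (auto simp: modulation_space_def Lpq_space_def modulation_norm_def)

end

locale remainder_op = remainder N v w m \<mu> p q Cm Cv C\<mu>
  for N :: nat and v w m \<mu> :: "'d::finite phase \<Rightarrow> real" and p q :: ennreal and Cm Cv C\<mu> :: real +
  fixes \<phi>1 \<phi>2 \<phi>3 \<phi>4 :: "real^'d \<Rightarrow> complex" and a :: "'d phase \<Rightarrow> complex"
    and B :: "('d phase \<Rightarrow> nat) \<Rightarrow> 'd phase \<Rightarrow> complex"
  assumes \<phi>1: "\<phi>1 \<in> M1_space u" and \<phi>4: "\<phi>4 \<in> M1_space u" and \<phi>2: "\<phi>2 \<in> M1_space w" and \<phi>3: "\<phi>3 \<in> M1_space w"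
    and a: "a \<in> Linf_space (\<lambda>z. 1 / m z)" and B: "\<And>\<alpha>. \<alpha> \<in> multi_indices N \<Longrightarrow> B \<alpha> \<in> Linf_space m"
begin

lemmas sq = M1_space_square_integrable[OF \<phi>1] M1_space_square_integrable[OF \<phi>2]
  M1_space_square_integrable[OF \<phi>3] M1_space_square_integrable[OF \<phi>4]

lemma phi_measurable [measurable]:
  "\<phi>1 \<in> borel_measurable borel" "\<phi>2 \<in> borel_measurable borel" "\<phi>3 \<in> borel_measurable borel" "\<phi>4 \<in> borel_measurable borel"
  using sq by (simp_all add: square_integrableD)

lemma a_measurable [measurable]: "a \<in> borel_measurable borel"
  using a by (simp add: Linf_space_def)

lemma B_measurable: "\<alpha> \<in> multi_indices N \<Longrightarrow> B \<alpha> \<in> borel_measurable borel"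
  using B by (simp add: Linf_space_def)

lemma finite_norms:
  "M1_norm u \<phi>1 < top" "M1_norm w \<phi>2 < top" "M1_norm w \<phi>3 < top" "M1_norm u \<phi>4 < top"
  "Linf_norm (\<lambda>z. 1 / m z) a < top" "\<And>\<alpha>. \<alpha> \<in> multi_indices N \<Longrightarrow> Linf_norm m (B \<alpha>) < top"
  using M1_space_finite[OF u_exp] M1_space_finite[OF w_exp] \<phi>1 \<phi>2 \<phi>3 \<phi>4 a B by (auto simp: Linf_space_def)

lemma gabor_integrable_2: "integrable lborel (gabor \<phi>2)"
  using submult_weightD(5)[OF w] by (intro M1_space_gabor_integrable[of _ w] sq finite_norms) auto

lemma gabor_integrable_4: "integrable lborel (gabor \<phi>4)"
  using u_ge_1 by (intro M1_space_gabor_integrable[of _ u] sq finite_norms) auto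

abbreviation A :: ennreal where "A \<equiv> Linf_norm (\<lambda>z. 1 / m z) a"
abbreviation L :: "('d phase \<Rightarrow> nat) \<Rightarrow> ennreal" where "L \<alpha> \<equiv> Linf_norm m (B \<alpha>)"

section \<open>Convolution majorants for the kernel of the operator\<close>

definition \<Lambda> :: ennreal where "\<Lambda> = (\<Sum>\<alpha>\<in>multi_indices N. ennreal (1 / multi_fact \<alpha>) * L \<alpha>)"

definition P :: "'d phase \<Rightarrow> ennreal" where "P = cnv (gab \<phi>1) (\<lambda>z. gab \<phi>4 (- z))"
text \<open>The majorant stripped of constants and symbols: v comes from moving the weight m, |x|^N
  from the Taylor monomials, and P from the bracket of the shifted \<open>\<phi>4\<close> and
  \<open>\<phi>1\<close>.\<close>

definition H0 :: "'d phase \<Rightarrow> ennreal" where "H0 x = ennreal (v x * norm x ^ N) * P x"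

lemma P_measurable [measurable]: "P \<in> borel_measurable borel"
  unfolding P_def by measurable

lemma H0_measurable [measurable]: "H0 \<in> borel_measurable borel"
  unfolding H0_def[abs_def] by measurable

text \<open>By \<open>le_u\<close> the weight w v |x|^N is at most u, and \<open>u_submult\<close>
  distributes u over the two windows; this is the origin of 2^N.\<close>

lemma H0_L1: "(\<integral>\<^sup>+ x. H0 x * ennreal (w x) \<partial>lborel) \<le> ennreal (2 ^ N) * M1_norm u \<phi>1 * M1_norm u \<phi>4"
proof -
  have u0: "0 \<le> u z" for z using u_ge_1[of z] by linarith
  have "(\<integral>\<^sup>+ x. H0 x * ennreal (w x) \<partial>lborel) \<le> (\<integral>\<^sup>+ x. P x * ennreal (u x) \<partial>lborel)"
  proof (rule nn_integral_mono)
    fix x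
    have "H0 x * ennreal (w x) = P x * ennreal (w x * (v x * norm x ^ N))"
      by (simp add: H0_def ennreal_mult' mult_ac)
    also have "\<dots> \<le> P x * ennreal (u x)" by (intro mult_left_mono ennreal_leI le_u) simp
    finally show "H0 x * ennreal (w x) \<le> P x * ennreal (u x)" .
  qed
  also have "\<dots> \<le> ennreal (2 ^ N) * (\<integral>\<^sup>+ z. gab \<phi>1 z * ennreal (u z) \<partial>lborel) * (\<integral>\<^sup>+ z. gab \<phi>4 (- z) * ennreal (u z) \<partial>lborel)"
    unfolding P_def using u_submult u0 by (intro cnv_L1) simp_all
  also have "\<dots> = ennreal (2 ^ N) * M1_norm u \<phi>1 * M1_norm u \<phi>4"
    by (simp add: wL1_reflect u_even M1_norm_gab)
  finally show ?thesis .
qed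

lemma bracket_le_P: "ennreal (gconst TYPE('d)) * ennreal (cmod (L2_bracket (tf_shift z \<phi>4) (tf_shift y \<phi>1))) \<le> P (z - y)"
proof -
  have "ennreal (gconst TYPE('d)) * ennreal (cmod (L2_bracket (tf_shift z \<phi>4) (tf_shift y \<phi>1)))
     \<le> (\<integral>\<^sup>+ \<zeta>. gab \<phi>4 (\<zeta> - z) * gab \<phi>1 (\<zeta> - y) \<partial>lborel)"
    using cmod_L2_bracket_le[OF sq(4) gabor_integrable_4 sq(1), of z y] by (simp add: gab_def)
  also have "\<dots> = (\<integral>\<^sup>+ \<zeta>. gab \<phi>4 ((\<zeta> - y) - (z - y)) * gab \<phi>1 (\<zeta> - y) \<partial>lborel)" by simp
  also have "\<dots> = (\<integral>\<^sup>+ \<zeta>. gab \<phi>4 (\<zeta> - (z - y)) * gab \<phi>1 \<zeta> \<partial>lborel)"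
    by (rule nn_integral_lborel_shift[of "\<lambda>\<zeta>. gab \<phi>4 (\<zeta> - (z - y)) * gab \<phi>1 \<zeta>"]) measurable
  also have "\<dots> = P (z - y)" by (simp add: P_def cnv_def mult.commute)
  finally show ?thesis .
qed

definition k :: "'d phase \<Rightarrow> 'd phase \<Rightarrow> complex" where
  "k y z = a y * taylor_remainder N B y z * L2_bracket (tf_shift z \<phi>4) (tf_shift y \<phi>1)"

lemma k_measurable [measurable]: "(\<lambda>(y, z). k y z) \<in> borel_measurable (borel \<Otimes>\<^sub>M borel)"
proof -
  note [measurable] = taylor_remainder_measurable[OF B_measurable]
  show ?thesis unfolding k_def by measurable
qed

lemma AE_a: "AE y in lborel. ennreal (cmod (a y)) \<le> A * ennreal (m y)"
proof -
  have "AE y in lborel. ennreal (cmod (a y) * (1 / m y)) \<le> A" unfolding Linf_norm_def by (rule esssup_AE)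
  then show ?thesis
  proof eventually_elim
    case (elim y)
    have "ennreal (cmod (a y)) = ennreal (cmod (a y) * (1 / m y)) * ennreal (m y)"
      using less_imp_neq[OF pos(3)[of y]] by (simp add: ennreal_mult[symmetric])
    also have "\<dots> \<le> A * ennreal (m y)" by (intro mult_right_mono elim) simp
    finally show ?case .
  qed
qed

lemma AE_pair_fst: "AE y in lborel. Q y \<Longrightarrow> AE (y, z) in (lborel :: ('d phase \<times> 'd phase) measure). Q y"
proof -
  assume "AE y in lborel. Q y"
  then obtain S where S: "S \<in> null_sets (lborel :: 'd phase measure)" "{y. \<not> Q y} \<subseteq> S"
    by (auto simp: eventually_ae_filter)
  then have "AE y in lborel. y \<notin> S" by (intro AE_not_in)
  have [measurable]: "S \<in> sets borel" using S by auto
  have "AE x in (lborel \<Otimes>\<^sub>M (lborel :: 'd phase measure)). fst x \<notin> S"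
  proof (rule lborel_pair.AE_pair_measure)
    show "AE x in lborel. AE z in (lborel :: 'd phase measure). fst (x, z) \<notin> S"
      using AE_not_in[OF S(1)] by eventually_elim simp
  qed measurable
  then have "AE x in (lborel :: ('d phase \<times> 'd phase) measure). fst x \<notin> S" unfolding lborel_prod .
  then show ?thesis by eventually_elim (use S in auto)
qed

definition K1 :: real where "K1 = real N * Cm * Cv"

lemma K1_nonneg: "0 \<le> K1"
  using Cm Cv by (simp add: K1_def)

text \<open>The factor m(y) in |a(y)| <= A m(y) is exactly what \<open>taylor_remainder_le\<close>
  consumes. \<open>\<Lambda>'\<close> may depend on (y,z): a constant yields boundedness, a function
  that is small off a bounded set yields compactness.\<close>

lemma kernel_le:
  assumes "AE (y, z) in lborel. taylor_kernel N B m v y z \<le> ennreal (Cv * v (z - y)) * \<Lambda>' y z"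
  shows "AE (y, z) in lborel. ennreal (gconst TYPE('d)) * ennreal (cmod (k y z)) \<le> ennreal K1 * A * \<Lambda>' y z * H0 (z - y)"
  using assms AE_pair_fst[OF AE_a]
proof eventually_elim
  case (elim yz)
  obtain y z where yz: "yz = (y, z)" by (cases yz)
  have "ennreal (cmod (a y)) * ennreal (cmod (taylor_remainder N B y z)) \<le> (A * ennreal (m y)) * ennreal (cmod (taylor_remainder N B y z))"
    using elim(2) yz by (intro mult_right_mono) auto
  also have "\<dots> = A * (ennreal (cmod (taylor_remainder N B y z)) * ennreal (m y))" by (simp only: mult_ac)
  also have "\<dots> \<le> A * (ennreal (real N * Cm) * taylor_kernel N B m v y z * ennreal (norm (z - y) ^ N))"
    by (intro mult_left_mono taylor_remainder_le v m Cm B_measurable) auto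
  also have "\<dots> \<le> A * (ennreal (real N * Cm) * (ennreal (Cv * v (z - y)) * \<Lambda>' y z) * ennreal (norm (z - y) ^ N))"
    using elim(1) yz by (intro mult_left_mono mult_right_mono) auto
  also have "\<dots> = ennreal K1 * A * \<Lambda>' y z * ennreal (v (z - y) * norm (z - y) ^ N)"
    using Cm Cv by (simp add: K1_def ennreal_mult mult_ac)
  finally have 1: "ennreal (cmod (a y)) * ennreal (cmod (taylor_remainder N B y z)) \<le> ennreal K1 * A * \<Lambda>' y z * ennreal (v (z - y) * norm (z - y) ^ N)" .
  have "ennreal (gconst TYPE('d)) * ennreal (cmod (k y z)) = (ennreal (cmod (a y)) * ennreal (cmod (taylor_remainder N B y z))) * (ennreal (gconst TYPE('d)) * ennreal (cmod (L2_bracket (tf_shift z \<phi>4) (tf_shift y \<phi>1))))"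
    by (simp add: k_def norm_mult ennreal_mult mult_ac)
  also have "\<dots> \<le> (ennreal K1 * A * \<Lambda>' y z * ennreal (v (z - y) * norm (z - y) ^ N)) * P (z - y)"
    by (intro mult_mono 1 bracket_le_P) auto
  finally show ?case by (simp add: yz H0_def mult.assoc)
qed

lemma AE_B: "\<alpha> \<in> multi_indices N \<Longrightarrow> AE x in lborel. ennreal (cmod (B \<alpha> x) * m x) \<le> L \<alpha>"
  unfolding Linf_norm_def by (rule esssup_AE)

lemma AE_segment_B:
  "AE (y, z) in lborel. \<forall>\<alpha>\<in>multi_indices N. AE t in lborel. ennreal (cmod (B \<alpha> (y + t *\<^sub>R (z - y))) * m (y + t *\<^sub>R (z - y))) \<le> L \<alpha>"
  unfolding case_prod_beta'
proof (rule AE_finite_allI[OF finite_multi_indices])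
  fix \<alpha> :: "'d phase \<Rightarrow> nat" assume \<alpha>: "\<alpha> \<in> multi_indices N"
  note [measurable] = B_measurable[OF \<alpha>]
  have "Measurable.pred borel (\<lambda>x. ennreal (cmod (B \<alpha> x) * m x) \<le> L \<alpha>)" by measurable
  from AE_segment[OF this AE_B[OF \<alpha>]]
  show "AE x in lborel. AE t in lborel. ennreal (cmod (B \<alpha> (fst x + t *\<^sub>R (snd x - fst x))) * m (fst x + t *\<^sub>R (snd x - fst x))) \<le> L \<alpha>"
    by (simp add: case_prod_beta')
qed

definition H1 :: "'d phase \<Rightarrow> ennreal" where "H1 x = ennreal K1 * A * \<Lambda> * H0 x"

lemma diff_kernel_measurable [measurable]:
  fixes H :: "'d phase \<Rightarrow> ennreal"
  assumes [measurable]: "H \<in> borel_measurable borel"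
  shows "(\<lambda>(y, z). H (z - y)) \<in> borel_measurable (borel \<Otimes>\<^sub>M borel)"
  by measurable

lemma H1_measurable [measurable]: "H1 \<in> borel_measurable borel"
  unfolding H1_def[abs_def] by measurable

lemma kernel_le_H1: "AE (y, z) in lborel. ennreal (gconst TYPE('d)) * ennreal (cmod (k y z)) \<le> H1 (z - y)"
  unfolding H1_def
proof (rule kernel_le)
  show "AE (y, z) in lborel. taylor_kernel N B m v y z \<le> ennreal (Cv * v (z - y)) * \<Lambda>"
    using AE_segment_B
  proof eventually_elim
    case (elim yz)
    then show ?case unfolding \<Lambda>_def case_prod_beta'
      by (intro taylor_kernel_le v Cv(2)) (auto elim: eventually_mono)
  qed
qed

lemma \<Lambda>_finite: "\<Lambda> < top"
  unfolding \<Lambda>_def using finite_norms(6) by (simp add: finite_multi_indices ennreal_mult_less_top)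

lemma H0_finite: "(\<integral>\<^sup>+ x. H0 x * ennreal (w x) \<partial>lborel) < top"
  by (rule le_less_trans[OF H0_L1]) (use finite_norms in \<open>simp add: ennreal_mult_less_top\<close>)

lemma H1_L1: "(\<integral>\<^sup>+ x. H1 x * ennreal (w x) \<partial>lborel) = ennreal K1 * A * \<Lambda> * (\<integral>\<^sup>+ x. H0 x * ennreal (w x) \<partial>lborel)"
  unfolding H1_def by (simp add: mult.assoc nn_integral_cmult)

lemma H1_finite: "(\<integral>\<^sup>+ x. H1 x * ennreal (w x) \<partial>lborel) < top"
  unfolding H1_L1 using \<Lambda>_finite H0_finite finite_norms by (simp add: ennreal_mult_less_top)

section \<open>Absolute convergence and the action on the antidual\<close>

abbreviation EI where "EI \<equiv> E_integrand N a B \<phi>1 \<phi>2 \<phi>3 \<phi>4"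
abbreviation E where "E \<equiv> E_op w N a B \<phi>1 \<phi>2 \<phi>3 \<phi>4"

lemma EI_eq: "EI f g y z = k y z * STFT \<phi>3 f z * L2_bracket (tf_shift y \<phi>2) g"
  by (simp add: E_integrand_def k_def mult_ac)

lemma EI_measurable:
  assumes "f \<in> M1_antidual w" "g \<in> borel_measurable borel"
  shows "(\<lambda>(y, z). EI f g y z) \<in> borel_measurable (borel \<Otimes>\<^sub>M borel)"
proof -
  note [measurable] = STFT_measurable[OF assms(1) w \<phi>3] assms(2)
  show ?thesis unfolding EI_eq by measurable
qed

text \<open>The integral of absolute values with the kernel replaced by a majorant. \<open>h\<close>
  depends on both variables because the near part of the later splitting is not a convolution
  kernel.\<close>

definition pairing :: "((real^'d \<Rightarrow> complex) \<Rightarrow> complex) \<Rightarrow> (real^'d \<Rightarrow> complex) \<Rightarrow> ('d phase \<Rightarrow> 'd phase \<Rightarrow> ennreal) \<Rightarrow> ennreal" where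
  "pairing f g h = (\<integral>\<^sup>+ y. \<integral>\<^sup>+ z. h y z * ennreal (cmod (STFT \<phi>3 f z)) * ennreal (cmod (L2_bracket (tf_shift y \<phi>2) g)) \<partial>lborel \<partial>lborel)"

lemma EI_le_pairing:
  assumes f: "f \<in> M1_antidual w" and g: "g \<in> borel_measurable borel"
    and h[measurable]: "(\<lambda>(y, z). h y z) \<in> borel_measurable (borel \<Otimes>\<^sub>M borel)"
    and le: "AE (y, z) in lborel. ennreal (gconst TYPE('d)) * ennreal (cmod (k y z)) \<le> h y z"
  shows "ennreal (gconst TYPE('d)) * (\<integral>\<^sup>+ y. \<integral>\<^sup>+ z. ennreal (cmod (EI f g y z)) \<partial>lborel \<partial>lborel) \<le> pairing f g h"
proof -
  note [measurable] = STFT_measurable[OF f w \<phi>3] g EI_measurable[OF f g]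
  have it: "(\<integral>\<^sup>+ y. \<integral>\<^sup>+ z. G y z \<partial>lborel \<partial>lborel) = (\<integral>\<^sup>+ x. G (fst x) (snd x) \<partial>lborel)"
    if "(\<lambda>(y, z). G y z) \<in> borel_measurable (borel \<Otimes>\<^sub>M borel)" for G :: "'d phase \<Rightarrow> 'd phase \<Rightarrow> ennreal"
  proof -
    have "(\<lambda>(y, z). G y z) \<in> borel_measurable (lborel \<Otimes>\<^sub>M lborel)" using that by measurable
    from lborel.nn_integral_fst[OF this] show ?thesis by (simp add: lborel_prod case_prod_beta')
  qed
  have "ennreal (gconst TYPE('d)) * (\<integral>\<^sup>+ y. \<integral>\<^sup>+ z. ennreal (cmod (EI f g y z)) \<partial>lborel \<partial>lborel)
    = (\<integral>\<^sup>+ x. ennreal (gconst TYPE('d)) * ennreal (cmod (EI f g (fst x) (snd x))) \<partial>lborel)"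
    by (subst it) (measurable, subst nn_integral_cmult, simp_all add: borel_measurable_pairI[symmetric])
  also have "\<dots> \<le> (\<integral>\<^sup>+ x. h (fst x) (snd x) * ennreal (cmod (STFT \<phi>3 f (snd x))) * ennreal (cmod (L2_bracket (tf_shift (fst x) \<phi>2) g)) \<partial>lborel)"
  proof (rule nn_integral_mono_AE)
    show "AE x in lborel. ennreal (gconst TYPE('d)) * ennreal (cmod (EI f g (fst x) (snd x)))
      \<le> h (fst x) (snd x) * ennreal (cmod (STFT \<phi>3 f (snd x))) * ennreal (cmod (L2_bracket (tf_shift (fst x) \<phi>2) g))"
      using le
    proof eventually_elim
      case (elim x)
      have "ennreal (gconst TYPE('d)) * ennreal (cmod (EI f g (fst x) (snd x))) = (ennreal (gconst TYPE('d)) * ennreal (cmod (k (fst x) (snd x)))) * ennreal (cmod (STFT \<phi>3 f (snd x))) * ennreal (cmod (L2_bracket (tf_shift (fst x) \<phi>2) g))"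
        by (simp add: EI_eq norm_mult ennreal_mult mult.assoc)
      also have "\<dots> \<le> h (fst x) (snd x) * ennreal (cmod (STFT \<phi>3 f (snd x))) * ennreal (cmod (L2_bracket (tf_shift (fst x) \<phi>2) g))"
        using elim by (intro mult_right_mono) (auto simp: case_prod_beta')
      finally show ?case .
    qed
  qed
  also have "\<dots> = pairing f g h" unfolding pairing_def by (rule it[symmetric]) measurable
  finally show ?thesis .
qed

lemma pairing_le:
  assumes f: "f \<in> M1_antidual w" and g: "g \<in> square_integrable" and [measurable]: "H \<in> borel_measurable borel"
  shows "ennreal (gconst TYPE('d)) * ennreal (gconst TYPE('d)) * pairing f g (\<lambda>y z. H (z - y)) \<le> (\<integral>\<^sup>+ \<zeta>. gab g \<zeta> * kernel_cnv (FF f) H \<phi>2 \<phi>3 \<zeta> \<partial>lborel)"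
  unfolding pairing_def FF_def by (rule kernel_pairing_le[OF f w sq(2) gabor_integrable_2 \<phi>3 g]) measurable

lemma kernel_cnv_bound:
  assumes f: "f \<in> M1_antidual w" and [measurable]: "H \<in> borel_measurable borel" and H: "(\<integral>\<^sup>+ x. H x * ennreal (w x) \<partial>lborel) < top"
  shows "\<exists>C\<ge>0. \<forall>z. kernel_cnv (FF f) H \<phi>2 \<phi>3 z \<le> ennreal C * ennreal (w z)"
proof -
  obtain C where C: "0 \<le> C" "\<And>z. cmod (STFT gaussian f z) \<le> C * w z" using STFT_gaussian_bound[OF f w] by blast
  have F: "FF f z \<le> ennreal C * ennreal (w z)" for z
    unfolding FF_def using C by (simp add: ennreal_mult[symmetric] ennreal_leI)
  let ?D = "ennreal C * M1_norm w \<phi>3 * (\<integral>\<^sup>+ z. H z * ennreal (w z) \<partial>lborel) * M1_norm w \<phi>2"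
  have le: "kernel_cnv (FF f) H \<phi>2 \<phi>3 z \<le> ?D * ennreal (w z)" for z
    using F by (intro kernel_cnv_le_weight w FF_measurable f) measurable
  have "?D < top" using finite_norms H by (simp add: ennreal_mult_less_top)
  then obtain D where "?D = ennreal D" "0 \<le> D" by (cases ?D) auto
  then show ?thesis using le by auto
qed

text \<open>The transform of any functional in the antidual grows at most like w, and the
  convolutions preserve this growth. So the integrals converge, with a bound in the M^1_w-norm of
  \<open>g\<close>, without reference to the mixed norm of \<open>f\<close>.\<close>

lemma EI_finite:
  assumes f: "f \<in> M1_antidual w"
  shows "\<exists>C\<ge>0. \<forall>g\<in>M1_space w. (\<integral>\<^sup>+ y. \<integral>\<^sup>+ z. ennreal (cmod (EI f g y z)) \<partial>lborel \<partial>lborel) \<le> ennreal C * M1_norm w g"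
proof -
  obtain C where C: "0 \<le> C" "\<And>z. kernel_cnv (FF f) H1 \<phi>2 \<phi>3 z \<le> ennreal C * ennreal (w z)"
    using kernel_cnv_bound[OF f H1_measurable H1_finite] by blast
  let ?g = "gconst TYPE('d)"
  show ?thesis
  \<comment> \<open>Three factors kappa: one from the bracket of \<open>\<phi>4\<close> with
    \<open>\<phi>1\<close> in the kernel, two from \<open>pairing_le\<close>.\<close>
  proof (intro exI[of _ "C / ?g ^ 3"] conjI ballI)
    show "0 \<le> C / ?g ^ 3" using C gconst_pos[where 'd='d] by simp
    fix g assume g: "g \<in> M1_space w"
    note sg = M1_space_square_integrable[OF g]
    note [measurable] = square_integrableD[OF sg]
    let ?I = "\<integral>\<^sup>+ y. \<integral>\<^sup>+ z. ennreal (cmod (EI f g y z)) \<partial>lborel \<partial>lborel"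
    have "ennreal (gconst TYPE('d)) * ennreal (gconst TYPE('d)) * (ennreal (gconst TYPE('d)) * ?I) \<le> ennreal (gconst TYPE('d)) * ennreal (gconst TYPE('d)) * pairing f g (\<lambda>y z. H1 (z - y))"
      by (intro mult_left_mono EI_le_pairing f kernel_le_H1 diff_kernel_measurable H1_measurable) simp_all
    also have "\<dots> \<le> (\<integral>\<^sup>+ \<zeta>. gab g \<zeta> * kernel_cnv (FF f) H1 \<phi>2 \<phi>3 \<zeta> \<partial>lborel)"
      by (rule pairing_le[OF f sg]) measurable
    also have "\<dots> \<le> (\<integral>\<^sup>+ \<zeta>. ennreal C * (gab g \<zeta> * ennreal (w \<zeta>)) \<partial>lborel)"
    proof (rule nn_integral_mono)
      fix \<zeta>
      have "gab g \<zeta> * kernel_cnv (FF f) H1 \<phi>2 \<phi>3 \<zeta> \<le> gab g \<zeta> * (ennreal C * ennreal (w \<zeta>))"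
        by (intro mult_left_mono C) simp
      then show "gab g \<zeta> * kernel_cnv (FF f) H1 \<phi>2 \<phi>3 \<zeta> \<le> ennreal C * (gab g \<zeta> * ennreal (w \<zeta>))"
        by (simp only: mult_ac)
    qed
    also have "\<dots> = ennreal C * M1_norm w g" by (simp add: nn_integral_cmult M1_norm_gab)
    finally have 1: "ennreal (gconst TYPE('d)) * ennreal (gconst TYPE('d)) * (ennreal (gconst TYPE('d)) * ?I) \<le> ennreal C * M1_norm w g" .
    have kk: "ennreal (1 / ?g ^ 3) * (ennreal (gconst TYPE('d)) * ennreal (gconst TYPE('d)) * (ennreal (gconst TYPE('d)) * x)) = x" for x
    proof -
      have "ennreal (1 / ?g ^ 3) * (ennreal (gconst TYPE('d)) * (ennreal (gconst TYPE('d)) * ennreal (gconst TYPE('d)))) = 1"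
        using gconst_pos[where 'd='d] by (simp add: ennreal_mult[symmetric] power3_eq_cube)
      moreover have "c * (e * e * (e * x)) = (c * (e * (e * e))) * x" for c e :: ennreal by (simp only: mult_ac)
      ultimately show ?thesis by simp
    qed
    have "?I = ennreal (1 / ?g ^ 3) * (ennreal (gconst TYPE('d)) * ennreal (gconst TYPE('d)) * (ennreal (gconst TYPE('d)) * ?I))" by (rule kk[symmetric])
    also have "\<dots> \<le> ennreal (1 / ?g ^ 3) * (ennreal C * M1_norm w g)" by (intro mult_left_mono 1) simp
    also have "\<dots> = ennreal (C / ?g ^ 3) * M1_norm w g"
      using C(1) gconst_pos[where 'd='d] by (simp add: mult.assoc[symmetric] ennreal_mult[symmetric])
    finally show "?I \<le> ennreal (C / ?g ^ 3) * M1_norm w g" .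
  qed
qed

lemma EI_integrable:
  assumes f: "f \<in> M1_antidual w" and g: "g \<in> M1_space w"
  shows "integrable lborel (\<lambda>(y, z). EI f g y z)"
    and "E f g = (LINT x|lborel. EI f g (fst x) (snd x))"
    and "ennreal (cmod (E f g)) \<le> (\<integral>\<^sup>+ y. \<integral>\<^sup>+ z. ennreal (cmod (EI f g y z)) \<partial>lborel \<partial>lborel)"
proof -
  have gm: "g \<in> borel_measurable borel" by (rule square_integrableD[OF M1_space_square_integrable[OF g]])
  obtain C where "(\<integral>\<^sup>+ y. \<integral>\<^sup>+ z. ennreal (cmod (EI f g y z)) \<partial>lborel \<partial>lborel) \<le> ennreal C * M1_norm w g"
    using EI_finite[OF f] g by blast
  also have "\<dots> < top" using M1_space_finite[OF w_exp g] by (simp add: ennreal_mult_less_top)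
  finally have fin: "(\<integral>\<^sup>+ y. \<integral>\<^sup>+ z. ennreal (cmod (EI f g y z)) \<partial>lborel \<partial>lborel) < top" .
  note F = Fubini_lborel[OF EI_measurable[OF f gm] fin]
  show "integrable lborel (\<lambda>(y, z). EI f g y z)" by (rule F(1))
  show "E f g = (LINT x|lborel. EI f g (fst x) (snd x))" using F(2) g by (simp add: E_op_def)
  have "ennreal (cmod (E f g)) \<le> (\<integral>\<^sup>+ y. ennreal (cmod (LINT z|lborel. EI f g y z)) \<partial>lborel)"
    using g by (simp add: E_op_def cmod_integral_le_nn_integral)
  also have "\<dots> \<le> (\<integral>\<^sup>+ y. \<integral>\<^sup>+ z. ennreal (cmod (EI f g y z)) \<partial>lborel \<partial>lborel)"
    by (intro nn_integral_mono cmod_integral_le_nn_integral)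
  finally show "ennreal (cmod (E f g)) \<le> (\<integral>\<^sup>+ y. \<integral>\<^sup>+ z. ennreal (cmod (EI f g y z)) \<partial>lborel \<partial>lborel)" .
qed

lemma E_antidual:
  assumes f: "f \<in> M1_antidual w"
  shows "E f \<in> M1_antidual w"
  unfolding M1_antidual_def mem_Collect_eq
proof (intro conjI ballI allI impI)
  fix g h assume g: "g \<in> M1_space w" and h: "h \<in> M1_space w"
  have gh: "(\<lambda>t. g t + h t) \<in> M1_space w" by (intro M1_space_add g h) measurable
  have "EI f (\<lambda>t. g t + h t) y z = EI f g y z + EI f h y z" for y z
    unfolding EI_eq by (subst L2_bracket_add_right)
      (simp_all add: distrib_left square_integrable_tf_shift sq M1_space_square_integrable[OF g] M1_space_square_integrable[OF h])
  then show "E f (\<lambda>t. g t + h t) = E f g + E f h"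
    using EI_integrable(1)[OF f g] EI_integrable(1)[OF f h]
    by (simp add: EI_integrable(2)[OF f] gh g h case_prod_beta')
next
  fix c g assume g: "g \<in> M1_space w"
  have cg: "(\<lambda>t. c * g t) \<in> M1_space w" by (intro M1_space_cmult g) measurable
  have "EI f (\<lambda>t. c * g t) y z = cnj c * EI f g y z" for y z
    unfolding EI_eq by (simp add: L2_bracket_cmult_right mult_ac)
  then show "E f (\<lambda>t. c * g t) = cnj c * E f g"
    by (simp add: EI_integrable(2)[OF f] cg g)
next
  obtain C where "0 \<le> C" "\<forall>g\<in>M1_space w. (\<integral>\<^sup>+ y. \<integral>\<^sup>+ z. ennreal (cmod (EI f g y z)) \<partial>lborel \<partial>lborel) \<le> ennreal C * M1_norm w g"
    using EI_finite[OF f] by blast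
  then show "\<exists>C. \<forall>g\<in>M1_space w. ennreal (cmod (E f g)) \<le> ennreal C * M1_norm w g"
    using EI_integrable(3)[OF f] by (meson order_trans)
next
  fix g assume "g \<notin> M1_space w"
  then show "E f g = 0" by (simp add: E_op_def)
qed

section \<open>The mixed-norm estimate and linearity\<close>

lemma STFT_E_le:
  assumes f: "f \<in> M1_antidual w"
    and h: "(\<lambda>(y, z). h y z) \<in> borel_measurable (borel \<Otimes>\<^sub>M borel)"
    and le: "AE (y, z) in lborel. ennreal (gconst TYPE('d)) * ennreal (cmod (k y z)) \<le> h y z"
  shows "ennreal (gconst TYPE('d)) * FF (E f) \<zeta> \<le> pairing f (tf_shift \<zeta> gaussian) h"
proof -
  have "ennreal (gconst TYPE('d)) * FF (E f) \<zeta> \<le> ennreal (gconst TYPE('d)) * (\<integral>\<^sup>+ y. \<integral>\<^sup>+ z. ennreal (cmod (EI f (tf_shift \<zeta> gaussian) y z)) \<partial>lborel \<partial>lborel)"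
    unfolding FF_def STFT_def
    by (intro mult_left_mono EI_integrable(3) f tf_shift_gaussian_M1_space) simp_all
  also have "\<dots> \<le> pairing f (tf_shift \<zeta> gaussian) h"
    by (intro EI_le_pairing f h le) measurable
  finally show ?thesis .
qed

lemma pairing_gaussian_le:
  assumes f: "f \<in> M1_antidual w" and [measurable]: "H \<in> borel_measurable borel"
  shows "ennreal (gconst TYPE('d)) * ennreal (gconst TYPE('d)) * pairing f (tf_shift \<zeta> gaussian) (\<lambda>y z. H (z - y)) \<le> cnv (kernel_cnv (FF f) H \<phi>2 \<phi>3) (gab gaussian) \<zeta>"
proof -
  note [measurable] = FF_measurable[OF f]
  have "ennreal (gconst TYPE('d)) * ennreal (gconst TYPE('d)) * pairing f (tf_shift \<zeta> gaussian) (\<lambda>y z. H (z - y)) \<le> (\<integral>\<^sup>+ \<eta>. gab (tf_shift \<zeta> gaussian) \<eta> * kernel_cnv (FF f) H \<phi>2 \<phi>3 \<eta> \<partial>lborel)"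
    by (intro pairing_le f square_integrable_tf_shift gaussian_square_integrable) measurable
  also have "\<dots> = cnv (kernel_cnv (FF f) H \<phi>2 \<phi>3) (gab gaussian) \<zeta>"
    unfolding cnv_def gab_tf_shift[OF gaussian_measurable] gab_gaussian_even[of _ \<zeta>] by (simp only: mult.commute)
  finally show ?thesis .
qed

text \<open>Testing E f on shifted Gaussians adds a fourth convolution, with the transform of the
  Gaussian; hence the fourth power of \<open>C\<mu>\<close>.\<close>

lemma Lpq_cnv_gaussian:
  assumes f: "f \<in> M1_antidual w" and [measurable]: "H \<in> borel_measurable borel"
  shows "Lpq_enorm p q (\<lambda>z. cnv (kernel_cnv (FF f) H \<phi>2 \<phi>3) (gab gaussian) z * ennreal (\<mu> z))
    \<le> ennreal (C\<mu> ^ 4) * M1_norm w gaussian * M1_norm w \<phi>2 * M1_norm w \<phi>3 * (\<integral>\<^sup>+ z. H z * ennreal (w z) \<partial>lborel) * Lpq_enorm p q (\<lambda>z. FF f z * ennreal (\<mu> z))"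
proof -
  note [measurable] = FF_measurable[OF f]
  have "cnv (kernel_cnv (FF f) H \<phi>2 \<phi>3) (gab gaussian) = cnv (gab gaussian) (kernel_cnv (FF f) H \<phi>2 \<phi>3)"
    by (intro ext cnv_commute) measurable
  then have "Lpq_enorm p q (\<lambda>z. cnv (kernel_cnv (FF f) H \<phi>2 \<phi>3) (gab gaussian) z * ennreal (\<mu> z))
    \<le> ennreal C\<mu> * (\<integral>\<^sup>+ z. gab gaussian z * ennreal (w z) \<partial>lborel) * Lpq_enorm p q (\<lambda>z. kernel_cnv (FF f) H \<phi>2 \<phi>3 z * ennreal (\<mu> z))"
    by (simp only:) (intro cnv_Lpq_enorm p q C\<mu> pos; measurable)
  also have "\<dots> \<le> ennreal C\<mu> * (\<integral>\<^sup>+ z. gab gaussian z * ennreal (w z) \<partial>lborel) *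
     (ennreal (C\<mu> ^ 3) * M1_norm w \<phi>2 * (\<integral>\<^sup>+ z. H z * ennreal (w z) \<partial>lborel) * M1_norm w \<phi>3 * Lpq_enorm p q (\<lambda>z. FF f z * ennreal (\<mu> z)))"
    by (intro mult_left_mono kernel_cnv_Lpq p q w C\<mu> pos) simp_all
  also have "\<dots> = (ennreal C\<mu> * ennreal (C\<mu> ^ 3)) * M1_norm w gaussian * M1_norm w \<phi>2 * M1_norm w \<phi>3 * (\<integral>\<^sup>+ z. H z * ennreal (w z) \<partial>lborel) * Lpq_enorm p q (\<lambda>z. FF f z * ennreal (\<mu> z))"
  proof -
    have "(\<integral>\<^sup>+ z. gab gaussian z * ennreal (w z) \<partial>lborel) = M1_norm w gaussian" by (simp add: M1_norm_gab)
    then show ?thesis by (simp only: mult_ac)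
  qed
  also have "ennreal C\<mu> * ennreal (C\<mu> ^ 3) = ennreal (C\<mu> ^ 4)"
    using C\<mu>(1) by (simp add: ennreal_mult[symmetric] power_Suc[symmetric])
  finally show ?thesis .
qed

lemma E_norm_le:
  assumes f: "f \<in> M1_antidual w"
  shows "ennreal (gconst TYPE('d)) * ennreal (gconst TYPE('d)) * ennreal (gconst TYPE('d)) * modulation_norm p q \<mu> (E f)
    \<le> ennreal (C\<mu> ^ 4) * M1_norm w gaussian * M1_norm w \<phi>2 * M1_norm w \<phi>3 * (\<integral>\<^sup>+ z. H1 z * ennreal (w z) \<partial>lborel) * modulation_norm p q \<mu> f"
proof -
  note [measurable] = FF_measurable[OF f] FF_measurable[OF E_antidual[OF f]]
  have kk: "x = ennreal (1 / gconst TYPE('d) ^ 3) * (ennreal (gconst TYPE('d)) * ennreal (gconst TYPE('d)) * ennreal (gconst TYPE('d)) * x)" for x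
  proof -
    have "ennreal (1 / gconst TYPE('d) ^ 3) * (ennreal (gconst TYPE('d)) * (ennreal (gconst TYPE('d)) * ennreal (gconst TYPE('d)))) = 1"
      using gconst_pos[where 'd='d] by (simp add: ennreal_mult[symmetric] power3_eq_cube)
    moreover have "c * (e * e * e * x) = (c * (e * (e * e))) * x" for c e :: ennreal by (simp only: mult_ac)
    ultimately show ?thesis by simp
  qed
  have pw: "ennreal (gconst TYPE('d)) * ennreal (gconst TYPE('d)) * ennreal (gconst TYPE('d)) * FF (E f) \<zeta> \<le> cnv (kernel_cnv (FF f) H1 \<phi>2 \<phi>3) (gab gaussian) \<zeta>" for \<zeta>
  proof -
    have "ennreal (gconst TYPE('d)) * ennreal (gconst TYPE('d)) * (ennreal (gconst TYPE('d)) * FF (E f) \<zeta>) \<le> ennreal (gconst TYPE('d)) * ennreal (gconst TYPE('d)) * pairing f (tf_shift \<zeta> gaussian) (\<lambda>y z. H1 (z - y))"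
      by (intro mult_left_mono STFT_E_le f kernel_le_H1 diff_kernel_measurable H1_measurable) simp_all
    also have "\<dots> \<le> cnv (kernel_cnv (FF f) H1 \<phi>2 \<phi>3) (gab gaussian) \<zeta>"
      by (intro pairing_gaussian_le f) measurable
    finally show ?thesis by (simp add: mult.assoc)
  qed
  have "modulation_norm p q \<mu> (E f) \<le> Lpq_enorm p q (\<lambda>z. ennreal (1 / gconst TYPE('d) ^ 3) * (cnv (kernel_cnv (FF f) H1 \<phi>2 \<phi>3) (gab gaussian) z * ennreal (\<mu> z)))"
    unfolding modulation_norm_eq
  proof (intro Lpq_enorm_mono p q)
    fix z
    have "FF (E f) z \<le> ennreal (1 / gconst TYPE('d) ^ 3) * cnv (kernel_cnv (FF f) H1 \<phi>2 \<phi>3) (gab gaussian) z"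
      by (subst kk) (intro mult_left_mono pw, simp)
    then have "FF (E f) z * ennreal (\<mu> z) \<le> ennreal (1 / gconst TYPE('d) ^ 3) * cnv (kernel_cnv (FF f) H1 \<phi>2 \<phi>3) (gab gaussian) z * ennreal (\<mu> z)"
      by (rule mult_right_mono) simp
    then show "FF (E f) z * ennreal (\<mu> z) \<le> ennreal (1 / gconst TYPE('d) ^ 3) * (cnv (kernel_cnv (FF f) H1 \<phi>2 \<phi>3) (gab gaussian) z * ennreal (\<mu> z))"
      by (simp only: mult.assoc)
  qed measurable
  also have "\<dots> \<le> ennreal (1 / gconst TYPE('d) ^ 3) * Lpq_enorm p q (\<lambda>z. cnv (kernel_cnv (FF f) H1 \<phi>2 \<phi>3) (gab gaussian) z * ennreal (\<mu> z))"
    by (intro Lpq_enorm_cmult_le p q) measurable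
  finally have "ennreal (gconst TYPE('d)) * ennreal (gconst TYPE('d)) * ennreal (gconst TYPE('d)) * modulation_norm p q \<mu> (E f) \<le> ennreal (gconst TYPE('d)) * ennreal (gconst TYPE('d)) * ennreal (gconst TYPE('d)) * (ennreal (1 / gconst TYPE('d) ^ 3) * Lpq_enorm p q (\<lambda>z. cnv (kernel_cnv (FF f) H1 \<phi>2 \<phi>3) (gab gaussian) z * ennreal (\<mu> z)))"
    by (rule mult_left_mono) simp
  also have "\<dots> = Lpq_enorm p q (\<lambda>z. cnv (kernel_cnv (FF f) H1 \<phi>2 \<phi>3) (gab gaussian) z * ennreal (\<mu> z))"
    using kk[of "Lpq_enorm p q (\<lambda>z. cnv (kernel_cnv (FF f) H1 \<phi>2 \<phi>3) (gab gaussian) z * ennreal (\<mu> z))"] by (simp only: mult_ac)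
  also have "\<dots> \<le> ennreal (C\<mu> ^ 4) * M1_norm w gaussian * M1_norm w \<phi>2 * M1_norm w \<phi>3 * (\<integral>\<^sup>+ z. H1 z * ennreal (w z) \<partial>lborel) * modulation_norm p q \<mu> f"
    unfolding modulation_norm_eq by (intro Lpq_cnv_gaussian f) measurable
  finally show ?thesis .
qed

text \<open>Rearranges \<open>E_norm_le\<close> so that the leading constant involves neither
  windows nor symbols.\<close>

lemma E_norm_bound:
  assumes f: "f \<in> M1_antidual w"
  shows "modulation_norm p q \<mu> (E f)
    \<le> ennreal (1 / gconst TYPE('d) ^ 3) * (ennreal (C\<mu> ^ 4) * M1_norm w gaussian * ennreal (K1 * 2 ^ N)) *
      A * \<Lambda> * M1_norm u \<phi>1 * M1_norm w \<phi>2 * M1_norm w \<phi>3 * M1_norm u \<phi>4 * modulation_norm p q \<mu> f"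
proof -
  let ?M = "modulation_norm p q \<mu> (E f)"
  have "(\<integral>\<^sup>+ z. H1 z * ennreal (w z) \<partial>lborel) \<le> ennreal K1 * A * \<Lambda> * (ennreal (2 ^ N) * M1_norm u \<phi>1 * M1_norm u \<phi>4)"
    unfolding H1_L1 by (intro mult_left_mono H0_L1) simp
  then have "ennreal (C\<mu> ^ 4) * M1_norm w gaussian * M1_norm w \<phi>2 * M1_norm w \<phi>3 * (\<integral>\<^sup>+ z. H1 z * ennreal (w z) \<partial>lborel) * modulation_norm p q \<mu> f
    \<le> ennreal (C\<mu> ^ 4) * M1_norm w gaussian * M1_norm w \<phi>2 * M1_norm w \<phi>3 * (ennreal K1 * A * \<Lambda> * (ennreal (2 ^ N) * M1_norm u \<phi>1 * M1_norm u \<phi>4)) * modulation_norm p q \<mu> f"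
    by (intro mult_left_mono mult_right_mono) simp_all
  with E_norm_le[OF f] have le: "ennreal (gconst TYPE('d)) * ennreal (gconst TYPE('d)) * ennreal (gconst TYPE('d)) * ?M \<le> ennreal (C\<mu> ^ 4) * M1_norm w gaussian * M1_norm w \<phi>2 * M1_norm w \<phi>3 * (ennreal K1 * A * \<Lambda> * (ennreal (2 ^ N) * M1_norm u \<phi>1 * M1_norm u \<phi>4)) * modulation_norm p q \<mu> f"
    by (rule order_trans)
  have "?M = ennreal (1 / gconst TYPE('d) ^ 3) * (ennreal (gconst TYPE('d)) * ennreal (gconst TYPE('d)) * ennreal (gconst TYPE('d)) * ?M)"
  proof -
    have "ennreal (1 / gconst TYPE('d) ^ 3) * (ennreal (gconst TYPE('d)) * (ennreal (gconst TYPE('d)) * ennreal (gconst TYPE('d)))) = 1"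
      using gconst_pos[where 'd='d] by (simp add: ennreal_mult[symmetric] power3_eq_cube)
    moreover have "c * (e * e * e * x) = (c * (e * (e * e))) * x" for c e x :: ennreal by (simp only: mult_ac)
    ultimately show ?thesis by simp
  qed
  also have "\<dots> \<le> ennreal (1 / gconst TYPE('d) ^ 3) * (ennreal (C\<mu> ^ 4) * M1_norm w gaussian * M1_norm w \<phi>2 * M1_norm w \<phi>3 * (ennreal K1 * A * \<Lambda> * (ennreal (2 ^ N) * M1_norm u \<phi>1 * M1_norm u \<phi>4)) * modulation_norm p q \<mu> f)"
    by (intro mult_left_mono le) simp
  also have "\<dots> = ennreal (1 / gconst TYPE('d) ^ 3) * (ennreal (C\<mu> ^ 4) * M1_norm w gaussian * (ennreal K1 * ennreal (2 ^ N))) *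
      A * \<Lambda> * M1_norm u \<phi>1 * M1_norm w \<phi>2 * M1_norm w \<phi>3 * M1_norm u \<phi>4 * modulation_norm p q \<mu> f"
    by (simp only: mult_ac)
  also have "ennreal K1 * ennreal (2 ^ N) = ennreal (K1 * 2 ^ N)" using K1_nonneg by (simp add: ennreal_mult)
  finally show ?thesis .
qed

lemma E_X:
  assumes "f \<in> X" shows "E f \<in> X"
proof -
  have f: "f \<in> M1_antidual w" "modulation_norm p q \<mu> f < top" using assms by (auto simp: X_iff)
  have "modulation_norm p q \<mu> (E f) < top"
    by (rule le_less_trans[OF E_norm_bound[OF f(1)]]) (use f(2) finite_norms gaussian_finite \<Lambda>_finite in \<open>simp add: ennreal_mult_less_top\<close>)
  then show ?thesis using E_antidual[OF f(1)] by (simp add: X_iff)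
qed

lemma E_linear_add:
  assumes f: "f \<in> M1_antidual w" and h: "h \<in> M1_antidual w"
  shows "E (\<lambda>g. f g + h g) = (\<lambda>g. E f g + E h g)"
proof
  fix g
  show "E (\<lambda>g. f g + h g) g = E f g + E h g"
  proof (cases "g \<in> M1_space w")
    case g: True
    have gm: "g \<in> borel_measurable borel" by (rule square_integrableD[OF M1_space_square_integrable[OF g]])
    have eq: "EI (\<lambda>g. f g + h g) g = (\<lambda>y z. EI f g y z + EI h g y z)"
      by (intro ext) (simp add: EI_eq STFT_def distrib_left distrib_right)
    have i: "(\<integral>\<^sup>+ y. \<integral>\<^sup>+ z. ennreal (cmod (EI f g y z)) \<partial>lborel \<partial>lborel) < top" if fM: "f \<in> M1_antidual w" for f
    proof -
      obtain C where "(\<integral>\<^sup>+ y. \<integral>\<^sup>+ z. ennreal (cmod (EI f g y z)) \<partial>lborel \<partial>lborel) \<le> ennreal C * M1_norm w g"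
        using EI_finite[OF fM] g by blast
      also have "\<dots> < top" using M1_space_finite[OF w_exp g] by (simp add: ennreal_mult_less_top)
      finally show ?thesis .
    qed
    note Ff = Fubini_lborel[OF EI_measurable[OF f gm] i[OF f]] and Fh = Fubini_lborel[OF EI_measurable[OF h gm] i[OF h]]
    have "E (\<lambda>g. f g + h g) g = (LINT y|lborel. LINT z|lborel. EI f g y z + EI h g y z)"
      using g by (simp add: E_op_def eq)
    also have "\<dots> = (LINT y|lborel. (LINT z|lborel. EI f g y z) + (LINT z|lborel. EI h g y z))"
    \<comment> \<open>The inner integrals exist only for almost every y, so their additivity is
      available only almost everywhere.\<close>
    proof (rule integral_cong_AE)
      show "AE y in lborel. (LINT z|lborel. EI f g y z + EI h g y z) = (LINT z|lborel. EI f g y z) + (LINT z|lborel. EI h g y z)"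
        using Ff(6) Fh(6) by eventually_elim simp
      note [measurable] = EI_measurable[OF f gm] EI_measurable[OF h gm]
      show "(\<lambda>y. LINT z|lborel. EI f g y z + EI h g y z) \<in> borel_measurable lborel" by measurable
      show "(\<lambda>y. (LINT z|lborel. EI f g y z) + (LINT z|lborel. EI h g y z)) \<in> borel_measurable lborel" by measurable
    qed
    also have "\<dots> = E f g + E h g" using Ff(4) Fh(4) g by (simp add: E_op_def)
    finally show ?thesis .
  qed (simp add: E_op_def)
qed

lemma E_linear_cmult: "E (\<lambda>g. c * f g) = (\<lambda>g. c * E f g)"
proof
  fix g
  have "EI (\<lambda>g. c * f g) g = (\<lambda>y z. c * EI f g y z)" by (intro ext) (simp add: EI_eq STFT_def mult_ac)
  then show "E (\<lambda>g. c * f g) g = c * E f g" by (simp add: E_op_def)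
qed

lemma E_linear: "linear_operator_on X E"
  unfolding linear_operator_on_def using E_X E_linear_add E_linear_cmult by (auto simp: X_iff)

lemma E_conv:
  assumes f: "f \<in> X" shows "E_converges w N a B \<phi>1 \<phi>2 \<phi>3 \<phi>4 f"
  unfolding E_converges_def
proof (intro conjI ballI)
  show "integrable lborel (\<lambda>(y, z). EI f g y z)" if "g \<in> M1_space w" for g
    using f that by (intro EI_integrable) (simp_all add: X_iff)
  show "AE (y, z) in lborel. \<forall>\<alpha>\<in>multi_indices N. set_integrable lborel {0..1} (taylor_integrand N (B \<alpha>) y z)"
    using AE_segment_B
  proof eventually_elim
    case (elim yz)
    obtain y z where yz: "yz = (y, z)" by (cases yz)
    have "set_integrable lborel {0..1} (taylor_integrand N (B \<alpha>) y z)" if \<alpha>: "\<alpha> \<in> multi_indices N" for \<alpha>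
      unfolding set_integrable_def
    proof (rule integrableI_bounded)
      note [measurable] = B_measurable[OF \<alpha>]
      show "(\<lambda>t. indicator {0..1} t *\<^sub>R taylor_integrand N (B \<alpha>) y z t) \<in> borel_measurable lborel"
        unfolding taylor_integrand_def by measurable
      let ?I = "\<integral>\<^sup>+ t. ennreal (norm (indicator {0..1} t *\<^sub>R taylor_integrand N (B \<alpha>) y z t)) \<partial>lborel"
      \<comment> \<open>Multiplication by the positive number m(y) makes
        \<open>taylor_integrand_bound\<close> applicable; finiteness of the product gives finiteness
        of \<open>?I\<close>.\<close>
      have "?I * ennreal (m y) = (\<integral>\<^sup>+ t. ennreal (norm (indicator {0..1} t *\<^sub>R taylor_integrand N (B \<alpha>) y z t)) * ennreal (m y) \<partial>lborel)"
        unfolding taylor_integrand_def by (rule nn_integral_multc[symmetric]) measurable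
      also have "\<dots> \<le> (\<integral>\<^sup>+ t. (ennreal Cm * L \<alpha>) * (ennreal (v (t *\<^sub>R (z - y))) * indicator {0..1} t) \<partial>lborel)"
      proof (rule nn_integral_mono_AE)
        have "AE t in lborel. ennreal (cmod (B \<alpha> (y + t *\<^sub>R (z - y))) * m (y + t *\<^sub>R (z - y))) \<le> L \<alpha>"
          using elim \<alpha> yz by auto
        then show "AE t in lborel. ennreal (norm (indicator {0..1} t *\<^sub>R taylor_integrand N (B \<alpha>) y z t)) * ennreal (m y)
          \<le> (ennreal Cm * L \<alpha>) * (ennreal (v (t *\<^sub>R (z - y))) * indicator {0..1} t)"
        proof eventually_elim
          case (elim t)
          show ?case
          proof (cases "t \<in> {0..1}")
            case True
            have "ennreal (cmod (taylor_integrand N (B \<alpha>) y z t)) * ennreal (m y)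
              \<le> ennreal Cm * (ennreal (cmod (B \<alpha> (y + t *\<^sub>R (z - y))) * m (y + t *\<^sub>R (z - y))) * ennreal (v (t *\<^sub>R (z - y))))"
              by (rule taylor_integrand_bound[OF v m Cm True])
            also have "\<dots> \<le> ennreal Cm * (L \<alpha> * ennreal (v (t *\<^sub>R (z - y))))"
              by (intro mult_left_mono mult_right_mono elim) simp_all
            finally show ?thesis using True by (simp add: mult.assoc)
          qed simp
        qed
      qed
      also have "\<dots> = (ennreal Cm * L \<alpha>) * (\<integral>\<^sup>+ t. ennreal (v (t *\<^sub>R (z - y))) * indicator {0..1} t \<partial>lborel)"
        by (rule nn_integral_cmult) measurable
      also have "\<dots> \<le> (ennreal Cm * L \<alpha>) * ennreal (Cv * v (z - y))" by (intro mult_left_mono Cv) simp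
      also have "\<dots> < top" using finite_norms(6)[OF \<alpha>] by (simp add: ennreal_mult_less_top)
      finally have "?I * ennreal (m y) < top" .
      then show "?I < \<infinity>" using pos(3)[of y] by (auto simp: ennreal_mult_less_top)
    qed
    then show ?case by (simp add: yz)
  qed
qed

end

section \<open>Bounded sequences in modulation spaces\<close>

lemma M1_antidual_add:
  assumes f: "f \<in> M1_antidual w" and h: "h \<in> M1_antidual w"
  shows "(\<lambda>g. f g + h g) \<in> M1_antidual w"
proof -
  obtain C where C: "0 \<le> C" "\<And>g. g \<in> M1_space w \<Longrightarrow> ennreal (cmod (f g)) \<le> ennreal C * M1_norm w g"
    using M1_antidual_bound[OF f] by blast
  obtain D where D: "0 \<le> D" "\<And>g. g \<in> M1_space w \<Longrightarrow> ennreal (cmod (h g)) \<le> ennreal D * M1_norm w g"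
    using M1_antidual_bound[OF h] by blast
  have "ennreal (cmod (f g + h g)) \<le> ennreal (C + D) * M1_norm w g" if "g \<in> M1_space w" for g
  proof -
    have "ennreal (cmod (f g + h g)) \<le> ennreal (cmod (f g) + cmod (h g))" by (intro ennreal_leI norm_triangle_ineq)
    also have "\<dots> \<le> ennreal C * M1_norm w g + ennreal D * M1_norm w g"
      using C(2)[OF that] D(2)[OF that] by (simp add: add_mono)
    finally show ?thesis using C D by (simp add: distrib_right)
  qed
  then show ?thesis using M1_antidualD[OF f] M1_antidualD[OF h] unfolding M1_antidual_def
    by (auto simp: distrib_left)
qed

lemma M1_antidual_cmult:
  assumes f: "f \<in> M1_antidual w"
  shows "(\<lambda>g. c * f g) \<in> M1_antidual w"
proof -
  obtain C where C: "0 \<le> C" "\<And>g. g \<in> M1_space w \<Longrightarrow> ennreal (cmod (f g)) \<le> ennreal C * M1_norm w g"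
    using M1_antidual_bound[OF f] by blast
  have "ennreal (cmod (c * f g)) \<le> ennreal (cmod c * C) * M1_norm w g" if "g \<in> M1_space w" for g
  proof -
    have "ennreal (cmod (c * f g)) = ennreal (cmod c) * ennreal (cmod (f g))" by (simp add: norm_mult ennreal_mult)
    also have "\<dots> \<le> ennreal (cmod c) * (ennreal C * M1_norm w g)" by (intro mult_left_mono C(2)[OF that]) simp
    finally show ?thesis using C by (simp add: ennreal_mult mult.assoc)
  qed
  then show ?thesis using M1_antidualD[OF f] unfolding M1_antidual_def
    by (auto simp: distrib_left mult.left_commute)
qed

text \<open>First fix j with a_j small, then let k grow. In \<open>E_compact\<close> the far part of
  the kernel supplies \<open>a\<close>, the near part supplies \<open>b\<close>.\<close>

lemma ennreal_tendsto_0_double: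
  fixes x a :: "nat \<Rightarrow> ennreal"
  assumes le: "\<And>j k. x k \<le> a j + b j k" and a: "a \<longlonglongrightarrow> 0" and b: "\<And>j. b j \<longlonglongrightarrow> 0"
  shows "x \<longlonglongrightarrow> 0"
proof (rule order_tendstoI)
  fix c :: ennreal assume "0 < c"
  obtain e where e: "0 < e" "ennreal e + ennreal e \<le> c"
  proof (cases c)
    case (real r)
    then have "0 < r" using \<open>0 < c\<close> by auto
    show ?thesis by (rule that[of "r / 2"]) (use \<open>0 < r\<close> real in \<open>auto simp flip: ennreal_plus\<close>)
  qed (auto intro: that[of 1])
  have "\<forall>\<^sub>F j in sequentially. a j < ennreal e" using order_tendstoD(2)[OF a, of "ennreal e"] e by simp
  then obtain j where j: "a j < ennreal e" using eventually_happens'[OF sequentially_bot] by blast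
  have "\<forall>\<^sub>F k in sequentially. b j k < ennreal e" using order_tendstoD(2)[OF b, of "ennreal e"] e by simp
  then show "\<forall>\<^sub>F k in sequentially. x k < c"
  proof eventually_elim
    case (elim k)
    have "x k \<le> a j + b j k" by (rule le)
    also have "\<dots> < ennreal e + ennreal e" using j elim by (rule add_strict_mono)
    finally show ?case using e(2) by simp
  qed
qed simp

lemma Lpq_enorm_cmult:
  assumes p: "1 \<le> p" "1 \<le> q" and [measurable]: "h \<in> borel_measurable borel" and r: "0 < r"
  shows "Lpq_enorm p q (\<lambda>z. ennreal r * h z) = ennreal r * Lpq_enorm p q h"
proof (rule antisym)
  show "Lpq_enorm p q (\<lambda>z. ennreal r * h z) \<le> ennreal r * Lpq_enorm p q h" by (rule Lpq_enorm_cmult_le[OF p]) simp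
  have inv: "ennreal (1 / r) * ennreal r = 1" using r by (simp add: ennreal_mult[symmetric])
  have "Lpq_enorm p q h = Lpq_enorm p q (\<lambda>z. ennreal (1 / r) * (ennreal r * h z))"
    by (simp add: mult.assoc[symmetric] inv)
  also have "\<dots> \<le> ennreal (1 / r) * Lpq_enorm p q (\<lambda>z. ennreal r * h z)" by (rule Lpq_enorm_cmult_le[OF p]) simp
  finally have "ennreal r * Lpq_enorm p q h \<le> ennreal r * (ennreal (1 / r) * Lpq_enorm p q (\<lambda>z. ennreal r * h z))"
    by (rule mult_left_mono) simp
  also have "\<dots> = (ennreal (1 / r) * ennreal r) * Lpq_enorm p q (\<lambda>z. ennreal r * h z)" by (simp only: mult_ac)
  finally show "ennreal r * Lpq_enorm p q h \<le> Lpq_enorm p q (\<lambda>z. ennreal r * h z)" by (simp add: inv)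
qed

text \<open>The rate pi/4 is half of the rate pi/2 in the transform of the Gaussian; the other half
  absorbs w. One-variable bumps are used because the crude Hoelder inequality acts in position and
  frequency separately.\<close>

definition gauss_bump :: "real^'d::finite \<Rightarrow> real^'d \<Rightarrow> ennreal" where
  "gauss_bump a x = ennreal (exp (- (pi / 4) * (norm (x - a))\<^sup>2))"

lemma gauss_bump_measurable [measurable]: "gauss_bump a \<in> borel_measurable borel"
  unfolding gauss_bump_def[abs_def] by measurable

lemma gauss_bump_le_1: "gauss_bump a x \<le> 1"
  by (simp add: gauss_bump_def)

lemma gauss_bump_integral:
  "(\<integral>\<^sup>+ x. gauss_bump (a :: real^'d::finite) x \<partial>lborel) = (\<integral>\<^sup>+ x. gauss_bump 0 (x :: real^'d) \<partial>lborel)"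
  "(\<integral>\<^sup>+ x. gauss_bump 0 (x :: real^'d) \<partial>lborel) < top"
proof -
  show "(\<integral>\<^sup>+ x. gauss_bump (a :: real^'d::finite) x \<partial>lborel) = (\<integral>\<^sup>+ x. gauss_bump 0 (x :: real^'d) \<partial>lborel)"
    using nn_integral_lborel_shift[of "gauss_bump 0" a] by (simp add: gauss_bump_def)
  show "(\<integral>\<^sup>+ x. gauss_bump 0 (x :: real^'d) \<partial>lborel) < top"
    using gauss_integrable[of "pi / 4", where 'a="real^'d"] by (simp add: gauss_bump_def integrable_iff_bounded)
qed

lemma gauss_bump_prod:
  "gauss_bump (fst b) (fst z) * gauss_bump (snd b) (snd z) = ennreal (exp (- (pi / 4) * (norm (z - b))\<^sup>2))"
proof -
  have "exp (- (pi / 4) * (norm (fst z - fst b))\<^sup>2) * exp (- (pi / 4) * (norm (snd z - snd b))\<^sup>2) = exp (- (pi / 4) * (norm (z - b))\<^sup>2)"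
    by (simp add: norm_pair_squared exp_add[symmetric] algebra_simps)
  then show ?thesis by (simp add: gauss_bump_def ennreal_mult[symmetric])
qed

context remainder
begin

text \<open>Moderateness also bounds mu from below by a multiple of 1/w, through mu(0) = mu(-y +
  y).\<close>

lemma \<mu>_lower: "1 \<le> C\<mu> / \<mu> 0 * w y * \<mu> y"
proof -
  have "\<mu> 0 \<le> C\<mu> * w y * \<mu> y" using C\<mu>(2)[of "- y" y] submult_weightD(3)[OF w, of y] by simp
  then show ?thesis using pos(4)[of 0] by (simp add: field_simps)
qed

text \<open>The embedding of M^{p,q}_mu into M^infinity with weight 1/w. The reproducing formula
  bounds the value at zeta by a Gaussian average around zeta; the Gaussian absorbs w(y - zeta), and
  the crude Hoelder inequality treats all exponents at once.\<close>

lemma FF_pointwise_bound: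
  obtains c0 where "0 \<le> c0" "\<And>f \<zeta>. f \<in> M1_antidual w \<Longrightarrow> FF f \<zeta> \<le> ennreal (c0 * w \<zeta>) * modulation_norm p q \<mu> f"
proof -
  let ?g = "gconst TYPE('d)"
  have g: "0 < ?g" by (rule gconst_pos)
  obtain K where K: "0 \<le> K" "\<And>z. w z * exp (- (pi / 2) * (norm z)\<^sup>2) \<le> K * exp (- (pi / 2 / 2) * (norm z)\<^sup>2)"
    using exp_bounded_gauss[OF w_exp, of "pi / 2"] by auto
  define c where "c = C\<mu> / \<mu> 0"
  have c: "0 \<le> c" using C\<mu>(1) pos(8)[of 0] by (simp add: c_def)
  obtain I where I: "(\<integral>\<^sup>+ x. gauss_bump 0 (x :: real^'d) \<partial>lborel) = ennreal I" "0 \<le> I"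
    using gauss_bump_integral(2)[where 'd='d] by (cases "\<integral>\<^sup>+ x. gauss_bump 0 (x :: real^'d) \<partial>lborel") auto
  have main: "FF f \<zeta> \<le> ennreal (c * K * ((1 + I) * (1 + I)) * w \<zeta>) * modulation_norm p q \<mu> f" if f: "f \<in> M1_antidual w" for f \<zeta>
  proof -
    note [measurable] = FF_measurable[OF f]
    have pw: "FF f y * gab gaussian (- (\<zeta> - y))
      \<le> ennreal (?g * c * K * w \<zeta>) * (FF f y * ennreal (\<mu> y) * (gauss_bump (fst \<zeta>) (fst y) * gauss_bump (snd \<zeta>) (snd y)))" for y
    proof -
      let ?e = "exp (- (pi / 2) * (norm (y - \<zeta>))\<^sup>2)"
      have "w y \<le> w \<zeta> * w (y - \<zeta>)" using submult_weightD(4)[OF w, of \<zeta> "y - \<zeta>"] by simp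
      then have "c * w y * \<mu> y \<le> c * (w \<zeta> * w (y - \<zeta>)) * \<mu> y"
        using c by (intro mult_right_mono mult_left_mono) simp_all
      with \<mu>_lower[of y, folded c_def] have "1 \<le> c * (w \<zeta> * w (y - \<zeta>)) * \<mu> y" by (rule order_trans)
      then have "?g * ?e * 1 \<le> ?g * ?e * (c * (w \<zeta> * w (y - \<zeta>)) * \<mu> y)"
        using g by (intro mult_left_mono) auto
      also have "\<dots> = ?g * c * w \<zeta> * \<mu> y * (w (y - \<zeta>) * ?e)" by (simp only: mult_ac)
      also have "\<dots> \<le> ?g * c * w \<zeta> * \<mu> y * (K * exp (- (pi / 2 / 2) * (norm (y - \<zeta>))\<^sup>2))"
        using g c by (intro mult_left_mono K) simp_all
      finally have "?g * ?e \<le> ?g * c * K * w \<zeta> * (\<mu> y * exp (- (pi / 4) * (norm (y - \<zeta>))\<^sup>2))"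
        by (simp add: mult_ac)
      then have "ennreal (?g * ?e) \<le> ennreal (?g * c * K * w \<zeta> * (\<mu> y * exp (- (pi / 4) * (norm (y - \<zeta>))\<^sup>2)))"
        by (rule ennreal_leI)
      also have "\<dots> = ennreal (?g * c * K * w \<zeta>) * (ennreal (\<mu> y) * (gauss_bump (fst \<zeta>) (fst y) * gauss_bump (snd \<zeta>) (snd y)))"
        unfolding gauss_bump_prod using g c K by (simp add: ennreal_mult[symmetric])
      finally have "FF f y * ennreal (?g * ?e) \<le> FF f y * (ennreal (?g * c * K * w \<zeta>) * (ennreal (\<mu> y) * (gauss_bump (fst \<zeta>) (fst y) * gauss_bump (snd \<zeta>) (snd y))))"
        by (rule mult_left_mono) simp
      then show ?thesis by (simp add: gab_def cmod_gabor_gaussian mult_ac)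
    qed
    have "ennreal ?g * FF f \<zeta> \<le> cnv (FF f) (\<lambda>z. gab gaussian (- z)) \<zeta>"
      using STFT_le_cnv[OF f w gaussian_M1, of \<zeta>] by (simp add: FF_def[abs_def] gab_def)
    also have "\<dots> \<le> (\<integral>\<^sup>+ y. ennreal (?g * c * K * w \<zeta>) * (FF f y * ennreal (\<mu> y) * (gauss_bump (fst \<zeta>) (fst y) * gauss_bump (snd \<zeta>) (snd y))) \<partial>lborel)"
      unfolding cnv_def by (intro nn_integral_mono pw)
    also have "\<dots> = ennreal (?g * c * K * w \<zeta>) * (\<integral>\<^sup>+ y. FF f y * ennreal (\<mu> y) * (gauss_bump (fst \<zeta>) (fst y) * gauss_bump (snd \<zeta>) (snd y)) \<partial>lborel)"
      by (rule nn_integral_cmult) measurable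
    also have "\<dots> \<le> ennreal (?g * c * K * w \<zeta>) * ((1 + (\<integral>\<^sup>+ x. gauss_bump (fst \<zeta>) x \<partial>lborel)) * (1 + (\<integral>\<^sup>+ x. gauss_bump (snd \<zeta>) x \<partial>lborel)) * modulation_norm p q \<mu> f)"
      unfolding modulation_norm_eq by (intro mult_left_mono nn_integral_mult_le_Lpq_enorm p q gauss_bump_le_1) simp_all
    also have "\<dots> = ennreal ?g * (ennreal (c * K * ((1 + I) * (1 + I)) * w \<zeta>) * modulation_norm p q \<mu> f)"
    proof -
      have "1 + ennreal I = ennreal (1 + I)" using I by simp
      moreover have "ennreal (?g * c * K * w \<zeta>) * (ennreal (1 + I) * ennreal (1 + I)) = ennreal ?g * ennreal (c * K * ((1 + I) * (1 + I)) * w \<zeta>)"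
        using g c K I by (simp add: ennreal_mult[symmetric] mult_ac del: ennreal_plus)
      ultimately show ?thesis unfolding gauss_bump_integral(1)[of "fst \<zeta>"] gauss_bump_integral(1)[of "snd \<zeta>"] I(1)
        by (simp only: mult.assoc[symmetric])
    qed
    finally have "ennreal (1 / ?g) * (ennreal ?g * FF f \<zeta>) \<le> ennreal (1 / ?g) * (ennreal ?g * (ennreal (c * K * ((1 + I) * (1 + I)) * w \<zeta>) * modulation_norm p q \<mu> f))"
      by (rule mult_left_mono) simp
    moreover have "ennreal (1 / ?g) * ennreal ?g = 1" using g by (simp add: ennreal_mult[symmetric])
    ultimately show ?thesis by (simp add: mult.assoc[symmetric])
  qed
  show ?thesis by (rule that[OF _ main]) (use c K I in simp)
qed

text \<open>The embedding of M^1_w into M^{p,q}_mu: convolve with the transform of the Gaussian,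
  whose mixed norm is finite, and apply Young. It is needed for \<open>\<phi>2\<close>, which
  carries the mixed norm of the near part.\<close>

lemma gab_\<mu>_finite:
  assumes \<phi>: "\<phi> \<in> M1_space w"
  shows "Lpq_enorm p q (\<lambda>z. gab \<phi> z * ennreal (\<mu> z)) < top"
proof -
  let ?g = "gconst TYPE('d)"
  have g: "0 < ?g" by (rule gconst_pos)
  note sq = M1_space_square_integrable[OF \<phi>]
  note [measurable] = square_integrableD[OF sq]
  obtain K where K: "0 \<le> K" "\<And>z. w z * exp (- (pi / 2) * (norm z)\<^sup>2) \<le> K * exp (- (pi / 2 / 2) * (norm z)\<^sup>2)"
    using exp_bounded_gauss[OF w_exp, of "pi / 2"] by auto
  have "Lpq_enorm p q (\<lambda>z. gab gaussian z * ennreal (\<mu> z))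
    \<le> Lpq_enorm p q (\<lambda>z :: 'd phase. ennreal (?g * C\<mu> * \<mu> 0 * K) * (gauss_bump 0 (fst z) * gauss_bump 0 (snd z)))"
  proof (intro Lpq_enorm_mono p q)
    fix z
    have "\<mu> z \<le> C\<mu> * w z * \<mu> 0" using C\<mu>(2)[of z 0] by simp
    then have "?g * exp (- (pi / 2) * (norm z)\<^sup>2) * \<mu> z \<le> ?g * exp (- (pi / 2) * (norm z)\<^sup>2) * (C\<mu> * w z * \<mu> 0)"
      using g by (intro mult_left_mono) auto
    also have "\<dots> = ?g * C\<mu> * \<mu> 0 * (w z * exp (- (pi / 2) * (norm z)\<^sup>2))" by (simp only: mult_ac)
    also have "\<dots> \<le> ?g * C\<mu> * \<mu> 0 * (K * exp (- (pi / 2 / 2) * (norm z)\<^sup>2))"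
      using g C\<mu>(1) by (intro mult_left_mono K) simp_all
    finally have "?g * exp (- (pi / 2) * (norm z)\<^sup>2) * \<mu> z \<le> ?g * C\<mu> * \<mu> 0 * K * exp (- (pi / 4) * (norm z)\<^sup>2)"
      by (simp add: mult_ac)
    then have "ennreal (?g * exp (- (pi / 2) * (norm z)\<^sup>2) * \<mu> z) \<le> ennreal (?g * C\<mu> * \<mu> 0 * K * exp (- (pi / 4) * (norm z)\<^sup>2))"
      by (rule ennreal_leI)
    then show "gab gaussian z * ennreal (\<mu> z) \<le> ennreal (?g * C\<mu> * \<mu> 0 * K) * (gauss_bump 0 (fst z) * gauss_bump 0 (snd z))"
      using g C\<mu>(1) K gauss_bump_prod[of 0 z] by (simp add: gab_def cmod_gabor_gaussian ennreal_mult[symmetric])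
  qed measurable
  also have "\<dots> \<le> ennreal (?g * C\<mu> * \<mu> 0 * K) * Lpq_enorm p q (\<lambda>z :: 'd phase. gauss_bump 0 (fst z) * gauss_bump 0 (snd z))"
    by (intro Lpq_enorm_cmult_le p q) measurable
  also have "\<dots> < top"
  proof -
    have "Lpq_enorm p q (\<lambda>z :: 'd phase. gauss_bump 0 (fst z) * gauss_bump 0 (snd z)) < top"
      by (intro Lpq_enorm_finite p q gauss_bump_le_1 gauss_bump_integral) measurable
    then show ?thesis by (simp add: ennreal_mult_less_top)
  qed
  finally have fin: "Lpq_enorm p q (\<lambda>z. gab gaussian z * ennreal (\<mu> z)) < top" .
  have pw: "ennreal ?g * gab \<phi> \<zeta> \<le> cnv (gab \<phi>) (gab gaussian) \<zeta>" for \<zeta>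
  proof -
    have "ennreal ?g * gab \<phi> \<zeta> = ennreal (cmod (of_real ?g * gabor \<phi> \<zeta>))"
      using g by (simp add: gab_def norm_mult ennreal_mult)
    also have "\<dots> \<le> (\<integral>\<^sup>+ z. ennreal (cmod (gabor \<phi> z * gabor (tf_shift z gaussian) \<zeta>)) \<partial>lborel)"
      unfolding gabor_reproducing[OF sq, symmetric] by (rule cmod_integral_le_nn_integral)
    also have "\<dots> = cnv (gab \<phi>) (gab gaussian) \<zeta>"
      by (simp add: cnv_def gab_def norm_mult ennreal_mult cmod_gabor_tf_shift)
    finally show ?thesis .
  qed
  have "ennreal ?g * Lpq_enorm p q (\<lambda>z. gab \<phi> z * ennreal (\<mu> z)) = Lpq_enorm p q (\<lambda>z. ennreal ?g * (gab \<phi> z * ennreal (\<mu> z)))"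
    using g by (intro Lpq_enorm_cmult[symmetric] p q) simp_all
  also have "\<dots> \<le> Lpq_enorm p q (\<lambda>z. cnv (gab \<phi>) (gab gaussian) z * ennreal (\<mu> z))"
    by (intro Lpq_enorm_mono p q) (simp_all add: mult.assoc[symmetric] mult_right_mono pw)
  also have "\<dots> \<le> ennreal C\<mu> * (\<integral>\<^sup>+ z. gab \<phi> z * ennreal (w z) \<partial>lborel) * Lpq_enorm p q (\<lambda>z. gab gaussian z * ennreal (\<mu> z))"
    by (intro cnv_Lpq_enorm p q C\<mu> pos; measurable)
  also have "\<dots> < top" using fin M1_space_finite[OF w_exp \<phi>] by (simp add: M1_norm_gab ennreal_mult_less_top)
  finally show ?thesis using g by (auto simp: ennreal_mult_less_top)
qed

text \<open>An Arzela-Ascoli argument for the transforms gives pointwise convergence along a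
  subsequence. The reproducing formula and dominated convergence turn this into convergence on every
  test function, and Fatou keeps the norm of the limit below \<open>R\<close>. The common constant
  \<open>C\<close> is recorded for later domination.\<close>

lemma bounded_sequence_limit:
  assumes f: "\<And>n. f n \<in> X" and R: "R < top" "\<And>n. modulation_norm p q \<mu> (f n) \<le> R"
  shows "\<exists>r f0 C. strict_mono (r :: nat \<Rightarrow> nat) \<and> f0 \<in> M1_antidual w \<and> modulation_norm p q \<mu> f0 \<le> R \<and> 0 \<le> C \<and>
    (\<forall>g. (\<lambda>n. f (r n) g) \<longlonglongrightarrow> f0 g) \<and>
    (\<forall>n. \<forall>g\<in>M1_space w. ennreal (cmod (f n g)) \<le> ennreal C * M1_norm w g) \<and>
    (\<forall>g\<in>M1_space w. ennreal (cmod (f0 g)) \<le> ennreal C * M1_norm w g)"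
proof -
  let ?g = "gconst TYPE('d)"
  have g: "0 < ?g" by (rule gconst_pos)
  have fM: "f n \<in> M1_antidual w" for n using f by (simp add: X_iff)
  define S where "S n = STFT gaussian (f n)" for n
  obtain \<rho> where \<rho>: "R = ennreal \<rho>" "0 \<le> \<rho>" using R(1) by (cases R) auto
  obtain c0 where c0: "0 \<le> c0" "\<And>f \<zeta>. f \<in> M1_antidual w \<Longrightarrow> FF f \<zeta> \<le> ennreal (c0 * w \<zeta>) * modulation_norm p q \<mu> f"
    using FF_pointwise_bound by blast
  define D where "D = c0 * \<rho>"
  have D0: "0 \<le> D" using c0 \<rho> by (simp add: D_def)
  have D: "cmod (S n \<zeta>) \<le> D * w \<zeta>" for n \<zeta>
  proof -
    have "ennreal (cmod (S n \<zeta>)) \<le> ennreal (c0 * w \<zeta>) * modulation_norm p q \<mu> (f n)"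
      using c0(2)[OF fM] by (simp add: FF_def S_def)
    also have "\<dots> \<le> ennreal (c0 * w \<zeta>) * ennreal \<rho>" using R \<rho> by (intro mult_left_mono) simp_all
    also have "\<dots> = ennreal (D * w \<zeta>)" using c0 \<rho> by (simp add: D_def ennreal_mult[symmetric] mult_ac)
    finally show ?thesis using D0 by (simp add: ennreal_le_iff)
  qed
  have Sm[measurable]: "S n \<in> borel_measurable borel" for n
    unfolding S_def by (rule STFT_gaussian_measurable[OF fM w_exp])
  have gfin: "h \<in> borel_measurable borel" "M1_norm w h < top" if "h \<in> M1_space w" for h
    using square_integrableD[OF M1_space_square_integrable[OF that]] M1_space_finite[OF w_exp that] by auto
  have rep: "f n h = (LINT \<zeta>|lborel. S n \<zeta> * cnj (gabor h \<zeta>)) / of_real ?g" if "h \<in> M1_space w" for n h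
    using M1_antidual_reproducing[OF fM w that, of n] g by (simp add: S_def field_simps)
  define C where "C = D / ?g"
  have C0: "0 \<le> C" using D0 g by (simp add: C_def)
  have C: "ennreal (cmod (f n h)) \<le> ennreal C * M1_norm w h" if h: "h \<in> M1_space w" for n h
  proof -
    have "ennreal (cmod (f n h)) = ennreal (1 / ?g) * ennreal (cmod (LINT \<zeta>|lborel. S n \<zeta> * cnj (gabor h \<zeta>)))"
      using g by (simp add: rep[OF h] norm_divide ennreal_mult[symmetric])
    also have "\<dots> \<le> ennreal (1 / ?g) * (ennreal D * M1_norm w h)"
      by (intro mult_left_mono weighted_bracket_integrable(2)[OF w_exp Sm D gfin[OF h]]) simp
    finally show ?thesis using g D0 by (simp add: C_def mult.assoc[symmetric] ennreal_mult[symmetric])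
  qed
  obtain Q :: "'d phase set" where Q: "countable Q" "\<And>T. open T \<Longrightarrow> T \<noteq> {} \<Longrightarrow> \<exists>d\<in>Q. d \<in> T"
    by (erule countable_dense_setE)
  \<comment> \<open>Dividing by w makes the transforms uniformly bounded, as the diagonal selection
    on the countable dense set requires.\<close>
  have bd: "norm (S n \<zeta> / of_real (w \<zeta>)) \<le> D" for n \<zeta>
    using D[of n \<zeta>] by (simp add: norm_divide divide_le_eq)
  obtain r where r: "strict_mono (r :: nat \<Rightarrow> nat)" "\<And>x. x \<in> Q \<Longrightarrow> \<exists>l. (\<lambda>n. S (r n) x / of_real (w x)) \<longlonglongrightarrow> l"
    using function_convergent_subsequence[OF Q(1), of "\<lambda>n \<zeta>. S n \<zeta> / of_real (w \<zeta>)" D] bd by blast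
  have convQ: "Cauchy (\<lambda>n. S (r n) x)" if xQ: "x \<in> Q" for x
  proof -
    obtain l where "(\<lambda>n. S (r n) x / of_real (w x)) \<longlonglongrightarrow> l" using r(2)[OF xQ] by blast
    then have "(\<lambda>n. S (r n) x / of_real (w x) * of_real (w x)) \<longlonglongrightarrow> l * of_real (w x)" by (intro tendsto_intros)
    then have "(\<lambda>n. S (r n) x) \<longlonglongrightarrow> l * of_real (w x)" using less_imp_neq[OF pos(2)[of x]] by simp
    then show ?thesis by (rule LIMSEQ_imp_Cauchy)
  qed
  have convS: "convergent (\<lambda>n. S (r n) \<zeta>)" for \<zeta>
  proof (rule Cauchy_convergent, rule metric_CauchyI)
    fix e :: real assume e: "0 < e"
    have "\<exists>b\<in>Q. b \<in> ball \<zeta> (1 / real (Suc i))" for i by (rule Q(2)) auto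
    then obtain b where b: "\<And>i. b i \<in> Q" "\<And>i. dist \<zeta> (b i) < 1 / real (Suc i)" by (metis mem_ball)
    have "(\<lambda>i. dist (b i) \<zeta>) \<longlonglongrightarrow> 0"
      by (rule tendsto_sandwich[OF _ _ tendsto_const LIMSEQ_Suc[OF lim_1_over_n]])
        (use b(2) in \<open>auto simp: dist_commute intro!: always_eventually less_imp_le\<close>)
    then have "b \<longlonglongrightarrow> \<zeta>" by (simp add: tendsto_dist_iff[symmetric])
    then have "(\<lambda>i. ennreal C * M1_norm w (\<lambda>t. tf_shift (b i) gaussian t - tf_shift \<zeta> gaussian t)) \<longlonglongrightarrow> ennreal C * 0"
      by (intro ennreal_tendsto_cmult tf_shift_gaussian_tendsto w_exp) simp
    then have "\<forall>\<^sub>F i in sequentially. ennreal C * M1_norm w (\<lambda>t. tf_shift (b i) gaussian t - tf_shift \<zeta> gaussian t) < ennreal (e / 3)"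
      using e by (intro order_tendstoD(2)[where y=0]) simp_all
    then obtain i where i: "ennreal C * M1_norm w (\<lambda>t. tf_shift (b i) gaussian t - tf_shift \<zeta> gaussian t) < ennreal (e / 3)"
      using eventually_happens'[OF sequentially_bot] by blast
    \<comment> \<open>One point \<open>b i\<close> close to zeta serves all n, because the bound
      involves only the common constant \<open>C\<close>.\<close>
    have near: "cmod (S n (b i) - S n \<zeta>) < e / 3" for n
    proof -
      have "ennreal (cmod (S n (b i) - S n \<zeta>)) < ennreal (e / 3)"
        unfolding S_def by (rule le_less_trans[OF STFT_gaussian_diff_le[OF fM _ C] i]) simp_all
      then show ?thesis using e by (simp add: ennreal_less_iff)
    qed
    obtain M where M: "\<And>j k. M \<le> j \<Longrightarrow> M \<le> k \<Longrightarrow> dist (S (r j) (b i)) (S (r k) (b i)) < e / 3"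
      using metric_CauchyD[OF convQ[OF b(1)], of "e / 3" i] e by auto
    show "\<exists>M. \<forall>j\<ge>M. \<forall>k\<ge>M. dist (S (r j) \<zeta>) (S (r k) \<zeta>) < e"
    proof (intro exI[of _ M] allI impI)
      fix j k assume "M \<le> j" "M \<le> k"
      then have "dist (S (r j) (b i)) (S (r k) (b i)) < e / 3" by (rule M)
      moreover have "dist (S (r j) \<zeta>) (S (r j) (b i)) < e / 3" "dist (S (r k) (b i)) (S (r k) \<zeta>) < e / 3"
        using near by (simp_all add: dist_norm norm_minus_commute)
      ultimately show "dist (S (r j) \<zeta>) (S (r k) \<zeta>) < e"
        using dist_triangle[of "S (r j) \<zeta>" "S (r k) \<zeta>" "S (r j) (b i)"]
          dist_triangle[of "S (r j) (b i)" "S (r k) \<zeta>" "S (r k) (b i)"] by linarith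
    qed
  qed
  have convf: "convergent (\<lambda>n. f (r n) h)" for h
  proof (cases "h \<in> M1_space w")
    case False
    then have "f (r n) h = 0" for n using M1_antidualD(3)[OF fM] by blast
    then show ?thesis by (simp add: convergent_const)
  next
    case h: True
    note [measurable] = gfin(1)[OF h]
    have "(\<lambda>n. LINT \<zeta>|lborel. S (r n) \<zeta> * cnj (gabor h \<zeta>)) \<longlonglongrightarrow> (LINT \<zeta>|lborel. lim (\<lambda>n. S (r n) \<zeta>) * cnj (gabor h \<zeta>))"
    proof (rule integral_dominated_convergence[where w="\<lambda>\<zeta>. D * (cmod (gabor h \<zeta>) * w \<zeta>)"])
      show "integrable lborel (\<lambda>\<zeta>. D * (cmod (gabor h \<zeta>) * w \<zeta>))"
      proof (intro integrable_mult_right integrableI_bounded)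
        show "(\<integral>\<^sup>+ \<zeta>. ennreal (norm (cmod (gabor h \<zeta>) * w \<zeta>)) \<partial>lborel) < \<infinity>"
          using gfin(2)[OF h] by (simp add: M1_norm_eq ennreal_mult abs_mult)
      qed measurable
      show "AE \<zeta> in lborel. (\<lambda>n. S (r n) \<zeta> * cnj (gabor h \<zeta>)) \<longlonglongrightarrow> lim (\<lambda>n. S (r n) \<zeta>) * cnj (gabor h \<zeta>)"
        using convS by (intro AE_I2 tendsto_intros) (simp add: convergent_LIMSEQ_iff)
      show "AE \<zeta> in lborel. norm (S (r n) \<zeta> * cnj (gabor h \<zeta>)) \<le> D * (cmod (gabor h \<zeta>) * w \<zeta>)" for n
      proof (rule AE_I2)
        fix \<zeta>
        have "cmod (S (r n) \<zeta>) * cmod (gabor h \<zeta>) \<le> D * w \<zeta> * cmod (gabor h \<zeta>)"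
          by (intro mult_right_mono D) simp
        then show "norm (S (r n) \<zeta> * cnj (gabor h \<zeta>)) \<le> D * (cmod (gabor h \<zeta>) * w \<zeta>)"
          by (simp add: norm_mult mult_ac)
      qed
    qed measurable
    from tendsto_divide[OF this tendsto_const[of "of_real ?g"]] g
    have "(\<lambda>n. f (r n) h) \<longlonglongrightarrow> (LINT \<zeta>|lborel. lim (\<lambda>n. S (r n) \<zeta>) * cnj (gabor h \<zeta>)) / of_real ?g"
      by (simp add: rep[OF h])
    then show ?thesis by (rule convergentI)
  qed
  define f0 where "f0 h = lim (\<lambda>n. f (r n) h)" for h
  have lim: "(\<lambda>n. f (r n) h) \<longlonglongrightarrow> f0 h" for h
    using convf by (simp add: f0_def convergent_LIMSEQ_iff)
  have f0C: "ennreal (cmod (f0 h)) \<le> ennreal C * M1_norm w h" if "h \<in> M1_space w" for h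
    by (rule LIMSEQ_le_const2[where X="\<lambda>n. ennreal (cmod (f (r n) h))"])
      (use C[OF that] in \<open>auto intro!: tendsto_ennrealI tendsto_norm lim\<close>)
  have f0: "f0 \<in> M1_antidual w"
    unfolding M1_antidual_def mem_Collect_eq
  proof (intro conjI ballI allI impI)
    fix h k assume h: "h \<in> M1_space w" and k: "k \<in> M1_space w"
    have "(\<lambda>n. f (r n) (\<lambda>t. h t + k t)) \<longlonglongrightarrow> f0 h + f0 k"
      unfolding M1_antidualD(1)[OF fM h k] by (intro tendsto_add lim)
    then show "f0 (\<lambda>t. h t + k t) = f0 h + f0 k" using lim LIMSEQ_unique by blast
  next
    fix c h assume h: "h \<in> M1_space w"
    have "(\<lambda>n. f (r n) (\<lambda>t. c * h t)) \<longlonglongrightarrow> cnj c * f0 h"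
      unfolding M1_antidualD(2)[OF fM h] by (intro tendsto_mult tendsto_const lim)
    then show "f0 (\<lambda>t. c * h t) = cnj c * f0 h" using lim LIMSEQ_unique by blast
  next
    show "\<exists>C. \<forall>g\<in>M1_space w. ennreal (cmod (f0 g)) \<le> ennreal C * M1_norm w g" using f0C by blast
  next
    fix h assume "h \<notin> M1_space w"
    then have "f (r n) h = 0" for n using M1_antidualD(3)[OF fM] by blast
    then show "f0 h = 0" by (simp add: f0_def)
  qed
  have "modulation_norm p q \<mu> f0 = Lpq_enorm p q (\<lambda>z. liminf (\<lambda>n. FF (f (r n)) z * ennreal (\<mu> z)))"
  proof -
    have "FF f0 z * ennreal (\<mu> z) = liminf (\<lambda>n. FF (f (r n)) z * ennreal (\<mu> z))" for z
    proof (rule lim_imp_Liminf[symmetric])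
      have "(\<lambda>n. ennreal (cmod (f (r n) (tf_shift z gaussian)) * \<mu> z)) \<longlonglongrightarrow> ennreal (cmod (f0 (tf_shift z gaussian)) * \<mu> z)"
        by (intro tendsto_intros lim)
      then show "(\<lambda>n. FF (f (r n)) z * ennreal (\<mu> z)) \<longlonglongrightarrow> FF f0 z * ennreal (\<mu> z)"
        by (simp add: FF_def STFT_def ennreal_mult)
    qed simp
    then show ?thesis by (simp add: modulation_norm_eq)
  qed
  also have "\<dots> \<le> liminf (\<lambda>n. modulation_norm p q \<mu> (f (r n)))"
  proof -
    note [measurable] = FF_measurable[OF fM]
    show ?thesis unfolding modulation_norm_eq by (intro Lpq_enorm_liminf_le p q) measurable
  qed
  also have "\<dots> \<le> R"
    by (rule order_trans[OF Liminf_le_Limsup Limsup_bounded]) (use R in auto)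
  finally have f0R: "modulation_norm p q \<mu> f0 \<le> R" .
  show ?thesis
    by (intro exI[of _ r] exI[of _ f0] exI[of _ C] conjI allI ballI r(1) f0 f0R C0 lim C f0C)
qed

end

section \<open>Compactness of the remainder operator\<close>

context remainder_op
begin

section \<open>Splitting the kernel into a far and a near part\<close>

lemma cball_sets [measurable]: "cball (0 :: 'd phase) R \<in> sets borel"
  by (simp add: borel_closed)

text \<open>Majorant when y or z lies outside the ball of radius R. The indicator covers steps
  longer than R/2, where only the global norm of the derivative is available but H0 has little mass;
  epsilon covers shorter steps, whose segments stay where the derivatives are small.\<close>

definition H_far :: "real \<Rightarrow> real \<Rightarrow> 'd phase \<Rightarrow> ennreal" where
  "H_far R \<epsilon> x = ennreal K1 * A *
     (\<Sum>\<alpha>\<in>multi_indices N. ennreal (1 / multi_fact \<alpha>) * (L \<alpha> * indicator {x. R / 2 < norm x} x + ennreal \<epsilon>)) * H0 x"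

definition H_near :: "real \<Rightarrow> 'd phase \<Rightarrow> 'd phase \<Rightarrow> ennreal" where
  "H_near R y z = indicator (cball 0 R) y * indicator (cball 0 R) z * H1 (z - y)"

lemma H_far_measurable [measurable]: "H_far R \<epsilon> \<in> borel_measurable borel"
  unfolding H_far_def[abs_def] by measurable

lemma H_near_measurable [measurable]: "(\<lambda>(y, z). H_near R y z) \<in> borel_measurable (borel \<Otimes>\<^sub>M borel)"
  unfolding H_near_def by measurable

text \<open>Every point of the segment lies within its length of both endpoints, so the endpoint
  outside the ball keeps the whole segment away from the origin.\<close>

lemma segment_far:
  assumes t: "t \<in> {0..1}" and far: "R < norm y \<or> R < norm (z :: 'd phase)" and zy: "norm (z - y) \<le> R / 2"
  shows "R / 2 < norm (y + t *\<^sub>R (z - y))"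
proof -
  have a: "norm (t *\<^sub>R (z - y)) \<le> R / 2"
    using t zy mult_left_le_one_le[of "norm (z - y)" t] by simp
  have b: "norm ((1 - t) *\<^sub>R (z - y)) \<le> R / 2"
    using t zy mult_left_le_one_le[of "norm (z - y)" "1 - t"] by simp
  have "norm y \<le> norm (y + t *\<^sub>R (z - y)) + norm (t *\<^sub>R (z - y))"
    using norm_triangle_ineq4[of "y + t *\<^sub>R (z - y)" "t *\<^sub>R (z - y)"] by simp
  moreover have "norm z \<le> norm (y + t *\<^sub>R (z - y)) + norm ((1 - t) *\<^sub>R (z - y))"
    using norm_triangle_ineq[of "y + t *\<^sub>R (z - y)" "(1 - t) *\<^sub>R (z - y)"] by (simp add: algebra_simps)
  ultimately show ?thesis using a b far by linarith
qed

lemma kernel_le_split: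
  assumes \<epsilon>: "\<And>\<alpha>. \<alpha> \<in> multi_indices N \<Longrightarrow> AE x in lborel. R / 2 < norm x \<longrightarrow> ennreal (cmod (B \<alpha> x) * m x) \<le> ennreal \<epsilon>"
  shows "AE (y, z) in lborel. ennreal (gconst TYPE('d)) * ennreal (cmod (k y z)) \<le> H_far R \<epsilon> (z - y) + H_near R y z"
proof -
  \<comment> \<open>One summand for each of the three cases below: long step, small derivative on
    the segment, both endpoints in the ball. Being a sum, the bound splits by distributivity into
    \<open>H_far\<close> and \<open>H_near\<close>.\<close>
  define \<Lambda>' where "\<Lambda>' y z = (\<Sum>\<alpha>\<in>multi_indices N. ennreal (1 / multi_fact \<alpha>) *
    ((L \<alpha> * indicator {x. R / 2 < norm x} (z - y) + ennreal \<epsilon>) + indicator (cball 0 R) y * indicator (cball 0 R) z * L \<alpha>))" for y z :: "'d phase"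
  have seg: "AE (y, z) in lborel. \<forall>\<alpha>\<in>multi_indices N. AE t in lborel. R / 2 < norm (y + t *\<^sub>R (z - y)) \<longrightarrow>
      ennreal (cmod (B \<alpha> (y + t *\<^sub>R (z - y))) * m (y + t *\<^sub>R (z - y))) \<le> ennreal \<epsilon>"
    unfolding case_prod_beta'
  proof (rule AE_finite_allI[OF finite_multi_indices])
    fix \<alpha> :: "'d phase \<Rightarrow> nat" assume \<alpha>: "\<alpha> \<in> multi_indices N"
    note [measurable] = B_measurable[OF \<alpha>]
    have "Measurable.pred borel (\<lambda>x. R / 2 < norm x \<longrightarrow> ennreal (cmod (B \<alpha> x) * m x) \<le> ennreal \<epsilon>)" by measurable
    from AE_segment[OF this \<epsilon>[OF \<alpha>]]
    show "AE x in lborel. AE t in lborel. R / 2 < norm (fst x + t *\<^sub>R (snd x - fst x)) \<longrightarrow>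
      ennreal (cmod (B \<alpha> (fst x + t *\<^sub>R (snd x - fst x))) * m (fst x + t *\<^sub>R (snd x - fst x))) \<le> ennreal \<epsilon>"
      by (simp add: case_prod_beta')
  qed
  have "AE (y, z) in lborel. taylor_kernel N B m v y z \<le> ennreal (Cv * v (z - y)) * \<Lambda>' y z"
    using AE_segment_B seg
  proof eventually_elim
    case (elim yz)
    obtain y z where yz: "yz = (y, z)" by (cases yz)
    have "taylor_kernel N B m v y z \<le> ennreal (Cv * v (z - y)) * \<Lambda>' y z"
      unfolding \<Lambda>'_def
    proof (intro taylor_kernel_le v Cv(2))
      fix \<alpha> :: "'d phase \<Rightarrow> nat" assume \<alpha>: "\<alpha> \<in> multi_indices N"
      have "AE t in lborel. ennreal (cmod (B \<alpha> (y + t *\<^sub>R (z - y))) * m (y + t *\<^sub>R (z - y))) \<le> L \<alpha>"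
        and "AE t in lborel. R / 2 < norm (y + t *\<^sub>R (z - y)) \<longrightarrow> ennreal (cmod (B \<alpha> (y + t *\<^sub>R (z - y))) * m (y + t *\<^sub>R (z - y))) \<le> ennreal \<epsilon>"
        using elim \<alpha> yz by auto
      then show "AE t in lborel. t \<in> {0..1} \<longrightarrow> ennreal (cmod (B \<alpha> (y + t *\<^sub>R (z - y))) * m (y + t *\<^sub>R (z - y)))
        \<le> (L \<alpha> * indicator {x. R / 2 < norm x} (z - y) + ennreal \<epsilon>) + indicator (cball 0 R) y * indicator (cball 0 R) z * L \<alpha>"
      proof eventually_elim
        case (elim t)
        let ?b = "ennreal (cmod (B \<alpha> (y + t *\<^sub>R (z - y))) * m (y + t *\<^sub>R (z - y)))"
        show ?case
        proof
          assume t: "t \<in> {0..1}"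
          consider "norm y \<le> R \<and> norm z \<le> R" | "R / 2 < norm (z - y)" | "R / 2 < norm (y + t *\<^sub>R (z - y))"
            using segment_far[OF t, of R y z] by linarith
          then show "?b \<le> (L \<alpha> * indicator {x. R / 2 < norm x} (z - y) + ennreal \<epsilon>) + indicator (cball 0 R) y * indicator (cball 0 R) z * L \<alpha>"
          proof cases
            case 1
            then show ?thesis using elim(1) by (simp add: add_increasing)
          next
            case 2
            then show ?thesis using elim(1) by (simp add: add_increasing2)
          next
            case 3
            then have "?b \<le> ennreal \<epsilon>" using elim(2) by simp
            then show ?thesis by (simp add: add_increasing add_increasing2)
          qed
        qed
      qed
    qed
    then show ?case by (simp add: yz)
  qed
  from kernel_le[OF this]
  have "AE (y, z) in lborel. ennreal (gconst TYPE('d)) * ennreal (cmod (k y z)) \<le> ennreal K1 * A * \<Lambda>' y z * H0 (z - y)" .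
  moreover have "ennreal K1 * A * \<Lambda>' y z * H0 (z - y) = H_far R \<epsilon> (z - y) + H_near R y z" for y z
  proof -
    have "\<Lambda>' y z = (\<Sum>\<alpha>\<in>multi_indices N. ennreal (1 / multi_fact \<alpha>) * (L \<alpha> * indicator {x. R / 2 < norm x} (z - y) + ennreal \<epsilon>))
        + indicator (cball 0 R) y * indicator (cball 0 R) z * \<Lambda>"
      unfolding \<Lambda>'_def \<Lambda>_def by (simp only: distrib_left sum.distrib sum_distrib_left mult_ac)
    then show ?thesis
      unfolding H_far_def H_near_def H1_def by (simp only: distrib_left distrib_right mult_ac)
  qed
  ultimately show ?thesis by simp
qed

definition near_mass :: "real \<Rightarrow> ((real^'d \<Rightarrow> complex) \<Rightarrow> complex) \<Rightarrow> ennreal" where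
  "near_mass R d = (\<integral>\<^sup>+ z. indicator (cball 0 R) z * (ennreal (cmod (STFT \<phi>3 d z)) * ennreal (w z)) \<partial>lborel)"

text \<open>The far part is a convolution kernel and is treated as for boundedness. In the near part
  the integral \<open>q0\<close> over z lies in L^1_w, with norm governed by the transform of
  \<open>d\<close> on a ball, and Young's inequality puts the mixed norm on \<open>\<phi>2\<close>.
  So only the size of the transform of \<open>d\<close> on a bounded set matters there, whatever the
  exponents.\<close>

lemma E_norm_split:
  assumes d: "d \<in> M1_antidual w"
    and \<epsilon>: "\<And>\<alpha>. \<alpha> \<in> multi_indices N \<Longrightarrow> AE x in lborel. R / 2 < norm x \<longrightarrow> ennreal (cmod (B \<alpha> x) * m x) \<le> ennreal \<epsilon>"
  shows "ennreal (gconst TYPE('d) ^ 3) * modulation_norm p q \<mu> (E d)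
    \<le> ennreal (C\<mu> ^ 4) * M1_norm w gaussian * M1_norm w \<phi>2 * M1_norm w \<phi>3 * (\<integral>\<^sup>+ z. H_far R \<epsilon> z * ennreal (w z) \<partial>lborel) * modulation_norm p q \<mu> d
     + ennreal (gconst TYPE('d) ^ 2) * (ennreal C\<mu> * ((\<integral>\<^sup>+ z. H1 z * ennreal (w z) \<partial>lborel) * near_mass R d) * Lpq_enorm p q (\<lambda>z. gab \<phi>2 z * ennreal (\<mu> z)))"
proof -
  let ?g = "gconst TYPE('d)"
  have g: "0 < ?g" by (rule gconst_pos)
  note [measurable] = FF_measurable[OF d] FF_measurable[OF E_antidual[OF d]] STFT_measurable[OF d w \<phi>3]
  have [measurable]: "(\<lambda>(y, z). H_far R \<epsilon> (z - y)) \<in> borel_measurable (borel \<Otimes>\<^sub>M borel)" by (rule diff_kernel_measurable) measurable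
  define q0 where "q0 y = (\<integral>\<^sup>+ z. H_near R y z * ennreal (cmod (STFT \<phi>3 d z)) \<partial>lborel)" for y
  have [measurable]: "q0 \<in> borel_measurable borel" unfolding q0_def by measurable
  let ?Q = "cnv (kernel_cnv (FF d) (H_far R \<epsilon>) \<phi>2 \<phi>3) (gab gaussian)"
  have pw: "ennreal (?g ^ 3) * FF (E d) \<zeta> \<le> ?Q \<zeta> + ennreal (?g ^ 2) * cnv q0 (gab \<phi>2) \<zeta>" for \<zeta>
  proof -
    \<comment> \<open>The modulus of the bracket of the shifted \<open>\<phi>2\<close> with a
      shifted Gaussian is a value of \<open>gab \<phi>2\<close> exactly, so the near part uses up no
      further kappa; two of the three factors stay in front of it.\<close>
    have near: "pairing d (tf_shift \<zeta> gaussian) (H_near R) = cnv q0 (gab \<phi>2) \<zeta>"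
    proof -
      have "ennreal (cmod (L2_bracket (tf_shift y \<phi>2) (tf_shift \<zeta> gaussian))) = gab \<phi>2 (\<zeta> - y)" for y
        using gab_tf_shift[of \<phi>2 y \<zeta>] by (simp add: gab_def gabor_def)
      then show ?thesis unfolding pairing_def cnv_def q0_def by (simp add: nn_integral_multc)
    qed
    have "ennreal (?g ^ 3) * FF (E d) \<zeta> = ennreal ?g * ennreal ?g * (ennreal ?g * FF (E d) \<zeta>)"
      using g by (simp add: power3_eq_cube ennreal_mult mult.assoc)
    also have "\<dots> \<le> ennreal ?g * ennreal ?g * pairing d (tf_shift \<zeta> gaussian) (\<lambda>y z. H_far R \<epsilon> (z - y) + H_near R y z)"
    proof (intro mult_left_mono STFT_E_le d kernel_le_split \<epsilon>)
      show "(\<lambda>(y, z). H_far R \<epsilon> (z - y) + H_near R y z) \<in> borel_measurable (borel \<Otimes>\<^sub>M borel)" by measurable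
    qed simp_all
    also have "pairing d (tf_shift \<zeta> gaussian) (\<lambda>y z. H_far R \<epsilon> (z - y) + H_near R y z)
      = pairing d (tf_shift \<zeta> gaussian) (\<lambda>y z. H_far R \<epsilon> (z - y)) + pairing d (tf_shift \<zeta> gaussian) (H_near R)"
      unfolding pairing_def distrib_right by (subst nn_integral_add[symmetric], measurable, subst nn_integral_add[symmetric]) (simp_all, measurable)
    also have "ennreal ?g * ennreal ?g * (pairing d (tf_shift \<zeta> gaussian) (\<lambda>y z. H_far R \<epsilon> (z - y)) + pairing d (tf_shift \<zeta> gaussian) (H_near R))
      \<le> ?Q \<zeta> + ennreal (?g ^ 2) * cnv q0 (gab \<phi>2) \<zeta>"
      unfolding distrib_left near using g
      by (intro add_mono pairing_gaussian_le d) (simp_all add: power2_eq_square ennreal_mult)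
    finally show ?thesis .
  qed
  have q0L1: "(\<integral>\<^sup>+ y. q0 y * ennreal (w y) \<partial>lborel) \<le> (\<integral>\<^sup>+ z. H1 z * ennreal (w z) \<partial>lborel) * near_mass R d"
  proof -
    have "(\<integral>\<^sup>+ y. q0 y * ennreal (w y) \<partial>lborel) = (\<integral>\<^sup>+ y. \<integral>\<^sup>+ z. H_near R y z * ennreal (cmod (STFT \<phi>3 d z)) * ennreal (w y) \<partial>lborel \<partial>lborel)"
      unfolding q0_def by (intro nn_integral_cong nn_integral_multc[symmetric]) measurable
    also have "\<dots> \<le> (\<integral>\<^sup>+ y. \<integral>\<^sup>+ z. (indicator (cball 0 R) z * (ennreal (cmod (STFT \<phi>3 d z)) * ennreal (w z))) * (H1 (z - y) * ennreal (w (z - y))) \<partial>lborel \<partial>lborel)"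
    proof (intro nn_integral_mono)
      fix y z :: "'d phase"
      have "w y \<le> w z * w (z - y)" using submult_weightD(4)[OF w, of z "y - z"] submult_weightD(3)[OF w, of "z - y"] by simp
      then have "ennreal (w y) \<le> ennreal (w z) * ennreal (w (z - y))" by (simp add: ennreal_mult[symmetric] ennreal_leI)
      moreover have "H_near R y z \<le> indicator (cball 0 R) z * H1 (z - y)" by (simp add: H_near_def indicator_def)
      ultimately have "H_near R y z * ennreal (cmod (STFT \<phi>3 d z)) * ennreal (w y)
        \<le> indicator (cball 0 R) z * H1 (z - y) * ennreal (cmod (STFT \<phi>3 d z)) * (ennreal (w z) * ennreal (w (z - y)))"
        by (intro mult_mono) auto
      then show "H_near R y z * ennreal (cmod (STFT \<phi>3 d z)) * ennreal (w y)
        \<le> (indicator (cball 0 R) z * (ennreal (cmod (STFT \<phi>3 d z)) * ennreal (w z))) * (H1 (z - y) * ennreal (w (z - y)))"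
        by (simp only: mult_ac)
    qed
    also have "\<dots> = (\<integral>\<^sup>+ z. \<integral>\<^sup>+ y. (indicator (cball 0 R) z * (ennreal (cmod (STFT \<phi>3 d z)) * ennreal (w z))) * (H1 (z - y) * ennreal (w (z - y))) \<partial>lborel \<partial>lborel)"
      by (rule lborel_pair.Fubini') measurable
    also have "\<dots> = (\<integral>\<^sup>+ z. (indicator (cball 0 R) z * (ennreal (cmod (STFT \<phi>3 d z)) * ennreal (w z))) * (\<integral>\<^sup>+ y. H1 (z - y) * ennreal (w (z - y)) \<partial>lborel) \<partial>lborel)"
      by (intro nn_integral_cong nn_integral_cmult) measurable
    also have "\<dots> = (\<integral>\<^sup>+ z. (indicator (cball 0 R) z * (ennreal (cmod (STFT \<phi>3 d z)) * ennreal (w z))) * (\<integral>\<^sup>+ y. H1 y * ennreal (w y) \<partial>lborel) \<partial>lborel)"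
      by (subst nn_integral_lborel_reflect[of "\<lambda>y. H1 y * ennreal (w y)"]) simp_all
    also have "\<dots> = near_mass R d * (\<integral>\<^sup>+ y. H1 y * ennreal (w y) \<partial>lborel)"
      unfolding near_mass_def by (rule nn_integral_multc) measurable
    finally show ?thesis by (simp add: mult.commute)
  qed
  have "ennreal (?g ^ 3) * modulation_norm p q \<mu> (E d) = Lpq_enorm p q (\<lambda>z. ennreal (?g ^ 3) * (FF (E d) z * ennreal (\<mu> z)))"
    unfolding modulation_norm_eq using g by (intro Lpq_enorm_cmult[symmetric] p q) simp_all
  also have "\<dots> \<le> Lpq_enorm p q (\<lambda>z. ?Q z * ennreal (\<mu> z) + ennreal (?g ^ 2) * (cnv q0 (gab \<phi>2) z * ennreal (\<mu> z)))"
  proof (intro Lpq_enorm_mono p q)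
    fix z
    have "ennreal (?g ^ 3) * FF (E d) z * ennreal (\<mu> z) \<le> (?Q z + ennreal (?g ^ 2) * cnv q0 (gab \<phi>2) z) * ennreal (\<mu> z)"
      by (intro mult_right_mono pw) simp
    then show "ennreal (?g ^ 3) * (FF (E d) z * ennreal (\<mu> z)) \<le> ?Q z * ennreal (\<mu> z) + ennreal (?g ^ 2) * (cnv q0 (gab \<phi>2) z * ennreal (\<mu> z))"
      by (simp only: distrib_right mult.assoc)
  qed measurable
  also have "\<dots> \<le> Lpq_enorm p q (\<lambda>z. ?Q z * ennreal (\<mu> z)) + Lpq_enorm p q (\<lambda>z. ennreal (?g ^ 2) * (cnv q0 (gab \<phi>2) z * ennreal (\<mu> z)))"
    by (intro Lpq_enorm_add_le p q) measurable
  also have "\<dots> \<le> ennreal (C\<mu> ^ 4) * M1_norm w gaussian * M1_norm w \<phi>2 * M1_norm w \<phi>3 * (\<integral>\<^sup>+ z. H_far R \<epsilon> z * ennreal (w z) \<partial>lborel) * modulation_norm p q \<mu> d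
     + ennreal (?g ^ 2) * (ennreal C\<mu> * ((\<integral>\<^sup>+ z. H1 z * ennreal (w z) \<partial>lborel) * near_mass R d) * Lpq_enorm p q (\<lambda>z. gab \<phi>2 z * ennreal (\<mu> z)))"
  proof (rule add_mono)
    show "Lpq_enorm p q (\<lambda>z. ?Q z * ennreal (\<mu> z)) \<le> ennreal (C\<mu> ^ 4) * M1_norm w gaussian * M1_norm w \<phi>2 * M1_norm w \<phi>3 * (\<integral>\<^sup>+ z. H_far R \<epsilon> z * ennreal (w z) \<partial>lborel) * modulation_norm p q \<mu> d"
      unfolding modulation_norm_eq by (intro Lpq_cnv_gaussian d) measurable
    have "Lpq_enorm p q (\<lambda>z. ennreal (?g ^ 2) * (cnv q0 (gab \<phi>2) z * ennreal (\<mu> z))) \<le> ennreal (?g ^ 2) * Lpq_enorm p q (\<lambda>z. cnv q0 (gab \<phi>2) z * ennreal (\<mu> z))"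
      by (intro Lpq_enorm_cmult_le p q) measurable
    also have "\<dots> \<le> ennreal (?g ^ 2) * (ennreal C\<mu> * (\<integral>\<^sup>+ y. q0 y * ennreal (w y) \<partial>lborel) * Lpq_enorm p q (\<lambda>z. gab \<phi>2 z * ennreal (\<mu> z)))"
      by (intro mult_left_mono cnv_Lpq_enorm p q C\<mu> pos) simp_all
    also have "\<dots> \<le> ennreal (?g ^ 2) * (ennreal C\<mu> * ((\<integral>\<^sup>+ z. H1 z * ennreal (w z) \<partial>lborel) * near_mass R d) * Lpq_enorm p q (\<lambda>z. gab \<phi>2 z * ennreal (\<mu> z)))"
      by (intro mult_left_mono mult_right_mono q0L1) simp_all
    finally show "Lpq_enorm p q (\<lambda>z. ennreal (?g ^ 2) * (cnv q0 (gab \<phi>2) z * ennreal (\<mu> z)))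
      \<le> ennreal (?g ^ 2) * (ennreal C\<mu> * ((\<integral>\<^sup>+ z. H1 z * ennreal (w z) \<partial>lborel) * near_mass R d) * Lpq_enorm p q (\<lambda>z. gab \<phi>2 z * ennreal (\<mu> z)))" .
  qed
  finally show ?thesis .
qed

text \<open>Dominated convergence on the ball: the integrand converges pointwise because the
  functionals do so at each shifted \<open>\<phi>3\<close>, and it is dominated because they share
  \<open>C\<close> and w is bounded on the ball.\<close>

lemma near_mass_tendsto:
  assumes d: "\<And>k. d k \<in> M1_antidual w" and lim: "\<And>g. (\<lambda>k. d k g) \<longlonglongrightarrow> 0"
    and C: "\<And>k g. g \<in> M1_space w \<Longrightarrow> ennreal (cmod (d k g)) \<le> ennreal C * M1_norm w g"
  shows "(\<lambda>k. near_mass R (d k)) \<longlonglongrightarrow> 0"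
proof -
  obtain D c where D: "0 \<le> D" "0 \<le> c" "\<And>z. w z \<le> D * exp (c * norm z)" using w_exp unfolding exp_bounded_def by blast
  note [measurable] = STFT_measurable[OF d w \<phi>3]
  define W where "W = D * exp (c * \<bar>R\<bar>)"
  have W: "0 \<le> W" "\<And>z. norm z \<le> R \<Longrightarrow> w z \<le> W"
  proof -
    show "0 \<le> W" using D by (simp add: W_def)
    fix z :: "'d phase" assume "norm z \<le> R"
    then have "c * norm z \<le> c * \<bar>R\<bar>" using D by (intro mult_left_mono) auto
    then have "D * exp (c * norm z) \<le> W" using D by (simp add: W_def mult_left_mono)
    then show "w z \<le> W" using D(3)[of z] by linarith
  qed
  have "(\<lambda>k. near_mass R (d k)) \<longlonglongrightarrow> (\<integral>\<^sup>+ z. 0 \<partial>(lborel :: 'd phase measure))"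
    unfolding near_mass_def
  proof (rule nn_integral_dominated_convergence[where w="\<lambda>z. (ennreal C * (ennreal W * M1_norm w \<phi>3) * ennreal W) * indicator (cball 0 R) z"])
    show "(\<integral>\<^sup>+ z. (ennreal C * (ennreal W * M1_norm w \<phi>3) * ennreal W) * indicator (cball 0 R) z \<partial>(lborel :: 'd phase measure)) < \<infinity>"
      using finite_norms(3) emeasure_bounded_finite[OF bounded_cball, of "0 :: 'd phase" R]
      by (simp add: nn_integral_cmult_indicator ennreal_mult_less_top)
    show "AE z in lborel. indicator (cball 0 R) z * (ennreal (cmod (STFT \<phi>3 (d k) z)) * ennreal (w z))
      \<le> (ennreal C * (ennreal W * M1_norm w \<phi>3) * ennreal W) * indicator (cball 0 R) z" for k
    proof (rule AE_I2)
      fix z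
      show "indicator (cball 0 R) z * (ennreal (cmod (STFT \<phi>3 (d k) z)) * ennreal (w z))
        \<le> (ennreal C * (ennreal W * M1_norm w \<phi>3) * ennreal W) * indicator (cball 0 R) z"
      proof (cases "norm z \<le> R")
        case True
        then have wz: "ennreal (w z) \<le> ennreal W" by (intro ennreal_leI W)
        have "ennreal (cmod (STFT \<phi>3 (d k) z)) \<le> ennreal C * M1_norm w (tf_shift z \<phi>3)"
          unfolding STFT_def by (intro C M1_space_tf_shift w \<phi>3)
        also have "\<dots> \<le> ennreal C * (ennreal (w z) * M1_norm w \<phi>3)"
          by (intro mult_left_mono M1_norm_tf_shift_le w) simp_all
        also have "\<dots> \<le> ennreal C * (ennreal W * M1_norm w \<phi>3)"
          by (intro mult_left_mono mult_right_mono wz) simp_all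
        finally have "ennreal (cmod (STFT \<phi>3 (d k) z)) * ennreal (w z) \<le> ennreal C * (ennreal W * M1_norm w \<phi>3) * ennreal W"
          by (intro mult_mono wz) simp_all
        then show ?thesis using True by simp
      qed simp
    qed
    show "AE z in lborel. (\<lambda>k. indicator (cball 0 R) z * (ennreal (cmod (STFT \<phi>3 (d k) z)) * ennreal (w z))) \<longlonglongrightarrow> 0"
    proof (rule AE_I2)
      fix z
      have "(\<lambda>k. ennreal (cmod (d k (tf_shift z \<phi>3)) * w z)) \<longlonglongrightarrow> ennreal (cmod 0 * w z)"
        by (intro tendsto_intros lim)
      then have "(\<lambda>k. ennreal (cmod (STFT \<phi>3 (d k) z)) * ennreal (w z)) \<longlonglongrightarrow> 0"
        by (simp add: STFT_def ennreal_mult)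
      then have "(\<lambda>k. indicator (cball 0 R) z * (ennreal (cmod (STFT \<phi>3 (d k) z)) * ennreal (w z))) \<longlonglongrightarrow> indicator (cball 0 R) z * 0"
        by (intro ennreal_tendsto_cmult) (auto simp: indicator_def)
      then show "(\<lambda>k. indicator (cball 0 R) z * (ennreal (cmod (STFT \<phi>3 (d k) z)) * ennreal (w z))) \<longlonglongrightarrow> 0" by simp
    qed
  qed measurable
  then show ?thesis by simp
qed

text \<open>Dominated convergence: at a fixed z the indicator vanishes once R_j >= 2|z|, and the
  remaining coefficient is a multiple of 1/(j+1).\<close>

lemma H_far_tendsto:
  assumes Rj: "\<And>j. real j \<le> Rj j"
  shows "(\<lambda>j. \<integral>\<^sup>+ z. H_far (Rj j) (1 / real (Suc j)) z * ennreal (w z) \<partial>lborel) \<longlonglongrightarrow> 0"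
proof -
  define \<sigma> where "\<sigma> = (\<Sum>\<alpha>\<in>(multi_indices N :: ('d phase \<Rightarrow> nat) set). ennreal (1 / multi_fact \<alpha>))"
  have \<sigma>: "\<sigma> < top" unfolding \<sigma>_def by (simp add: finite_multi_indices)
  \<comment> \<open>Only a finite value times 1/(j+1) tends to 0 in \<open>ennreal\<close>, so the
    points where the majorant is infinite have to be discarded.\<close>
  have "AE z in lborel. H0 z * ennreal (w z) \<noteq> top"
    using nn_integral_PInf_AE[of "\<lambda>z. H0 z * ennreal (w z)" lborel] H0_finite by simp
  note Hfin = this
  have "(\<lambda>j. \<integral>\<^sup>+ z. H_far (Rj j) (1 / real (Suc j)) z * ennreal (w z) \<partial>lborel) \<longlonglongrightarrow> (\<integral>\<^sup>+ z. 0 \<partial>(lborel :: 'd phase measure))"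
  proof (rule nn_integral_dominated_convergence[where w="\<lambda>z. (ennreal K1 * A * (\<Lambda> + \<sigma>)) * (H0 z * ennreal (w z))"])
    show "(\<integral>\<^sup>+ z. (ennreal K1 * A * (\<Lambda> + \<sigma>)) * (H0 z * ennreal (w z)) \<partial>lborel) < \<infinity>"
      using H0_finite \<Lambda>_finite \<sigma> finite_norms(5) by (simp add: nn_integral_cmult ennreal_mult_less_top)
    show "AE z in lborel. H_far (Rj j) (1 / real (Suc j)) z * ennreal (w z) \<le> (ennreal K1 * A * (\<Lambda> + \<sigma>)) * (H0 z * ennreal (w z))" for j
    proof (rule AE_I2)
      fix z :: "'d phase"
      have "(\<Sum>\<alpha>\<in>multi_indices N. ennreal (1 / multi_fact \<alpha>) * (L \<alpha> * indicator {x. Rj j / 2 < norm x} z + ennreal (1 / real (Suc j))))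
        \<le> (\<Sum>\<alpha>\<in>multi_indices N. ennreal (1 / multi_fact \<alpha>) * (L \<alpha> + 1))"
        by (intro sum_mono mult_left_mono add_mono) (auto simp: indicator_def)
      also have "\<dots> = \<Lambda> + \<sigma>" by (simp add: \<Lambda>_def \<sigma>_def distrib_left sum.distrib)
      finally have "H_far (Rj j) (1 / real (Suc j)) z \<le> ennreal K1 * A * (\<Lambda> + \<sigma>) * H0 z"
        unfolding H_far_def by (intro mult_right_mono mult_left_mono) simp_all
      then have "H_far (Rj j) (1 / real (Suc j)) z * ennreal (w z) \<le> ennreal K1 * A * (\<Lambda> + \<sigma>) * H0 z * ennreal (w z)"
        by (rule mult_right_mono) simp
      then show "H_far (Rj j) (1 / real (Suc j)) z * ennreal (w z) \<le> (ennreal K1 * A * (\<Lambda> + \<sigma>)) * (H0 z * ennreal (w z))"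
        by (simp only: mult.assoc)
    qed
    show "AE z in lborel. (\<lambda>j. H_far (Rj j) (1 / real (Suc j)) z * ennreal (w z)) \<longlonglongrightarrow> 0"
      using Hfin
    proof eventually_elim
      case (elim z)
      have "(\<lambda>j. ennreal (1 / real (Suc j))) \<longlonglongrightarrow> ennreal 0"
        by (intro tendsto_ennrealI LIMSEQ_Suc[OF lim_1_over_n])
      moreover have "ennreal K1 * A * \<sigma> * (H0 z * ennreal (w z)) < top"
      proof -
        have "H0 z * ennreal (w z) < top" using elim by (simp add: less_top)
        then show ?thesis using \<sigma> finite_norms(5) by (simp add: ennreal_mult_less_top)
      qed
      ultimately have "(\<lambda>j. (ennreal K1 * A * \<sigma> * (H0 z * ennreal (w z))) * ennreal (1 / real (Suc j))) \<longlonglongrightarrow> (ennreal K1 * A * \<sigma> * (H0 z * ennreal (w z))) * ennreal 0"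
        by (intro ennreal_tendsto_cmult)
      then have "(\<lambda>j. (ennreal K1 * A * \<sigma> * (H0 z * ennreal (w z))) * ennreal (1 / real (Suc j))) \<longlonglongrightarrow> 0" by simp
      moreover have "\<forall>\<^sub>F j in sequentially. H_far (Rj j) (1 / real (Suc j)) z * ennreal (w z) = (ennreal K1 * A * \<sigma> * (H0 z * ennreal (w z))) * ennreal (1 / real (Suc j))"
        using eventually_ge_at_top[of "nat \<lceil>2 * norm z\<rceil>"]
      proof eventually_elim
        case (elim j)
        have "2 * norm z \<le> real j" using elim by linarith
        then have "\<not> Rj j / 2 < norm z" using Rj[of j] by linarith
        then have "(\<Sum>\<alpha>\<in>multi_indices N. ennreal (1 / multi_fact \<alpha>) * (L \<alpha> * indicator {x. Rj j / 2 < norm x} z + ennreal (1 / real (Suc j))))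
          = \<sigma> * ennreal (1 / real (Suc j))"
          by (simp add: \<sigma>_def sum_distrib_right)
        then show ?case unfolding H_far_def by (simp only: mult_ac)
      qed
      ultimately show ?case by (rule tendsto_cong[THEN iffD2, rotated])
    qed
  qed measurable
  then show ?thesis by simp
qed

text \<open>With d_k = f_(r k) - f_0, bounded and tending to 0 on every test function, the claim is
  that E d_k tends to 0 in norm. The far part is small uniformly in k, the near part tends to 0 for
  each fixed radius.\<close>

lemma E_compact:
  assumes L0: "\<And>\<alpha>. \<alpha> \<in> multi_indices N \<Longrightarrow> (\<lambda>z. B \<alpha> z * of_real (m z)) \<in> L0_space"
  shows "compact_operator_on X (modulation_norm p q \<mu>) E"
  unfolding compact_operator_on_def
proof (intro conjI allI impI E_linear)
  fix f assume "(\<forall>n::nat. f n \<in> X) \<and> (\<exists>R<top. \<forall>n. modulation_norm p q \<mu> (f n) \<le> R)"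
  then obtain R where f: "\<And>n. f n \<in> X" and R: "R < top" "\<And>n. modulation_norm p q \<mu> (f n) \<le> R" by blast
  obtain r f0 C where r: "strict_mono (r :: nat \<Rightarrow> nat)" and f0: "f0 \<in> M1_antidual w" "modulation_norm p q \<mu> f0 \<le> R" and C: "0 \<le> C"
    and lim': "\<forall>g. (\<lambda>n. f (r n) g) \<longlonglongrightarrow> f0 g"
    and fC': "\<forall>n. \<forall>g\<in>M1_space w. ennreal (cmod (f n g)) \<le> ennreal C * M1_norm w g"
    and f0C': "\<forall>g\<in>M1_space w. ennreal (cmod (f0 g)) \<le> ennreal C * M1_norm w g"
    using bounded_sequence_limit[of f R, OF f R] by (elim exE conjE) (rule that)
  note lim = lim'[rule_format] and fC = fC'[rule_format] and f0C = f0C'[rule_format]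
  have f0X: "f0 \<in> X" using f0 R by (auto simp: X_iff)
  have fM: "f n \<in> M1_antidual w" for n using f by (simp add: X_iff)
  \<comment> \<open>Written as a sum with a scalar multiple, so that \<open>E_linear_add\<close> and
    \<open>E_linear_cmult\<close> apply.\<close>
  define d where "d k = (\<lambda>g. f (r k) g + (- 1) * f0 g)" for k
  have dM: "d k \<in> M1_antidual w" for k
    unfolding d_def by (intro M1_antidual_add M1_antidual_cmult fM f0)
  have Ed: "(\<lambda>g. E (f (r k)) g - E f0 g) = E (d k)" for k
  proof -
    have "E (d k) = (\<lambda>g. E (f (r k)) g + E (\<lambda>g. (- 1) * f0 g) g)"
      unfolding d_def by (rule E_linear_add[OF fM M1_antidual_cmult[OF f0(1)]])
    then show ?thesis by (simp only: E_linear_cmult) simp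
  qed
  have dlim: "(\<lambda>k. d k g) \<longlonglongrightarrow> 0" for g
    unfolding d_def using tendsto_diff[OF lim[of g] tendsto_const[of "f0 g"]] by simp
  have dC: "ennreal (cmod (d k g)) \<le> ennreal (2 * C) * M1_norm w g" if "g \<in> M1_space w" for k g
  proof -
    have "ennreal (cmod (d k g)) \<le> ennreal (cmod (f (r k) g) + cmod (f0 g))"
      unfolding d_def using norm_triangle_ineq4[of "f (r k) g" "f0 g"] by (intro ennreal_leI) simp
    also have "\<dots> \<le> ennreal C * M1_norm w g + ennreal C * M1_norm w g"
      using fC[OF that, of "r k"] f0C[OF that] by (simp add: add_mono)
    also have "\<dots> = ennreal (2 * C) * M1_norm w g"
      by (simp only: mult_2 ennreal_plus[OF C C] distrib_right)
    finally show ?thesis .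
  qed
  have dR: "modulation_norm p q \<mu> (d k) \<le> R + R" for k
  proof -
    note [measurable] = FF_measurable[OF fM] FF_measurable[OF f0(1)] FF_measurable[OF dM]
    have "modulation_norm p q \<mu> (d k) \<le> Lpq_enorm p q (\<lambda>z. FF (f (r k)) z * ennreal (\<mu> z) + FF f0 z * ennreal (\<mu> z))"
      unfolding modulation_norm_eq
    proof (intro Lpq_enorm_mono p q)
      fix z
      have "FF (d k) z \<le> ennreal (cmod (f (r k) (tf_shift z gaussian)) + cmod (f0 (tf_shift z gaussian)))"
        unfolding FF_def d_def STFT_def
        using norm_triangle_ineq4[of "f (r k) (tf_shift z gaussian)" "f0 (tf_shift z gaussian)"] by (intro ennreal_leI) simp
      also have "\<dots> = FF (f (r k)) z + FF f0 z" by (simp add: FF_def STFT_def)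
      finally show "FF (d k) z * ennreal (\<mu> z) \<le> FF (f (r k)) z * ennreal (\<mu> z) + FF f0 z * ennreal (\<mu> z)"
        unfolding distrib_right[symmetric] by (rule mult_right_mono) simp
    qed measurable
    also have "\<dots> \<le> modulation_norm p q \<mu> (f (r k)) + modulation_norm p q \<mu> f0"
      unfolding modulation_norm_eq by (intro Lpq_enorm_add_le p q) measurable
    also have "\<dots> \<le> R + R" by (intro add_mono R f0)
    finally show ?thesis .
  qed
  have "\<exists>Q. \<forall>\<alpha>\<in>multi_indices N. 0 < Q \<alpha> \<and> (AE z in lborel. norm z > Q \<alpha> \<longrightarrow> cmod (B \<alpha> z * of_real (m z)) < 1 / real (Suc j))" for j
    using L0 unfolding L0_space_def by (intro bchoice ballI) auto
  then have "\<forall>j. \<exists>Q. \<forall>\<alpha>\<in>multi_indices N. 0 < Q \<alpha> \<and> (AE z in lborel. norm z > Q \<alpha> \<longrightarrow> cmod (B \<alpha> z * of_real (m z)) < 1 / real (Suc j))"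
    by (rule allI)
  from choice[OF this] obtain Q where "\<forall>j. \<forall>\<alpha>\<in>multi_indices N. 0 < Q j \<alpha> \<and> (AE z in lborel. norm z > Q j \<alpha> \<longrightarrow> cmod (B \<alpha> z * of_real (m z)) < 1 / real (Suc j))" ..
  then have Q: "\<And>j \<alpha>. \<alpha> \<in> multi_indices N \<Longrightarrow> 0 < Q j \<alpha>"
      "\<And>j \<alpha>. \<alpha> \<in> multi_indices N \<Longrightarrow> AE z in lborel. norm z > Q j \<alpha> \<longrightarrow> cmod (B \<alpha> z * of_real (m z)) < 1 / real (Suc j)"
    by auto
  \<comment> \<open>Twice the sum of the radii puts |x| > R_j/2 beyond \<open>Q j \<alpha>\<close>
    for all multi-indices at once; the summand j forces the radii to infinity, as
    \<open>H_far_tendsto\<close> requires.\<close>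
  define Rj where "Rj j = 2 * (\<Sum>\<alpha>\<in>multi_indices N. Q j \<alpha>) + real j" for j
  have Rj: "real j \<le> Rj j" for j
    unfolding Rj_def using Q(1) by (simp add: sum_nonneg less_imp_le)
  have small: "AE x in lborel. Rj j / 2 < norm x \<longrightarrow> ennreal (cmod (B \<alpha> x) * m x) \<le> ennreal (1 / real (Suc j))"
    if \<alpha>: "\<alpha> \<in> multi_indices N" for j \<alpha>
    using Q(2)[OF \<alpha>, of j]
  proof eventually_elim
    case (elim x)
    have "Q j \<alpha> \<le> (\<Sum>\<alpha>\<in>multi_indices N. Q j \<alpha>)"
      using \<alpha> Q(1)[of _ j] by (intro member_le_sum) (auto simp: finite_multi_indices less_imp_le)
    then have "Q j \<alpha> \<le> Rj j / 2" by (simp add: Rj_def)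
    then show ?case using elim by (auto simp: norm_mult intro!: ennreal_leI less_imp_le)
  qed
  let ?g = "gconst TYPE('d)"
  have g: "0 < ?g" by (rule gconst_pos)
  let ?c1 = "ennreal (C\<mu> ^ 4) * M1_norm w gaussian * M1_norm w \<phi>2 * M1_norm w \<phi>3 * (R + R)"
  let ?c2 = "ennreal (?g ^ 2) * (ennreal C\<mu> * (\<integral>\<^sup>+ z. H1 z * ennreal (w z) \<partial>lborel) * Lpq_enorm p q (\<lambda>z. gab \<phi>2 z * ennreal (\<mu> z)))"
  let ?h = "\<lambda>j. \<integral>\<^sup>+ z. H_far (Rj j) (1 / real (Suc j)) z * ennreal (w z) \<partial>lborel"
  have c1: "?c1 < top" using finite_norms gaussian_finite R(1) by (simp add: ennreal_mult_less_top)
  have c2: "?c2 < top" using H1_finite gab_\<mu>_finite[OF \<phi>2] by (simp add: ennreal_mult_less_top)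
  have "(\<lambda>k. ennreal (?g ^ 3) * modulation_norm p q \<mu> (E (d k))) \<longlonglongrightarrow> 0"
  proof (rule ennreal_tendsto_0_double[where a="\<lambda>j. ?c1 * ?h j" and b="\<lambda>j k. ?c2 * near_mass (Rj j) (d k)"])
    fix j k
    have "ennreal (?g ^ 3) * modulation_norm p q \<mu> (E (d k))
      \<le> ennreal (C\<mu> ^ 4) * M1_norm w gaussian * M1_norm w \<phi>2 * M1_norm w \<phi>3 * ?h j * modulation_norm p q \<mu> (d k)
       + ennreal (?g ^ 2) * (ennreal C\<mu> * ((\<integral>\<^sup>+ z. H1 z * ennreal (w z) \<partial>lborel) * near_mass (Rj j) (d k)) * Lpq_enorm p q (\<lambda>z. gab \<phi>2 z * ennreal (\<mu> z)))"
      by (rule E_norm_split[OF dM small])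
    also have "\<dots> \<le> ennreal (C\<mu> ^ 4) * M1_norm w gaussian * M1_norm w \<phi>2 * M1_norm w \<phi>3 * ?h j * (R + R)
       + ennreal (?g ^ 2) * (ennreal C\<mu> * ((\<integral>\<^sup>+ z. H1 z * ennreal (w z) \<partial>lborel) * near_mass (Rj j) (d k)) * Lpq_enorm p q (\<lambda>z. gab \<phi>2 z * ennreal (\<mu> z)))"
      by (intro add_mono mult_left_mono dR) simp_all
    also have "\<dots> = ?c1 * ?h j + ?c2 * near_mass (Rj j) (d k)" by (simp only: mult_ac)
    finally show "ennreal (?g ^ 3) * modulation_norm p q \<mu> (E (d k)) \<le> ?c1 * ?h j + ?c2 * near_mass (Rj j) (d k)" .
  next
    have "(\<lambda>j. ?c1 * ?h j) \<longlonglongrightarrow> ?c1 * 0" by (intro ennreal_tendsto_cmult c1 H_far_tendsto Rj)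
    then show "(\<lambda>j. ?c1 * ?h j) \<longlonglongrightarrow> 0" by simp
  next
    fix j
    have "(\<lambda>k. ?c2 * near_mass (Rj j) (d k)) \<longlonglongrightarrow> ?c2 * 0"
      by (intro ennreal_tendsto_cmult c2 near_mass_tendsto[OF dM dlim dC])
    then show "(\<lambda>k. ?c2 * near_mass (Rj j) (d k)) \<longlonglongrightarrow> 0" by simp
  qed
  then have "(\<lambda>k. ennreal (1 / ?g ^ 3) * (ennreal (?g ^ 3) * modulation_norm p q \<mu> (E (d k)))) \<longlonglongrightarrow> ennreal (1 / ?g ^ 3) * 0"
    by (intro ennreal_tendsto_cmult) simp_all
  moreover have "ennreal (1 / ?g ^ 3) * ennreal (?g ^ 3) = 1" using g by (simp add: ennreal_mult[symmetric])
  ultimately have "(\<lambda>k. modulation_norm p q \<mu> (E (d k))) \<longlonglongrightarrow> 0" by (simp add: mult.assoc[symmetric])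
  then have "(\<lambda>k. modulation_norm p q \<mu> (\<lambda>g. E (f (r k)) g - E f0 g)) \<longlonglongrightarrow> 0" by (simp only: Ed)
  then show "\<exists>h\<in>X. \<exists>r. strict_mono r \<and> (\<lambda>k. modulation_norm p q \<mu> (\<lambda>g. E (f (r k)) g - h g)) \<longlonglongrightarrow> 0"
    using E_X[OF f0X] r by blast
qed

end

theorem theorem5p1:
  fixes v w m \<mu> :: "'d::finite phase \<Rightarrow> real" and p q :: ennreal and N :: nat
  assumes "N \<ge> 1"
    and "submult_weight v" and "submult_weight w"
    and "m \<in> moderate_weights v" and "\<mu> \<in> moderate_weights w"
    and "1 \<le> p" and "1 \<le> q"
  defines "u \<equiv> (\<lambda>z. w z * v z * japanese_bracket z ^ N)"
    and "X \<equiv> modulation_space w p q \<mu>"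
  shows
    "(\<exists>c>0. \<forall>\<phi>1 \<phi>2 \<phi>3 \<phi>4 a b B.
       \<phi>1 \<in> M1_space u \<and> \<phi>4 \<in> M1_space u \<and> \<phi>2 \<in> M1_space w \<and> \<phi>3 \<in> M1_space w \<and>
       distribution b \<and> (\<forall>\<alpha>\<in>multi_indices N. has_distr_partial b \<alpha> (B \<alpha>)) \<and>
       a \<in> Linf_space (\<lambda>z. 1 / m z) \<and> (\<forall>\<alpha>\<in>multi_indices N. B \<alpha> \<in> Linf_space m) \<longrightarrow>
       linear_operator_on X (E_op w N a B \<phi>1 \<phi>2 \<phi>3 \<phi>4) \<and>
       (\<forall>f\<in>X. E_converges w N a B \<phi>1 \<phi>2 \<phi>3 \<phi>4 f \<and>
          modulation_norm p q \<mu> (E_op w N a B \<phi>1 \<phi>2 \<phi>3 \<phi>4 f)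
          \<le> ennreal c * Linf_norm (\<lambda>z. 1 / m z) a *
            (\<Sum>\<alpha>\<in>multi_indices N. ennreal (1 / multi_fact \<alpha>) * Linf_norm m (B \<alpha>)) *
            M1_norm u \<phi>1 * M1_norm w \<phi>2 * M1_norm w \<phi>3 * M1_norm u \<phi>4 *
            modulation_norm p q \<mu> f)) \<and>
    (\<forall>\<phi>1 \<phi>2 \<phi>3 \<phi>4 a b B.
       \<phi>1 \<in> M1_space u \<and> \<phi>4 \<in> M1_space u \<and> \<phi>2 \<in> M1_space w \<and> \<phi>3 \<in> M1_space w \<and>
       distribution b \<and> (\<forall>\<alpha>\<in>multi_indices N. has_distr_partial b \<alpha> (B \<alpha>)) \<and>
       a \<in> Linf_space (\<lambda>z. 1 / m z) \<and>
       (\<forall>\<alpha>\<in>multi_indices N. (\<lambda>z. B \<alpha> z * of_real (m z)) \<in> L0_space) \<longrightarrow>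
       compact_operator_on X (modulation_norm p q \<mu>) (E_op w N a B \<phi>1 \<phi>2 \<phi>3 \<phi>4))"
proof -
  have moderate_const: "\<exists>C\<ge>0. \<forall>z1 z2. m (z1 + z2) \<le> C * v z1 * m z2"
    if v: "submult_weight v" and m: "m \<in> moderate_weights v" for v m :: "'d phase \<Rightarrow> real"
  proof -
    obtain C where C: "\<And>z1 z2. m (z1 + z2) \<le> C * v z1 * m z2" using m unfolding moderate_weights_def by blast
    have pos: "0 < v z" "0 < m z" for z using submult_weightD(2)[OF v] m unfolding moderate_weights_def by blast+
    have "m (z1 + z2) \<le> max 0 C * v z1 * m z2" for z1 z2
    proof -
      have "C * v z1 * m z2 \<le> max 0 C * v z1 * m z2"
        using pos(1)[of z1] pos(2)[of z2] by (intro mult_right_mono) auto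
      then show ?thesis using C[of z1 z2] by linarith
    qed
    then show ?thesis by (intro exI[of _ "max 0 C"]) simp
  qed
  obtain Cm where Cm: "0 \<le> Cm" "\<And>z1 z2. m (z1 + z2) \<le> Cm * v z1 * m z2" using moderate_const[OF assms(2,4)] by blast
  obtain C\<mu> where C\<mu>: "0 \<le> C\<mu>" "\<And>z1 z2. \<mu> (z1 + z2) \<le> C\<mu> * w z1 * \<mu> z2" using moderate_const[OF assms(3,5)] by blast
  obtain Cv where Cv: "0 \<le> Cv" "\<And>x. (\<integral>\<^sup>+ t. ennreal (v (t *\<^sub>R x)) * indicator {0..1} t \<partial>lborel) \<le> ennreal (Cv * v x)"
    using submult_weight_segment[OF assms(2)] by blast
  interpret remainder N v w m \<mu> p q Cm Cv C\<mu>
    by unfold_locales (use assms Cm Cv C\<mu> in auto)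
  have u_eq: "u = remainder.u N v w" unfolding assms by (rule ext) (simp only: u_def)
  \<comment> \<open>The leading constant of \<open>E_norm_bound\<close> with \<open>K1\<close>
    unfolded. Adding 1 secures positivity, since the factors are only known to be
    nonnegative.\<close>
  define c where "c = 1 / gconst TYPE('d) ^ 3 * (C\<mu> ^ 4 * enn2real (M1_norm w gaussian) * (real N * Cm * Cv * 2 ^ N)) + 1"
  have M: "M1_norm w gaussian = ennreal (enn2real (M1_norm w gaussian))"
    using gaussian_finite by simp
  have cpos: "0 < c"
    unfolding c_def using C\<mu> Cm Cv gconst_pos[where 'd='d] by (intro add_nonneg_pos) auto
  have cle: "ennreal (1 / gconst TYPE('d) ^ 3) * (ennreal (C\<mu> ^ 4) * M1_norm w gaussian * ennreal (real N * Cm * Cv * 2 ^ N)) \<le> ennreal c"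
    using C\<mu> Cm Cv gconst_pos[where 'd='d] unfolding c_def
    by (subst M) (simp add: ennreal_mult[symmetric] ennreal_leI)
  show ?thesis
  proof (intro conjI exI[of _ c] cpos allI impI)
    fix \<phi>1 \<phi>2 \<phi>3 \<phi>4 a b and B :: "('d phase \<Rightarrow> nat) \<Rightarrow> 'd phase \<Rightarrow> complex"
    assume *: "\<phi>1 \<in> M1_space u \<and> \<phi>4 \<in> M1_space u \<and> \<phi>2 \<in> M1_space w \<and> \<phi>3 \<in> M1_space w \<and>
       distribution b \<and> (\<forall>\<alpha>\<in>multi_indices N. has_distr_partial b \<alpha> (B \<alpha>)) \<and>
       a \<in> Linf_space (\<lambda>z. 1 / m z) \<and> (\<forall>\<alpha>\<in>multi_indices N. B \<alpha> \<in> Linf_space m)"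
    interpret remainder_op N v w m \<mu> p q Cm Cv C\<mu> \<phi>1 \<phi>2 \<phi>3 \<phi>4 a B
      by unfold_locales (use * u_eq in auto)
    show "linear_operator_on X (E_op w N a B \<phi>1 \<phi>2 \<phi>3 \<phi>4)" unfolding X_def by (rule E_linear)
    show "\<forall>f\<in>X. E_converges w N a B \<phi>1 \<phi>2 \<phi>3 \<phi>4 f \<and>
          modulation_norm p q \<mu> (E_op w N a B \<phi>1 \<phi>2 \<phi>3 \<phi>4 f)
          \<le> ennreal c * Linf_norm (\<lambda>z. 1 / m z) a *
            (\<Sum>\<alpha>\<in>multi_indices N. ennreal (1 / multi_fact \<alpha>) * Linf_norm m (B \<alpha>)) *
            M1_norm u \<phi>1 * M1_norm w \<phi>2 * M1_norm w \<phi>3 * M1_norm u \<phi>4 *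
            modulation_norm p q \<mu> f"
    proof (intro ballI conjI)
      fix f assume "f \<in> X"
      then have f: "f \<in> modulation_space w p q \<mu>" by (simp add: X_def)
      show "E_converges w N a B \<phi>1 \<phi>2 \<phi>3 \<phi>4 f" by (rule E_conv[OF f])
      have fM: "f \<in> M1_antidual w" using f by (simp add: X_iff)
      show "modulation_norm p q \<mu> (E_op w N a B \<phi>1 \<phi>2 \<phi>3 \<phi>4 f)
          \<le> ennreal c * Linf_norm (\<lambda>z. 1 / m z) a *
            (\<Sum>\<alpha>\<in>multi_indices N. ennreal (1 / multi_fact \<alpha>) * Linf_norm m (B \<alpha>)) *
            M1_norm u \<phi>1 * M1_norm w \<phi>2 * M1_norm w \<phi>3 * M1_norm u \<phi>4 *
            modulation_norm p q \<mu> f"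
        unfolding u_eq \<Lambda>_def[symmetric]
        by (rule order_trans[OF E_norm_bound[OF fM]]) (intro mult_right_mono cle[folded K1_def], simp_all)
    qed
  next
    fix \<phi>1 \<phi>2 \<phi>3 \<phi>4 a b and B :: "('d phase \<Rightarrow> nat) \<Rightarrow> 'd phase \<Rightarrow> complex"
    assume *: "\<phi>1 \<in> M1_space u \<and> \<phi>4 \<in> M1_space u \<and> \<phi>2 \<in> M1_space w \<and> \<phi>3 \<in> M1_space w \<and>
       distribution b \<and> (\<forall>\<alpha>\<in>multi_indices N. has_distr_partial b \<alpha> (B \<alpha>)) \<and>
       a \<in> Linf_space (\<lambda>z. 1 / m z) \<and>
       (\<forall>\<alpha>\<in>multi_indices N. (\<lambda>z. B \<alpha> z * of_real (m z)) \<in> L0_space)"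
    \<comment> \<open>\<open>L0_space\<close> contains the bound for |B alpha| m; measurability of
      \<open>B \<alpha>\<close> itself is taken from \<open>has_distr_partial\<close>.\<close>
    have B: "B \<alpha> \<in> Linf_space m" if "\<alpha> \<in> multi_indices N" for \<alpha>
      using * that by (auto simp: has_distr_partial_def L0_space_def Linf_space_def Linf_norm_def norm_mult)
    interpret remainder_op N v w m \<mu> p q Cm Cv C\<mu> \<phi>1 \<phi>2 \<phi>3 \<phi>4 a B
      by unfold_locales (use * u_eq B in auto)
    show "compact_operator_on X (modulation_norm p q \<mu>) (E_op w N a B \<phi>1 \<phi>2 \<phi>3 \<phi>4)"
      unfolding X_def by (rule E_compact) (use * in blast)
  qed
qed

end
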